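(* Let $\mathscr C$ be a non-empty set of finite totally ordered sets of even cardinality, let $\mathcal{TL}=\mathcal{TL}(\mathscr C)$ be the Temperley--Lieb category over $\mathscr C$ (planar Brauer partitions), let $\xi$ be the least cardinal strictly greater than $|A|$ for every $A\in\mathscr C$, let $I_r=\{\alpha\in\mathcal{TL}:\operatorname{rank}(\alpha)\le r\}$ for even $0\le r<\xi$, with $I_\omega=\mathcal{TL}$ if $\xi=\omega$, and let $D_2=I_2\setminus I_0$. (i) The minimal ideal $I_0$ is (isomorphic to) a partial rectangular band, so its congruences are precisely those corresponding to the relations $\sigma_{\mathcal E_1,\mathcal E_2}$ described in the context. In particular, $\operatorname{Cong}(I_0)$ is isomorphic to the lattice direct product $$\prod_{A\in\mathscr C}\mathfrak{Eq}(\mathscr P^+(\mathfrak{Eq}_2(A)))\times\prod_{A\in\mathscr C}\mathfrak{Eq}(\mathscr P^+(\mathfrak{Eq}_2(A))).$$ (ii) (If $\xi>2$.) The ideal $I_2$ is retractable, every congruence on $I_0$ is liftable to $I_2$, and $$\operatorname{Cong}(I_2)=\{\tau\cup\Delta_{D_2}:\tau\in\operatorname{Cong}(I_0)\}\cup\{\theta^{I_2}_{I_2,\tau}:\tau\in\operatorname{Cong}(I_0)\}.$$ In particular, $\operatorname{Cong}(I_2)$ is isomorphic to the lattice direct product $\operatorname{Cong}(I_0)\times\mathbf 2$, where $\mathbf 2$ is the two-element chain. (iii) For even $r\ge4$ with $r<\xi$ (and also for $r=\omega$ if $\xi=\omega$), $$\operatorname{Cong}(I_r)=\{\mu^{I_r}_{I_q},\lambda^{I_r}_{I_q},\rho^{I_r}_{I_q},R^{I_r}_{I_q}:q=0,2\}\cup\{R^{I_r}_{I_q}:4\le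 q<r,\ q\text{ even}\}\cup\{\widetilde\nabla_{I_r}\}.$$ The inclusion order is as follows: for $q,q'\in\{0,2\}$ and $\kappa,\kappa'\in\{\mu,\lambda,\rho,R\}$, $\kappa_{I_q}\subseteq\kappa'_{I_{q'}}$ iff $q\le q'$ and $\kappa\le\kappa'$ in the diamond with bottom $\mu$, top $R$ and incomparable middle elements $\lambda,\rho$ (these 8 congruences being distinct), and above these there is the chain $R_{I_2}\subset R_{I_4}\subset\cdots$, with $\widetilde\nabla_{I_r}$ as top element.
   Context: **Category.** Let $X=\bigcup_{A\in\mathscr C}A$ with disjoint copies $X'$, $X''$. For $A,B\in\mathscr C$, a Brauer partition $\alpha\in\mathcal B_{A,B}$ is a set partition of $A\cup B'$ into blocks of size 2; $\mathbf d(\alpha)=A$, $\mathbf r(\alpha)=B$. For $\alpha\in\mathcal B_{A,B}$, $\beta\in\mathcal B_{B,C}$, regard them as equivalences, rename each $b'$ in $\alpha$ and each $b$ in $\beta$ to $b''$ ($b\in B$), take the join of the resulting equivalences on $A\cup B''\cup C'$, and restrict to $A\cup C'$: this is $\alpha\beta\in\mathcal B_{A,C}$. A block is a transversal if it meets both $A$ and $B'$; $\operatorname{rank}(\alpha)$ is the number of transversals. With $A=\{a_1<\cdots<a_k\}$, $B=\{b_1<\cdots<b_l\}$, $\alpha$ is planar if its blocks can be drawn as non-crossing edges inside the rectangle $[0,\max(k,l)+1]\times[0,1]$ with $a_i$ at $(i,1)$ and $b_i'$ at $(i,0)$. $\mathfrak{Eq}(Z)$ is the lattice of equivalences on $Z$.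 For $|A|$ even, $\mathfrak{Eq}_2(A)$ is the set of equivalences on $A$ all of whose classes have size 2. For $U,V\subseteq A$: $U,V$ are separated if $u<v$ for all $u\in U,v\in V$ or $v<u$ for all such; $U$ is nested by $V$ if there are $v_1,v_2\in V$ with $v_1<u<v_2$ for all $u\in U$ and no $v\in V$ with $v_1<v<v_2$. An equivalence is planar if any two distinct classes are separated or one is nested by the other. $\mathscr P^+(\mathfrak{Eq}_2(A))$ is the set of planar members of $\mathfrak{Eq}_2(A)$. **Congruences.** For a partial semigroup (category without necessarily having identities) $S$, write $x\sim y$ if $\mathbf d(x)=\mathbf d(y)$ and $\mathbf r(x)=\mathbf r(y)$. A congruence on $S$ is an equivalence contained in $\sim$ and compatible with all defined left and right multiplications. $\operatorname{Cong}(S)$ is the lattice of congruences. $\Delta_S$ is equality, $\widetilde\nabla_S=\{(x,y):x\sim y\}$. For an ideal $I$ (non-empty, closed under defined multiplication by elements of $S$ on either side), $R_I^S=\widetilde\nabla_I\cup\Delta_S$. Green's relations: $x\mathrel{\mathscr R}y\Leftrightarrow xS^1=yS^1$, $x\mathrel{\mathscr L}y\Leftrightarrow S^1x=S^1y$, $\mathscr H=\mathscr R\cap\mathscr L$ ($S^1$ is $S$ with identities adjoined where needed). Let $M$ be the minimal ideal of $S$. An ideal $I$ is retractable if there is a map $f:I\to M$ (then unique) with $x\sim xf$, $(xy)f=(xf)(yf)$ for all defined products, and $xf=x$ for $x\in M$. A congruence $\tau$ on $M$ is liftable to $S$ if $\tau\cup\Delta_S\in\operatorname{Cong}(S)$.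 For $I$ retractable and $\tau$ liftable, $\theta^S_{I,\tau}=\{(x,y)\in I\times I:(xf,yf)\in\tau\}\cup\Delta_S$. For $I$ retractable, $\lambda^S_{I}=\{(x,y)\in I\times I:x\sim y,\ (xf,yf)\in\mathscr L\}\cup\Delta_S$, and $\rho^S_{I}$, $\mu^S_{I}$ are defined likewise with $\mathscr R$, $\mathscr H$ in place of $\mathscr L$. **Partial rectangular bands.** Given non-empty sets $X_A,Y_A$ ($A\in\mathscr C$), the $X_A$ pairwise disjoint and the $Y_A$ pairwise disjoint, the partial rectangular band is $\bigcup_{A,B}X_A\times Y_B$ with $\mathbf d(x,y)=A$, $\mathbf r(x,y)=B$ for $x\in X_A,y\in Y_B$, and $(x_1,y_1)(x_2,y_2)=(x_1,y_2)$ when $\mathbf r(x_1,y_1)=\mathbf d(x_2,y_2)$. For tuples $\mathcal E_1=(\varepsilon^A_1)_A$, $\mathcal E_2=(\varepsilon_2^A)_A$ with $\varepsilon_1^A\in\mathfrak{Eq}(X_A)$, $\varepsilon_2^A\in\mathfrak{Eq}(Y_A)$, $\sigma_{\mathcal E_1,\mathcal E_2}$ relates $(x_1,y_1)$, $(x_2,y_2)$ iff both lie in a common $X_A\times Y_B$ and $(x_1,x_2)\in\varepsilon_1^A$, $(y_1,y_2)\in\varepsilon_2^B$. Isomorphisms preserve $\mathbf d$, $\mathbf r$. *)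

theory Defs
  imports "HOL-Algebra.Lattice" "HOL-Analysis.Analysis"
begin

section \<open>Lattices as order structures\<close>

definition inclusion_order :: "'x set set \<Rightarrow> 'x set gorder" where
  "inclusion_order F = \<lparr>carrier = F, eq = (=), le = (\<subseteq>)\<rparr>"

definition times_order :: "'x gorder \<Rightarrow> 'y gorder \<Rightarrow> ('x \<times> 'y) gorder" where
  "times_order L M =
     \<lparr>carrier = carrier L \<times> carrier M, eq = (=),
      le = (\<lambda>p q. fst p \<sqsubseteq>\<^bsub>L\<^esub> fst q \<and> snd p \<sqsubseteq>\<^bsub>M\<^esub> snd q)\<rparr>"

definition PiE_order :: "'i set \<Rightarrow> ('i \<Rightarrow> 'x gorder) \<Rightarrow> ('i \<Rightarrow> 'x) gorder" where
  "PiE_order J L =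
     \<lparr>carrier = (\<Pi>\<^sub>E i\<in>J. carrier (L i)), eq = (=),
      le = (\<lambda>f g. \<forall>i\<in>J. f i \<sqsubseteq>\<^bsub>L i\<^esub> g i)\<rparr>"

definition two_chain :: "bool gorder" where
  "two_chain = \<lparr>carrier = UNIV, eq = (=), le = (\<le>)\<rparr>"

(* join_pres and meet_pres include the requirement that both structures are lattices. *)
definition lattice_isomorphic :: "'x gorder \<Rightarrow> 'y gorder \<Rightarrow> bool" where
  "lattice_isomorphic L M \<longleftrightarrow>
     (\<exists>f. bij_betw f (carrier L) (carrier M) \<and> join_pres L M f \<and> meet_pres L M f)"

definition Equivs :: "'x set \<Rightarrow> ('x \<times> 'x) set set" where
  "Equivs Z = {E. equiv Z E}"

section \<open>Partial semigroups, ideals and congruences\<close>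

(* pmul S x y is meaningful only for x, y in the carrier with pcod S x = pdom S y. *)
record ('x, 'o) psemigroup = "'x partial_object" +
  pdom :: "'x \<Rightarrow> 'o"
  pcod :: "'x \<Rightarrow> 'o"
  pmul :: "'x \<Rightarrow> 'x \<Rightarrow> 'x"

definition sim :: "('x, 'o) psemigroup \<Rightarrow> ('x \<times> 'x) set" where
  "sim S = {(x, y). x \<in> carrier S \<and> y \<in> carrier S \<and> pdom S x = pdom S y \<and> pcod S x = pcod S y}"

definition Cong :: "('x, 'o) psemigroup \<Rightarrow> ('x \<times> 'x) set set" where
  "Cong S = {\<sigma>. equiv (carrier S) \<sigma> \<and> \<sigma> \<subseteq> sim S \<and>
     (\<forall>(x, y)\<in>\<sigma>. \<forall>s\<in>carrier S.
        (pcod S s = pdom S x \<longrightarrow> (pmul S s x, pmul S s y) \<in> \<sigma>) \<and>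
        (pcod S x = pdom S s \<longrightarrow> (pmul S x s, pmul S y s) \<in> \<sigma>))}"

definition is_ideal :: "('x, 'o) psemigroup \<Rightarrow> 'x set \<Rightarrow> bool" where
  "is_ideal S J \<longleftrightarrow> J \<noteq> {} \<and> J \<subseteq> carrier S \<and>
     (\<forall>x\<in>J. \<forall>s\<in>carrier S.
        (pcod S s = pdom S x \<longrightarrow> pmul S s x \<in> J) \<and>
        (pcod S x = pdom S s \<longrightarrow> pmul S x s \<in> J))"

definition is_minimal_ideal :: "('x, 'o) psemigroup \<Rightarrow> 'x set \<Rightarrow> bool" where
  "is_minimal_ideal S M \<longleftrightarrow> is_ideal S M \<and> (\<forall>J. is_ideal S J \<and> J \<subseteq> M \<longrightarrow> J = M)"

definition min_ideal :: "('x, 'o) psemigroup \<Rightarrow> 'x set" where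
  "min_ideal S = (THE M. is_minimal_ideal S M)"

definition subsemi :: "('x, 'o) psemigroup \<Rightarrow> 'x set \<Rightarrow> ('x, 'o) psemigroup" where
  "subsemi S J = S\<lparr>carrier := J\<rparr>"

definition Delta :: "('x, 'o) psemigroup \<Rightarrow> ('x \<times> 'x) set" where
  "Delta S = Id_on (carrier S)"

definition Rees_cong :: "('x, 'o) psemigroup \<Rightarrow> 'x set \<Rightarrow> ('x \<times> 'x) set" where
  "Rees_cong S J = sim (subsemi S J) \<union> Delta S"

(* The sets x S^1 and S^1 x, where S^1 has identities adjoined. *)
definition right_principal :: "('x, 'o) psemigroup \<Rightarrow> 'x \<Rightarrow> 'x set" where
  "right_principal S x = insert x {pmul S x s | s. s \<in> carrier S \<and> pcod S x = pdom S s}"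

definition left_principal :: "('x, 'o) psemigroup \<Rightarrow> 'x \<Rightarrow> 'x set" where
  "left_principal S x = insert x {pmul S s x | s. s \<in> carrier S \<and> pcod S s = pdom S x}"

definition Green_R :: "('x, 'o) psemigroup \<Rightarrow> ('x \<times> 'x) set" where
  "Green_R S = {(x, y). x \<in> carrier S \<and> y \<in> carrier S \<and> right_principal S x = right_principal S y}"

definition Green_L :: "('x, 'o) psemigroup \<Rightarrow> ('x \<times> 'x) set" where
  "Green_L S = {(x, y). x \<in> carrier S \<and> y \<in> carrier S \<and> left_principal S x = left_principal S y}"

definition Green_H :: "('x, 'o) psemigroup \<Rightarrow> ('x \<times> 'x) set" where
  "Green_H S = Green_R S \<inter> Green_L S"

definition is_retraction :: "('x, 'o) psemigroup \<Rightarrow> 'x set \<Rightarrow> ('x \<Rightarrow> 'x) \<Rightarrow> bool" where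
  "is_retraction S J f \<longleftrightarrow>
     (\<forall>x\<in>J. f x \<in> min_ideal S \<and> (x, f x) \<in> sim S) \<and>
     (\<forall>x\<in>J. \<forall>y\<in>J. pcod S x = pdom S y \<longrightarrow> f (pmul S x y) = pmul S (f x) (f y)) \<and>
     (\<forall>x\<in>min_ideal S. f x = x)"

definition retractable :: "('x, 'o) psemigroup \<Rightarrow> 'x set \<Rightarrow> bool" where
  "retractable S J \<longleftrightarrow> is_ideal S J \<and> (\<exists>f. is_retraction S J f)"

(* The retraction of a retractable ideal is unique on that ideal; off the ideal it is irrelevant. *)
definition the_retraction :: "('x, 'o) psemigroup \<Rightarrow> 'x set \<Rightarrow> 'x \<Rightarrow> 'x" where
  "the_retraction S J = (SOME f. is_retraction S J f)"

definition liftable :: "('x, 'o) psemigroup \<Rightarrow> ('x \<times> 'x) set \<Rightarrow> bool" where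
  "liftable S \<tau> \<longleftrightarrow> \<tau> \<in> Cong (subsemi S (min_ideal S)) \<and> \<tau> \<union> Delta S \<in> Cong S"

definition theta_cong ::
    "('x, 'o) psemigroup \<Rightarrow> 'x set \<Rightarrow> ('x \<times> 'x) set \<Rightarrow> ('x \<times> 'x) set" where
  "theta_cong S J \<tau> =
     {(x, y). x \<in> J \<and> y \<in> J \<and> (the_retraction S J x, the_retraction S J y) \<in> \<tau>} \<union> Delta S"

definition Green_cong ::
    "('x, 'o) psemigroup \<Rightarrow> ('x \<times> 'x) set \<Rightarrow> 'x set \<Rightarrow> ('x \<times> 'x) set" where
  "Green_cong S K J =
     {(x, y). x \<in> J \<and> y \<in> J \<and> (x, y) \<in> sim S \<and>
        (the_retraction S J x, the_retraction S J y) \<in> K} \<union> Delta S"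

definition lambda_cong :: "('x, 'o) psemigroup \<Rightarrow> 'x set \<Rightarrow> ('x \<times> 'x) set" where
  "lambda_cong S J = Green_cong S (Green_L S) J"

definition rho_cong :: "('x, 'o) psemigroup \<Rightarrow> 'x set \<Rightarrow> ('x \<times> 'x) set" where
  "rho_cong S J = Green_cong S (Green_R S) J"

definition mu_cong :: "('x, 'o) psemigroup \<Rightarrow> 'x set \<Rightarrow> ('x \<times> 'x) set" where
  "mu_cong S J = Green_cong S (Green_H S) J"

datatype diamond = Mu | Lam | Rho | Rees

definition diamond_le :: "diamond \<Rightarrow> diamond \<Rightarrow> bool" where
  "diamond_le k k' \<longleftrightarrow> k = k' \<or> k = Mu \<or> k' = Rees"

fun diamond_cong :: "diamond \<Rightarrow> ('x, 'o) psemigroup \<Rightarrow> 'x set \<Rightarrow> ('x \<times> 'x) set" where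
  "diamond_cong Mu = mu_cong"
| "diamond_cong Lam = lambda_cong"
| "diamond_cong Rho = rho_cong"
| "diamond_cong Rees = Rees_cong"

definition psemigroup_iso ::
    "('x, 'o) psemigroup \<Rightarrow> ('y, 'o) psemigroup \<Rightarrow> ('x \<Rightarrow> 'y) \<Rightarrow> bool" where
  "psemigroup_iso S T \<phi> \<longleftrightarrow> bij_betw \<phi> (carrier S) (carrier T) \<and>
     (\<forall>x\<in>carrier S. pdom T (\<phi> x) = pdom S x \<and> pcod T (\<phi> x) = pcod S x) \<and>
     (\<forall>x\<in>carrier S. \<forall>y\<in>carrier S. pcod S x = pdom S y \<longrightarrow>
        \<phi> (pmul S x y) = pmul T (\<phi> x) (\<phi> y))"

section \<open>Partial rectangular bands\<close>

definition prb_data :: "'o set \<Rightarrow> ('o \<Rightarrow> 'p set) \<Rightarrow> ('o \<Rightarrow> 'q set) \<Rightarrow> bool" where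
  "prb_data C X Y \<longleftrightarrow> (\<forall>A\<in>C. X A \<noteq> {} \<and> Y A \<noteq> {}) \<and>
     disjoint_family_on X C \<and> disjoint_family_on Y C"

definition prb ::
    "'o set \<Rightarrow> ('o \<Rightarrow> 'p set) \<Rightarrow> ('o \<Rightarrow> 'q set) \<Rightarrow> ('p \<times> 'q, 'o) psemigroup" where
  "prb C X Y =
     \<lparr>carrier = (\<Union>A\<in>C. \<Union>B\<in>C. X A \<times> Y B),
      pdom = (\<lambda>(x, y). THE A. A \<in> C \<and> x \<in> X A),
      pcod = (\<lambda>(x, y). THE B. B \<in> C \<and> y \<in> Y B),
      pmul = (\<lambda>(x1, y1) (x2, y2). (x1, y2))\<rparr>"

definition prb_sigma ::
    "'o set \<Rightarrow> ('o \<Rightarrow> 'p set) \<Rightarrow> ('o \<Rightarrow> 'q set) \<Rightarrow>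
     ('o \<Rightarrow> ('p \<times> 'p) set) \<Rightarrow> ('o \<Rightarrow> ('q \<times> 'q) set) \<Rightarrow> (('p \<times> 'q) \<times> ('p \<times> 'q)) set" where
  "prb_sigma C X Y E1 E2 =
     {((x1, y1), (x2, y2)). \<exists>A\<in>C. \<exists>B\<in>C.
        x1 \<in> X A \<and> y1 \<in> Y B \<and> x2 \<in> X A \<and> y2 \<in> Y B \<and> (x1, x2) \<in> E1 A \<and> (y1, y2) \<in> E2 B}"

section \<open>Brauer partitions\<close>

(* A totally ordered set is represented by its reflexive order relation A :: 'a rel, with
   underlying set Field A; so C :: 'a rel set is a set of totally ordered sets, which may overlap.
   An element of the category carries its source A and its target B explicitly, and
   A \<union> B' is rendered as the disjoint sum Field A <+> Field B. *)
datatype 'a diagram =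
  Diagram (source: "'a rel") (blocks: "('a + 'a) set set") (target: "'a rel")

definition is_brauer :: "'a diagram \<Rightarrow> bool" where
  "is_brauer \<alpha> \<longleftrightarrow> partition_on (Field (source \<alpha>) <+> Field (target \<alpha>)) (blocks \<alpha>) \<and>
     (\<forall>b\<in>blocks \<alpha>. card b = 2)"

definition drank :: "'a diagram \<Rightarrow> nat" where
  "drank \<alpha> = card {b \<in> blocks \<alpha>.
     b \<inter> Inl ` Field (source \<alpha>) \<noteq> {} \<and> b \<inter> Inr ` Field (target \<alpha>) \<noteq> {}}"

definition block_rel :: "'x set set \<Rightarrow> ('x \<times> 'x) set" where
  "block_rel P = {(x, y). \<exists>b\<in>P. x \<in> b \<and> y \<in> b}"

datatype 'a layered = Upper 'a | Middle 'a | Lower 'a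

(* E is the join, in the lattice of equivalences on Z, of the two renamed equivalences. *)
definition diagram_mult :: "'a diagram \<Rightarrow> 'a diagram \<Rightarrow> 'a diagram" where
  "diagram_mult \<alpha> \<beta> =
    (let A = source \<alpha>; B = target \<alpha>; C = target \<beta>;
         Z = Upper ` Field A \<union> Middle ` Field B \<union> Lower ` Field C;
         up = case_sum Upper Middle; low = case_sum Middle Lower; out = case_sum Upper Lower;
         E = \<Inter>{E. equiv Z E \<and>
               map_prod up up ` block_rel (blocks \<alpha>) \<subseteq> E \<and>
               map_prod low low ` block_rel (blocks \<beta>) \<subseteq> E};
         W = Field A <+> Field C
     in Diagram A (W // {(x, y). x \<in> W \<and> y \<in> W \<and> (out x, out y) \<in> E}) C)"

(* card (under A a) is the 1-based position of a in the totally ordered set A. *)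
definition vertex :: "'a rel \<Rightarrow> 'a rel \<Rightarrow> 'a + 'a \<Rightarrow> real \<times> real" where
  "vertex A B = case_sum (\<lambda>a. (real (card (under A a)), 1)) (\<lambda>b. (real (card (under B b)), 0))"

definition planar_diagram :: "'a diagram \<Rightarrow> bool" where
  "planar_diagram \<alpha> \<longleftrightarrow>
     (let A = source \<alpha>; B = target \<alpha>; m = real (max (card (Field A)) (card (Field B)) + 1) in
      \<exists>e :: ('a + 'a) set \<Rightarrow> real \<Rightarrow> real \<times> real.
        (\<forall>b\<in>blocks \<alpha>. arc (e b) \<and> {pathstart (e b), pathfinish (e b)} = vertex A B ` b \<and>
           path_image (e b) \<subseteq> {0..m} \<times> {0..1}) \<and>
        (\<forall>b\<in>blocks \<alpha>. \<forall>c\<in>blocks \<alpha>. b \<noteq> c \<longrightarrow> path_image (e b) \<inter> path_image (e c) = {}))"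

section \<open>The Temperley--Lieb category and its ideals\<close>

definition TL :: "'a rel set \<Rightarrow> ('a diagram, 'a rel) psemigroup" where
  "TL C =
     \<lparr>carrier = {\<alpha>. source \<alpha> \<in> C \<and> target \<alpha> \<in> C \<and> is_brauer \<alpha> \<and> planar_diagram \<alpha>},
      pdom = source, pcod = target, pmul = diagram_mult\<rparr>"

(* Cardinals up to \<omega> are rendered in enat, with \<infinity> in the role of \<omega>;
   this suffices as every member of C is finite. *)
definition xi :: "'a rel set \<Rightarrow> enat" where
  "xi C = (LEAST k. \<forall>A\<in>C. enat (card (Field A)) < k)"

definition TL_ideal :: "'a rel set \<Rightarrow> enat \<Rightarrow> 'a diagram set" where
  "TL_ideal C r = {\<alpha> \<in> carrier (TL C). enat (drank \<alpha>) \<le> r}"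

abbreviation TL_sub :: "'a rel set \<Rightarrow> enat \<Rightarrow> ('a diagram, 'a rel) psemigroup" where
  "TL_sub C r \<equiv> subsemi (TL C) (TL_ideal C r)"

section \<open>Planar equivalences\<close>

definition olt :: "'a rel \<Rightarrow> 'a \<Rightarrow> 'a \<Rightarrow> bool" where
  "olt A u v \<longleftrightarrow> (u, v) \<in> A \<and> u \<noteq> v"

definition Eq2 :: "'a rel \<Rightarrow> 'a rel set" where
  "Eq2 A = {E \<in> Equivs (Field A). \<forall>U\<in>Field A // E. card U = 2}"

definition separated :: "'a rel \<Rightarrow> 'a set \<Rightarrow> 'a set \<Rightarrow> bool" where
  "separated A U V \<longleftrightarrow> (\<forall>u\<in>U. \<forall>v\<in>V. olt A u v) \<or> (\<forall>u\<in>U. \<forall>v\<in>V. olt A v u)"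

definition nested_by :: "'a rel \<Rightarrow> 'a set \<Rightarrow> 'a set \<Rightarrow> bool" where
  "nested_by A U V \<longleftrightarrow> (\<exists>v1\<in>V. \<exists>v2\<in>V.
     (\<forall>u\<in>U. olt A v1 u \<and> olt A u v2) \<and> \<not> (\<exists>v\<in>V. olt A v1 v \<and> olt A v v2))"

definition planar_equiv :: "'a rel \<Rightarrow> 'a rel \<Rightarrow> bool" where
  "planar_equiv A E \<longleftrightarrow> (\<forall>U\<in>Field A // E. \<forall>V\<in>Field A // E. U \<noteq> V \<longrightarrow>
     separated A U V \<or> nested_by A U V \<or> nested_by A V U)"

definition planar_Eq2 :: "'a rel \<Rightarrow> 'a rel set" where
  "planar_Eq2 A = {E \<in> Eq2 A. planar_equiv A E}"

end

theory Submission
  imports Defs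
begin

text \<open>
  A diagram from \<open>A\<close> to \<open>B\<close> is encoded as an involution of the integers without crossings that moves
  exactly the points \<open>- a\<close> (the vertex of \<open>A\<close> in position \<open>a\<close>) and \<open>b\<close> (the vertex of \<open>B'\<close> in
  position \<open>b\<close>). That planarity of a drawing forces the absence of crossings comes from bending the
  strip into a half plane, where arcs with interlaced endpoints meet by the Fashoda theorem.
  A diagram of rank at most two has well-defined upper and lower closures, which do not depend on how
  its transversals are closed up; their product is the retraction to rank zero. A congruence that
  relates two distinct diagrams, the larger rank being at least four, contains the full relation
  below that rank, and a nontrivial relation at rank zero spreads to all rank-zero diagrams on the
  same side as soon as four points are available, by exchanging the two matchings of four points.
\<close>

section \<open>Noncrossing involutions\<close>

text \<open>Reading the upper row from right to left and then the lower row from left to right turns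
  a diagram into a pairing of points on a line. If two diagrams are laid side by side, their middle
  points form concentric pairs, so composition is the removal of innermost pairs one after another,
  and a single removal is easily seen to create no crossing.

  The category need not contain an object with as many points as the rank of a given diagram, so
  splitting a diagram at its transversals leaves the category. The congruence is therefore extended
  to arbitrary finite sets of positions by multiplying from both sides into genuine objects; these
  outer factors bound the rank, so inside the extension diagrams of every rank may act.

  The thresholds come from counting matchings: two points have one planar matching, four points have
  two. A diagram of rank at most two cannot tell how its loose ends are closed, while multipliers of
  rank four carry an exchange of two matchings to any place. With multipliers of rank at most two
  there is no such spreading, which is why the lattice at rank two is still a direct
  product.\<close>

definition supp :: "('v \<Rightarrow> 'v) \<Rightarrow> 'v set" where
  "supp f = {z. f z \<noteq> z}"

definition involution :: "('v \<Rightarrow> 'v) \<Rightarrow> bool" where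
  "involution f \<longleftrightarrow> (\<forall>z. f (f z) = z)"

definition noncrossing :: "('v \<Rightarrow> int) \<Rightarrow> ('v \<Rightarrow> 'v) \<Rightarrow> bool" where
  "noncrossing k f \<longleftrightarrow> (\<forall>x y. \<not> (k x < k y \<and> k y < k (f x) \<and> k (f x) < k (f y)))"

definition graph :: "('v \<Rightarrow> 'v) \<Rightarrow> ('v \<times> 'v) set" where
  "graph f = {(z, f z) | z. True}"

text \<open>Joining \<open>x\<close> to \<open>y\<close> by an outside arc and pulling the path
  tight: the former partners of \<open>x\<close> and \<open>y\<close> become partners. If
  \<open>x\<close> and \<open>y\<close> are partners of each other, a closed loop arises and
  disappears.\<close>

definition contract :: "('v \<Rightarrow> 'v) \<Rightarrow> 'v \<Rightarrow> 'v \<Rightarrow> 'v \<Rightarrow> 'v" where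
  "contract f x y z =
    (if z = x \<or> z = y then z else if f z = x then f y else if f z = y then f x else f z)"

lemma involutionD: "involution f \<Longrightarrow> f (f z) = z"
  by (simp add: involution_def)

lemma involution_contract:
  assumes "involution f" "f x \<noteq> x" "f y \<noteq> y" "x \<noteq> y"
  shows "involution (contract f x y)"
proof -
  have ff: "f (f z) = z" for z using assms(1) by (simp add: involution_def)
  show ?thesis
    unfolding involution_def contract_def using ff assms(2-4) by (auto split: if_splits) metis+
qed

lemma supp_contract:
  assumes "involution f" "f x \<noteq> x" "f y \<noteq> y" "x \<noteq> y"
  shows "supp (contract f x y) = supp f - {x, y}"
proof -
  have ff: "f (f z) = z" for z using assms(1) by (simp add: involution_def)
  have "contract f x y z \<noteq> z \<longleftrightarrow> f z \<noteq> z \<and> z \<noteq> x \<and> z \<noteq> y" for z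
    unfolding contract_def using ff[of z] ff[of x] ff[of y] assms(2-4) by auto
  then show ?thesis by (auto simp: supp_def)
qed

text \<open>No point lies between \<open>x\<close> and \<open>y\<close>, so a pair that crosses the
  new pair \<open>f x\<close>, \<open>f y\<close> must already cross one of the old pairs through
  \<open>x\<close> or \<open>y\<close>. The points carry labels \<open>k\<close> because the lemma
  will be applied to a disjoint union laid out on a line.\<close>

lemma noncrossing_contract:
  assumes f: "involution f" "f x \<noteq> x" "f y \<noteq> y" "x \<noteq> y" and nc: "noncrossing k f" and inj: "inj_on k (supp f)"
    and adj: "k x < k y" "\<And>w. w \<in> supp f \<Longrightarrow> \<not> (k x < k w \<and> k w < k y)"
  shows "noncrossing k (contract f x y)"
  unfolding noncrossing_def
proof (intro allI notI)
  fix a b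
  let ?g = "contract f x y"
  assume A: "k a < k b \<and> k b < k (?g a) \<and> k (?g a) < k (?g b)"
  have ab: "a \<in> supp ?g" "b \<in> supp ?g"
    using A by (auto simp: supp_def)
  have s: "a \<in> supp f" "b \<in> supp f" "a \<noteq> x" "a \<noteq> y" "b \<noteq> x" "b \<noteq> y"
    using ab supp_contract[OF f] by auto
  have fs: "f z \<in> supp f" if "z \<in> supp f" for z
    using that f(1) by (auto simp: supp_def involution_def)
  have xy: "x \<in> supp f" "y \<in> supp f" using f by (auto simp: supp_def)
  have ne: "k u \<noteq> k v" if "u \<in> supp f" "v \<in> supp f" "u \<noteq> v" for u v
    using inj that by (auto simp: inj_on_def)
  have ff: "f (f z) = z" for z using f(1) by (simp add: involution_def)
  \<comment> \<open>A pair with one end inside another pair lies inside it entirely.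
    \<open>noncrossing\<close> states one of the two forbidden interlacings; the other is the same
    statement read from \<open>f v\<close>.\<close>
  have N: "k u < k (f v) \<and> k (f v) < k (f u)"
    if uv: "u \<in> supp f" "v \<in> supp f" and b: "k u < k v" "k v < k (f u)" for u v
  proof -
    have *: "\<not> (k u < k v \<and> k v < k (f u) \<and> k (f u) < k (f v))" for u v
      using nc by (auto simp: noncrossing_def)
    have "f v \<noteq> u" "f v \<noteq> f u" using b ff by (metis less_irrefl)+
    then have "k (f v) \<noteq> k u" "k (f v) \<noteq> k (f u)" using ne fs uv by auto
    then show ?thesis using *[of u v] *[of "f v" u] b ff[of v] by (smt (verit))
  qed
  have S: "k w < k x \<or> k y < k w" if "w \<in> supp f" "w \<noteq> x" "w \<noteq> y" for w
    using adj(2)[OF that(1)] ne[OF that(1) xy(1) that(2)] ne[OF that(1) xy(2) that(3)] by linarith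
  have fe: "f u = v \<longleftrightarrow> u = f v" for u v using ff by metis
  show False
  \<comment> \<open>At most one side of the presumed crossing is the new pair; the other side is
    then compared with the old pairs through \<open>x\<close> and \<open>y\<close>.\<close>
  proof (cases "f a = x \<or> f a = y")
    case True
    then have b: "f b \<noteq> x" "f b \<noteq> y" "?g b = f b"
      using A s ff unfolding contract_def by (auto split: if_splits)
    define c where "c = ?g a"
    have c: "(a = f x \<and> c = f y) \<or> (a = f y \<and> c = f x)"
      using True s ff f(4) unfolding c_def contract_def by auto
    have A': "k a < k b" "k b < k c" "k c < k (f b)" using A b c_def by auto
    have Sb: "k b < k x \<or> k y < k b" "k (f b) < k x \<or> k y < k (f b)"
      using S[of b] S[of "f b"] s b fs by auto
    note in_supp = xy s(1,2) fs[OF xy(1)] fs[OF xy(2)] fs[OF s(2)]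
    from c show False
    proof
      assume "a = f x \<and> c = f y"
      then show False
        using A' Sb adj(1) N[of y b] N[of "f x" b] N[of "f y" "f b"] in_supp ff by fastforce
    next
      assume "a = f y \<and> c = f x"
      then show False
        using A' Sb adj(1) N[of x b] N[of "f y" b] N[of "f x" "f b"] in_supp ff by fastforce
    qed
  next
    case False
    then have ga: "?g a = f a" using s by (simp add: contract_def)
    show False
    proof (cases "f b = x \<or> f b = y")
      case True
      define c where "c = ?g b"
      have c: "(b = f x \<and> c = f y) \<or> (b = f y \<and> c = f x)"
        using True s ff f(4) unfolding c_def contract_def by auto
      have A': "k a < k b" "k b < k (f a)" "k (f a) < k c" using A ga c_def by auto
      have Sa: "k a < k x \<or> k y < k a" "k (f a) < k x \<or> k y < k (f a)"
        using S[of a] S[of "f a"] s False fs by auto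
      note in_supp = xy s(1,2) fs[OF xy(1)] fs[OF xy(2)] fs[OF s(1)]
      from c show False
      proof
        assume "b = f x \<and> c = f y"
        then show False
          using A' Sa adj(1) N[of y "f a"] N[of x a] N[of "f x" "f a"] in_supp ff by fastforce
      next
        assume "b = f y \<and> c = f x"
        then show False
          using A' Sa adj(1) N[of x "f a"] N[of y a] N[of "f y" "f a"] in_supp ff by fastforce
      qed
    next
      case F2: False
      then show False using A ga s nc by (auto simp: contract_def noncrossing_def)
    qed
  qed
qed

text \<open>A path can use the \<open>G\<close>-edge between \<open>x\<close> and \<open>y\<close>
  only on the detour from \<open>F x\<close> to \<open>F y\<close>, and this detour is a single edge
  of the contracted involution.\<close>

lemma contract_connected:
  assumes F: "involution F" "F x \<noteq> x" "F y \<noteq> y" and G: "involution G" "G x = y" "x \<noteq> y"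
    and uw: "u \<noteq> x" "u \<noteq> y" "w \<noteq> x" "w \<noteq> y"
  defines "F' \<equiv> contract F x y" and "G' \<equiv> (\<lambda>z. if z = x \<or> z = y then z else G z)"
  shows "(u, w) \<in> (graph F \<union> graph G)\<^sup>* \<longleftrightarrow> (u, w) \<in> (graph F' \<union> graph G')\<^sup>*"
proof
  let ?R = "(graph F \<union> graph G)\<^sup>*" and ?R' = "(graph F' \<union> graph G')\<^sup>*"
  have eF: "(z, F z) \<in> ?R" and eG: "(z, G z) \<in> ?R" for z
    by (auto simp: graph_def)
  have eF': "(z, F' z) \<in> ?R'" and eG': "(z, G' z) \<in> ?R'" for z
    by (auto simp: graph_def)
  have Gy: "G y = x" using G by (metis involutionD)
  have st: "(z, F' z) \<in> ?R" for z
  proof -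
    consider "z = x \<or> z = y" | "z \<noteq> x" "z \<noteq> y" "F z = x" | "z \<noteq> x" "z \<noteq> y" "F z = y" 
      | "F' z = F z" unfolding F'_def contract_def by metis
    then show ?thesis
    proof cases
      case 1 then show ?thesis by (simp add: F'_def contract_def)
    next
      case 2
      then have "F' z = F y" by (simp add: F'_def contract_def)
      then show ?thesis using eF[of z] eG[of x] eF[of y] 2 G by (metis rtrancl_trans)
    next
      case 3
      then have "F' z = F x" using F(3) G(3) by (simp add: F'_def contract_def)
      then show ?thesis using eF[of z] eG[of y] eF[of x] 3 Gy by (metis rtrancl_trans)
    next
      case 4 then show ?thesis using eF by simp
    qed
  qed
  have st': "(z, G' z) \<in> ?R" for z using eG[of z] by (simp add: G'_def)
  have "graph F' \<union> graph G' \<subseteq> ?R" using st st' by (auto simp: graph_def)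
  then show "(u, w) \<in> ?R' \<Longrightarrow> (u, w) \<in> ?R"
    by (metis rtrancl_subset_rtrancl subsetD)
  assume uw': "(u, w) \<in> ?R"
  show "(u, w) \<in> ?R'"
  \<comment> \<open>If \<open>x\<close> and \<open>y\<close> are partners in both involutions, they
    form a component of their own, which no path from \<open>u\<close> can enter.\<close>
  proof (cases "F x = y")
    case True
    have Fy: "F y = x" using True F by (metis involutionD)
    have "v \<noteq> x \<and> v \<noteq> y \<and> (u, v) \<in> ?R'" if "(u, v) \<in> ?R" for v
      using that
    proof (induction rule: rtrancl_induct)
      case base then show ?case using uw by simp
    next
      case (step v v')
      then have v: "v \<noteq> x" "v \<noteq> y" "(u, v) \<in> ?R'" by auto
      have "v' = F v \<or> v' = G v" using step by (auto simp: graph_def)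
      moreover have "F v \<noteq> x" "F v \<noteq> y" "G v \<noteq> x" "G v \<noteq> y"
        using v True Fy Gy G F by (metis involutionD)+
      moreover have "F' v = F v" "G' v = G v"
        using v calculation by (auto simp: F'_def G'_def contract_def)
      ultimately show ?case using v eF'[of v] eG'[of v] by (metis rtrancl_trans)
    qed
    then show ?thesis using uw' by blast
  next
    case False
    \<comment> \<open>Pushing \<open>x\<close> and \<open>y\<close> outwards to their
      \<open>F\<close>-partners maps every edge to a path of the contracted graph and fixes
      \<open>u\<close> and \<open>w\<close>.\<close>
    define r where "r z = (if z = x then F x else if z = y then F y else z)" for z
    have Fy: "F y \<noteq> x" using False F by (metis involutionD)
    have F'x: "F' (F x) = F y" "F' (F y) = F x"
      using False F Fy G(3) by (auto simp: F'_def contract_def involution_def)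
    have FF: "F (F z) = z" for z using F(1) by (simp add: involution_def)
    have rF: "(r v, r (F v)) \<in> ?R'" for v
    proof (cases "v = x \<or> v = y \<or> F v = x \<or> F v = y")
      case True
      then have "r (F v) = r v" using F False Fy FF[of v] FF[of x] FF[of y] by (auto simp: r_def)
      then show ?thesis by simp
    next
      case F: False
      then have "r v = v" "r (F v) = F' v" by (auto simp: r_def F'_def contract_def)
      then show ?thesis using eF'[of v] by simp
    qed
    have rG: "(r v, r (G v)) \<in> ?R'" for v
    proof (cases "v = x \<or> v = y")
      case True
      then show ?thesis using eF'[of "F x"] eF'[of "F y"] F'x G Gy by (auto simp: r_def)
    next
      case F: False
      then have "G v \<noteq> x" "G v \<noteq> y" using G Gy by (metis involutionD)+
      then have "r v = v" "r (G v) = G' v" using F by (auto simp: r_def G'_def)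
      then show ?thesis using eG'[of v] by simp
    qed
    have "(r u, r v) \<in> ?R'" if "(u, v) \<in> ?R" for v
      using that
    proof (induction rule: rtrancl_induct)
      case (step v v')
      then have "v' = F v \<or> v' = G v" by (auto simp: graph_def)
      then show ?case using step rF[of v] rG[of v] by (metis rtrancl_trans)
    qed simp
    from this[OF uw'] show ?thesis using uw by (auto simp: r_def)
  qed
qed

lemma rtrancl_graph_involution:
  assumes "involution H"
  shows "(u, w) \<in> (graph H)\<^sup>* \<longleftrightarrow> w = u \<or> w = H u"
proof
  show "w = u \<or> w = H u \<Longrightarrow> (u, w) \<in> (graph H)\<^sup>*" by (auto simp: graph_def)
  show "(u, w) \<in> (graph H)\<^sup>* \<Longrightarrow> w = u \<or> w = H u"
    by (induction rule: rtrancl_induct) (use assms in \<open>auto simp: graph_def involution_def\<close>)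
qed

text \<open>The pairs of \<open>G\<close> are removed from the inside outwards. By the last
  hypothesis everything between the ends of a pair of \<open>G\<close> is again paired by
  \<open>G\<close> within it, so a shortest pair of \<open>G\<close> has no point of
  \<open>supp F\<close> between its ends and can be contracted.\<close>

lemma contract_all:
  fixes k :: "'v \<Rightarrow> int"
  assumes "involution F" "finite (supp F)" "inj_on k (supp F)" "noncrossing k F"
    and "involution G" "supp G \<subseteq> supp F"
    and "\<And>x w. \<lbrakk>x \<in> supp G; w \<in> supp F; k x < k w; k w < k (G x)\<rbrakk> \<Longrightarrow>
           w \<in> supp G \<and> k x < k (G w) \<and> k (G w) < k (G x)"
  shows "\<exists>H. involution H \<and> supp H = supp F - supp G \<and> noncrossing k H \<and>
           (\<forall>u w. u \<notin> supp G \<longrightarrow> w \<notin> supp G \<longrightarrow>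
              ((u, w) \<in> (graph F \<union> graph G)\<^sup>* \<longleftrightarrow> w = u \<or> w = H u))"
  using assms
proof (induction "card (supp G)" arbitrary: F G rule: less_induct)
  case less
  note F = less.prems(1-4) and G = less.prems(5-6) and nest = less.prems(7)
  show ?case
  proof (cases "supp G = {}")
    case True
    then have "G = id" by (auto simp: supp_def)
    then have "graph G \<subseteq> Id" by (auto simp: graph_def)
    then have "(graph F \<union> graph G)\<^sup>* = (graph F)\<^sup>*"
      by (intro rtrancl_subset) auto
    then show ?thesis using True F rtrancl_graph_involution[OF F(1)] by (intro exI[of _ F]) simp
  next
    case False
    have GG: "G (G z) = z" for z using G(1) by (simp add: involution_def)
    have Gs: "G z \<in> supp G" if "z \<in> supp G" for z
      using that GG[of z] by (metis (mono_tags) mem_Collect_eq supp_def)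
    have kne: "k z \<noteq> k (G z)" if z: "z \<in> supp G" for z
    proof
      assume "k z = k (G z)"
      then have "z = G z" using F(3) G(2) Gs[OF z] z unfolding inj_on_def by blast
      then show False using z by (simp add: supp_def)
    qed
    let ?P = "\<lambda>x. x \<in> supp G \<and> k x < k (G x)"
    let ?m = "\<lambda>x. nat (k (G x) - k x)"
    have "\<exists>x. ?P x"
    proof -
      obtain z where z: "z \<in> supp G" using False by auto
      then have "?P z \<or> ?P (G z)"
        using kne[OF z] Gs[OF z] involutionD[OF G(1), of z] by auto
      then show ?thesis by blast
    qed
    then obtain x0 where "?P x0" by (elim exE)
    \<comment> \<open>\<open>?m\<close> is the length of a pair; a shortest pair is
      innermost.\<close>
    from ex_has_least_nat[of ?P x0 ?m, OF this]
    obtain x where x: "?P x" and xm: "\<And>z. ?P z \<Longrightarrow> ?m x \<le> ?m z" by (elim exE conjE) simp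
    define y where "y = G x"
    have y: "y \<in> supp G" "x \<noteq> y" "G y = x" "k x < k y"
      using x Gs[of x] G(1) by (auto simp: y_def involution_def)
    have adj: "\<not> (k x < k w \<and> k w < k y)" if w: "w \<in> supp F" for w
    proof
      assume b: "k x < k w \<and> k w < k y"
      then have n: "w \<in> supp G" "k x < k (G w)" "k (G w) < k (G x)"
        using nest[of x w] x w by (auto simp: y_def)
      then have "?P w \<or> ?P (G w)"
        using kne[OF n(1)] Gs[OF n(1)] involutionD[OF G(1), of w] by auto
      moreover have "?m w < ?m x" "?m (G w) < ?m x"
        using b n x involutionD[OF G(1), of w] by (auto simp: y_def)
      ultimately show False using xm[of w] xm[of "G w"] by linarith
    qed
    have Fxy: "F x \<noteq> x" "F y \<noteq> y" using x y G(2) by (auto simp: supp_def)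
    define F' where "F' = contract F x y"
    define G' where "G' = (\<lambda>z. if z = x \<or> z = y then z else G z)"
    have sG': "supp G' = supp G - {x, y}" by (auto simp: G'_def supp_def)
    have sF': "supp F' = supp F - {x, y}" unfolding F'_def by (rule supp_contract) (use F Fxy y in auto)
    have iG': "involution G'"
    proof -
      have "G z \<noteq> x \<and> G z \<noteq> y" if "z \<noteq> x" "z \<noteq> y" for z
        using that GG[of z] y y_def by metis
      then show ?thesis unfolding involution_def G'_def using GG by simp
    qed
    have "finite (supp G)" using G F finite_subset by blast
    then have c: "card (supp G') < card (supp G)"
      unfolding sG' by (intro psubset_card_mono) (use x in auto)
    have iF': "involution F'" unfolding F'_def by (rule involution_contract) (use F Fxy y in auto)
    have fin': "finite (supp F')" and inj': "inj_on k (supp F')" using F sF' by (auto simp: inj_on_def)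
    have nc': "noncrossing k F'" unfolding F'_def
      by (rule noncrossing_contract) (use F Fxy y adj in auto)
    have sub': "supp G' \<subseteq> supp F'" using sG' sF' G by auto
    have nest': "w \<in> supp G' \<and> k z < k (G' w) \<and> k (G' w) < k (G' z)"
      if "z \<in> supp G'" "w \<in> supp F'" "k z < k w" "k w < k (G' z)" for z w
      using that nest[of z w] sG' sF' by (auto simp: G'_def)
    have "\<exists>H. involution H \<and> supp H = supp F' - supp G' \<and> noncrossing k H \<and>
           (\<forall>u w. u \<notin> supp G' \<longrightarrow> w \<notin> supp G' \<longrightarrow>
              ((u, w) \<in> (graph F' \<union> graph G')\<^sup>* \<longleftrightarrow> w = u \<or> w = H u))"
      by (rule less.hyps[OF c iF' fin' inj' nc' iG' sub']) (rule nest')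
    then obtain H where H: "involution H" "supp H = supp F' - supp G'" "noncrossing k H"
      "\<forall>u w. u \<notin> supp G' \<longrightarrow> w \<notin> supp G' \<longrightarrow> ((u, w) \<in> (graph F' \<union> graph G')\<^sup>* \<longleftrightarrow> w = u \<or> w = H u)"
      by (elim exE conjE) simp
    have "(u, w) \<in> (graph F \<union> graph G)\<^sup>* \<longleftrightarrow> w = u \<or> w = H u" if "u \<notin> supp G" "w \<notin> supp G" for u w
    proof -
      have n: "u \<noteq> x" "u \<noteq> y" "w \<noteq> x" "w \<noteq> y" "u \<notin> supp G'" "w \<notin> supp G'"
        using that x y sG' by auto
      show ?thesis
        using H(4)[rule_format, OF n(5,6)] contract_connected[OF F(1) Fxy G(1) y_def[symmetric] y(2) n(1-4)]
        by (simp add: F'_def G'_def)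
    qed
    moreover have "supp H = supp F - supp G" using H(2) sF' sG' x y by auto
    ultimately show ?thesis using H(1,3) by (intro exI[of _ H]) simp
  qed
qed

section \<open>Composition of noncrossing involutions\<close>

definition NC :: "int set \<Rightarrow> int set \<Rightarrow> (int \<Rightarrow> int) set" where
  "NC D E = {f. involution f \<and> supp f = uminus ` D \<union> E \<and> noncrossing (\<lambda>z. z) f \<and>
     finite D \<and> finite E \<and> (\<forall>d\<in>D. 0 < d) \<and> (\<forall>e\<in>E. 0 < e)}"

text \<open>Coordinates in a stack of strips: the first component is the row, the second the
  position in it. The lower row of one strip and the upper row of the next receive the same
  coordinates, which glues them.\<close>

definition place :: "nat \<Rightarrow> nat \<Rightarrow> int \<Rightarrow> nat \<times> int" where
  "place i j z = (if z < 0 then (i, - z) else (j, z))"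

definition layer :: "nat \<Rightarrow> nat \<Rightarrow> (int \<Rightarrow> int) \<Rightarrow> ((nat \<times> int) \<times> (nat \<times> int)) set" where
  "layer i j f = {(place i j z, place i j (f z)) | z. True}"

definition conn :: "(int \<Rightarrow> int) \<Rightarrow> (int \<Rightarrow> int) \<Rightarrow> ((nat \<times> int) \<times> (nat \<times> int)) set" where
  "conn f g = (layer 0 1 f \<union> layer 1 2 g)\<^sup>*"

text \<open>The choice is harmless for composable involutions, where the other outer end of the path
  through \<open>z\<close> is unique. Closed loops in the middle row leave no trace, as in the
  Brauer category.\<close>

definition nc_mult :: "(int \<Rightarrow> int) \<Rightarrow> (int \<Rightarrow> int) \<Rightarrow> int \<Rightarrow> int" (infixl "\<odot>" 70) where
  "(f \<odot> g) z =
    (if \<exists>w. w \<noteq> z \<and> (place 0 2 z, place 0 2 w) \<in> conn f g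
     then SOME w. w \<noteq> z \<and> (place 0 2 z, place 0 2 w) \<in> conn f g else z)"

lemma uminus_image_iff: "(z::int) \<in> uminus ` D \<longleftrightarrow> - z \<in> D"
proof
  assume "- z \<in> D"
  then have "- (- z) \<in> uminus ` D" by (rule imageI)
  then show "z \<in> uminus ` D" by (simp only: minus_minus)
qed (elim imageE, simp only: minus_minus)

lemma NC_D:
  assumes "f \<in> NC D E"
  shows "involution f" "supp f = uminus ` D \<union> E" "noncrossing (\<lambda>z. z) f"
    "finite D" "finite E" "\<And>d. d \<in> D \<Longrightarrow> 0 < d" "\<And>e. e \<in> E \<Longrightarrow> 0 < e"
    "\<And>z. f (f z) = z" "\<And>z. f z \<noteq> z \<longleftrightarrow> - z \<in> D \<or> z \<in> E"
proof -
  show "f z \<noteq> z \<longleftrightarrow> - z \<in> D \<or> z \<in> E" for z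
  proof -
    have "f z \<noteq> z \<longleftrightarrow> z \<in> supp f" by (simp add: supp_def)
    also have "\<dots> \<longleftrightarrow> - z \<in> D \<or> z \<in> E" using assms by (simp add: NC_def uminus_image_iff)
    finally show ?thesis .
  qed
qed (use assms in \<open>auto simp: NC_def involution_def\<close>)

lemma NC_I:
  assumes "\<And>z. f (f z) = z" "\<And>z. f z \<noteq> z \<longleftrightarrow> - z \<in> D \<or> z \<in> E"
    "\<And>x y. x < y \<Longrightarrow> y < f x \<Longrightarrow> f x < f y \<Longrightarrow> False"
    "finite D" "finite E" "\<And>d. d \<in> D \<Longrightarrow> 0 < d" "\<And>e. e \<in> E \<Longrightarrow> 0 < e"
  shows "f \<in> NC D E"
proof -
  have "supp f = uminus ` D \<union> E"
    by (rule Set.set_eqI) (simp add: supp_def assms(2) uminus_image_iff)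
  then show ?thesis
    using assms by (auto simp: NC_def involution_def noncrossing_def)
qed

lemma NC_noncrossing:
  assumes "f \<in> NC D E" "x < y" "y < f x"
  shows "x < f y" "f y < f x"
proof -
  have N: "\<not> (x < y \<and> y < f x \<and> f x < f y)" for x y
    using NC_D(3)[OF assms(1)] by (auto simp: noncrossing_def)
  have ff: "f (f z) = z" for z using NC_D(8)[OF assms(1)] .
  have 1: "f y \<noteq> x" "f y \<noteq> f x" using assms(2,3) ff by (metis less_irrefl)+
  show "f y < f x" using N[of x y] 1 assms by linarith
  show "x < f y" using N[of "f y" x] ff[of y] 1 assms by (smt (verit))
qed

text \<open>The two involutions are laid side by side on a line, \<open>f\<close> to the left of
  \<open>g\<close>; identifying the middle rows pairs the point \<open>b\<close> of \<open>f\<close>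
  with the point \<open>- b\<close> of \<open>g\<close>. These pairs are concentric and enclose only
  middle points, so \<open>contract_all\<close> removes them.\<close>

lemma nc_mult_ex:
  assumes f: "f \<in> NC D E" and g: "g \<in> NC E G"
  shows "\<exists>h\<in>NC D G. \<forall>u w. (place 0 2 u, place 0 2 w) \<in> conn f g \<longleftrightarrow> w = u \<or> w = h u"
proof -
  note fD = NC_D[OF f] and gD = NC_D[OF g]
  define M where "M = insert 0 (abs ` (supp f \<union> supp g))"
  have "finite M" unfolding M_def fD(2) gD(2) using fD gD by simp
  \<comment> \<open>\<open>N\<close> exceeds all absolute values in both supports, so shifting by
    \<open>N\<close> in opposite directions separates \<open>f\<close> from \<open>g\<close>. The 0
    in \<open>M\<close> keeps the maximum defined and \<open>N\<close> positive.\<close>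
  define N where "N = Max M + 1"
  have N: "\<bar>z\<bar> < N" if "z \<in> supp f \<or> z \<in> supp g" for z
  proof -
    have "\<bar>z\<bar> \<in> M" using that by (auto simp: M_def)
    then show ?thesis using \<open>finite M\<close> Max_ge[of M "\<bar>z\<bar>"] by (simp add: N_def)
  qed
  have "0 \<in> M" by (simp add: M_def)
  then have N0: "0 < N" using \<open>finite M\<close> Max_ge[of M 0] by (simp add: N_def)
  define F where "F = map_sum f g"
  define K where "K = case_sum (\<lambda>b. if b \<in> E then Inr (- b) else Inl b) (\<lambda>z. if - z \<in> E then Inl (- z) else Inr z)"
  define k where "k = case_sum (\<lambda>z. z - N) (\<lambda>z. z + N)"
  have F_simps [simp]: "F (Inl z) = Inl (f z)" "F (Inr z) = Inr (g z)" for z by (auto simp: F_def)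
  have k_simps [simp]: "k (Inl z) = z - N" "k (Inr z) = z + N" for z by (auto simp: k_def)
  have sF: "supp F = Inl ` supp f \<union> Inr ` supp g"
  proof -
    have "x \<in> supp F \<longleftrightarrow> x \<in> Inl ` supp f \<union> Inr ` supp g" for x
      by (cases x) (auto simp: supp_def)
    then show ?thesis by blast
  qed
  have sK: "supp K = Inl ` E \<union> Inr ` uminus ` E"
  proof -
    have "x \<in> supp K \<longleftrightarrow> x \<in> Inl ` E \<union> Inr ` uminus ` E" for x
      by (cases x) (force simp: supp_def K_def image_iff)+
    then show ?thesis by blast
  qed
  have iF: "involution F"
    unfolding involution_def using fD(8) gD(8) by (auto simp: F_def split: sum.split) (metis map_sum.simps sumE F_simps F_def)
  have iK: "involution K"
    unfolding involution_def by (auto simp: K_def split: sum.split)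
  have sgn: "\<And>z. z \<in> supp f \<Longrightarrow> z < N" "\<And>z. z \<in> supp g \<Longrightarrow> - N < z"
    using N by fastforce+
  have inj: "inj_on k (supp F)"
    unfolding inj_on_def sF using sgn by fastforce
  have ncF: "noncrossing k F"
    unfolding noncrossing_def
  proof (intro allI notI)
    fix x y assume A: "k x < k y \<and> k y < k (F x) \<and> k (F x) < k (F y)"
    have ff: "f z < N" if "f z \<noteq> z" for z using sgn(1)[of "f z"] fD(8)[of z] that by (auto simp: supp_def)
    have gg: "- N < z" if "g z \<noteq> z" for z using sgn(2)[of "z"] that by (auto simp: supp_def)
    show False
    proof (cases x)
      case (Inl a)
      show False
      proof (cases y)
        case (Inl b) then show False using A \<open>x = Inl a\<close> fD(3) by (auto simp: noncrossing_def)
      next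
        case (Inr b)
        have "f a \<noteq> a" "g b \<noteq> b" using A Inr \<open>x = Inl a\<close> by auto
        then show False using A Inr \<open>x = Inl a\<close> ff[of a] gg[of b] by auto
      qed
    next
      case (Inr a)
      show False
      proof (cases y)
        case (Inr b) then show False using A \<open>x = Inr a\<close> gD(3) by (auto simp: noncrossing_def)
      next
        case (Inl b)
        have "f b \<noteq> b" "g a \<noteq> a" using A Inl \<open>x = Inr a\<close> by auto
        then show False using A Inl \<open>x = Inr a\<close> ff[of b] gg[of a] sgn(1)[of b] by (auto simp: supp_def)
      qed
    qed
  qed
  \<comment> \<open>The pair for the middle point \<open>b\<close> sits at \<open>b - N\<close> and
    \<open>N - b\<close>. The outer points lie further out: the upper ones of \<open>f\<close> left
    of \<open>- N\<close>, the lower ones of \<open>g\<close> right of \<open>N\<close>.\<close>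
  have nest: "w \<in> supp K \<and> k x < k (K w) \<and> k (K w) < k (K x)"
    if x: "x \<in> supp K" and w: "w \<in> supp F" and b: "k x < k w" "k w < k (K x)" for x w
  proof -
    have "\<exists>e\<in>E. x = Inl e \<and> K x = Inr (- e)"
    proof -
      consider e where "e \<in> E" "x = Inl e" | e where "e \<in> E" "x = Inr (- e)" using x sK by auto
      then show ?thesis
      proof cases
        case 1 then show ?thesis by (auto simp: K_def)
      next
        case 2
        then have "N - e < e - N" using b by (auto simp: K_def)
        moreover have "e < N" using 2 N[of e] fD(9)[of e] fD(7)[of e] by (auto simp: supp_def)
        ultimately show ?thesis by simp
      qed
    qed
    then obtain e where e: "e \<in> E" "x = Inl e" "K x = Inr (- e)" by blast
    show ?thesis
    proof (cases w)
      case (Inl a)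
      then have "e < a" using b e by auto
      moreover have "a \<in> supp f" using w Inl sF by auto
      ultimately have "a \<in> E" using fD(2,6) fD(7)[OF e(1)] by force
      then show ?thesis using Inl b e sK \<open>e < a\<close> by (auto simp: K_def)
    next
      case (Inr a)
      then have "a < - e" using b e by auto
      moreover have "a \<in> supp g" using w Inr sF by auto
      ultimately have "- a \<in> E" using gD(2,7) fD(7)[OF e(1)] by force
      moreover have "w \<in> supp K" unfolding sK Inr using calculation by (intro UnI2 imageI) (metis imageI minus_minus)
      ultimately show ?thesis using Inr b e \<open>a < - e\<close> by (auto simp: K_def)
    qed
  qed
  have "\<exists>H. involution H \<and> supp H = supp F - supp K \<and> noncrossing k H \<and>
           (\<forall>u w. u \<notin> supp K \<longrightarrow> w \<notin> supp K \<longrightarrow>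
              ((u, w) \<in> (graph F \<union> graph K)\<^sup>* \<longleftrightarrow> w = u \<or> w = H u))"
  proof (rule contract_all[OF iF _ inj ncF iK])
    show "finite (supp F)" unfolding sF fD(2) gD(2) using fD gD by simp
    show "supp K \<subseteq> supp F" unfolding sF sK fD(2) gD(2) by auto
  qed (rule nest)
  then obtain H where H: "involution H" "supp H = supp F - supp K" "noncrossing k H"
    "\<And>u w. u \<notin> supp K \<Longrightarrow> w \<notin> supp K \<Longrightarrow>
              ((u, w) \<in> (graph F \<union> graph K)\<^sup>* \<longleftrightarrow> w = u \<or> w = H u)"
    by blast
  have sH: "supp H = Inl ` uminus ` D \<union> Inr ` G"
    unfolding H(2) sF sK fD(2) gD(2) using fD(6,7) gD(6,7) by fastforce
  \<comment> \<open>\<open>inn\<close> puts an outer point of the product on its side of the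
    disjoint union, which the sign determines; \<open>dec\<close> forgets the side.\<close>
  define inn :: "int \<Rightarrow> int + int" where "inn z = (if z < 0 then Inl z else Inr z)" for z
  define dec :: "int + int \<Rightarrow> int" where "dec = case_sum (\<lambda>z. z) (\<lambda>z. z)"
  have dec [simp]: "dec (inn z) = z" for z by (simp add: dec_def inn_def)
  have inn_K: "inn z \<notin> supp K" for z
    using fD(7)[of z] fD(7)[of "- z"] unfolding sK inn_def by (auto split: if_splits)
  have sH_inn: "x = inn (dec x)" if "x \<in> supp H" for x
    using that fD(6) gD(7) unfolding sH inn_def dec_def by force
  define h where "h z = dec (H (inn z))" for z
  have Hh: "H (inn z) = inn (h z)" for z
  proof (cases "H (inn z) = inn z")
    case True then show ?thesis by (simp add: h_def)
  next
    case False
    then have "H (inn z) \<in> supp H" using involutionD[OF H(1)] by (auto simp: supp_def)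
    then show ?thesis using sH_inn by (simp add: h_def)
  qed
  have hh: "h (h z) = z" for z
    using Hh[of "h z"] Hh[of z] involutionD[OF H(1), of "inn z"] by (metis dec)
  have hs: "h z \<noteq> z \<longleftrightarrow> - z \<in> D \<or> z \<in> G" for z
  proof -
    have "h z \<noteq> z \<longleftrightarrow> inn z \<in> supp H" using Hh[of z] by (auto simp: supp_def) (metis dec)
    also have "\<dots> \<longleftrightarrow> - z \<in> D \<or> z \<in> G"
      unfolding sH inn_def using fD(6)[of "-z"] gD(7)[of z] by (force simp: image_iff)
    finally show ?thesis .
  qed
  have kmono: "k (inn a) < k (inn b)" if "a < b" for a b
    using that N0 by (auto simp: inn_def)
  have "h \<in> NC D G"
  proof (rule NC_I[OF hh hs])
    fix x y assume "x < y" "y < h x" "h x < h y"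
    then have "k (inn x) < k (inn y) \<and> k (inn y) < k (H (inn x)) \<and> k (H (inn x)) < k (H (inn y))"
      using kmono by (auto simp: Hh)
    then show False using H(3) by (auto simp: noncrossing_def)
  qed (use fD gD in auto)
  moreover have "(place 0 2 u, place 0 2 w) \<in> conn f g \<longleftrightarrow> w = u \<or> w = h u" for u w
  proof -
    \<comment> \<open>\<open>P\<close> performs the gluing: points paired by \<open>K\<close> have
      equal coordinates in the stack. Conversely, a step in the stack lifts to the disjoint union,
      possibly after a \<open>K\<close>-edge that changes the side.\<close>
    define P where "P = case_sum (place 0 1) (place 1 2)"
    have P [simp]: "P (Inl z) = place 0 1 z" "P (Inr z) = place 1 2 z" for z by (auto simp: P_def)
    have Pinn: "P (inn z) = place 0 2 z" for z by (auto simp: inn_def place_def)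
    let ?R = "(graph F \<union> graph K)\<^sup>*"
    have lF: "(v, F v) \<in> ?R" and lK: "(v, K v) \<in> ?R" for v by (auto simp: graph_def)
    have "(P x, P y) \<in> conn f g" if "(x, y) \<in> ?R" for x y
      using that
    proof (induction rule: rtrancl_induct)
      case base then show ?case by (simp add: conn_def)
    next
      case (step y z)
      then consider "z = F y" | "z = K y" by (auto simp: graph_def)
      then show ?case
      proof cases
        case 1
        have "(P y, P z) \<in> layer 0 1 f \<union> layer 1 2 g"
          using 1 by (cases y) (auto simp: layer_def)
        then show ?thesis using step.IH unfolding conn_def by (rule rtrancl.rtrancl_into_rtrancl[rotated])
      next
        case 2
        then have "P z = P y" using fD(7) by (cases y) (force simp: K_def place_def)+
        then show ?thesis using step.IH by simp
      qed
    qed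
    note fwd = this
    have bwd: "\<exists>v. P v = p \<and> (inn u, v) \<in> ?R" if "(place 0 2 u, p) \<in> conn f g" for p
      using that unfolding conn_def
    proof (induction rule: rtrancl_induct)
      case base then show ?case using Pinn by blast
    next
      case (step p q)
      then obtain v where v: "P v = p" "(inn u, v) \<in> ?R" by blast
      from step(2) consider z where "p = place 0 1 z" "q = place 0 1 (f z)"
        | z where "p = place 1 2 z" "q = place 1 2 (g z)" by (auto simp: layer_def)
      then show ?case
      proof cases
        case 1
        have "v = Inl z \<or> v = Inr (- z) \<and> z > 0"
          using v(1) 1(1) by (cases v) (auto simp: place_def split: if_splits)
        then show ?thesis
        proof
          assume "v = Inl z"
          then show ?thesis using v lF[of v] 1 by (intro exI[of _ "F v"]) (auto intro: rtrancl_trans)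
        next
          assume A: "v = Inr (- z) \<and> z > 0"
          show ?thesis
          proof (cases "z \<in> E")
            case True
            then have "K v = Inl z" using A by (simp add: K_def)
            then have "(inn u, Inl (f z)) \<in> ?R"
              using v lK[of v] lF[of "Inl z"] by (auto intro: rtrancl_trans)
            then show ?thesis using 1 P(1) by blast
          next
            case False
            then have "f z = z" using fD(9)[of z] fD(6)[of "-z"] A by auto
            then show ?thesis using 1 v by auto
          qed
        qed
      next
        case 2
        have "v = Inr z \<or> v = Inl (- z) \<and> z < 0"
          using v(1) 2(1) by (cases v) (auto simp: place_def split: if_splits)
        then show ?thesis
        proof
          assume "v = Inr z"
          then show ?thesis using v lF[of v] 2 by (intro exI[of _ "F v"]) (auto intro: rtrancl_trans)
        next
          assume A: "v = Inl (- z) \<and> z < 0"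
          show ?thesis
          proof (cases "- z \<in> E")
            case True
            then have "K v = Inr z" using A by (simp add: K_def)
            then have "(inn u, Inr (g z)) \<in> ?R"
              using v lK[of v] lF[of "Inr z"] by (auto intro: rtrancl_trans)
            then show ?thesis using 2 P(2) by blast
          next
            case False
            then have "g z = z" using gD(9)[of z] gD(7)[of "z"] A by auto
            then show ?thesis using 2 v by auto
          qed
        qed
      qed
    qed
    have uniq: "v = inn w" if "P v = place 0 2 w" for v
      using that by (cases v) (auto simp: place_def inn_def split: if_splits)
    have "(place 0 2 u, place 0 2 w) \<in> conn f g \<longleftrightarrow> (inn u, inn w) \<in> ?R"
      using fwd[of "inn u" "inn w"] bwd[of "place 0 2 w"] uniq Pinn by metis
    also have "\<dots> \<longleftrightarrow> w = u \<or> w = h u"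
      using H(4)[OF inn_K inn_K, of u w] Hh[of u] by (metis dec)
    finally show ?thesis .
  qed
  ultimately show ?thesis by blast
qed

lemma nc_mult_conn:
  assumes "f \<in> NC D E" "g \<in> NC E G"
  shows "(place 0 2 u, place 0 2 w) \<in> conn f g \<longleftrightarrow> w = u \<or> w = (f \<odot> g) u"
    and nc_mult_NC: "f \<odot> g \<in> NC D G"
proof -
  obtain h where h: "h \<in> NC D G" "\<And>u w. (place 0 2 u, place 0 2 w) \<in> conn f g \<longleftrightarrow> w = u \<or> w = h u"
    using nc_mult_ex[OF assms] by blast
  have "(f \<odot> g) z = h z" for z
  proof (cases "h z = z")
    case True then show ?thesis by (simp add: nc_mult_def h(2))
  next
    case False
    then have "(SOME w. w \<noteq> z \<and> (w = z \<or> w = h z)) = h z" by (intro some_equality) auto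
    then show ?thesis using False by (auto simp: nc_mult_def h(2))
  qed
  then have "f \<odot> g = h" by blast
  then show "(place 0 2 u, place 0 2 w) \<in> conn f g \<longleftrightarrow> w = u \<or> w = (f \<odot> g) u" "f \<odot> g \<in> NC D G"
    using h by auto
qed

text \<open>The path through an outer point has only one other outer end, so it is enough to exhibit
  some path to the expected partner.\<close>

lemma nc_mult_eqI:
  assumes "f \<in> NC D E" "g \<in> NC E G"
    and "\<And>z. h z \<noteq> z \<longleftrightarrow> - z \<in> D \<or> z \<in> G"
    and "\<And>z. - z \<in> D \<or> z \<in> G \<Longrightarrow> (place 0 2 z, place 0 2 (h z)) \<in> conn f g"
  shows "f \<odot> g = h"
proof
  fix z
  show "(f \<odot> g) z = h z"
    using assms(3)[of z] assms(4)[of z] nc_mult_conn(1)[OF assms(1,2), of z "h z"]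
      NC_D(9)[OF nc_mult_NC[OF assms(1,2)], of z] by metis
qed

section \<open>Rank and factorisation\<close>

text \<open>Reflection in a horizontal line: negation exchanges the rows and keeps the
  positions.\<close>

definition flip :: "(int \<Rightarrow> int) \<Rightarrow> int \<Rightarrow> int" where
  "flip f z = - f (- z)"

definition nc_id :: "int set \<Rightarrow> int \<Rightarrow> int" where
  "nc_id D z = (if z \<in> D \<or> - z \<in> D then - z else z)"

definition nc_rank :: "(int \<Rightarrow> int) \<Rightarrow> nat" where
  "nc_rank f = card {z. z < 0 \<and> 0 < f z}"

lemma NC_zero:
  assumes "f \<in> NC D E"
  shows "f 0 = 0" "f z = 0 \<longleftrightarrow> z = 0"
proof -
  show "f 0 = 0" using NC_D(6,7,9)[OF assms, of 0] by auto
  then show "f z = 0 \<longleftrightarrow> z = 0" using NC_D(8)[OF assms] by metis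
qed

text \<open>The upper points determine all upper arcs and all transversals; only arcs between two
  lower points remain.\<close>

lemma NC_ext_half:
  assumes f: "f \<in> NC D E" and h: "h \<in> NC D E"
    and "\<And>z. z < 0 \<Longrightarrow> - z \<in> D \<Longrightarrow> f z = h z"
    and "\<And>z. 0 < z \<Longrightarrow> z \<in> E \<Longrightarrow> 0 < h z \<Longrightarrow> f z = h z"
  shows "f = h"
proof
  fix z
  have neg: "f z = h z" if "z < 0" for z
    using assms(3)[OF that] NC_D(7,9)[OF f, of z] NC_D(7,9)[OF h, of z] that
    by (metis not_less_iff_gr_or_eq)
  consider "z < 0" | "z = 0" | "0 < z" "h z < 0" | "0 < z" "0 < h z" "z \<in> E" | "0 < z" "z \<notin> E"
    using NC_zero(2)[OF h, of z] by linarith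
  then show "f z = h z"
  proof cases
    case 1 then show ?thesis by (rule neg)
  next
    case 2 then show ?thesis using NC_zero(1)[OF f] NC_zero(1)[OF h] by simp
  next
    case 3
    then have "f (h z) = z" using neg[of "h z"] NC_D(8)[OF h] by simp
    then show ?thesis using NC_D(8)[OF f] by metis
  next
    case 4 then show ?thesis by (intro assms(4))
  next
    case 5
    then show ?thesis using NC_D(6,9)[OF f, of "- z"] NC_D(9)[OF f, of z] NC_D(9)[OF h, of z] NC_D(6)[OF h, of "- z"] by auto
  qed
qed

section \<open>Evaluating products along short paths\<close>

lemma conn_refl: "(p, p) \<in> conn f g"
  by (simp add: conn_def)

lemma conn_left: "(place 0 1 z, place 0 1 (f z)) \<in> conn f g"
  unfolding conn_def by (rule r_into_rtrancl) (auto simp: layer_def)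

lemma conn_right: "(place 1 2 z, place 1 2 (g z)) \<in> conn f g"
  unfolding conn_def by (rule r_into_rtrancl) (auto simp: layer_def)

lemma conn_trans: "(p, q) \<in> conn f g \<Longrightarrow> (q, r) \<in> conn f g \<Longrightarrow> (p, r) \<in> conn f g"
  by (simp add: conn_def)

lemma nc_mult_at:
  assumes "f \<in> NC D E" "g \<in> NC E G" "(place 0 2 z, place 0 2 w) \<in> conn f g" "w \<noteq> z"
  shows "(f \<odot> g) z = w"
  using assms nc_mult_conn(1)[OF assms(1,2), of z w] by auto

lemma conn_up_up: "z < 0 \<Longrightarrow> f z < 0 \<Longrightarrow> (place 0 2 z, place 0 2 (f z)) \<in> conn f g"
  using conn_left[of z f g] by (simp add: place_def)

lemma conn_up_mid: "z < 0 \<Longrightarrow> 0 < f z \<Longrightarrow> (place 0 2 z, place 1 2 (- f z)) \<in> conn f g"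
  using conn_left[of z f g] by (simp add: place_def)

lemma conn_mid_mid1: "0 < b \<Longrightarrow> 0 < f b \<Longrightarrow> (place 1 2 (- b), place 1 2 (- f b)) \<in> conn f g"
  using conn_left[of b f g] by (simp add: place_def)

lemma conn_mid_up: "0 < b \<Longrightarrow> f b < 0 \<Longrightarrow> (place 1 2 (- b), place 0 2 (f b)) \<in> conn f g"
  using conn_left[of b f g] by (simp add: place_def)

lemma conn_mid_low: "b < 0 \<Longrightarrow> 0 < g b \<Longrightarrow> (place 1 2 b, place 0 2 (g b)) \<in> conn f g"
  using conn_right[of b g f] by (simp add: place_def)

lemma conn_low_low: "0 < z \<Longrightarrow> 0 < g z \<Longrightarrow> (place 0 2 z, place 0 2 (g z)) \<in> conn f g"
  using conn_right[of z g f] by (simp add: place_def)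

lemma nc_mult_up:
  assumes "f \<in> NC D E" "g \<in> NC E G" "z < 0" "f z < 0"
  shows "(f \<odot> g) z = f z"
proof (cases "f z = z")
  case True
  then have "(f \<odot> g) z = z"
    using NC_D(9)[OF assms(1), of z] NC_D(9)[OF nc_mult_NC[OF assms(1,2)], of z] NC_D(7)[OF assms(2), of z] assms(3) by auto
  then show ?thesis using True by simp
next
  case False
  show ?thesis by (rule nc_mult_at[OF assms(1,2) _ False]) (rule conn_up_up, use assms in simp_all)
qed

lemma nc_mult_low:
  assumes "f \<in> NC D E" "g \<in> NC E G" "0 < z" "0 < g z"
  shows "(f \<odot> g) z = g z"
proof (cases "g z = z")
  case True
  then have "(f \<odot> g) z = z"
    using NC_D(9)[OF assms(2), of z] NC_D(9)[OF nc_mult_NC[OF assms(1,2)], of z] NC_D(6)[OF assms(1), of "- z"] assms(3) by auto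
  then show ?thesis using True by simp
next
  case False
  show ?thesis by (rule nc_mult_at[OF assms(1,2) _ False]) (rule conn_low_low, use assms in simp_all)
qed

lemma nc_mult_down:
  assumes "f \<in> NC D E" "g \<in> NC E G" "z < 0" "0 < f z" "0 < g (- f z)"
  shows "(f \<odot> g) z = g (- f z)"
proof (rule nc_mult_at[OF assms(1,2)])
  show "(place 0 2 z, place 0 2 (g (- f z))) \<in> conn f g"
    by (rule conn_trans[OF conn_up_mid conn_mid_low]) (use assms in simp_all)
qed (use assms in simp)

text \<open>The path goes down, follows one upper arc of \<open>g\<close> and climbs back. The last
  hypothesis says that this arc is a genuine one, which keeps the final end different from
  \<open>z\<close>.\<close>

lemma nc_mult_up_up:
  assumes "f \<in> NC D E" "g \<in> NC E G" "z < 0" "0 < f z" "g (- f z) < 0" "f (- g (- f z)) < 0"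
    "g (- f z) \<noteq> - f z"
  shows "(f \<odot> g) z = f (- g (- f z))"
proof (rule nc_mult_at[OF assms(1,2)])
  have "(place 1 2 (- f z), place 1 2 (g (- f z))) \<in> conn f g" by (rule conn_right)
  moreover have "(place 1 2 (g (- f z)), place 0 2 (f (- g (- f z)))) \<in> conn f g"
    using conn_mid_up[of "- g (- f z)" f g] assms by simp
  ultimately show "(place 0 2 z, place 0 2 (f (- g (- f z)))) \<in> conn f g"
    using conn_up_mid[of z f g] assms conn_trans by meson
  show "f (- g (- f z)) \<noteq> z"
  proof
    assume "f (- g (- f z)) = z"
    then have "- g (- f z) = f z" using NC_D(8)[OF assms(1)] by metis
    then show False using assms(7) by simp
  qed
qed

text \<open>Rows can be renamed freely because positions within a row are untouched. This embeds a
  stack of two strips in a larger one and turns stacks upside down.\<close>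

lemma map_layers:
  assumes "(p, q) \<in> (layer a b f \<union> layer c d g)\<^sup>*"
  shows "(map_prod \<tau> id p, map_prod \<tau> id q) \<in> (layer (\<tau> a) (\<tau> b) f \<union> layer (\<tau> c) (\<tau> d) g)\<^sup>*"
  using assms
proof (induction rule: rtrancl_induct)
  case (step q r)
  have pl: "map_prod \<tau> id (place i j z) = place (\<tau> i) (\<tau> j) z" for i j z
    by (simp add: place_def)
  from step(2) have "(map_prod \<tau> id q, map_prod \<tau> id r) \<in> layer (\<tau> a) (\<tau> b) f \<union> layer (\<tau> c) (\<tau> d) g"
    unfolding layer_def using pl by auto
  then show ?case using step.IH by (rule rtrancl.rtrancl_into_rtrancl[rotated])
qed simp

lemma flip_flip [simp]: "flip (flip f) = f"
  by (auto simp: flip_def)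

lemma flip_NC:
  assumes "f \<in> NC D E"
  shows "flip f \<in> NC E D"
proof (rule NC_I)
  show "flip f (flip f z) = z" for z using NC_D(8)[OF assms] by (simp add: flip_def)
  show "flip f z \<noteq> z \<longleftrightarrow> - z \<in> E \<or> z \<in> D" for z
    using NC_D(9)[OF assms, of "- z"] by (auto simp: flip_def minus_equation_iff) 
  fix x y :: int assume A: "x < y" "y < flip f x" "flip f x < flip f y"
  then have "f (- x) < - y" "- y < f (f (- x))" using NC_D(8)[OF assms] by (auto simp: flip_def)
  from NC_noncrossing(1)[OF assms this] A show False by (simp add: flip_def)
qed (use NC_D[OF assms] in auto)

text \<open>Turning the stack upside down, by renaming row \<open>i\<close> to \<open>2 - i\<close>,
  takes the paths for \<open>f\<close> and \<open>g\<close> to the paths for the reflected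
  pair.\<close>

lemma flip_mult:
  assumes f: "f \<in> NC D E" and g: "g \<in> NC E G"
  shows "flip (f \<odot> g) = flip g \<odot> flip f"
proof -
  let ?h = "f \<odot> g"
  note hN = nc_mult_NC[OF f g]
  have "flip g \<odot> flip f = flip ?h"
  proof (rule nc_mult_eqI[OF flip_NC[OF g] flip_NC[OF f]])
    show "flip ?h z \<noteq> z \<longleftrightarrow> - z \<in> G \<or> z \<in> D" for z
      by (rule NC_D(9)[OF flip_NC[OF hN]])
    fix z assume z: "- z \<in> G \<or> z \<in> D"
    define \<tau> :: "nat \<Rightarrow> nat" where "\<tau> i = 2 - i" for i
    have pl: "place j i (- z) = place i j z" if "z \<noteq> 0" for i j z
      using that by (auto simp: place_def)
    \<comment> \<open>0 is the only point at which exchanging the rows does not match negation. It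
      is fixed by every diagram and so contributes only a trivial step.\<close>
    have la: "layer j i f \<subseteq> layer i j (flip f) \<union> Id" if "f \<in> NC X Y" for i j f X Y
    proof
      fix p assume "p \<in> layer j i f"
      then obtain z where z: "p = (place j i z, place j i (f z))" by (auto simp: layer_def)
      show "p \<in> layer i j (flip f) \<union> Id"
      proof (cases "z = 0")
        case True then show ?thesis using z NC_zero(1)[OF that] by simp
      next
        case False
        then have "p = (place i j (- z), place i j (flip f (- z)))"
          using z pl[of "- z" j i] pl[of "- f z" j i] NC_zero(2)[OF that, of z] by (simp add: flip_def)
        then show ?thesis by (auto simp: layer_def)
      qed
    qed
    have z0: "z \<noteq> 0" "flip ?h z \<noteq> 0"
      using z NC_D(6)[OF f, of z] NC_D(7)[OF g, of "- z"] NC_zero(2)[OF flip_NC[OF hN], of z] by auto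
    have "(place 0 2 (- z), place 0 2 (?h (- z))) \<in> conn f g"
      using nc_mult_conn(1)[OF f g] by blast
    then have "(map_prod \<tau> id (place 0 2 (- z)), map_prod \<tau> id (place 0 2 (?h (- z))))
       \<in> (layer 2 1 f \<union> layer 1 0 g)\<^sup>*"
      unfolding conn_def by (drule_tac map_layers[where \<tau> = \<tau>]) (simp add: \<tau>_def)
    also have "map_prod \<tau> id (place 0 2 (- z)) = place 0 2 z"
      using z0 by (auto simp: place_def \<tau>_def)
    also have "map_prod \<tau> id (place 0 2 (?h (- z))) = place 0 2 (flip ?h z)"
      using z0 by (auto simp: place_def \<tau>_def flip_def)
    finally have "(place 0 2 z, place 0 2 (flip ?h z)) \<in> (layer 2 1 f \<union> layer 1 0 g)\<^sup>*" .
    moreover have "layer 2 1 f \<union> layer 1 0 g \<subseteq> (layer 0 1 (flip g) \<union> layer 1 2 (flip f))\<^sup>*"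
      using la[OF f, of 2 1] la[OF g, of 1 0] by auto
    ultimately show "(place 0 2 z, place 0 2 (flip ?h z)) \<in> conn (flip g) (flip f)"
      unfolding conn_def using rtrancl_subset_rtrancl by blast
  qed
  then show ?thesis by simp
qed

text \<open>Both bracketings are compared with the stack of three strips with rows 0 to 3. A path
  for the right bracketing is expanded into the stack, and a path in the stack is compressed to the
  left bracketing; since partners are unique, this one direction suffices.\<close>

lemma nc_mult_assoc:
  assumes f: "f \<in> NC A B" and g: "g \<in> NC B C" and h: "h \<in> NC C D"
  shows "(f \<odot> g) \<odot> h = f \<odot> (g \<odot> h)"
proof -
  note fg = nc_mult_NC[OF f g] and gh = nc_mult_NC[OF g h]
  let ?R = "layer 0 1 f \<union> layer 1 2 g" and ?K = "layer 2 3 h"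
  let ?S = "(layer 0 2 (f \<odot> g) \<union> ?K)\<^sup>*"
  have S2: "(place 0 2 a, place 0 2 ((f \<odot> g) a)) \<in> ?S" for a
    by (rule r_into_rtrancl) (auto simp: layer_def)
  have lvl3: "fst p \<noteq> 3 \<and> fst q \<noteq> 3" if pq: "(p, q) \<in> ?R\<^sup>*" and ne: "p \<noteq> q" for p q
  proof -
    from pq have "\<exists>x. (p, x) \<in> ?R" by (rule converse_rtranclE) (use ne in auto)
    moreover from pq have "\<exists>y. (y, q) \<in> ?R" by (rule rtranclE) (use ne in auto)
    ultimately show ?thesis by (auto simp: layer_def place_def split: if_splits)
  qed
  \<comment> \<open>Invariant along a path in the full stack: it consists of a compressed path to
    some \<open>v\<close> outside row 1, followed by a piece that has not yet left the upper two
    strips.\<close>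
  have inv: "\<exists>v. (\<exists>a. v = place 0 2 a \<or> v = place 2 3 a) \<and> (place 0 3 u, v) \<in> ?S \<and> (v, q) \<in> ?R\<^sup>*"
    if "(place 0 3 u, q) \<in> (?R \<union> ?K)\<^sup>*" for u q
    using that
  proof (induction rule: rtrancl_induct)
    case base
    have "place 0 3 u = place 0 2 u \<or> place 0 3 u = place 2 3 u" by (simp add: place_def)
    then show ?case by blast
  next
    case (step q r)
    then obtain v where v: "\<exists>a. v = place 0 2 a \<or> v = place 2 3 a" "(place 0 3 u, v) \<in> ?S" "(v, q) \<in> ?R\<^sup>*" by blast
    from step(2) consider "(q, r) \<in> ?R" | b where "q = place 2 3 b" "r = place 2 3 (h b)"
      by (auto simp: layer_def)
    then show ?case
    proof cases
      case 1
      with v(3) have "(v, r) \<in> ?R\<^sup>*" by (rule rtrancl.rtrancl_into_rtrancl)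
      with v(1,2) show ?thesis by (intro exI[of _ v] conjI)
    next
      case 2
      have "(v, q) \<in> ?S" 
        using v(1,3) 2(1) h
      proof -
        show ?thesis
        proof (cases "v = q")
          case False
          have lvl: "fst q \<noteq> 3" "fst v \<noteq> 3"
            using lvl3[OF v(3) False] by auto
          then have "b < 0" using 2(1) by (auto simp: place_def split: if_splits)
          then have q: "q = place 0 2 (- b)" using 2(1) by (simp add: place_def)
          obtain a where a: "v = place 0 2 a"
          proof -
            from v(1) obtain a where "v = place 0 2 a \<or> v = place 2 3 a" by blast
            then have "v = place 0 2 a \<or> v = place 0 2 (- a)" using lvl by (auto simp: place_def split: if_splits)
            then show ?thesis using that by blast
          qed
          have "- b = a \<or> - b = (f \<odot> g) a"
            using nc_mult_conn(1)[OF f g, of a "- b"] v(3) unfolding conn_def q a by simp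
          then show ?thesis unfolding q a using S2[of a] by auto
        qed simp
      qed
      moreover have "(q, r) \<in> ?S" using 2 by (auto simp: layer_def)
      ultimately have "(place 0 3 u, r) \<in> ?S" using v(2) by simp
      then show ?thesis using 2 by blast
    qed
  qed
  have uniq: "w = u \<or> w = ((f \<odot> g) \<odot> h) u" if c: "(place 0 3 u, place 0 3 w) \<in> (?R \<union> ?K)\<^sup>*" for u w
  proof -
    obtain v where v: "\<exists>a. v = place 0 2 a \<or> v = place 2 3 a" "(place 0 3 u, v) \<in> ?S" "(v, place 0 3 w) \<in> ?R\<^sup>*"
      using inv[OF c] by blast
    have "(v, place 0 3 w) \<in> ?S"
    proof (cases "v = place 0 3 w")
      case False
      have lvl: "fst (place 0 3 w) \<noteq> 3" "fst v \<noteq> 3"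
        using lvl3[OF v(3) False] by auto
      then have q: "place 0 3 w = place 0 2 w" by (auto simp: place_def split: if_splits)
      obtain a where a: "v = place 0 2 a"
      proof -
        from v(1) obtain a where "v = place 0 2 a \<or> v = place 2 3 a" by blast
        then have "v = place 0 2 a \<or> v = place 0 2 (- a)" using lvl by (auto simp: place_def split: if_splits)
        then show ?thesis using that by blast
      qed
      have "w = a \<or> w = (f \<odot> g) a"
        using nc_mult_conn(1)[OF f g, of a w] v(3) unfolding conn_def q a by simp
      then show ?thesis unfolding q a using S2[of a] by auto
    qed simp
    then have S: "(place 0 3 u, place 0 3 w) \<in> ?S" using v(2) by simp
    \<comment> \<open>Rows 0, 2, 3 become 0, 1, 2, the rows of a product of two factors; truncated
      subtraction keeps row 0.\<close>
    define \<tau> :: "nat \<Rightarrow> nat" where "\<tau> i = i - 1" for i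
    have "(place 0 2 u, place 0 2 w) \<in> conn (f \<odot> g) h"
      using map_layers[OF S, of \<tau>] by (simp add: conn_def \<tau>_def place_def split: if_splits)
    then show ?thesis using nc_mult_conn(1)[OF fg h] by simp
  qed
  have "(f \<odot> (g \<odot> h)) u = ((f \<odot> g) \<odot> h) u" for u
  proof -
    let ?w = "(f \<odot> (g \<odot> h)) u"
    define \<tau> :: "nat \<Rightarrow> nat" where "\<tau> i = (if i = 2 then 3 else i)" for i
    have c: "(place 0 2 u, place 0 2 ?w) \<in> (layer 0 1 f \<union> layer 1 2 (g \<odot> h))\<^sup>*"
      using nc_mult_conn(1)[OF f gh] unfolding conn_def by blast
    have c': "(place 0 3 u, place 0 3 ?w) \<in> (layer 0 1 f \<union> layer 1 3 (g \<odot> h))\<^sup>*"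
      using map_layers[OF c, of \<tau>] by (simp add: \<tau>_def place_def split: if_splits)
    have "layer 1 3 (g \<odot> h) \<subseteq> (layer 1 2 g \<union> ?K)\<^sup>*"
    proof
      fix p assume "p \<in> layer 1 3 (g \<odot> h)"
      then obtain z where z: "p = (place 1 3 z, place 1 3 ((g \<odot> h) z))" by (auto simp: layer_def)
      have c: "(place 0 2 z, place 0 2 ((g \<odot> h) z)) \<in> (layer 0 1 g \<union> layer 1 2 h)\<^sup>*"
        using nc_mult_conn(1)[OF g h] unfolding conn_def by blast
      show "p \<in> (layer 1 2 g \<union> ?K)\<^sup>*"
        using map_layers[OF c, of Suc] unfolding z by (simp add: place_def numeral_2_eq_2 numeral_3_eq_3 split: if_splits)
    qed
    then have "layer 0 1 f \<union> layer 1 3 (g \<odot> h) \<subseteq> (?R \<union> ?K)\<^sup>*"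
      using rtrancl_mono[of "layer 1 2 g \<union> ?K" "?R \<union> ?K"] by auto
    then have "(place 0 3 u, place 0 3 ?w) \<in> (?R \<union> ?K)\<^sup>*"
      using c' rtrancl_subset_rtrancl by blast
    from uniq[OF this] show ?thesis
    proof
      assume u: "?w = u"
      then have "- u \<notin> A \<and> u \<notin> D" using NC_D(9)[OF nc_mult_NC[OF f gh], of u] by simp
      then have "((f \<odot> g) \<odot> h) u = u" using NC_D(9)[OF nc_mult_NC[OF fg h], of u] by simp
      then show ?thesis using u by simp
    qed
  qed
  then show ?thesis by auto
qed

lemma nc_id_NC:
  assumes "finite D" "\<And>d. d \<in> D \<Longrightarrow> 0 < d"
  shows "nc_id D \<in> NC D D"
proof (rule NC_I)
  show "nc_id D (nc_id D z) = z" for z by (simp add: nc_id_def)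
  show "nc_id D z \<noteq> z \<longleftrightarrow> - z \<in> D \<or> z \<in> D" for z
    using assms(2)[of z] assms(2)[of "- z"] by (auto simp: nc_id_def)
qed (use assms in \<open>auto simp: nc_id_def split: if_splits\<close>)

lemma NC_neg_iff:
  assumes "f \<in> NC D E" "f z \<noteq> z"
  shows "f z < 0 \<Longrightarrow> - f z \<in> D" "0 < f z \<Longrightarrow> f z \<in> E"
proof -
  have "f (f z) \<noteq> f z" using NC_D(8)[OF assms(1)] assms(2) by metis
  then have *: "- f z \<in> D \<or> f z \<in> E" using NC_D(9)[OF assms(1)] by blast
  show "f z < 0 \<Longrightarrow> - f z \<in> D" using * NC_D(7)[OF assms(1), of "f z"] by linarith
  show "0 < f z \<Longrightarrow> f z \<in> E" using * NC_D(6)[OF assms(1), of "- f z"] by linarith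
qed

lemma nc_mult_id_left:
  assumes f: "f \<in> NC D E"
  shows "nc_id D \<odot> f = f"
proof -
  have i: "nc_id D \<in> NC D D" using NC_D[OF f] by (intro nc_id_NC) auto
  show ?thesis
  proof (rule NC_ext_half[OF nc_mult_NC[OF i f] f])
    fix z :: int assume z: "z < 0" "- z \<in> D"
    have iz: "nc_id D z = - z" using z by (simp add: nc_id_def)
    have fz: "f z \<noteq> z" using z NC_D(9)[OF f] by blast
    consider "0 < f z" | "f z < 0" using NC_zero(2)[OF f, of z] z by linarith
    then show "(nc_id D \<odot> f) z = f z"
    proof cases
      case 1 then show ?thesis using nc_mult_down[OF i f, of z] z iz by simp
    next
      case 2
      have "nc_id D (- f z) = f z" using NC_neg_iff(1)[OF f fz 2] by (simp add: nc_id_def)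
      then show ?thesis using nc_mult_up_up[OF i f, of z] z iz 2 fz by simp
    qed
  next
    fix z :: int assume "0 < z" "0 < f z"
    then show "(nc_id D \<odot> f) z = f z" by (rule nc_mult_low[OF i f])
  qed
qed

lemma flip_id [simp]: "flip (nc_id D) = nc_id D"
  by (auto simp: flip_def nc_id_def)

lemma nc_mult_id_right:
  assumes f: "f \<in> NC D E"
  shows "f \<odot> nc_id E = f"
proof -
  have "nc_id E \<in> NC E E" using NC_D[OF f] by (intro nc_id_NC) auto
  then have "flip (f \<odot> nc_id E) = flip f"
    using flip_mult[OF f] nc_mult_id_left[OF flip_NC[OF f]] by simp
  then show ?thesis by (metis flip_flip)
qed

section \<open>Rank\<close>

lemma finite_transversal:
  assumes "f \<in> NC D E"
  shows "finite {z. z < 0 \<and> 0 < f z}"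
proof (rule finite_subset)
  show "{z. z < 0 \<and> 0 < f z} \<subseteq> supp f" by (auto simp: supp_def)
  show "finite (supp f)" using NC_D(2,4,5)[OF assms] by simp
qed

lemma nc_rank_low:
  assumes "f \<in> NC D E"
  shows "nc_rank f = card {b. 0 < b \<and> f b < 0}"
  unfolding nc_rank_def
  by (rule bij_betw_same_card[of f], rule bij_betw_byWitness[of _ f]) (use NC_D(8)[OF assms] in auto)

lemma nc_rank_flip:
  assumes "f \<in> NC D E"
  shows "nc_rank (flip f) = nc_rank f"
  unfolding nc_rank_low[OF flip_NC[OF assms]] unfolding nc_rank_def
  by (rule bij_betw_same_card[of uminus], rule bij_betw_byWitness[of _ uminus]) (auto simp: flip_def)

text \<open>Upper arcs of \<open>f\<close> survive in the product, so every transversal of the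
  product starts along a transversal of \<open>f\<close>.\<close>

lemma nc_rank_mult_left:
  assumes "f \<in> NC D E" "g \<in> NC E G"
  shows "nc_rank (f \<odot> g) \<le> nc_rank f"
  unfolding nc_rank_def
proof (rule card_mono[OF finite_transversal[OF assms(1)]], intro subsetI CollectI conjI)
  fix z assume "z \<in> {z. z < 0 \<and> 0 < (f \<odot> g) z}"
  then show "z < 0" "0 < f z"
    using nc_mult_up[OF assms, of z] NC_zero(2)[OF assms(1), of z] by (cases "f z < 0"; auto)+
qed

lemma nc_rank_mult_right:
  assumes "f \<in> NC D E" "g \<in> NC E G"
  shows "nc_rank (f \<odot> g) \<le> nc_rank g"
  using nc_rank_mult_left[OF flip_NC[OF assms(2)] flip_NC[OF assms(1)]] flip_mult[OF assms]
    nc_rank_flip[OF assms(2)] nc_rank_flip[OF nc_mult_NC[OF assms]] by simp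

lemma nc_rank_le:
  assumes "f \<in> NC D E"
  shows "nc_rank f \<le> card E" "nc_rank f \<le> card D"
proof -
  have *: "nc_rank f \<le> card E" if "f \<in> NC D E" for f D E
    unfolding nc_rank_low[OF that]
    by (rule card_mono[OF NC_D(5)[OF that]]) (use NC_D(6,9)[OF that] in force)
  show "nc_rank f \<le> card E" "nc_rank f \<le> card D"
    using *[OF assms] *[OF flip_NC[OF assms]] nc_rank_flip[OF assms] by auto
qed

lemma nc_rank_full_iff:
  assumes "f \<in> NC D E"
  shows "nc_rank f = card E \<longleftrightarrow> (\<forall>b\<in>E. f b < 0)"
proof -
  have sub: "{b. 0 < b \<and> f b < 0} \<subseteq> E"
    using NC_D(6,9)[OF assms] by force
  then have "nc_rank f = card E \<longleftrightarrow> {b. 0 < b \<and> f b < 0} = E"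
    unfolding nc_rank_low[OF assms] using card_subset_eq[OF NC_D(5)[OF assms]] by auto
  also have "\<dots> \<longleftrightarrow> (\<forall>b\<in>E. f b < 0)"
    using sub NC_D(7)[OF assms] by blast
  finally show ?thesis .
qed

text \<open>Full rank means that every lower point is the end of a transversal, so in the product
  each point runs up a transversal and down the same one.\<close>

lemma full_flip_mult:
  assumes P: "P \<in> NC A K" and full: "nc_rank P = card K"
  shows "flip P \<odot> P = nc_id K"
proof (rule NC_ext_half[OF nc_mult_NC[OF flip_NC[OF P] P] nc_id_NC])
  fix z :: int assume z: "z < 0" "- z \<in> K"
  then have "P (- z) < 0" using full nc_rank_full_iff[OF P] by blast
  then show "(flip P \<odot> P) z = nc_id K z"
    using nc_mult_down[OF flip_NC[OF P] P, of z] z NC_D(8)[OF P] by (simp add: flip_def nc_id_def)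
next
  fix z :: int assume "0 < z" "0 < nc_id K z"
  then have "z \<notin> K" by (auto simp: nc_id_def split: if_splits)
  moreover assume "z \<in> K"
  ultimately show "(flip P \<odot> P) z = nc_id K z" by simp
qed (use NC_D[OF P] in auto)

section \<open>Factorisation at the transversals\<close>

definition idx :: "int set \<Rightarrow> int \<Rightarrow> int" where
  "idx D d = int (card {a \<in> D. a \<le> d})"

lemma idx_mono:
  assumes "finite D" "d' \<in> D" "d < d'"
  shows "idx D d < idx D d'"
proof -
  have "d' \<in> {a \<in> D. a \<le> d'}" "d' \<notin> {a \<in> D. a \<le> d}" using assms by auto
  moreover have "{a \<in> D. a \<le> d} \<subseteq> {a \<in> D. a \<le> d'}" using assms by auto
  ultimately have "{a \<in> D. a \<le> d} \<subset> {a \<in> D. a \<le> d'}" by blast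
  then show ?thesis unfolding idx_def of_nat_less_iff
    by (intro psubset_card_mono) (use assms in auto)
qed

lemma idx_bij:
  assumes "finite D"
  shows "bij_betw (idx D) D {1..int (card D)}"
proof -
  have inj: "inj_on (idx D) D"
    by (rule inj_onI) (metis idx_mono[OF assms] less_irrefl linorder_neqE)
  have "idx D d \<in> {1..int (card D)}" if "d \<in> D" for d
  proof -
    have "0 < card {a \<in> D. a \<le> d}" using that assms by (subst card_gt_0_iff) auto
    moreover have "card {a \<in> D. a \<le> d} \<le> card D" by (rule card_mono[OF assms]) auto
    ultimately show ?thesis unfolding idx_def by auto
  qed
  then have "idx D ` D \<subseteq> {1..int (card D)}" by blast
  moreover have "card (idx D ` D) = card {1..int (card D)}" using card_image[OF inj] by simp
  ultimately have "idx D ` D = {1..int (card D)}" by (intro card_subset_eq) auto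
  then show ?thesis using inj by (simp add: bij_betw_def)
qed

definition through :: "(int \<Rightarrow> int) \<Rightarrow> int set" where
  "through f = {d. 0 < d \<and> 0 < f (- d)}"

lemma through_subset:
  assumes "f \<in> NC A B"
  shows "through f \<subseteq> A"
proof
  fix d assume "d \<in> through f"
  then show "d \<in> A" using NC_D(7,9)[OF assms, of "- d"] by (auto simp: through_def)
qed

lemma finite_through: "f \<in> NC A B \<Longrightarrow> finite (through f)"
  using through_subset NC_D(4) finite_subset by metis

lemma card_through: "card (through f) = nc_rank f"
  unfolding nc_rank_def through_def
  by (rule bij_betw_same_card[of uminus], rule bij_betw_byWitness[of _ uminus]) auto

lemma through_flip: "through (flip f) = {b. 0 < b \<and> f b < 0}"
  by (auto simp: through_def flip_def)

lemma through_mono: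
  assumes f: "f \<in> NC A B" and "d \<in> through f" "d' \<in> through f" "d < d'"
  shows "f (- d) < f (- d')"
  using NC_noncrossing(2)[OF f, of "- d'" "- d"] assms by (auto simp: through_def)

text \<open>Transversals do not cross, so following them is an order isomorphism from their upper
  ends to their lower ends.\<close>

lemma idx_through:
  assumes f: "f \<in> NC A B" and d: "d \<in> through f"
  shows "f (- d) \<in> through (flip f)" "idx (through (flip f)) (f (- d)) = idx (through f) d"
proof -
  have ff: "f (f z) = z" for z by (rule NC_D(8)[OF f])
  show *: "f (- d) \<in> through (flip f)" using d ff by (simp add: through_flip) (simp add: through_def)
  let ?S = "{a \<in> through f. a \<le> d}" and ?T = "{b \<in> through (flip f). b \<le> f (- d)}"
  have "bij_betw (\<lambda>a. f (- a)) ?S ?T"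
  proof (rule bij_betw_byWitness[of _ "\<lambda>b. - f b"])
    show "(\<lambda>a. f (- a)) ` ?S \<subseteq> ?T"
    proof clarify
      fix a assume a: "a \<in> through f" "a \<le> d"
      have "f (- a) \<in> through (flip f)" using a ff by (simp add: through_flip) (simp add: through_def)
      moreover have "f (- a) \<le> f (- d)"
        using through_mono[OF f a(1) d] a(2) by (cases "a = d") auto
      ultimately show "f (- a) \<in> through (flip f) \<and> f (- a) \<le> f (- d)" ..
    qed
    show "(\<lambda>b. - f b) ` ?T \<subseteq> ?S"
    proof clarify
      fix b assume b: "b \<in> through (flip f)" "b \<le> f (- d)"
      have t: "- f b \<in> through f" using b ff by (simp add: through_flip) (simp add: through_def)
      have "- f b \<le> d"
      proof (rule ccontr)
        assume "\<not> - f b \<le> d"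
        then have "f (- d) < f (- (- f b))" using through_mono[OF f d t] by simp
        then show False using b ff by simp
      qed
      then show "- f b \<in> through f \<and> - f b \<le> d" using t by simp
    qed
  qed (use ff in auto)
  then show "idx (through (flip f)) (f (- d)) = idx (through f) d"
    unfolding idx_def using bij_betw_same_card by fastforce
qed

text \<open>The part of the diagram above a cut through all transversals, with the cut points
  renumbered from 1 to the rank. The renumbering gives all diagrams of equal rank a common middle
  row, so that their halves can be compared and multiplied.\<close>

definition upper_half :: "(int \<Rightarrow> int) \<Rightarrow> int \<Rightarrow> int" where
  "upper_half f z =
    (if z < 0 then if 0 < f z then idx (through f) (- z) else f z
     else if z \<in> {1..int (nc_rank f)} then - inv_into (through f) (idx (through f)) z else z)"

lemma upper_half_low:
  assumes f: "f \<in> NC A B" and z: "z \<in> {1..int (nc_rank f)}"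
  obtains d where "d \<in> through f" "idx (through f) d = z" "upper_half f z = - d"
proof -
  let ?D = "through f"
  have b: "bij_betw (idx ?D) ?D {1..int (nc_rank f)}"
    using idx_bij[OF finite_through[OF f]] by (simp add: card_through)
  let ?d = "inv_into ?D (idx ?D) z"
  have "z \<in> idx ?D ` ?D" using b z by (simp add: bij_betw_def)
  then have "?d \<in> ?D" "idx ?D ?d = z" by (rule inv_into_into, rule f_inv_into_f)
  then show ?thesis using that z by (auto simp: upper_half_def)
qed

lemma upper_half_through:
  assumes f: "f \<in> NC A B" and d: "d \<in> through f"
  shows "upper_half f (- d) = idx (through f) d" "idx (through f) d \<in> {1..int (nc_rank f)}"
    "upper_half f (idx (through f) d) = - d"
proof -
  let ?D = "through f"
  have b: "bij_betw (idx ?D) ?D {1..int (nc_rank f)}"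
    using idx_bij[OF finite_through[OF f]] by (simp add: card_through)
  show "upper_half f (- d) = idx (through f) d" using d by (auto simp: upper_half_def through_def)
  show *: "idx (through f) d \<in> {1..int (nc_rank f)}" using b d by (auto simp: bij_betw_def)
  have "inv_into ?D (idx ?D) (idx ?D d) = d" using b d by (simp add: bij_betw_def)
  then show "upper_half f (idx (through f) d) = - d" using * by (auto simp: upper_half_def)
qed

lemma upper_half_NC:
  assumes f: "f \<in> NC A B"
  shows "upper_half f \<in> NC A {1..int (nc_rank f)}"
proof -
  let ?h = "upper_half f" and ?D = "through f" and ?k = "int (nc_rank f)"
  note fD = NC_D[OF f]
  have hup: "?h z = f z" if "z < 0" "\<not> 0 < f z" for z using that by (simp add: upper_half_def)
  have hfix: "?h z = z" if "\<not> z < 0" "z \<notin> {1..?k}" for z using that by (auto simp: upper_half_def)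
  \<comment> \<open>Every point is the upper end of a transversal, another negative point, a
    renumbered cut point or a fixed nonnegative point.\<close>
  have cases: "(\<exists>d\<in>?D. z = - d) \<or> (z < 0 \<and> \<not> 0 < f z) \<or> (\<exists>d\<in>?D. z = idx ?D d \<and> ?h z = - d) \<or> (\<not> z < 0 \<and> z \<notin> {1..?k})" for z
  proof -
    have "z < 0 \<Longrightarrow> 0 < f z \<Longrightarrow> - z \<in> ?D" by (simp add: through_def)
    moreover have "z \<in> {1..?k} \<Longrightarrow> \<exists>d\<in>?D. z = idx ?D d \<and> ?h z = - d"
      using upper_half_low[OF f, of z] by metis
    ultimately show ?thesis by (metis minus_minus)
  qed
  have Dpos: "0 < d" if "d \<in> ?D" for d using that by (simp add: through_def)
  show ?thesis
  proof (rule NC_I)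
    fix z
    show "?h (?h z) = z"
      using cases[of z]
    proof (elim disjE bexE conjE)
      assume z: "z < 0" "\<not> 0 < f z"
      then have "f z < 0" using NC_zero(2)[OF f, of z] by linarith
      then show ?thesis using z hup[of "f z"] hup[of z] fD(8) by simp
    next
      fix d assume d: "d \<in> ?D" "z = - d"
      then show ?thesis using upper_half_through[OF f d(1)] by simp
    next
      fix d assume d: "d \<in> ?D" "z = idx ?D d"
      then show ?thesis using upper_half_through[OF f d(1)] by simp
    qed (use hfix in simp)
    show "?h z \<noteq> z \<longleftrightarrow> - z \<in> A \<or> z \<in> {1..?k}"
      using cases[of z]
    proof (elim disjE bexE conjE)
      assume z: "z < 0" "\<not> 0 < f z"
      then show ?thesis using hup[OF z] fD(9)[of z] fD(7)[of z] by auto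
    next
      fix d assume d: "d \<in> ?D" "z = - d"
      then show ?thesis using upper_half_through[OF f d(1)] Dpos[OF d(1)] through_subset[OF f] by auto
    next
      fix d assume d: "d \<in> ?D" "z = idx ?D d"
      then show ?thesis using upper_half_through[OF f d(1)] Dpos[OF d(1)] by auto
    next
      assume z: "\<not> z < 0" "z \<notin> {1..?k}"
      then show ?thesis using hfix[OF z] fD(6)[of "- z"] by auto
    qed
  next
    fix x y assume A: "x < y" "y < ?h x" "?h x < ?h y"
    show False
      using cases[of x]
    proof (elim disjE bexE conjE)
      assume x: "x < 0" "\<not> 0 < f x"
      then have n: "f x < 0" using NC_zero(2)[OF f, of x] by linarith
      have "y < f x" using A hup[OF x] by simp
      then have "f y < f x" "y < 0" using NC_noncrossing[OF f A(1)] n by auto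
      then show False using A hup[of x] hup[of y] x n by simp
    next
      fix d assume d: "d \<in> ?D" "x = - d"
      have h: "?h x = idx ?D d" using upper_half_through[OF f d(1)] d by simp
      show False
        using cases[of y]
      proof (elim disjE bexE conjE)
        assume "y < 0" "\<not> 0 < f y"
        then show False using A h hup[of y] upper_half_through(2)[OF f d(1)] by auto
      next
        fix d' assume d': "d' \<in> ?D" "y = - d'"
        then have "idx ?D d' < idx ?D d" using A d idx_mono[OF finite_through[OF f] d(1), of d'] by auto
        then show False using A h upper_half_through(1)[OF f d'(1)] d' by simp
      next
        fix d' assume "d' \<in> ?D" "y = idx ?D d'" "?h y = - d'"
        then show False using A h upper_half_through(2)[OF f d(1)] Dpos[of d'] by simp
      next
        assume y: "\<not> y < 0" "y \<notin> {1..?k}"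
        then show False using A h upper_half_through(2)[OF f d(1)] hfix[OF y] by simp
      qed
    next
      fix d assume d: "d \<in> ?D" "x = idx ?D d" "?h x = - d"
      then show False using A Dpos[OF d(1)] upper_half_through(2)[OF f d(1)] by simp
    next
      assume "\<not> x < 0" "x \<notin> {1..?k}"
      then show False using A hfix[of x] by simp
    qed
  qed (use fD in auto)
qed

lemma upper_half_rank:
  assumes f: "f \<in> NC A B"
  shows "nc_rank (upper_half f) = nc_rank f"
proof -
  have "\<forall>b\<in>{1..int (nc_rank f)}. upper_half f b < 0"
    using upper_half_low[OF f] by (metis neg_less_0_iff_less through_def mem_Collect_eq)
  then show ?thesis using nc_rank_full_iff[OF upper_half_NC[OF f]] by simp
qed

text \<open>The cut is numbered alike from above and from below, by \<open>idx_through\<close>, so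
  gluing the halves reconnects each transversal with itself.\<close>

lemma half_factorization:
  assumes f: "f \<in> NC A B"
  shows "f = upper_half f \<odot> flip (upper_half (flip f))"
proof -
  let ?P = "upper_half f" and ?Q = "flip (upper_half (flip f))"
  have P: "?P \<in> NC A {1..int (nc_rank f)}" by (rule upper_half_NC[OF f])
  have Q: "?Q \<in> NC {1..int (nc_rank f)} B"
    using flip_NC[OF upper_half_NC[OF flip_NC[OF f]]] nc_rank_flip[OF f] by simp
  have "?P \<odot> ?Q = f"
  proof (rule NC_ext_half[OF nc_mult_NC[OF P Q] f])
    fix z :: int assume z: "z < 0" "- z \<in> A"
    show "(?P \<odot> ?Q) z = f z"
    proof (cases "0 < f z")
      case True
      then have t: "- z \<in> through f" using z by (simp add: through_def)
      have "?P z = idx (through f) (- z)" using upper_half_through(1)[OF f t] by simp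
      moreover have "upper_half (flip f) (idx (through f) (- z)) = - f z"
        using idx_through[OF f t] upper_half_through(3)[OF flip_NC[OF f], of "f z"] by simp
      ultimately show ?thesis
        using nc_mult_down[OF P Q, of z] z True upper_half_through(2)[OF f t] by (simp add: flip_def)
    next
      case False
      then have "?P z = f z" "f z < 0" using z NC_zero(2)[OF f, of z] by (auto simp: upper_half_def)
      then show ?thesis using nc_mult_up[OF P Q] z by simp
    qed
  next
    fix z :: int assume z: "0 < z" "0 < f z"
    then have "?Q z = f z" by (simp add: flip_def upper_half_def)
    then show "(?P \<odot> ?Q) z = f z" using nc_mult_low[OF P Q] z by simp
  qed
  then show ?thesis by simp
qed

text \<open>If both rows consist of ends of transversals, each upper point must go to the lower
  point with the same index.\<close>

lemma full_unique:
  assumes f: "f \<in> NC A K" and g: "g \<in> NC A K" and "nc_rank f = card K" "nc_rank g = card K" "card A = card K"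
  shows "f = g"
proof -
  have thr: "through h = A" "through (flip h) = K" if h: "h \<in> NC A K" "nc_rank h = card K" for h
  proof -
    show "through h = A"
      by (rule card_subset_eq[OF NC_D(4)[OF h(1)] through_subset[OF h(1)]]) (simp add: card_through h(2) assms)
    show "through (flip h) = K"
      by (rule card_subset_eq[OF NC_D(5)[OF h(1)] through_subset[OF flip_NC[OF h(1)]]])
        (simp add: card_through nc_rank_flip[OF h(1)] h(2) assms)
  qed
  have idxK: "inj_on (idx K) K" using idx_bij[OF NC_D(5)[OF f]] by (simp add: bij_betw_def)
  show ?thesis
  proof (rule NC_ext_half[OF f g])
    fix z :: int assume "z < 0" "- z \<in> A"
    then have "f z \<in> K" "g z \<in> K" "idx K (f z) = idx K (g z)"
      using idx_through[OF f, of "- z"] idx_through[OF g, of "- z"] thr[OF f assms(3)] thr[OF g assms(4)] by auto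
    then show "f z = g z" using idxK by (simp add: inj_on_def)
  next
    fix z :: int assume "0 < z" "z \<in> K" "0 < g z"
    then show "f z = g z" using assms(4) nc_rank_full_iff[OF g] by fastforce
  qed
qed

lemma full_endo_id: "f \<in> NC K K \<Longrightarrow> nc_rank f = card K \<Longrightarrow> f = nc_id K"
proof -
  assume f: "f \<in> NC K K" "nc_rank f = card K"
  have i: "nc_id K \<in> NC K K" using NC_D[OF f(1)] by (intro nc_id_NC) auto
  then have "nc_rank (nc_id K) = card K"
    using nc_rank_full_iff[OF i] NC_D(7)[OF i] by (simp add: nc_id_def)
  then show ?thesis using full_unique[OF f(1) i] f(2) by simp
qed

section \<open>Cups and contractions\<close>

definition cup :: "int set \<Rightarrow> int \<Rightarrow> int \<Rightarrow> int \<Rightarrow> int" where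
  "cup A u v z = (if z = - u then - v else if z = - v then - u else nc_id (A - {u, v}) z)"

definition adjacent :: "int set \<Rightarrow> int \<Rightarrow> int \<Rightarrow> bool" where
  "adjacent A u v \<longleftrightarrow> u \<in> A \<and> v \<in> A \<and> u < v \<and> (\<forall>w\<in>A. \<not> (u < w \<and> w < v))"

text \<open>The lower row keeps the names of the remaining positions, so nothing is renumbered when
  a neighbouring pair is removed; this is why rows are arbitrary finite sets of positive integers
  and not initial segments.\<close>

lemma cup_NC:
  assumes "adjacent A u v" "finite A" "\<And>a. a \<in> A \<Longrightarrow> 0 < a"
  shows "cup A u v \<in> NC A (A - {u, v})"
proof (rule NC_I)
  have uv: "0 < u" "u < v" using assms by (auto simp: adjacent_def)
  show "cup A u v (cup A u v z) = z" for z
  proof (cases "z = - u \<or> z = - v")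
    case False
    then have 1: "cup A u v z = nc_id (A - {u, v}) z" by (simp add: cup_def)
    have "nc_id (A - {u, v}) z \<noteq> - u" "nc_id (A - {u, v}) z \<noteq> - v"
      using False uv assms(3)[of "- z"] by (auto simp: nc_id_def)
    then have "cup A u v (nc_id (A - {u, v}) z) = nc_id (A - {u, v}) (nc_id (A - {u, v}) z)"
      by (simp only: cup_def if_False simp_thms)
    also have "\<dots> = z" by (auto simp: nc_id_def)
    finally show ?thesis unfolding 1 .
  qed (use uv in \<open>auto simp: cup_def\<close>)
  show "cup A u v z \<noteq> z \<longleftrightarrow> - z \<in> A \<or> z \<in> A - {u, v}" for z
    using assms(1) assms(3)[of z] assms(3)[of "- z"] by (auto simp: cup_def nc_id_def adjacent_def)
  fix x y assume A: "x < y" "y < cup A u v x" "cup A u v x < cup A u v y"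
  show False
  proof (cases "x = - v")
    case True
    then have "- y \<notin> A" "y < 0" using A uv assms(1) by (auto simp: cup_def adjacent_def)
    then have "cup A u v y = y" using assms(1) assms(3)[of y] by (auto simp: cup_def nc_id_def adjacent_def)
    then show False using A by simp
  next
    case False
    then have "x \<noteq> - u" using A uv by (auto simp: cup_def)
    then have x: "- x \<in> A - {u, v}" "cup A u v x = - x" using A False assms(3)[of x] by (auto simp: cup_def nc_id_def split: if_splits)
    then show False using A uv assms(3) by (auto simp: cup_def nc_id_def split: if_splits)
  qed
qed (use assms in auto)

lemma cup_full:
  assumes "adjacent A u v" "finite A" "\<And>a. a \<in> A \<Longrightarrow> 0 < a"
  shows "nc_rank (cup A u v) = card (A - {u, v})"
proof -
  have "\<forall>b\<in>A - {u, v}. cup A u v b < 0"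
  proof
    fix b assume b: "b \<in> A - {u, v}"
    moreover have "0 < b" "0 < u" "0 < v" using b assms by (auto simp: adjacent_def)
    ultimately show "cup A u v b < 0" by (auto simp: cup_def nc_id_def)
  qed
  then show ?thesis using nc_rank_full_iff[OF cup_NC[OF assms]] by blast
qed

text \<open>Multiplying by the reflected cup joins \<open>u\<close> and \<open>v\<close> from above,
  which is a contraction. This translates between products, which congruences respect, and
  contractions, on which arcs and transversals can be read off.\<close>

lemma uncup:
  assumes uv: "adjacent A u v" and P: "P \<in> NC A K"
  shows "flip (cup A u v) \<odot> P = contract P (- u) (- v)"
proof -
  note PD = NC_D[OF P]
  let ?c = "flip (cup A u v)"
  have c: "?c \<in> NC (A - {u, v}) A" using flip_NC[OF cup_NC[OF uv]] PD by simp
  have u0: "u \<in> A" "v \<in> A" "0 < u" "u < v" using uv PD(6) by (auto simp: adjacent_def)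
  have Pne: "P (- u) \<noteq> - u" "P (- v) \<noteq> - v" using PD(9) u0 by auto
  have s: "supp (contract P (- u) (- v)) = supp P - {- u, - v}"
    by (rule supp_contract) (use PD(1) Pne u0 in auto)
  show ?thesis
  proof (rule nc_mult_eqI[OF c P])
    show *: "contract P (- u) (- v) z \<noteq> z \<longleftrightarrow> - z \<in> A - {u, v} \<or> z \<in> K" for z
    proof -
      have "contract P (- u) (- v) z \<noteq> z \<longleftrightarrow> z \<in> supp P - {- u, - v}"
        unfolding s[symmetric] by (simp add: supp_def)
      also have "\<dots> \<longleftrightarrow> (- z \<in> A \<or> z \<in> K) \<and> z \<noteq> - u \<and> z \<noteq> - v"
        using PD(9)[of z] by (auto simp: supp_def)
      also have "\<dots> \<longleftrightarrow> - z \<in> A - {u, v} \<or> z \<in> K"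
        using PD(7)[of z] u0 by auto
      finally show ?thesis .
    qed
    have cz: "?c z = - z" if "- z \<in> A - {u, v}" for z
      using that PD(6)[of "- z"] u0 by (auto simp: flip_def cup_def nc_id_def)
    have cz': "?c (- z) = z" if "- z \<in> A - {u, v}" for z
      using that PD(6)[of "- z"] u0 by (auto simp: flip_def cup_def nc_id_def)
    \<comment> \<open>\<open>entry\<close> and \<open>exit\<close> connect the outer row with the
      middle row along the vertical lines of the cup; for a lower point of \<open>P\<close> both are
      trivial.\<close>
    have entry: "(place 0 2 z, place 1 2 z) \<in> conn ?c P" if "- z \<in> A - {u, v} \<or> z \<in> K" for z
    proof (cases "z < 0")
      case True
      then have "- z \<in> A - {u, v}" using that PD(7)[of z] by auto
      then show ?thesis using conn_up_mid[of z ?c P] cz[of z] True by simp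
    next
      case False then show ?thesis using conn_refl by (simp add: place_def)
    qed
    have exit: "(place 1 2 z, place 0 2 z) \<in> conn ?c P" if "- z \<in> A - {u, v} \<or> z \<in> K" for z
    proof (cases "z < 0")
      case True
      then have "- z \<in> A - {u, v}" using that PD(7)[of z] by auto
      then show ?thesis using conn_mid_up[of "- z" ?c P] cz'[of z] True by simp
    next
      case False then show ?thesis using conn_refl by (simp add: place_def)
    qed
    have cu: "?c u = v" "?c v = u" using u0 by (auto simp: flip_def cup_def)
    have uvc: "(place 1 2 (- u), place 1 2 (- v)) \<in> conn ?c P" "(place 1 2 (- v), place 1 2 (- u)) \<in> conn ?c P"
      using conn_mid_mid1[of u ?c P] conn_mid_mid1[of v ?c P] cu u0 by auto
    fix z assume z: "- z \<in> A - {u, v} \<or> z \<in> K"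
    let ?w = "contract P (- u) (- v) z"
    have zne: "z \<noteq> - u" "z \<noteq> - v" using z PD(7)[of z] u0 by auto
    have w: "- ?w \<in> A - {u, v} \<or> ?w \<in> K"
    proof -
      have "involution (contract P (- u) (- v))" by (rule involution_contract) (use PD(1) Pne u0 in auto)
      then have "contract P (- u) (- v) ?w = z" by (simp add: involution_def)
      then show ?thesis using * z by metis
    qed
    have 1: "(place 0 2 z, place 1 2 (P z)) \<in> conn ?c P"
      using entry[OF z] conn_right conn_trans by blast
    have "(place 1 2 (P z), place 1 2 ?w) \<in> conn ?c P"
    proof -
      consider "P z = - u" "?w = P (- v)" | "P z = - v" "?w = P (- u)" | "?w = P z"
        using zne u0 by (cases "P z = - u"; cases "P z = - v") (auto simp: contract_def)
      then show ?thesis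
      proof cases
        case 1 then show ?thesis using uvc(1) conn_right[of "- v" P ?c] conn_trans by metis
      next
        case 2 then show ?thesis using uvc(2) conn_right[of "- u" P ?c] conn_trans by metis
      next
        case 3 then show ?thesis using conn_refl by simp
      qed
    qed
    then show "(place 0 2 z, place 0 2 ?w) \<in> conn ?c P"
      using 1 exit[OF w] conn_trans by blast
  qed
qed

text \<open>An arc that is present is removed and put back; every other point keeps its partner,
  which lies neither at \<open>u\<close> nor at \<open>v\<close>.\<close>

lemma cup_uncup:
  assumes uv: "adjacent A u v" and f: "f \<in> NC A K" and arc: "f (- u) = - v"
  shows "cup A u v \<odot> (flip (cup A u v) \<odot> f) = f"
proof -
  note fD = NC_D[OF f]
  have c: "cup A u v \<in> NC A (A - {u, v})" using cup_NC[OF uv] fD by simp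
  let ?h = "flip (cup A u v) \<odot> f"
  have h: "?h \<in> NC (A - {u, v}) K" by (rule nc_mult_NC[OF flip_NC[OF c] f])
  have u0: "u \<in> A" "v \<in> A" "0 < u" "u < v" using uv fD(6) by (auto simp: adjacent_def)
  have arc': "f (- v) = - u" using arc fD(8) by metis
  have hz: "?h z = f z" if "z \<noteq> - u" "z \<noteq> - v" for z
  proof -
    have "f z \<noteq> - u" "f z \<noteq> - v" using that arc arc' fD(8) by metis+
    then show ?thesis unfolding uncup[OF uv f] using that by (simp add: contract_def)
  qed
  show ?thesis
  proof (rule NC_ext_half[OF nc_mult_NC[OF c h] f])
    fix z :: int assume z: "z < 0" "- z \<in> A"
    show "(cup A u v \<odot> ?h) z = f z"
    proof (cases "z = - u \<or> z = - v")
      case True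
      then have "cup A u v z = f z" "f z < 0" using arc arc' u0 by (auto simp: cup_def)
      then show ?thesis using nc_mult_up[OF c h] z by simp
    next
      case False
      then have cz: "cup A u v z = - z" using z by (auto simp: cup_def nc_id_def)
      have hf: "?h z = f z" using hz False by simp
      have fz: "?h z \<noteq> z" using fD(9)[of z] z hf by simp
      consider "0 < f z" | "f z < 0" using NC_zero(2)[OF f, of z] z by linarith
      then show ?thesis
      proof cases
        case 1 then show ?thesis using nc_mult_down[OF c h, of z] z cz hf by simp
      next
        case 2
        then have "- f z \<in> A - {u, v}" using NC_neg_iff(1)[OF h fz] hf by simp
        then have "cup A u v (- f z) = f z" using 2 u0 by (auto simp: cup_def nc_id_def)
        then show ?thesis using nc_mult_up_up[OF c h, of z] z cz hf fz 2 by simp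
      qed
    qed
  next
    fix z :: int assume z: "0 < z" "0 < f z"
    then show "(cup A u v \<odot> ?h) z = f z" using nc_mult_low[OF c h, of z] hz[of z] u0 by simp
  qed
qed

section \<open>Parity of rows and ranks\<close>

lemma even_card_involution:
  assumes "finite S" "\<And>x. x \<in> S \<Longrightarrow> f x \<in> S \<and> f x \<noteq> x \<and> f (f x) = x"
  shows "even (card S)"
  using assms
proof (induction "card S" arbitrary: S rule: less_induct)
  case less
  show ?case
  proof (cases "S = {}")
    case False
    then obtain x where x: "x \<in> S" by blast
    let ?T = "S - {x, f x}"
    have fx: "f x \<in> S" "f x \<noteq> x" "f (f x) = x" using less.prems(2)[OF x] by auto
    have c: "card S = card ?T + 2"
      using x fx less.prems(1) card_Diff_subset[of "{x, f x}" S] card_mono[of S "{x, f x}"] by auto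
    have "even (card ?T)"
    proof (rule less.hyps)
      show "card ?T < card S" using c by simp
      show "finite ?T" using less.prems(1) by simp
      fix y assume y: "y \<in> ?T"
      have fy: "f y \<in> S \<and> f y \<noteq> y \<and> f (f y) = y" using less.prems(2) y by blast
      moreover have "f y \<noteq> x" "f y \<noteq> f x" using fy fx y by (metis DiffE insertCI)+
      ultimately show "f y \<in> ?T \<and> f y \<noteq> y \<and> f (f y) = y" by blast
    qed
    then show ?thesis using c by simp
  qed simp
qed

lemma NC_even:
  assumes f: "f \<in> NC D E"
  shows "even (card D + card E)"
proof -
  have "even (card (supp f))"
  proof (rule even_card_involution)
    show "finite (supp f)" using NC_D(2,4,5)[OF f] by simp
    show "f x \<in> supp f \<and> f x \<noteq> x \<and> f (f x) = x" if "x \<in> supp f" for x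
      using that NC_D(8)[OF f, of x] by (auto simp: supp_def)
  qed
  moreover have "card (uminus ` D \<union> E) = card (uminus ` D) + card E"
  proof (rule card_Un_disjoint)
    show "uminus ` D \<inter> E = {}" using NC_D(6,7)[OF f] by fastforce
  qed (use NC_D(4,5)[OF f] in auto)
  moreover have "card (uminus ` D) = card D" by (rule card_image) simp
  ultimately show ?thesis using NC_D(2)[OF f] by simp
qed

text \<open>The upper half pairs off the points of \<open>D\<close> together with as many cut points
  as the rank, so the two numbers have equal parity.\<close>

lemma nc_rank_even:
  assumes f: "f \<in> NC D E"
  shows "even (nc_rank f) \<longleftrightarrow> even (card D)"
  using NC_even[OF upper_half_NC[OF f]] by auto

lemma contract_comm: "x \<noteq> y \<Longrightarrow> contract f x y = contract f y x"
  by (auto simp: contract_def fun_eq_iff)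

text \<open>A shortest upper arc joins neighbours: a point strictly inside it would have its partner
  inside as well and so give a shorter arc.\<close>

lemma exists_adjacent_arc:
  assumes f: "f \<in> NC A K" and a: "a \<in> A" "f (- a) < 0"
  shows "\<exists>u v. adjacent A u v \<and> f (- u) = - v"
proof -
  note fD = NC_D[OF f]
  let ?P = "\<lambda>x. x < f x \<and> f x < 0"
  have "?P (- a) \<or> ?P (f (- a))"
    using a fD(6)[OF a(1)] fD(8,9)[of "- a"] by auto
  then obtain x0 where "?P x0" by blast
  from ex_has_least_nat[of ?P x0 "\<lambda>x. nat (f x - x)", OF this]
  obtain x where x: "?P x" and min: "\<And>z. ?P z \<Longrightarrow> nat (f x - x) \<le> nat (f z - z)" by (elim exE conjE) simp
  have inA: "- z \<in> A" if "f z \<noteq> z" "z < 0" for z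
    using fD(7,9)[of z] that by auto
  have "adjacent A (- f x) (- x)"
    unfolding adjacent_def
  proof (intro conjI ballI notI)
    show "- f x \<in> A" "- x \<in> A" "- f x < - x"
      using x inA[of x] inA[of "f x"] fD(8)[of x] by auto
    fix w assume w: "w \<in> A" "- f x < w \<and> w < - x"
    then have b: "x < - w" "- w < f x" by auto
    have n: "x < f (- w)" "f (- w) < f x" using NC_noncrossing[OF f b] by auto
    have ne: "f (- w) \<noteq> - w" using fD(9)[of "- w"] w by auto
    have "?P (- w) \<or> ?P (f (- w))" using ne n x b fD(8)[of "- w"] by auto
    then show False using min[of "- w"] min[of "f (- w)"] n b fD(8)[of "- w"] by auto
  qed
  moreover have "f (- (- f x)) = - (- x)" using fD(8) by simp
  ultimately show ?thesis by blast
qed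

text \<open>A closest pair with one point in \<open>S\<close> and one in \<open>A\<close> outside
  \<open>S\<close> is adjacent, since any point in between would form a closer such pair with one of
  the two.\<close>

lemma adjacent_boundary:
  assumes "S \<subseteq> A" "s \<in> S" "t \<in> A" "t \<notin> S"
  shows "\<exists>u v. adjacent A u v \<and> (u \<in> S \<longleftrightarrow> v \<notin> S)"
proof -
  let ?P = "\<lambda>p. fst p \<in> S \<and> snd p \<in> A \<and> snd p \<notin> S"
  let ?m = "\<lambda>p. nat \<bar>fst p - snd p :: int\<bar>"
  have "?P (s, t)" using assms by simp
  from ex_has_least_nat[of ?P "(s, t)" ?m, OF this]
  obtain p where p: "?P p" and mp: "\<And>q. ?P q \<Longrightarrow> ?m p \<le> ?m q" by (elim exE conjE) simp
  obtain s t where pp: "p = (s, t)" by (cases p)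
  have st: "s \<in> S" "t \<in> A" "t \<notin> S" using p pp by auto
  have m: "nat \<bar>s - t\<bar> \<le> nat \<bar>s' - t'\<bar>" if "s' \<in> S" "t' \<in> A" "t' \<notin> S" for s' t'
    using mp[of "(s', t')"] that pp by simp
  have "s \<noteq> t" "s \<in> A" using st assms(1) by auto
  have "\<not> (min s t < w \<and> w < max s t)" if w: "w \<in> A" for w
    using m[of w t] m[of s w] w st by (cases "w \<in> S") (auto simp: min_def max_def split: if_splits)
  then have "adjacent A (min s t) (max s t)"
    using st \<open>s \<in> A\<close> \<open>s \<noteq> t\<close> by (auto simp: adjacent_def min_def max_def)
  then show ?thesis using st by (intro exI[of _ "min s t"] exI[of _ "max s t"]) (auto simp: min_def max_def)
qed

text \<open>Joining a transversal to an upper arc merely lengthens it; only joining two transversals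
  turns their lower ends into an arc.\<close>

lemma contract_not_full:
  assumes P: "P \<in> NC A K" and full: "\<forall>b\<in>K. P b < 0" and pu: "p < 0" "u < 0"
    and b: "b \<in> K" "\<not> contract P p u b < 0"
  shows "0 < P p \<and> 0 < P u"
proof -
  have b0: "0 < b" using NC_D(7)[OF P b(1)] .
  have Pb: "P b < 0" using full b by blast
  have PP: "P (P z) = z" for z by (rule NC_D(8)[OF P])
  have z: "P z \<noteq> 0" if "z < 0" for z using NC_zero(2)[OF P, of z] that by simp
  consider "P b = p" | "P b = u" "P b \<noteq> p" | "P b \<noteq> p" "P b \<noteq> u" by blast
  then show ?thesis
  proof cases
    case 1
    then have "contract P p u b = P u" "P p = b" using b0 pu PP by (auto simp: contract_def)
    then show ?thesis using b b0 z[OF pu(2)] by simp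
  next
    case 2
    then have "contract P p u b = P p" "P u = b" using b0 pu PP by (auto simp: contract_def)
    then show ?thesis using b b0 z[OF pu(1)] by simp
  next
    case 3
    then have "contract P p u b = P b" using b0 pu by (auto simp: contract_def)
    then show ?thesis using b Pb by simp
  qed
qed

text \<open>If contracting an arc of \<open>P\<close> does not tell the two apart, they differ only
  on four points, which they pair in two different ways. A contraction across the border of these
  four points then sees the difference. The size condition provides a point beyond the border; it
  excludes cases such as the two matchings of four points and the two full diagrams from three
  points to one.\<close>

lemma distinguishing_contraction:
  assumes P: "P \<in> NC A K" and P': "P' \<in> NC A K"
    and full: "\<forall>b\<in>K. P b < 0" "\<forall>b\<in>K. P' b < 0" and ne: "P \<noteq> P'"
    and big: "2 \<le> card K \<or> 4 < card A"
  obtains u v where "adjacent A u v"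
    "((\<forall>b\<in>K. contract P (- u) (- v) b < 0) \<noteq> (\<forall>b\<in>K. contract P' (- u) (- v) b < 0)) \<or>
     ((\<forall>b\<in>K. contract P (- u) (- v) b < 0) \<and> (\<forall>b\<in>K. contract P' (- u) (- v) b < 0) \<and>
      contract P (- u) (- v) \<noteq> contract P' (- u) (- v))"
proof -
  note PD = NC_D[OF P] and PD' = NC_D[OF P']
  let ?full = "\<lambda>f. \<forall>b\<in>K. f b < 0"
  let ?c = "\<lambda>u v. contract P (- u) (- v)" and ?c' = "\<lambda>u v. contract P' (- u) (- v)"
  have "\<exists>a\<in>A. P (- a) < 0"
  proof (rule ccontr)
    assume "\<not> ?thesis"
    then have nn: "\<not> P (- b) < 0" if "b \<in> A" for b using that by blast
    have "\<forall>b\<in>A. flip P b < 0"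
    proof
      fix b assume b: "b \<in> A"
      show "flip P b < 0" using nn[OF b] NC_zero(2)[OF P, of "- b"] PD(6)[OF b] by (simp add: flip_def)
    qed
    then have r: "nc_rank P = card A"
      using nc_rank_full_iff[OF flip_NC[OF P]] nc_rank_flip[OF P] by simp
    have rK: "nc_rank P = card K" "nc_rank P' = card K"
      using nc_rank_full_iff[OF P] nc_rank_full_iff[OF P'] full by blast+
    have "P = P'" by (rule full_unique[OF P P' rK]) (use r rK in simp)
    then show False using ne by blast
  qed
  then obtain u v where uv: "adjacent A u v" "P (- u) = - v"
    using exists_adjacent_arc[OF P] by blast
  have uv0: "u \<in> A" "v \<in> A" "u < v" "0 < u" "0 < v" using uv PD(6) by (auto simp: adjacent_def)
  define x where "x = - u" define y where "y = - v"
  have xy: "P x = y" "P y = x" "x < 0" "y < 0" "x \<noteq> y" "P' x \<noteq> x" "P' y \<noteq> y"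
    using uv uv0 PD(8)[of "- u"] PD'(9)[of x] PD'(9)[of y] by (auto simp: x_def y_def)
  \<comment> \<open>\<open>x\<close> and \<open>y\<close> are joined by an upper arc of
    \<open>P\<close>, so contracting them destroys no transversal of \<open>P\<close>.\<close>
  have fc: "?full (?c u v)"
    using contract_not_full[OF P full(1), of x y] xy unfolding x_def[symmetric] y_def[symmetric] by fastforce
  show ?thesis
  proof (cases "\<not> ?full (?c' u v) \<or> ?c u v \<noteq> ?c' u v")
    case True then show ?thesis using that[OF uv(1)] fc by blast
  next
    case False
    then have fc': "?full (contract P' x y)" and cc: "contract P x y = contract P' x y" by (auto simp: x_def y_def)
    have "P' x \<noteq> y"
    proof
      assume "P' x = y"
      then have arc': "P' (- u) = - v" by (simp only: x_def y_def)
      have e: "flip (cup A u v) \<odot> P = flip (cup A u v) \<odot> P'"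
        unfolding uncup[OF uv(1) P] uncup[OF uv(1) P'] using cc unfolding x_def y_def .
      have "P = P'"
        using cup_uncup[OF uv(1) P uv(2)] cup_uncup[OF uv(1) P' arc'] unfolding e by (rule trans[OF sym])
      then show False using ne by blast
    qed
    define a where "a = P' x" define b where "b = P' y"
    have PP: "P (P z) = z" "P' (P' z) = z" for z by (rule PD(8), rule PD'(8))
    have ab: "P' a = x" "P' b = y" "a \<noteq> x" "a \<noteq> y" "b \<noteq> x" "b \<noteq> y" "a \<noteq> b"
    proof -
      show "P' a = x" "P' b = y" using PP by (simp_all add: a_def b_def)
      show "a \<noteq> x" "a \<noteq> y" "b \<noteq> y" using xy \<open>P' x \<noteq> y\<close> by (simp_all add: a_def b_def)
      show "b \<noteq> x" using \<open>P' x \<noteq> y\<close> PP(2)[of y] by (auto simp: b_def)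
      show "a \<noteq> b" using xy(5) PP(2)[of x] PP(2)[of y] by (auto simp: a_def b_def)
    qed
    have ca: "contract P' x y a = b" using ab(1,3,4) by (simp add: contract_def b_def)
    have Pab: "P a = b" "P b = a"
    proof -
      have "P a \<noteq> x" "P a \<noteq> y" using PP(1)[of a] xy(1,2) ab(3,4) by auto
      then have "contract P x y a = P a" using ab(3,4) by (simp add: contract_def)
      then show "P a = b" using cc ca by simp
      then show "P b = a" using PP(1)[of a] by simp
    qed
    \<comment> \<open>On \<open>U\<close> the pairs of \<open>P\<close> are \<open>x y\<close> and
      \<open>a b\<close>, those of \<open>P'\<close> are \<open>x a\<close> and \<open>y b\<close>.
      Outside \<open>U\<close> the two involutions agree.\<close>
    define U where "U = {x, y, a, b}"
    \<comment> \<open>If \<open>a\<close> and \<open>b\<close> were both lower points, contracting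
      \<open>x\<close> and \<open>y\<close> in \<open>P'\<close> would leave a lower arc.\<close>
    have one: "\<not> (0 < a \<and> 0 < b)"
    proof
      assume *: "0 < a \<and> 0 < b"
      then have "a \<in> K" using NC_neg_iff(2)[OF P', of x] xy by (simp add: a_def)
      then have "contract P' x y a < 0" using fc' by blast
      then show False using ca * by simp
    qed
    have out: "P' z = P z" "P z \<notin> U" if "z \<notin> U" for z
    proof -
      have "P z \<notin> U" "P' z \<noteq> x" "P' z \<noteq> y"
      proof -
        have "P z \<noteq> x" "P z \<noteq> y" "P z \<noteq> a" "P z \<noteq> b"
          using that xy Pab PP(1)[of z] by (auto simp: U_def)
        then show "P z \<notin> U" by (simp add: U_def)
        show "P' z \<noteq> x" "P' z \<noteq> y"
          using that PP(2)[of z] by (auto simp: U_def a_def b_def)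
      qed
      moreover have "contract P x y z = contract P' x y z" using cc by simp
      ultimately show "P' z = P z" "P z \<notin> U" using that by (auto simp: U_def contract_def)
    qed
    have "\<exists>t\<in>A. - t \<notin> U"
      using big
    proof
      assume "4 < card A"
      have "card (uminus ` U) \<le> 4"
        by (rule order.trans[OF card_image_le]) (auto simp: U_def card_insert_if)
      then have "\<not> A \<subseteq> uminus ` U"
        using \<open>4 < card A\<close> card_mono[of "uminus ` U" A] by (force simp: U_def)
      then show ?thesis by (auto simp: uminus_image_iff)
    next
      assume k: "2 \<le> card K"
      \<comment> \<open>At most one of \<open>a\<close> and \<open>b\<close> is a lower point, so
        two lower points are not both in \<open>U\<close>; the transversal from one outside
        \<open>U\<close> ends at an upper point outside \<open>U\<close>.\<close>
      have "\<exists>k\<in>K. k \<notin> U"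
      proof (rule ccontr)
        assume nk: "\<not> (\<exists>k\<in>K. k \<notin> U)"
        have "k = max a b" if k: "k \<in> K" for k
        proof -
          have "0 < k" "k \<in> U" using PD(7)[OF k] nk k by auto
          then have "k = a \<or> k = b" using xy(3,4) by (auto simp: U_def)
          then show ?thesis using \<open>0 < k\<close> one by auto
        qed
        then have "K \<subseteq> {max a b}" by blast
        then have "card K \<le> 1" using card_mono[of "{max a b}" K] by simp
        then show False using k by simp
      qed
      then obtain k where k: "k \<in> K" "k \<notin> U" by blast
      then have "P k < 0" "P k \<notin> U" using full out by auto
      moreover have "- P k \<in> A" using NC_neg_iff(1)[OF P, of k] calculation PD(7)[OF k(1)] by auto
      ultimately show ?thesis by (intro bexI[of _ "- P k"]) auto
    qed
    then obtain t where t: "t \<in> A" "t \<notin> {w \<in> A. - w \<in> U}" by blast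
    have "u \<in> {w \<in> A. - w \<in> U}" using uv0 by (simp add: U_def x_def)
    from adjacent_boundary[OF _ this t]
    obtain g h where gh: "adjacent A g h" "g \<in> {w \<in> A. - w \<in> U} \<longleftrightarrow> h \<notin> {w \<in> A. - w \<in> U}" by auto
    have gh0: "g \<in> A" "h \<in> A" "0 < g" "0 < h" "g \<noteq> h" using gh PD(6) by (auto simp: adjacent_def)
    obtain p q where pq: "p \<notin> U" "q \<in> U" "p < 0" "q < 0" "p \<noteq> q" "- p \<in> A" "- q \<in> A"
      "contract f (- g) (- h) = contract f p q" for f
    proof (cases "- g \<in> U")
      case True then show ?thesis using that[of "- h" "- g"] gh gh0 contract_comm[of "- g" "- h"] by auto
    next
      case False then show ?thesis using that[of "- g" "- h"] gh gh0 by auto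
    qed
    have v: "P q \<in> U" "P' q \<in> U" "P q \<noteq> P' q" "P q \<noteq> q"
    proof -
      consider "q = x" | "q = y" | "q = a" | "q = b" using pq(2) by (auto simp: U_def)
      then have "P q \<in> U \<and> P' q \<in> U \<and> P q \<noteq> P' q \<and> P q \<noteq> q"
      proof cases
        case 1 show ?thesis unfolding 1 xy(1) a_def[symmetric] using ab(4) xy(5) by (simp add: U_def)
      next
        case 2 show ?thesis unfolding 2 xy(2) b_def[symmetric] using ab(5) xy(5) by (simp add: U_def)
      next
        case 3 show ?thesis unfolding 3 Pab(1) ab(1) using ab(5,7) by (simp add: U_def)
      next
        case 4 show ?thesis unfolding 4 Pab(2) ab(2) using ab(4,7) by (simp add: U_def)
      qed
      then show "P q \<in> U" "P' q \<in> U" "P q \<noteq> P' q" "P q \<noteq> q" by blast+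
    qed
    have PU: "P' (P q) \<in> U"
    proof -
      consider "P q = x" | "P q = y" | "P q = a" | "P q = b" using v(1) by (auto simp: U_def)
      then show ?thesis
      proof cases
        case 1 show ?thesis unfolding 1 a_def[symmetric] by (simp add: U_def)
      next
        case 2 show ?thesis unfolding 2 b_def[symmetric] by (simp add: U_def)
      next
        case 3 show ?thesis unfolding 3 ab(1) by (simp add: U_def)
      next
        case 4 show ?thesis unfolding 4 ab(2) by (simp add: U_def)
      qed
    qed
    \<comment> \<open>The contraction of \<open>P\<close> leads the old partner \<open>P q\<close>
      of \<open>q\<close> out of \<open>U\<close>, while the contraction of \<open>P'\<close> leaves
      it paired within \<open>U\<close>.\<close>
    have "contract P p q (P q) = P p"
      using pq v PP by (auto simp: contract_def)
    moreover have "contract P' p q (P q) = P' (P q)"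
    proof -
      have "P q \<noteq> p" "P q \<noteq> q" "P' (P q) \<noteq> p" using v PU pq(1) by auto
      moreover have "P' (P q) \<noteq> q" using v(3) PP(2)[of "P q"] by auto
      ultimately show ?thesis by (simp add: contract_def)
    qed
    ultimately have ne2: "contract P p q \<noteq> contract P' p q"
      using out(2)[OF pq(1)] PU by metis
    \<comment> \<open>If both contractions lost a transversal, the partners of \<open>q\<close>
      under \<open>P\<close> and \<open>P'\<close> would be two different lower points in
      \<open>U\<close>, contrary to \<open>one\<close>.\<close>
    have "?full (contract P p q) \<or> ?full (contract P' p q)"
    proof (rule ccontr)
      assume "\<not> ?thesis"
      then have "0 < P q" "0 < P' q"
        using contract_not_full[OF P full(1) pq(3,4)] contract_not_full[OF P' full(2) pq(3,4)] by blast+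
      then show False using v one xy by (auto simp: U_def)
    qed
    then show ?thesis using that[OF gh(1)] ne2 pq(8) by auto
  qed
qed

text \<open>Contractions are applied until exactly one of the two diagrams keeps full rank. The
  multiplier \<open>Q\<close> consists of the cups used, followed by the surviving contraction,
  whose reflection undoes it by \<open>full_flip_mult\<close>.\<close>

lemma separation:
  assumes "P \<in> NC A K" "P' \<in> NC A K" "nc_rank P = card K" "nc_rank P' = card K" "P \<noteq> P'" "2 \<le> card K"
  shows "\<exists>Q\<in>NC A K. (nc_rank (flip Q \<odot> P) = card K \<and> nc_rank (flip Q \<odot> P') < card K) \<or>
                       (nc_rank (flip Q \<odot> P') = card K \<and> nc_rank (flip Q \<odot> P) < card K)"
  using assms
proof (induction "card A" arbitrary: A P P' rule: less_induct)
  case less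
  note P = less.prems(1) and P' = less.prems(2)
  have full: "\<forall>b\<in>K. P b < 0" "\<forall>b\<in>K. P' b < 0"
    using nc_rank_full_iff[OF P] nc_rank_full_iff[OF P'] less.prems by auto
  \<comment> \<open>One contraction already separates: the reflection of the surviving
    \<open>?c\<close> turns \<open>?c\<close> into the identity and cannot raise the rank of the
    other contraction \<open>?c'\<close>.\<close>
  have *: "\<exists>Q\<in>NC A K. nc_rank (flip Q \<odot> P) = card K \<and> nc_rank (flip Q \<odot> P') < card K"
    if P: "P \<in> NC A K" and P': "P' \<in> NC A K" and uv: "adjacent A u v"
      and f: "nc_rank (flip (cup A u v) \<odot> P) = card K" "nc_rank (flip (cup A u v) \<odot> P') \<noteq> card K" for P P' u v
  proof -
    let ?C = "cup A u v"
    have C: "?C \<in> NC A (A - {u, v})" using cup_NC[OF uv] NC_D[OF P] by simp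
    note fC = flip_NC[OF C]
    let ?c = "flip ?C \<odot> P" and ?c' = "flip ?C \<odot> P'"
    have c: "?c \<in> NC (A - {u, v}) K" "?c' \<in> NC (A - {u, v}) K" using nc_mult_NC fC P P' by auto
    have Q: "?C \<odot> ?c \<in> NC A K" by (rule nc_mult_NC[OF C c(1)])
    have "flip (?C \<odot> ?c) \<odot> X = flip ?c \<odot> (flip ?C \<odot> X)" if "X \<in> NC A K" for X
      using flip_mult[OF C c(1)] nc_mult_assoc[OF flip_NC[OF c(1)] fC that] by simp
    moreover have "nc_rank (flip ?c \<odot> ?c) = card K"
      using full_flip_mult[OF c(1) f(1)] nc_rank_full_iff[OF nc_id_NC] NC_D(5,7)[OF P] by (simp add: nc_id_def)
    moreover have "nc_rank (flip ?c \<odot> ?c') < card K"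
      using nc_rank_mult_right[OF flip_NC[OF c(1)] c(2)] nc_rank_le(1)[OF c(2)] f(2) by linarith
    ultimately show ?thesis using Q P P' by (intro bexI[of _ "?C \<odot> ?c"]) auto
  qed
  obtain u v where uv: "adjacent A u v" and cases:
    "((\<forall>b\<in>K. contract P (- u) (- v) b < 0) \<noteq> (\<forall>b\<in>K. contract P' (- u) (- v) b < 0)) \<or>
     ((\<forall>b\<in>K. contract P (- u) (- v) b < 0) \<and> (\<forall>b\<in>K. contract P' (- u) (- v) b < 0) \<and>
      contract P (- u) (- v) \<noteq> contract P' (- u) (- v))"
    by (rule distinguishing_contraction[OF P P' full less.prems(5)]) (use less.prems in auto)
  let ?C = "cup A u v"
  have C: "?C \<in> NC A (A - {u, v})" using cup_NC[OF uv] NC_D[OF P] by simp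
  note fC = flip_NC[OF C]
  have cN: "flip ?C \<odot> P \<in> NC (A - {u, v}) K" "flip ?C \<odot> P' \<in> NC (A - {u, v}) K" using nc_mult_NC fC P P' by auto
  have f: "nc_rank (flip ?C \<odot> P) = card K \<longleftrightarrow> (\<forall>b\<in>K. contract P (- u) (- v) b < 0)"
    "nc_rank (flip ?C \<odot> P') = card K \<longleftrightarrow> (\<forall>b\<in>K. contract P' (- u) (- v) b < 0)"
    using nc_rank_full_iff[OF cN(1)] nc_rank_full_iff[OF cN(2)] uncup[OF uv P] uncup[OF uv P'] by auto
  show ?case
    using cases
  proof
    assume "(\<forall>b\<in>K. contract P (- u) (- v) b < 0) \<noteq> (\<forall>b\<in>K. contract P' (- u) (- v) b < 0)"
    then show ?case using *[OF P P' uv] *[OF P' P uv] f by blast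
  next
    assume c: "(\<forall>b\<in>K. contract P (- u) (- v) b < 0) \<and> (\<forall>b\<in>K. contract P' (- u) (- v) b < 0) \<and>
      contract P (- u) (- v) \<noteq> contract P' (- u) (- v)"
    have "card (A - {u, v}) < card A"
      using uv NC_D(4)[OF P] by (intro psubset_card_mono) (auto simp: adjacent_def)
    from less.hyps[OF this cN] c f uncup[OF uv P] uncup[OF uv P'] less.prems(6)
    obtain Q where Q: "Q \<in> NC (A - {u, v}) K"
      "(nc_rank (flip Q \<odot> (flip ?C \<odot> P)) = card K \<and> nc_rank (flip Q \<odot> (flip ?C \<odot> P')) < card K) \<or>
       (nc_rank (flip Q \<odot> (flip ?C \<odot> P')) = card K \<and> nc_rank (flip Q \<odot> (flip ?C \<odot> P)) < card K)" by auto
    have "flip (?C \<odot> Q) \<odot> X = flip Q \<odot> (flip ?C \<odot> X)" if "X \<in> NC A K" for X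
      using flip_mult[OF C Q(1)] nc_mult_assoc[OF flip_NC[OF Q(1)] fC that] by simp
    then show ?case using Q(2) P P' nc_mult_NC[OF C Q(1)] by (intro bexI[of _ "?C \<odot> Q"]) auto
  qed
qed

section \<open>Matchings of a single row and their exchange\<close>

lemma nc_rank_id:
  assumes "finite D" "\<And>d. d \<in> D \<Longrightarrow> 0 < d"
  shows "nc_rank (nc_id D) = card D"
  using nc_rank_full_iff[OF nc_id_NC[OF assms]] assms(2) by (simp add: nc_id_def)

text \<open>The upper half of the identity renumbers \<open>D\<close> and is an isomorphism onto an
  initial segment, with its reflection as inverse.\<close>

lemma standardization:
  assumes "finite D" "\<And>d. d \<in> D \<Longrightarrow> 0 < d"
  obtains Q where "Q \<in> NC D {1..int (card D)}" "nc_rank Q = card D"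
    "Q \<odot> flip Q = nc_id D" "flip Q \<odot> Q = nc_id {1..int (card D)}"
proof -
  let ?Q = "upper_half (nc_id D)"
  note i = nc_id_NC[OF assms] and ri = nc_rank_id[OF assms]
  have Q: "?Q \<in> NC D {1..int (card D)}" using upper_half_NC[OF i] ri by simp
  have r: "nc_rank ?Q = card D" using upper_half_rank[OF i] ri by simp
  have "?Q \<odot> flip ?Q = nc_id D"
    using full_flip_mult[OF flip_NC[OF Q]] nc_rank_flip[OF Q] r by simp
  moreover have "flip ?Q \<odot> ?Q = nc_id {1..int (card D)}"
    using full_flip_mult[OF Q] r by simp
  ultimately show ?thesis using that Q r by blast
qed

lemma NC_arc:
  assumes "G \<in> NC A {}" "a \<in> A"
  shows "G (- a) < 0" "- G (- a) \<in> A" "G (- a) \<noteq> - a"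
proof -
  show ne: "G (- a) \<noteq> - a" using NC_D(9)[OF assms(1), of "- a"] assms(2) by simp
  show "G (- a) < 0"
    using NC_neg_iff(2)[OF assms(1) ne] NC_zero(2)[OF assms(1), of "- a"] NC_D(6)[OF assms] by force
  then show "- G (- a) \<in> A" using NC_neg_iff(1)[OF assms(1) ne] by simp
qed

lemma NC_small_unique:
  assumes G: "G \<in> NC A {}" and G': "G' \<in> NC A {}" and c: "card A \<le> 2"
  shows "G = G'"
proof (rule NC_ext_half[OF G G'])
  fix z :: int assume z: "z < 0" "- z \<in> A"
  show "G z = G' z"
  proof (rule ccontr)
    assume ne: "G z \<noteq> G' z"
    have "{- z, - G z, - G' z} \<subseteq> A" using NC_arc[OF G z(2)] NC_arc[OF G' z(2)] z by simp
    then have "card {- z, - G z, - G' z} \<le> card A" by (rule card_mono[OF NC_D(4)[OF G]])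
    moreover have "card {- z, - G z, - G' z} = 3"
      using ne NC_arc(3)[OF G z(2)] NC_arc(3)[OF G' z(2)] by simp
    ultimately show False using c by simp
  qed
qed simp

lemma card_diff_pair:
  assumes "adjacent A u v" "finite A"
  shows "card A = card (A - {u, v}) + 2"
proof -
  have "card {u, v} = 2" "{u, v} \<subseteq> A" using assms by (auto simp: adjacent_def)
  then show ?thesis using assms(2) card_mono[of A "{u, v}"] by (simp add: card_Diff_subset)
qed

text \<open>Arcs between neighbours are split off until no point is left.\<close>

lemma NC_nonempty:
  assumes "finite A" "\<And>a. a \<in> A \<Longrightarrow> 0 < a" "even (card A)"
  shows "\<exists>G. G \<in> NC A {}"
  using assms
proof (induction "card A" arbitrary: A rule: less_induct)
  case less
  show ?case
  proof (cases "A = {}")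
    case True
    then show ?thesis using nc_id_NC[of "{}"] by auto
  next
    case False
    then obtain s where s: "s \<in> A" by blast
    have "A \<noteq> {s}" using less.prems(3) by auto
    then obtain t where t: "t \<in> A" "t \<notin> {s}" using s by blast
    obtain u v where uv: "adjacent A u v" using adjacent_boundary[of "{s}" A s t] s t by blast
    have c: "card A = card (A - {u, v}) + 2" by (rule card_diff_pair[OF uv less.prems(1)])
    obtain G where "G \<in> NC (A - {u, v}) {}" using less.hyps[of "A - {u, v}"] c less.prems by auto
    then show ?thesis using nc_mult_NC[OF cup_NC[OF uv less.prems(1,2)]] by blast
  qed
qed

text \<open>With an empty lower row fullness holds vacuously, so a distinguishing contraction must
  give different results. The two matchings shrink in this way until only four points are left, the
  size at which \<open>distinguishing_contraction\<close> no longer applies.\<close>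

lemma rank0_separation:
  assumes "G \<in> NC A {}" "G' \<in> NC A {}" "G \<noteq> G'"
  shows "\<exists>Q\<in>NC A {1..4}. flip Q \<odot> G \<noteq> flip Q \<odot> G'"
  using assms
proof (induction "card A" arbitrary: A G G' rule: less_induct)
  case less
  note G = less.prems(1) and G' = less.prems(2)
  note AD = NC_D(4,6)[OF G]
  show ?case
  proof (cases "4 < card A")
    case True
    obtain u v where uv: "adjacent A u v" "contract G (- u) (- v) \<noteq> contract G' (- u) (- v)"
      by (rule distinguishing_contraction[OF G G' _ _ less.prems(3)]) (use True in auto)
    let ?C = "cup A u v"
    have C: "?C \<in> NC A (A - {u, v})" by (rule cup_NC[OF uv(1) AD])
    note fC = flip_NC[OF C]
    have "card (A - {u, v}) < card A" using card_diff_pair[OF uv(1) AD(1)] by simp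
    from less.hyps[OF this nc_mult_NC[OF fC G] nc_mult_NC[OF fC G']] uncup[OF uv(1) G] uncup[OF uv(1) G'] uv(2)
    obtain Q where Q: "Q \<in> NC (A - {u, v}) {1..4}" "flip Q \<odot> (flip ?C \<odot> G) \<noteq> flip Q \<odot> (flip ?C \<odot> G')"
      by auto
    have "flip (?C \<odot> Q) \<odot> X = flip Q \<odot> (flip ?C \<odot> X)" if "X \<in> NC A {}" for X
      using flip_mult[OF C Q(1)] nc_mult_assoc[OF flip_NC[OF Q(1)] fC that] by simp
    then show ?thesis using Q G G' nc_mult_NC[OF C Q(1)] by (intro bexI[of _ "?C \<odot> Q"]) auto
  next
    case False
    have "even (card A)" using NC_even[OF G] by simp
    moreover have "\<not> card A \<le> 2" using NC_small_unique[OF G G'] less.prems(3) by blast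
    ultimately have c: "card A = 4" using False by presburger
    obtain Q where Q: "Q \<in> NC A {1..4}" "Q \<odot> flip Q = nc_id A"
      using standardization[OF AD] c by auto
    have "Q \<odot> (flip Q \<odot> X) = X" if "X \<in> NC A {}" for X
      using nc_mult_assoc[OF Q(1) flip_NC[OF Q(1)] that] Q(2) nc_mult_id_left[OF that] by simp
    then show ?thesis using Q(1) G G' less.prems(3) by metis
  qed
qed

lemma cup_mult_arc:
  assumes uv: "adjacent A u v" and A: "finite A" "\<And>a. a \<in> A \<Longrightarrow> 0 < a" and G: "G \<in> NC (A - {u, v}) K"
  shows "(cup A u v \<odot> G) (- u) = - v"
    and "\<And>p q. p \<in> A - {u, v} \<Longrightarrow> q \<in> A - {u, v} \<Longrightarrow> G (- p) = - q \<Longrightarrow> (cup A u v \<odot> G) (- p) = - q"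
proof -
  have C: "cup A u v \<in> NC A (A - {u, v})" by (rule cup_NC[OF uv A])
  have uv0: "0 < u" "0 < v" using uv A(2) by (auto simp: adjacent_def)
  show "(cup A u v \<odot> G) (- u) = - v"
    using nc_mult_up[OF C G, of "- u"] uv0 by (simp add: cup_def)
  fix p q assume p: "p \<in> A - {u, v}" and q: "q \<in> A - {u, v}" and Gp: "G (- p) = - q"
  have pq0: "0 < p" "0 < q" using p q A(2)[of p] A(2)[of q] by auto
  have c: "cup A u v (- p) = p" "cup A u v q = - q"
    using p q pq0 uv0 by (auto simp: cup_def nc_id_def)
  have "p \<noteq> q" using NC_D(9)[OF G, of "- p"] p Gp by auto
  then show "(cup A u v \<odot> G) (- p) = - q"
    using nc_mult_up_up[OF C G, of "- p"] pq0 c Gp by simp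
qed

text \<open>An equivalence on the matchings of \<open>B\<close> that permits local exchanges: behind
  any diagram \<open>R\<close> from \<open>B\<close> to four points, one matching of the four points
  may be replaced by the other.\<close>

definition exchange_closed :: "int set \<Rightarrow> ((int \<Rightarrow> int) \<times> (int \<Rightarrow> int)) set \<Rightarrow> bool" where
  "exchange_closed B S \<longleftrightarrow> finite B \<and> (\<forall>b\<in>B. 0 < b) \<and> (\<forall>G\<in>NC B {}. (G, G) \<in> S) \<and>
     (\<forall>G G'. (G, G') \<in> S \<longrightarrow> (G', G) \<in> S) \<and> (\<forall>G G' G''. (G, G') \<in> S \<longrightarrow> (G', G'') \<in> S \<longrightarrow> (G, G'') \<in> S) \<and>
     (\<forall>R\<in>NC B {1..4}. \<forall>m\<in>NC {1..4} {}. \<forall>m'\<in>NC {1..4} {}. (R \<odot> m, R \<odot> m') \<in> S)"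

text \<open>Every nonempty planar matching has an arc between neighbours. Matchings sharing such an
  arc are related by induction after its removal; matchings with disjoint arcs of this kind are
  linked through one that contains both. From six points on, two overlapping arcs always leave room
  for a third arc disjoint from both.\<close>

lemma exchange_closed_universal:
  assumes "exchange_closed B S" "G \<in> NC B {}" "G' \<in> NC B {}"
  shows "(G, G') \<in> S"
proof -
  \<comment> \<open>\<open>S\<close> varies in the induction as well, since the step replaces it by
    its pullback along a cup.\<close>
  have "\<forall>B S G G'. card B = n \<longrightarrow> exchange_closed B S \<longrightarrow> G \<in> NC B {} \<longrightarrow> G' \<in> NC B {} \<longrightarrow> (G, G') \<in> S" for n
  proof (induction n rule: less_induct)
  case (less n)
  show ?case
  proof (intro allI impI)
  fix B S G G'
  assume n: "card B = n" and ec: "exchange_closed B S" and G: "G \<in> NC B {}" and G': "G' \<in> NC B {}"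
  have B: "finite B" "\<And>b. b \<in> B \<Longrightarrow> 0 < b" and rfl: "\<And>G. G \<in> NC B {} \<Longrightarrow> (G, G) \<in> S"
    and sym: "\<And>G G'. (G, G') \<in> S \<Longrightarrow> (G', G) \<in> S" and trans: "\<And>G G' G''. (G, G') \<in> S \<Longrightarrow> (G', G'') \<in> S \<Longrightarrow> (G, G'') \<in> S"
    and step: "\<And>R m m'. R \<in> NC B {1..4} \<Longrightarrow> m \<in> NC {1..4} {} \<Longrightarrow> m' \<in> NC {1..4} {} \<Longrightarrow> (R \<odot> m, R \<odot> m') \<in> S"
    using ec unfolding exchange_closed_def by blast+
  have ev: "even (card B)" using NC_even[OF G] by simp
  have "card B \<le> 2 \<or> card B = 4 \<or> 6 \<le> card B" using ev by presburger
  then consider "card B \<le> 2" | "card B = 4" | "6 \<le> card B" by blast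
  then show "(G, G') \<in> S"
  proof cases
    case 1 then show ?thesis using NC_small_unique[OF G G'] rfl G by simp
  next
    case 2
    obtain Q where Q: "Q \<in> NC B {1..4}" "Q \<odot> flip Q = nc_id B"
      using standardization[OF B] 2 by auto
    have "Q \<odot> (flip Q \<odot> X) = X" if "X \<in> NC B {}" for X
      using nc_mult_assoc[OF Q(1) flip_NC[OF Q(1)] that] Q(2) nc_mult_id_left[OF that] by simp
    then show ?thesis using step[OF Q(1) nc_mult_NC[OF flip_NC[OF Q(1)] G] nc_mult_NC[OF flip_NC[OF Q(1)] G']] G G' by simp
  next
    case 3
    \<comment> \<open>Both matchings are recovered from their contractions by
      \<open>cup_uncup\<close>, and the contractions are related in the pullback of \<open>S\<close>
      along the cup.\<close>
    have same: "(X, Y) \<in> S" if uv: "adjacent B u v" and X: "X \<in> NC B {}" "X (- u) = - v" and Y: "Y \<in> NC B {}" "Y (- u) = - v" for u v X Y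
    proof -
      let ?C = "cup B u v"
      have C: "?C \<in> NC B (B - {u, v})" by (rule cup_NC[OF uv B])
      note fC = flip_NC[OF C]
      have c: "card (B - {u, v}) < card B" using card_diff_pair[OF uv B(1)] by simp
      have "exchange_closed (B - {u, v}) {(X, Y). (?C \<odot> X, ?C \<odot> Y) \<in> S}"
        unfolding exchange_closed_def mem_Collect_eq case_prod_conv
      proof (intro conjI)
        show "\<forall>X\<in>NC (B - {u, v}) {}. (?C \<odot> X, ?C \<odot> X) \<in> S"
          using rfl[OF nc_mult_NC[OF C]] by blast
        show "\<forall>R\<in>NC (B - {u, v}) {1..4}. \<forall>m\<in>NC {1..4} {}. \<forall>m'\<in>NC {1..4} {}. (?C \<odot> (R \<odot> m), ?C \<odot> (R \<odot> m')) \<in> S"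
        proof (intro ballI)
          fix R m m' assume R: "R \<in> NC (B - {u, v}) {1..4}" and m: "m \<in> NC {1..4} {}" "m' \<in> NC {1..4} {}"
          show "(?C \<odot> (R \<odot> m), ?C \<odot> (R \<odot> m')) \<in> S"
            using step[OF nc_mult_NC[OF C R] m] unfolding nc_mult_assoc[OF C R m(1)] nc_mult_assoc[OF C R m(2)] .
        qed
        show "\<forall>X Y. (?C \<odot> X, ?C \<odot> Y) \<in> S \<longrightarrow> (?C \<odot> Y, ?C \<odot> X) \<in> S" using sym by blast
        show "\<forall>X Y Z. (?C \<odot> X, ?C \<odot> Y) \<in> S \<longrightarrow> (?C \<odot> Y, ?C \<odot> Z) \<in> S \<longrightarrow> (?C \<odot> X, ?C \<odot> Z) \<in> S"
          by (intro allI impI) (rule trans)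
        show "finite (B - {u, v})" "\<forall>b\<in>B - {u, v}. 0 < b" using B by auto
      qed
      then have "(flip ?C \<odot> X, flip ?C \<odot> Y) \<in> {(X, Y). (?C \<odot> X, ?C \<odot> Y) \<in> S}"
        using less.IH[of "card (B - {u, v})"] c n nc_mult_NC[OF fC X(1)] nc_mult_NC[OF fC Y(1)] by blast
      then show ?thesis using cup_uncup[OF uv X] cup_uncup[OF uv Y] by simp
    qed
    let ?n = "int (card B)"
    \<comment> \<open>\<open>b i\<close> is the \<open>i\<close>-th point of \<open>B\<close>, so
      pairs of neighbours correspond to the indices from 1 to \<open>?n - 1\<close>.\<close>
    define b where "b = inv_into B (idx B)"
    have bij: "bij_betw (idx B) B {1..?n}" by (rule idx_bij[OF B(1)])
    have bB: "b i \<in> B" "idx B (b i) = i" if "i \<in> {1..?n}" for i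
      using bij that inv_into_into[of i "idx B" B] f_inv_into_f[of i "idx B" B] by (auto simp: b_def bij_betw_def)
    have bidx: "b (idx B w) = w" "idx B w \<in> {1..?n}" if "w \<in> B" for w
      using bij that by (auto simp: b_def bij_betw_def)
    have idx_less: "w < w'" if "w \<in> B" "w' \<in> B" "idx B w < idx B w'" for w w'
      using idx_mono[OF B(1) that(1), of w'] that(3) by (cases w w' rule: linorder_cases) auto
    have badj: "adjacent B (b i) (b (i + 1))" if i: "1 \<le> i" "i < ?n" for i
    proof -
      have i': "i \<in> {1..?n}" "i + 1 \<in> {1..?n}" using i by auto
      have "b i < b (i + 1)" using idx_less[OF bB(1)[OF i'(1)] bB(1)[OF i'(2)]] bB(2) i' by simp
      moreover have "\<not> (b i < w \<and> w < b (i + 1))" if "w \<in> B" for w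
        using idx_mono[OF B(1) that, of "b i"] idx_mono[OF B(1) bB(1)[OF i'(2)], of w] bB(2) i' by force
      ultimately show ?thesis using bB i' by (simp add: adjacent_def)
    qed
    have adjb: "\<exists>i. 1 \<le> i \<and> i < ?n \<and> u = b i \<and> v = b (i + 1)" if uv: "adjacent B u v" for u v
    proof -
      have u: "u \<in> B" "v \<in> B" "u < v" using uv by (auto simp: adjacent_def)
      have lt: "idx B u < idx B v" using idx_mono[OF B(1) u(2,3)] .
      have iv: "idx B v = idx B u + 1"
      proof (rule ccontr)
        assume "idx B v \<noteq> idx B u + 1"
        then have l: "idx B u + 1 < idx B v" using lt by simp
        then have i: "idx B u + 1 \<in> {1..?n}" using bidx(2)[OF u(1)] bidx(2)[OF u(2)] by auto
        have "u < b (idx B u + 1)" "b (idx B u + 1) < v"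
          using idx_less[OF u(1) bB(1)[OF i]] idx_less[OF bB(1)[OF i] u(2)] bB(2)[OF i] l by auto
        then show False using uv bB(1)[OF i] by (auto simp: adjacent_def)
      qed
      show ?thesis
      proof (intro exI[of _ "idx B u"] conjI)
        show "1 \<le> idx B u" "idx B u < ?n" using bidx(2)[OF u(1)] bidx(2)[OF u(2)] iv by auto
        show "u = b (idx B u)" using bidx(1)[OF u(1)] by simp
        show "v = b (idx B u + 1)" using bidx(1)[OF u(2)] iv by simp
      qed
    qed
    \<comment> \<open>An intermediate matching contains both arcs and pairs the remaining points
      arbitrarily; it shares one arc with each side.\<close>
    have far: "(X, Y) \<in> S" if ij: "1 \<le> i" "i + 2 \<le> j" "j < ?n"
      and X: "X \<in> NC B {}" "X (- b i) = - b (i + 1)" and Y: "Y \<in> NC B {}" "Y (- b j) = - b (j + 1)" for i j X Y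
    proof -
      let ?u = "b i" and ?v = "b (i + 1)" and ?p = "b j" and ?q = "b (j + 1)"
      have uv: "adjacent B ?u ?v" and pq: "adjacent B ?p ?q" using ij by (auto intro!: badj)
      have ne: "?p \<noteq> ?u" "?p \<noteq> ?v" "?q \<noteq> ?u" "?q \<noteq> ?v"
        using bB(2)[of i] bB(2)[of "i + 1"] bB(2)[of j] bB(2)[of "j + 1"] ij by auto
      let ?B = "B - {?u, ?v}"
      have pq': "adjacent ?B ?p ?q" using pq ne by (auto simp: adjacent_def)
      have "even (card (?B - {?p, ?q}))"
        using card_diff_pair[OF uv B(1)] card_diff_pair[OF pq'] B(1) ev by simp
      then obtain G0 where G0: "G0 \<in> NC (?B - {?p, ?q}) {}" using NC_nonempty[of "?B - {?p, ?q}"] B by auto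
      have B': "finite ?B" "\<And>b. b \<in> ?B \<Longrightarrow> 0 < b" using B by auto
      have H: "cup ?B ?p ?q \<odot> G0 \<in> NC ?B {}" by (rule nc_mult_NC[OF cup_NC[OF pq' B'] G0])
      let ?Z = "cup B ?u ?v \<odot> (cup ?B ?p ?q \<odot> G0)"
      have Z: "?Z \<in> NC B {}" by (rule nc_mult_NC[OF cup_NC[OF uv B] H])
      have "?Z (- ?u) = - ?v" "?Z (- ?p) = - ?q"
        using cup_mult_arc[OF uv B H] cup_mult_arc(1)[OF pq' B' G0] pq' by (auto simp: adjacent_def)
      then show ?thesis using same[OF uv X Z] same[OF pq Z _ Y] trans by blast
    qed
    have ex: "\<exists>i. 1 \<le> i \<and> i < ?n \<and> X (- b i) = - b (i + 1)" if X: "X \<in> NC B {}" for X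
    proof -
      have "B \<noteq> {}" using 3 by auto
      then obtain a where "a \<in> B" by blast
      then show ?thesis using exists_adjacent_arc[OF X] NC_arc(1)[OF X] adjb by metis
    qed
    have mk: "\<exists>X\<in>NC B {}. X (- b k) = - b (k + 1)" if "1 \<le> k" "k < ?n" for k
    proof -
      have k: "adjacent B (b k) (b (k + 1))" using that by (rule badj)
      have "even (card (B - {b k, b (k + 1)}))" using card_diff_pair[OF k B(1)] ev by simp
      then obtain G0 where "G0 \<in> NC (B - {b k, b (k + 1)}) {}"
        using NC_nonempty[of "B - {b k, b (k + 1)}"] B by auto
      then show ?thesis using cup_mult_arc(1)[OF k B] nc_mult_NC[OF cup_NC[OF k B]] by blast
    qed
    obtain i where i: "1 \<le> i" "i < ?n" "G (- b i) = - b (i + 1)" using ex[OF G] by blast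
    obtain j where j: "1 \<le> j" "j < ?n" "G' (- b j) = - b (j + 1)" using ex[OF G'] by blast
    have via: "(G, G') \<in> S" if k: "1 \<le> k" "k < ?n" "i + 2 \<le> k \<or> k + 2 \<le> i" "j + 2 \<le> k \<or> k + 2 \<le> j" for k
    proof -
      obtain X where X: "X \<in> NC B {}" "X (- b k) = - b (k + 1)" using mk[OF k(1,2)] by blast
      have "(G, X) \<in> S" using k(3) far[of i k G X] far[of k i X G] i k X G sym by blast
      moreover have "(X, G') \<in> S" using k(4) far[of j k G' X] far[of k j X G'] j k X G' sym by blast
      ultimately show ?thesis by (rule trans)
    qed
    consider "i + 2 \<le> j" | "j + 2 \<le> i" | "i \<le> j + 1" "j \<le> i + 1" by linarith
    then show ?thesis
    proof cases
      case 1 then show ?thesis using far[of i j G G'] i j G G' by blast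
    next
      case 2 then show ?thesis using far[of j i G' G] i j G G' sym by blast
    next
      case near: 3
      show ?thesis
      \<comment> \<open>The indices differ by at most one. If there is no room to the right, then
        \<open>max i j\<close> is at least 4 because of the six points, so both indices are at least
        3 and index 1 is disjoint from both.\<close>
      proof (cases "max i j + 2 < ?n")
        case True then show ?thesis using via[of "max i j + 2"] i j by simp
      next
        case False
        then show ?thesis using via[of "1"] i j near 3 by simp
      qed
    qed
  qed
  qed
  qed
  then show ?thesis using assms by blast
qed

section \<open>The Temperley-Lieb generators\<close>

definition hook :: "int set \<Rightarrow> int \<Rightarrow> int \<Rightarrow> int \<Rightarrow> int" where
  "hook A u v = cup A u v \<odot> flip (cup A u v)"

context
  fixes A :: "int set"
  assumes A: "finite A" "\<And>a. a \<in> A \<Longrightarrow> 0 < a"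
begin

lemma hook_NC: "adjacent A u v \<Longrightarrow> hook A u v \<in> NC A A"
  unfolding hook_def by (rule nc_mult_NC[OF cup_NC flip_NC[OF cup_NC]]) (use A in auto)

lemma hook_absorb:
  assumes uv: "adjacent A u v" and f: "f \<in> NC A K" "f (- u) = - v"
  shows "hook A u v \<odot> f = f"
proof -
  have C: "cup A u v \<in> NC A (A - {u, v})" by (rule cup_NC[OF uv A])
  show ?thesis
    unfolding hook_def using nc_mult_assoc[OF C flip_NC[OF C] f(1)] cup_uncup[OF uv f] by simp
qed

lemma hook_arc:
  assumes uv: "adjacent A u v" and f: "f \<in> NC A K"
  shows "(hook A u v \<odot> f) (- u) = - v"
proof -
  have C: "cup A u v \<in> NC A (A - {u, v})" by (rule cup_NC[OF uv A])
  show ?thesis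
    unfolding hook_def using nc_mult_assoc[OF C flip_NC[OF C] f] cup_mult_arc(1)[OF uv A nc_mult_NC[OF flip_NC[OF C] f]] by simp
qed

text \<open>These are the relations \<open>e_i e_j e_i = e_i\<close> for neighbouring generators. A
  cap on \<open>v\<close>, \<open>w\<close> meeting a cup on \<open>u\<close>, \<open>v\<close>
  straightens: \<open>?F\<close> has full rank between rows of equal size, so its reflection is its
  inverse.\<close>

lemma hook_braid:
  assumes uv: "adjacent A u v" and vw: "adjacent A v w"
  shows "hook A v w \<odot> hook A u v \<odot> hook A v w = hook A v w"
    "hook A u v \<odot> hook A v w \<odot> hook A u v = hook A u v"
proof -
  let ?c = "cup A u v" and ?d = "cup A v w"
  have c: "?c \<in> NC A (A - {u, v})" and d: "?d \<in> NC A (A - {v, w})"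
    using cup_NC[OF uv A] cup_NC[OF vw A] by auto
  note c' = flip_NC[OF c] and d' = flip_NC[OF d]
  let ?F = "flip ?d \<odot> ?c"
  have F: "?F \<in> NC (A - {v, w}) (A - {u, v})" by (rule nc_mult_NC[OF d' c])
  have fF: "flip ?F = flip ?c \<odot> ?d" using flip_mult[OF d' c] by simp
  have u0: "0 < u" "u < v" "v < w" "w \<in> A" using uv vw A(2) by (auto simp: adjacent_def)
  have "\<forall>b\<in>A - {u, v}. ?F b < 0"
  proof
    fix b assume b: "b \<in> A - {u, v}"
    then have "0 < b" using A by auto
    then show "?F b < 0"
      unfolding uncup[OF vw c] using b u0 by (auto simp: contract_def cup_def nc_id_def)
  qed
  then have r: "nc_rank ?F = card (A - {u, v})" using nc_rank_full_iff[OF F] by blast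
  have "card (A - {u, v}) = card (A - {v, w})"
    using card_diff_pair[OF uv A(1)] card_diff_pair[OF vw A(1)] by simp
  then have r': "nc_rank (flip ?F) = card (A - {v, w})" using r nc_rank_flip[OF F] by simp
  have 1: "flip ?F \<odot> ?F = nc_id (A - {u, v})" by (rule full_flip_mult[OF F r])
  have 2: "?F \<odot> flip ?F = nc_id (A - {v, w})" using full_flip_mult[OF flip_NC[OF F] r'] by simp
  have gen: "(x \<odot> flip x) \<odot> (y \<odot> flip y) \<odot> (x \<odot> flip x) = x \<odot> flip x"
    if x: "x \<in> NC A X" and y: "y \<in> NC A Y" and i: "(flip x \<odot> y) \<odot> (flip y \<odot> x) = nc_id X" for x y X Y
  proof -
    note x' = flip_NC[OF x] and y' = flip_NC[OF y]
    note m = nc_mult_NC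
    have "(x \<odot> flip x) \<odot> (y \<odot> flip y) = x \<odot> ((flip x \<odot> y) \<odot> flip y)"
      using nc_mult_assoc[OF x x' m[OF y y']] nc_mult_assoc[OF x' y y'] by simp
    then have "(x \<odot> flip x) \<odot> (y \<odot> flip y) \<odot> (x \<odot> flip x)
        = x \<odot> (((flip x \<odot> y) \<odot> flip y) \<odot> (x \<odot> flip x))"
      using nc_mult_assoc[OF x m[OF m[OF x' y] y'] m[OF x x']] by simp
    also have "((flip x \<odot> y) \<odot> flip y) \<odot> (x \<odot> flip x) = ((flip x \<odot> y) \<odot> (flip y \<odot> x)) \<odot> flip x"
      using nc_mult_assoc[OF m[OF x' y] y' m[OF x x']] nc_mult_assoc[OF y' x x']
        nc_mult_assoc[OF m[OF x' y] m[OF y' x] x'] by simp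
    also have "((flip x \<odot> y) \<odot> (flip y \<odot> x)) \<odot> flip x = flip x" unfolding i by (rule nc_mult_id_left[OF x'])
    finally show ?thesis .
  qed
  show "hook A v w \<odot> hook A u v \<odot> hook A v w = hook A v w"
    unfolding hook_def by (rule gen[OF d c]) (use 2 fF in simp)
  show "hook A u v \<odot> hook A v w \<odot> hook A u v = hook A u v"
    unfolding hook_def by (rule gen[OF c d]) (use 1 fF in simp)
qed

end

lemma not_full_if_arc:
  assumes f: "f \<in> NC D E" and a: "a \<in> D" "f (- a) < 0"
  shows "nc_rank f < card D"
proof -
  have "nc_rank (flip f) \<noteq> card D"
    using nc_rank_full_iff[OF flip_NC[OF f]] a by (auto simp: flip_def)
  then show ?thesis using nc_rank_flip[OF f] nc_rank_le(2)[OF f] by simp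
qed

lemma arc_if_not_full:
  assumes f: "f \<in> NC D E" and r: "nc_rank f < card D"
  shows "\<exists>a\<in>D. f (- a) < 0"
proof -
  have "nc_rank (flip f) \<noteq> card D" using nc_rank_flip[OF f] r by simp
  then obtain a where a: "a \<in> D" "\<not> flip f a < 0" using nc_rank_full_iff[OF flip_NC[OF f]] by blast
  then have "f (- a) \<noteq> 0" using NC_zero(2)[OF f, of "- a"] NC_D(6)[OF f] by auto
  then show ?thesis using a by (intro bexI[of _ a]) (auto simp: flip_def)
qed

section \<open>Congruences on noncrossing involutions\<close>

definition NCr :: "enat \<Rightarrow> int set \<Rightarrow> int set \<Rightarrow> (int \<Rightarrow> int) set" where
  "NCr r D E = {f \<in> NC D E. enat (nc_rank f) \<le> r}"

lemma enat_le_trans: "m \<le> n \<Longrightarrow> enat n \<le> r \<Longrightarrow> enat m \<le> r"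
  by (metis enat_ord_simps(1) order.trans)

lemma NCr_mult_left: "f \<in> NCr r D E \<Longrightarrow> g \<in> NC E G \<Longrightarrow> f \<odot> g \<in> NCr r D G"
  unfolding NCr_def by (blast intro: nc_mult_NC enat_le_trans[OF nc_rank_mult_left])

lemma NCr_mult_right: "f \<in> NC D E \<Longrightarrow> g \<in> NCr r E G \<Longrightarrow> f \<odot> g \<in> NCr r D G"
  unfolding NCr_def by (blast intro: nc_mult_NC enat_le_trans[OF nc_rank_mult_right])

lemma NCr_flip: "f \<in> NCr r D E \<Longrightarrow> flip f \<in> NCr r E D"
  unfolding NCr_def using flip_NC nc_rank_flip by auto

lemma NCr_NC: "f \<in> NCr r D E \<Longrightarrow> f \<in> NC D E"
  by (simp add: NCr_def)

section \<open>Closures of diagrams of small rank\<close>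

lemma rank0_NC: "f \<in> NC D {} \<Longrightarrow> nc_rank f = 0" "f \<in> NC {} D \<Longrightarrow> nc_rank f = 0"
  using nc_rank_le[of f D "{}"] nc_rank_le[of f "{}" D] by auto

lemma NC_empty: "f \<in> NC {} {} \<Longrightarrow> f = nc_id {}"
  using NC_small_unique[of f "{}" "nc_id {}"] nc_id_NC[of "{}"] by simp

text \<open>The lower row is read off from \<open>x\<close>, so closures are functions of the
  involution alone. The choice depends only on this row; at rank at most two it has no influence on
  the product with \<open>x\<close>.\<close>

definition lower_closure :: "(int \<Rightarrow> int) \<Rightarrow> int \<Rightarrow> int" where
  "lower_closure x = (SOME H. H \<in> NC {z. 0 < z \<and> x z \<noteq> z} {})"

definition ucl :: "(int \<Rightarrow> int) \<Rightarrow> int \<Rightarrow> int" where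
  "ucl x = x \<odot> lower_closure x"

definition lcl :: "(int \<Rightarrow> int) \<Rightarrow> int \<Rightarrow> int" where
  "lcl x = flip (ucl (flip x))"

definition hat :: "(int \<Rightarrow> int) \<Rightarrow> int \<Rightarrow> int" where
  "hat x = ucl x \<odot> lcl x"

text \<open>Cutting \<open>x\<close> at its transversals leaves at most two open ends towards
  \<open>H\<close>, and two points can be closed in only one way.\<close>

lemma small_rank_absorb:
  assumes x: "x \<in> NC D E" and r: "nc_rank x \<le> 2" and H: "H \<in> NC E {}" "H' \<in> NC E {}"
  shows "x \<odot> H = x \<odot> H'"
proof -
  let ?P = "upper_half x" and ?R = "flip (upper_half (flip x))"
  have P: "?P \<in> NC D {1..int (nc_rank x)}" by (rule upper_half_NC[OF x])
  have R: "?R \<in> NC {1..int (nc_rank x)} E"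
    using flip_NC[OF upper_half_NC[OF flip_NC[OF x]]] nc_rank_flip[OF x] by simp
  have "?R \<odot> H = ?R \<odot> H'"
    by (rule NC_small_unique[OF nc_mult_NC[OF R H(1)] nc_mult_NC[OF R H(2)]]) (use r in simp)
  then have "(?P \<odot> ?R) \<odot> H = (?P \<odot> ?R) \<odot> H'"
    using nc_mult_assoc[OF P R] H by simp
  then show ?thesis using half_factorization[OF x] by simp
qed

lemma lower_closure_NC:
  assumes x: "x \<in> NC D E" and ev: "even (card E)"
  shows "lower_closure x \<in> NC E {}"
proof -
  have E: "{z. 0 < z \<and> x z \<noteq> z} = E" using NC_D(6,7,9)[OF x] by force
  have "\<exists>H. H \<in> NC E {}" by (rule NC_nonempty) (use NC_D[OF x] ev in auto)
  then show ?thesis unfolding lower_closure_def E by (rule someI_ex)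
qed

lemma ucl_NC: "x \<in> NC D E \<Longrightarrow> even (card E) \<Longrightarrow> ucl x \<in> NC D {}"
  unfolding ucl_def by (rule nc_mult_NC[OF _ lower_closure_NC])

lemma lcl_NC: "x \<in> NC D E \<Longrightarrow> even (card D) \<Longrightarrow> lcl x \<in> NC {} E"
  unfolding lcl_def by (rule flip_NC[OF ucl_NC[OF flip_NC]])

lemma ucl_eq:
  assumes x: "x \<in> NC D E" "nc_rank x \<le> 2" and H: "H \<in> NC E {}"
  shows "x \<odot> H = ucl x"
proof -
  have "even (card E)" using NC_even[OF H] by simp
  then show ?thesis unfolding ucl_def by (rule small_rank_absorb[OF x H lower_closure_NC[OF x(1)]])
qed

lemma lcl_eq:
  assumes x: "x \<in> NC D E" "nc_rank x \<le> 2" and H: "H \<in> NC {} D"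
  shows "H \<odot> x = lcl x"
proof -
  have "flip (H \<odot> x) = ucl (flip x)"
    using flip_mult[OF H x(1)] ucl_eq[OF flip_NC[OF x(1)] _ flip_NC[OF H]] nc_rank_flip[OF x(1)] x(2) by simp
  then show ?thesis unfolding lcl_def by (metis flip_flip)
qed

lemma ucl_mult_left:
  assumes s: "s \<in> NC D' D" and x: "x \<in> NC D E" "nc_rank x \<le> 2" and ev: "even (card E)"
  shows "ucl (s \<odot> x) = s \<odot> ucl x"
proof -
  have L: "lower_closure x \<in> NC E {}" by (rule lower_closure_NC[OF x(1) ev])
  have "nc_rank (s \<odot> x) \<le> 2" using nc_rank_mult_right[OF s x(1)] x(2) by simp
  then have "ucl (s \<odot> x) = (s \<odot> x) \<odot> lower_closure x"
    using ucl_eq[OF nc_mult_NC[OF s x(1)] _ L] by simp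
  then show ?thesis using nc_mult_assoc[OF s x(1) L] by (simp add: ucl_def)
qed

text \<open>A closing of \<open>x \<odot> t\<close> from below is a closing of \<open>x\<close> once
  it has been multiplied by \<open>t\<close>, and all closings of \<open>x\<close> give the same
  result.\<close>

lemma ucl_mult_right:
  assumes x: "x \<in> NC D E" "nc_rank x \<le> 2" and t: "t \<in> NC E E'" and ev: "even (card E)"
  shows "ucl (x \<odot> t) = ucl x"
proof -
  have "even (card E')" using NC_even[OF t] ev by simp
  then have L: "lower_closure t \<in> NC E' {}" by (rule lower_closure_NC[OF t])
  have "nc_rank (x \<odot> t) \<le> 2" using nc_rank_mult_left[OF x(1) t] x(2) by simp
  then have "ucl (x \<odot> t) = (x \<odot> t) \<odot> lower_closure t"
    using ucl_eq[OF nc_mult_NC[OF x(1) t] _ L] by simp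
  also have "\<dots> = x \<odot> (t \<odot> lower_closure t)" by (rule nc_mult_assoc[OF x(1) t L])
  also have "\<dots> = ucl x" by (rule ucl_eq[OF x nc_mult_NC[OF t L]])
  finally show ?thesis .
qed

lemma lcl_mult_right:
  assumes x: "x \<in> NC D E" "nc_rank x \<le> 2" and t: "t \<in> NC E E'" and ev: "even (card D)"
  shows "lcl (x \<odot> t) = lcl x \<odot> t"
proof -
  have "ucl (flip t \<odot> flip x) = flip t \<odot> ucl (flip x)"
    by (rule ucl_mult_left[OF flip_NC[OF t] flip_NC[OF x(1)] _ ev]) (use nc_rank_flip[OF x(1)] x(2) in simp)
  moreover have "ucl (flip x) \<in> NC E {}" by (rule ucl_NC[OF flip_NC[OF x(1)] ev])
  ultimately show ?thesis
    using flip_mult[OF x(1) t] flip_mult[OF flip_NC[OF t], of "ucl (flip x)"] by (simp add: lcl_def)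
qed

lemma lcl_mult_left:
  assumes s: "s \<in> NC D' D" and x: "x \<in> NC D E" "nc_rank x \<le> 2" and ev: "even (card D)"
  shows "lcl (s \<odot> x) = lcl x"
proof -
  have "ucl (flip x \<odot> flip s) = ucl (flip x)"
    by (rule ucl_mult_right[OF flip_NC[OF x(1)] _ flip_NC[OF s] ev]) (use nc_rank_flip[OF x(1)] x(2) in simp)
  then show ?thesis using flip_mult[OF s x(1)] by (simp add: lcl_def)
qed

lemma rank0_mult:
  assumes "H \<in> NC D {}" "V \<in> NC {} E"
  shows "H \<odot> V \<in> NC D E" "nc_rank (H \<odot> V) = 0" "ucl (H \<odot> V) = H" "lcl (H \<odot> V) = V"
proof -
  show "H \<odot> V \<in> NC D E" by (rule nc_mult_NC[OF assms])
  show r: "nc_rank (H \<odot> V) = 0" using nc_rank_mult_left[OF assms] rank0_NC(1)[OF assms(1)] by simp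
  have ev: "even (card D)" "even (card E)" using NC_even[OF assms(1)] NC_even[OF assms(2)] by auto
  have e: "nc_id {} \<in> NC {} {}" by (rule nc_id_NC) auto
  have "ucl (H \<odot> V) = ucl H" by (rule ucl_mult_right[OF assms(1) _ assms(2)]) (use rank0_NC assms in auto)
  also have "\<dots> = H" using ucl_eq[OF assms(1) _ e] rank0_NC(1)[OF assms(1)] nc_mult_id_right[OF assms(1)] by simp
  finally show "ucl (H \<odot> V) = H" .
  have "lcl (H \<odot> V) = lcl V" by (rule lcl_mult_left[OF assms]) (use rank0_NC assms in auto)
  also have "\<dots> = V" using lcl_eq[OF assms(2) _ e] rank0_NC(2)[OF assms(2)] nc_mult_id_left[OF assms(2)] by simp
  finally show "lcl (H \<odot> V) = V" .
qed

text \<open>At rank 0 the factorisation at the transversals passes through the empty row, and its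
  two factors are the closures.\<close>

lemma rank0_decomp:
  assumes x: "x \<in> NC D E" and r: "nc_rank x = 0"
  shows "ucl x \<odot> lcl x = x" "even (card D)" "even (card E)"
proof -
  let ?P = "upper_half x" and ?R = "flip (upper_half (flip x))"
  have P: "?P \<in> NC D {}" using upper_half_NC[OF x] r by simp
  have R: "?R \<in> NC {} E" using flip_NC[OF upper_half_NC[OF flip_NC[OF x]]] nc_rank_flip[OF x] r by simp
  have "x = ?P \<odot> ?R" by (rule half_factorization[OF x])
  then show "ucl x \<odot> lcl x = x" using rank0_mult[OF P R] by simp
  show "even (card D)" "even (card E)" using NC_even[OF P] NC_even[OF R] by auto
qed

lemma hat_props:
  assumes x: "x \<in> NC D E" and ev: "even (card D)" "even (card E)"
  shows "hat x \<in> NC D E" "nc_rank (hat x) = 0" "ucl (hat x) = ucl x" "lcl (hat x) = lcl x"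
  using rank0_mult[OF ucl_NC[OF x ev(2)] lcl_NC[OF x ev(1)]] by (simp_all add: hat_def)

lemma hat_rank0: "x \<in> NC D E \<Longrightarrow> nc_rank x = 0 \<Longrightarrow> hat x = x"
  using rank0_decomp(1) by (simp add: hat_def)

text \<open>The rectangular band law: the middle part \<open>V \<odot> H'\<close> consists of closed
  loops and is the empty diagram.\<close>

lemma middle_cancel:
  assumes "H \<in> NC D {}" "V \<in> NC {} E" "H' \<in> NC E {}" "V' \<in> NC {} G"
  shows "(H \<odot> V) \<odot> (H' \<odot> V') = H \<odot> V'"
proof -
  have "V \<odot> H' = nc_id {}" using NC_empty[OF nc_mult_NC[OF assms(2,3)]] .
  then have "V \<odot> (H' \<odot> V') = V'"
    using nc_mult_assoc[OF assms(2,3,4)] nc_mult_id_left[OF assms(4)] by simp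
  then show ?thesis using nc_mult_assoc[OF assms(1,2) nc_mult_NC[OF assms(3,4)]] by simp
qed

lemma hat_mult:
  assumes x: "x \<in> NC D E" "nc_rank x \<le> 2" and y: "y \<in> NC E G" "nc_rank y \<le> 2"
    and ev: "even (card D)" "even (card E)" "even (card G)"
  shows "hat (x \<odot> y) = hat x \<odot> hat y"
  unfolding hat_def
  using ucl_mult_right[OF x y(1) ev(2)] lcl_mult_left[OF x(1) y ev(2)]
    middle_cancel[OF ucl_NC[OF x(1) ev(2)] lcl_NC[OF x(1) ev(1)] ucl_NC[OF y(1) ev(3)] lcl_NC[OF y(1) ev(2)]]
  by simp

section \<open>Congruences on diagrams of bounded rank\<close>

lemma full_split:
  assumes x: "x \<in> NC D E" and k: "nc_rank x = k"
  obtains P R where "P \<in> NC D {1..int k}" "R \<in> NC E {1..int k}" "nc_rank P = k" "nc_rank R = k"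
    "x = P \<odot> flip R" "flip P \<odot> P = nc_id {1..int k}" "flip R \<odot> R = nc_id {1..int k}"
    "P = upper_half x" "R = upper_half (flip x)"
proof -
  have P: "upper_half x \<in> NC D {1..int k}" using upper_half_NC[OF x] k by simp
  have R: "upper_half (flip x) \<in> NC E {1..int k}"
    using upper_half_NC[OF flip_NC[OF x]] nc_rank_flip[OF x] k by simp
  have r: "nc_rank (upper_half x) = k" "nc_rank (upper_half (flip x)) = k"
    using upper_half_rank[OF x] upper_half_rank[OF flip_NC[OF x]] nc_rank_flip[OF x] k by auto
  show ?thesis
    by (rule that[OF P R r half_factorization[OF x] full_flip_mult[OF P] full_flip_mult[OF R]])
      (use r in auto)
qed

text \<open>Pairing 1 with 3 would cut off 2 from any partner; the partner of 1 then determines the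
  rest.\<close>

lemma two_matchings_of_four:
  assumes "m \<in> NC {1..4} {}"
  shows "m (- 1) = - 2 \<or> m (- 1) = - 4"
    and "m' \<in> NC {1..4} {} \<Longrightarrow> m' (- 1) = m (- 1) \<Longrightarrow> m' = m"
proof -
  have dom: "m (- a) \<in> {- 1, - 2, - 3, - 4} - {- a} \<and> m (m (- a)) = - a"
    if "m \<in> NC {1..4} {}" "a \<in> {1..4}" for m a
    using NC_arc[OF that] NC_D(8)[OF that(1)] by auto
  have n3: "m (- 1) \<noteq> - 3" if m: "m \<in> NC {1..4} {}" for m
  proof
    assume 3: "m (- 1) = - 3"
    then have "m (- 3) = - 1" using dom[OF m, of 1] by simp
    then have "- 3 < m (- 2)" "m (- 2) < - 1" using NC_noncrossing[OF m, of "- 3" "- 2"] by auto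
    then show False using dom[OF m, of 2] by auto
  qed
  show *: "m (- 1) = - 2 \<or> m (- 1) = - 4" using dom[OF assms, of 1] n3[OF assms] by auto
  have vals: "m (- 1) = - 2 \<Longrightarrow> m (- 2) = - 1 \<and> m (- 3) = - 4 \<and> m (- 4) = - 3"
    "m (- 1) = - 4 \<Longrightarrow> m (- 4) = - 1 \<and> m (- 2) = - 3 \<and> m (- 3) = - 2" if m: "m \<in> NC {1..4} {}" for m
    using dom[OF m, of 1] dom[OF m, of 2] dom[OF m, of 3] dom[OF m, of 4] by auto
  assume m': "m' \<in> NC {1..4} {}" "m' (- 1) = m (- 1)"
  show "m' = m"
  proof (rule NC_ext_half[OF m'(1) assms])
    fix z :: int assume "z < 0" "- z \<in> {1..4}"
    then have "z \<in> {- 1, - 2, - 3, - 4}" by auto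
    then show "m' z = m z" using * vals[OF m'(1)] vals[OF assms] m'(2) by auto
  qed simp
qed

text \<open>A congruence is presented as a family of relations, one for each pair of rows.
  Multipliers are confined to rank at most \<open>r\<close>, as the semigroup in question is the
  ideal and not the whole category.\<close>

locale tl_congruence =
  fixes C :: "'o set" and ob :: "'o \<Rightarrow> int set" and r :: enat
    and rel :: "'o \<Rightarrow> 'o \<Rightarrow> (int \<Rightarrow> int) \<Rightarrow> (int \<Rightarrow> int) \<Rightarrow> bool"
  assumes ob: "A \<in> C \<Longrightarrow> finite (ob A) \<and> (\<forall>a\<in>ob A. 0 < a) \<and> even (card (ob A))"
    and relD: "rel A B x y \<Longrightarrow> A \<in> C \<and> B \<in> C \<and> x \<in> NCr r (ob A) (ob B) \<and> y \<in> NCr r (ob A) (ob B)"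
    and rel_refl: "A \<in> C \<Longrightarrow> B \<in> C \<Longrightarrow> x \<in> NCr r (ob A) (ob B) \<Longrightarrow> rel A B x x"
    and rel_sym: "rel A B x y \<Longrightarrow> rel A B y x"
    and rel_trans: "rel A B x y \<Longrightarrow> rel A B y z \<Longrightarrow> rel A B x z"
    and rel_left: "rel A B x y \<Longrightarrow> D \<in> C \<Longrightarrow> s \<in> NCr r (ob D) (ob A) \<Longrightarrow> rel D B (s \<odot> x) (s \<odot> y)"
    and rel_right: "rel A B x y \<Longrightarrow> D \<in> C \<Longrightarrow> s \<in> NCr r (ob B) (ob D) \<Longrightarrow> rel A D (x \<odot> s) (y \<odot> s)"
begin

text \<open>Reflection is an anti-isomorphism. Interpreting the locale for the reflected family
  turns each result about upper rows into one about lower rows.\<close>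

lemma dual: "tl_congruence C ob r (\<lambda>A B x y. rel B A (flip x) (flip y))"
proof
  fix A B x y D s
  assume A: "rel B A (flip x) (flip y)"
  have x: "x \<in> NCr r (ob A) (ob B)" "y \<in> NCr r (ob A) (ob B)" using relD[OF A] NCr_flip[of "flip _"] by auto
  show "A \<in> C \<and> B \<in> C \<and> x \<in> NCr r (ob A) (ob B) \<and> y \<in> NCr r (ob A) (ob B)" using relD[OF A] x by auto
  show "rel B A (flip y) (flip x)" using A by (rule rel_sym)
  show "rel B D (flip (s \<odot> x)) (flip (s \<odot> y))" if "D \<in> C" "s \<in> NCr r (ob D) (ob A)"
    using rel_right[OF A that(1) NCr_flip[OF that(2)]] flip_mult[OF NCr_NC[OF that(2)] NCr_NC] x by simp
  show "rel D A (flip (x \<odot> s)) (flip (y \<odot> s))" if "D \<in> C" "s \<in> NCr r (ob B) (ob D)"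
    using rel_left[OF A that(1) NCr_flip[OF that(2)]] flip_mult[OF NCr_NC NCr_NC[OF that(2)]] x by simp
qed (use ob rel_refl NCr_flip rel_trans in auto)

text \<open>The rows here may be sets such as \<open>{1..int k}\<close> for a rank \<open>k\<close>
  that is not the size of any object in \<open>C\<close>. Testing against all factors from and to
  genuine objects brings such elements back to the given congruence.\<close>

definition ext :: "int set \<Rightarrow> int set \<Rightarrow> (int \<Rightarrow> int) \<Rightarrow> (int \<Rightarrow> int) \<Rightarrow> bool" where
  "ext D E u v \<longleftrightarrow> u \<in> NCr r D E \<and> v \<in> NCr r D E \<and>
     (\<forall>A\<in>C. \<forall>B\<in>C. \<forall>p\<in>NCr r (ob A) D. \<forall>q\<in>NCr r E (ob B). rel A B (p \<odot> u \<odot> q) (p \<odot> v \<odot> q))"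

lemma extD:
  assumes "ext D E u v" "A \<in> C" "B \<in> C" "p \<in> NCr r (ob A) D" "q \<in> NCr r E (ob B)"
  shows "rel A B (p \<odot> u \<odot> q) (p \<odot> v \<odot> q)"
  using assms by (simp add: ext_def)

lemma ext_refl: "u \<in> NCr r D E \<Longrightarrow> ext D E u u"
  unfolding ext_def by (meson NCr_NC NCr_mult_left rel_refl)

lemma ext_sym: "ext D E u v \<Longrightarrow> ext D E v u"
  unfolding ext_def using rel_sym by blast

lemma ext_trans: "ext D E u v \<Longrightarrow> ext D E v w \<Longrightarrow> ext D E u w"
  unfolding ext_def using rel_trans by blast

text \<open>The multiplier \<open>s\<close> may have any rank: it is absorbed into the outer factor
  \<open>p\<close>, and \<open>p \<odot> s\<close> has rank at most \<open>r\<close> because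
  \<open>p\<close> has.\<close>

lemma ext_left:
  assumes e: "ext D E u v" and s: "s \<in> NC D' D"
  shows "ext D' E (s \<odot> u) (s \<odot> v)"
  unfolding ext_def
proof (intro conjI ballI)
  have uv: "u \<in> NCr r D E" "v \<in> NCr r D E" using e by (auto simp: ext_def)
  show "s \<odot> u \<in> NCr r D' E" "s \<odot> v \<in> NCr r D' E" using NCr_mult_right[OF s] uv by auto
  fix A B p q assume A: "A \<in> C" "B \<in> C" "p \<in> NCr r (ob A) D'" "q \<in> NCr r E (ob B)"
  have "rel A B ((p \<odot> s) \<odot> u \<odot> q) ((p \<odot> s) \<odot> v \<odot> q)"
    by (rule extD[OF e A(1,2) NCr_mult_left[OF A(3) s] A(4)])
  then show "rel A B (p \<odot> (s \<odot> u) \<odot> q) (p \<odot> (s \<odot> v) \<odot> q)"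
    unfolding nc_mult_assoc[OF NCr_NC[OF A(3)] s NCr_NC[OF uv(1)]] nc_mult_assoc[OF NCr_NC[OF A(3)] s NCr_NC[OF uv(2)]] .
qed

lemma ext_right:
  assumes e: "ext D E u v" and s: "s \<in> NC E E'"
  shows "ext D E' (u \<odot> s) (v \<odot> s)"
  unfolding ext_def
proof (intro conjI ballI)
  have uv: "u \<in> NCr r D E" "v \<in> NCr r D E" using e by (auto simp: ext_def)
  show "u \<odot> s \<in> NCr r D E'" "v \<odot> s \<in> NCr r D E'" using NCr_mult_left[OF _ s] uv by auto
  fix A B p q assume A: "A \<in> C" "B \<in> C" "p \<in> NCr r (ob A) D" "q \<in> NCr r E' (ob B)"
  note p = NCr_NC[OF A(3)] and q = NCr_NC[OF A(4)]
  have "rel A B (p \<odot> u \<odot> (s \<odot> q)) (p \<odot> v \<odot> (s \<odot> q))"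
    by (rule extD[OF e A(1,2,3) NCr_mult_right[OF s A(4)]])
  moreover have "p \<odot> w \<odot> (s \<odot> q) = p \<odot> (w \<odot> s) \<odot> q" if w: "w \<in> NC D E" for w
    using nc_mult_assoc[OF nc_mult_NC[OF p w] s q] nc_mult_assoc[OF p w s] by simp
  ultimately show "rel A B (p \<odot> (u \<odot> s) \<odot> q) (p \<odot> (v \<odot> s) \<odot> q)"
    using NCr_NC[OF uv(1)] NCr_NC[OF uv(2)] by simp
qed

lemma rel_ext:
  assumes "rel A B x y"
  shows "ext (ob A) (ob B) x y"
  unfolding ext_def
proof (intro conjI ballI)
  show "x \<in> NCr r (ob A) (ob B)" "y \<in> NCr r (ob A) (ob B)" using relD[OF assms] by auto
  show "rel A' B' (p \<odot> x \<odot> q) (p \<odot> y \<odot> q)"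
    if "A' \<in> C" "B' \<in> C" "p \<in> NCr r (ob A') (ob A)" "q \<in> NCr r (ob B) (ob B')" for A' B' p q
    using rel_right[OF rel_left[OF assms that(1,3)] that(2,4)] .
qed

text \<open>\<open>separation\<close> yields \<open>Q\<close> for which exactly one of the upper
  halves keeps full rank under \<open>flip Q\<close>. If it is \<open>P\<close>, then
  \<open>flip Q \<odot> P\<close> is a full endomorphism and hence the identity, so multiplication
  by \<open>P \<odot> flip Q\<close> fixes one element and lowers the rank of the other.\<close>

lemma drop_rank_aux:
  assumes xy: "rel A B x y" and k: "nc_rank x = k" "nc_rank y = k" "2 \<le> k"
    and ne: "upper_half x \<noteq> upper_half y"
  shows "\<exists>x' y'. rel A B x' y' \<and> nc_rank x' = k \<and> nc_rank y' < k"
proof -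
  have x: "x \<in> NC (ob A) (ob B)" and y: "y \<in> NC (ob A) (ob B)" and AB: "A \<in> C" "B \<in> C"
    and kr: "enat k \<le> r"
    using relD[OF xy] k by (auto simp: NCr_def)
  let ?K = "{1..int k}"
  have key: "\<exists>x' y'. rel A B x' y' \<and> nc_rank x' = k \<and> nc_rank y' < k"
    if xy: "rel A B x y" and x: "x \<in> NC (ob A) (ob B)" "nc_rank x = k" and y: "y \<in> NC (ob A) (ob B)" "nc_rank y = k"
      and Q: "Q \<in> NC (ob A) ?K" "nc_rank (flip Q \<odot> upper_half x) = k" "nc_rank (flip Q \<odot> upper_half y) < k"
    for x y Q
  proof -
    obtain P R where P: "P \<in> NC (ob A) ?K" "R \<in> NC (ob B) ?K" "nc_rank P = k" "x = P \<odot> flip R" "P = upper_half x"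
      by (rule full_split[OF x]) blast
    obtain P' R' where P': "P' \<in> NC (ob A) ?K" "R' \<in> NC (ob B) ?K" "y = P' \<odot> flip R'" "P' = upper_half y"
      by (rule full_split[OF y]) blast
    note fQ = flip_NC[OF Q(1)] and fR = flip_NC[OF P(2)] and fR' = flip_NC[OF P'(2)]
    let ?s = "P \<odot> flip Q"
    have s: "?s \<in> NCr r (ob A) (ob A)"
      using nc_mult_NC[OF P(1) fQ] nc_rank_mult_left[OF P(1) fQ] P(3) kr
      by (auto simp: NCr_def intro: enat_le_trans)
    have id: "flip Q \<odot> P = nc_id ?K"
      by (rule full_endo_id[OF nc_mult_NC[OF fQ P(1)]]) (use Q(2) P(5) in simp)
    have "?s \<odot> x = P \<odot> ((flip Q \<odot> P) \<odot> flip R)"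
      unfolding P(4) using nc_mult_assoc[OF P(1) fQ nc_mult_NC[OF P(1) fR]] nc_mult_assoc[OF fQ P(1) fR] by simp
    also have "\<dots> = x" unfolding id using nc_mult_id_left[OF fR] P(4) by simp
    finally have sx: "?s \<odot> x = x" .
    have "?s \<odot> y = P \<odot> ((flip Q \<odot> P') \<odot> flip R')"
      unfolding P'(3) using nc_mult_assoc[OF P(1) fQ nc_mult_NC[OF P'(1) fR']] nc_mult_assoc[OF fQ P'(1) fR'] by simp
    then have "nc_rank (?s \<odot> y) \<le> nc_rank (flip Q \<odot> P')"
      using nc_rank_mult_right[OF P(1) nc_mult_NC[OF nc_mult_NC[OF fQ P'(1)] fR']]
        nc_rank_mult_left[OF nc_mult_NC[OF fQ P'(1)] fR'] by simp
    then have "nc_rank (?s \<odot> y) < k" using Q(3) P'(4) by simp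
    moreover have "rel A B x (?s \<odot> y)" using rel_left[OF xy AB(1) s] sx by simp
    ultimately show ?thesis using x by blast
  qed
  have P: "upper_half x \<in> NC (ob A) ?K" "nc_rank (upper_half x) = card ?K" 
    and P': "upper_half y \<in> NC (ob A) ?K" "nc_rank (upper_half y) = card ?K"
    using upper_half_NC[OF x] upper_half_NC[OF y] upper_half_rank[OF x] upper_half_rank[OF y] k by auto
  obtain Q where Q: "Q \<in> NC (ob A) ?K"
    "(nc_rank (flip Q \<odot> upper_half x) = k \<and> nc_rank (flip Q \<odot> upper_half y) < k) \<or>
     (nc_rank (flip Q \<odot> upper_half y) = k \<and> nc_rank (flip Q \<odot> upper_half x) < k)"
    using separation[OF P(1) P'(1) P(2) P'(2) ne] k(3) by auto
  then show ?thesis using key[OF xy x k(1) y k(2)] key[OF rel_sym[OF xy] y k(2) x k(1)] by blast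
qed

text \<open>Different elements of equal rank differ in their upper or in their lower halves; the
  second case is the reflection of the first.\<close>

lemma drop_rank:
  assumes xy: "rel A B x y" "x \<noteq> y" and k: "nc_rank x = k" "nc_rank y \<le> k" "2 \<le> k"
  shows "\<exists>x' y'. rel A B x' y' \<and> nc_rank x' = k \<and> nc_rank y' < k"
proof (cases "nc_rank y < k")
  case True then show ?thesis using xy k by blast
next
  case False
  then have ky: "nc_rank y = k" using k by simp
  have x: "x \<in> NC (ob A) (ob B)" and y: "y \<in> NC (ob A) (ob B)"
    using relD[OF xy(1)] by (auto simp: NCr_def)
  show ?thesis
  proof (cases "upper_half x = upper_half y")
    case False then show ?thesis by (rule drop_rank_aux[OF xy(1) k(1) ky k(3)])
  next
    case True
    then have ne: "upper_half (flip x) \<noteq> upper_half (flip y)"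
      using half_factorization[OF x] half_factorization[OF y] xy(2) by metis
    interpret d: tl_congruence C ob r "\<lambda>A B x y. rel B A (flip x) (flip y)" by (rule dual)
    obtain x' y' where "rel A B (flip x') (flip y')" "nc_rank x' = k" "nc_rank y' < k"
      using d.drop_rank_aux[where A = B and B = A and x = "flip x" and y = "flip y" and k = k] xy(1) ne k ky nc_rank_flip[OF x] nc_rank_flip[OF y] by auto
    moreover have "x' \<in> NC (ob B) (ob A)" "y' \<in> NC (ob B) (ob A)"
      using d.relD[where A = B and B = A and x = x' and y = y'] calculation by (auto simp: NCr_def)
    ultimately show ?thesis using nc_rank_flip by metis
  qed
qed

text \<open>Stripping both halves of \<open>x\<close> from the relation leaves the identity on its
  transversals. Here the middle row \<open>{1..int k}\<close> enters, which need not belong to an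
  object of \<open>C\<close>.\<close>

lemma ext_id:
  assumes xy: "rel A B x y" and k: "nc_rank x = k" "nc_rank y < k"
  shows "\<exists>u. ext {1..int k} {1..int k} (nc_id {1..int k}) u \<and> nc_rank u < k"
proof -
  have x: "x \<in> NC (ob A) (ob B)" and y: "y \<in> NC (ob A) (ob B)"
    using relD[OF xy(1)] by (auto simp: NCr_def)
  let ?K = "{1..int k}"
  obtain P R where P: "P \<in> NC (ob A) ?K" "R \<in> NC (ob B) ?K" "x = P \<odot> flip R"
    "flip P \<odot> P = nc_id ?K" "flip R \<odot> R = nc_id ?K"
    by (rule full_split[OF x k(1)]) blast
  note fP = flip_NC[OF P(1)] and fR = flip_NC[OF P(2)]
  have i: "nc_id ?K \<in> NC ?K ?K" by (rule nc_id_NC) auto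
  have "ext ?K ?K (flip P \<odot> x \<odot> R) (flip P \<odot> y \<odot> R)"
    by (rule ext_right[OF ext_left[OF rel_ext[OF xy] fP] P(2)])
  moreover have "flip P \<odot> x \<odot> R = nc_id ?K"
    unfolding P(3) using nc_mult_assoc[OF fP P(1) fR] nc_mult_assoc[OF i fR P(2)] P(4,5) nc_mult_id_left[OF fR] by simp
  moreover have "nc_rank (flip P \<odot> y \<odot> R) < k"
    using nc_rank_mult_left[OF nc_mult_NC[OF fP y] P(2)] nc_rank_mult_right[OF fP y] k(2) by simp
  ultimately show ?thesis by auto
qed

text \<open>The identity on two points is related to something of smaller rank, so \<open>a\<close>
  is related to some \<open>?w\<close>, which has rank 0 by parity. Multiplying by
  \<open>a \<odot> flip a\<close> and \<open>flip a \<odot> a\<close> keeps \<open>a\<close> and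
  replaces the closures of \<open>?w\<close> by those of \<open>a\<close>.\<close>

lemma rank_two_hat:
  assumes xy: "rel A B x y" "x \<noteq> y" and k: "nc_rank x = 2" "nc_rank y \<le> 2"
    and a: "A' \<in> C" "B' \<in> C" "a \<in> NC (ob A') (ob B')" "nc_rank a = 2"
  shows "rel A' B' a (hat a)"
proof -
  obtain x' y' where xy': "rel A B x' y'" "nc_rank x' = 2" "nc_rank y' < 2" using drop_rank[OF xy k] by auto
  obtain u where u: "ext {1..int 2} {1..int 2} (nc_id {1..int 2}) u" "nc_rank u < 2" using ext_id[OF xy'] by blast
  let ?K = "{1..int 2}"
  have r2: "enat 2 \<le> r" using relD[OF xy(1)] k by (auto simp: NCr_def)
  obtain P R where P: "P \<in> NC (ob A') ?K" "R \<in> NC (ob B') ?K" "nc_rank P = 2" "nc_rank R = 2" "a = P \<odot> flip R"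
    "flip P \<odot> P = nc_id ?K" "flip R \<odot> R = nc_id ?K"
    by (rule full_split[OF a(3,4)]) blast
  note fP = flip_NC[OF P(1)] and fR = flip_NC[OF P(2)] and fa = flip_NC[OF a(3)]
  have PR: "P \<in> NCr r (ob A') ?K" "flip R \<in> NCr r ?K (ob B')"
    using P r2 nc_rank_flip[OF P(2)] fR by (auto simp: NCr_def)
  have ev: "even (card (ob A'))" "even (card (ob B'))" using ob a by auto
  let ?w = "P \<odot> u \<odot> flip R"
  have uK: "u \<in> NC ?K ?K" using u(1) by (auto simp: ext_def NCr_def)
  have aw: "rel A' B' a ?w" using extD[OF u(1) a(1,2) PR] nc_mult_id_right[OF P(1)] P(5) by simp
  have w: "?w \<in> NC (ob A') (ob B')" using relD[OF aw] by (auto simp: NCr_def)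
  have "nc_rank ?w < 2"
    using nc_rank_mult_left[OF nc_mult_NC[OF P(1) uK] fR] nc_rank_mult_right[OF P(1) uK] u(2) by simp
  moreover have "even (nc_rank ?w)" using nc_rank_even[OF w] ev by simp
  moreover have "n < 2 \<Longrightarrow> even n \<Longrightarrow> n = 0" for n :: nat by presburger
  ultimately have w0: "nc_rank ?w = 0" by blast
  have fa': "flip a = R \<odot> flip P" unfolding P(5) using flip_mult[OF P(1) fR] by simp
  let ?s = "a \<odot> flip a" and ?t = "flip a \<odot> a"
  note s = nc_mult_NC[OF a(3) fa] and t = nc_mult_NC[OF fa a(3)]
  have saa: "?s \<odot> a = a"
  proof -
    have "flip a \<odot> a = R \<odot> flip R"
      unfolding fa' unfolding P(5)
      using nc_mult_assoc[OF P(2) fP nc_mult_NC[OF P(1) fR]] nc_mult_assoc[OF fP P(1) fR] P(6) nc_mult_id_left[OF fR] by simp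
    then have "?s \<odot> a = a \<odot> (R \<odot> flip R)" using nc_mult_assoc[OF a(3) fa a(3)] by simp
    also have "\<dots> = P \<odot> ((flip R \<odot> R) \<odot> flip R)"
      unfolding P(5) using nc_mult_assoc[OF P(1) fR nc_mult_NC[OF P(2) fR]] nc_mult_assoc[OF fR P(2) fR] by simp
    also have "\<dots> = a" unfolding P(7) using nc_mult_id_left[OF fR] P(5) by simp
    finally show ?thesis .
  qed
  then have ata: "a \<odot> ?t = a" using nc_mult_assoc[OF a(3) fa a(3)] by simp
  have rs: "nc_rank ?s \<le> 2" "nc_rank ?t \<le> 2"
    using nc_rank_mult_left[OF a(3) fa] nc_rank_mult_right[OF fa a(3)] a(4) by auto
  then have st: "?s \<in> NCr r (ob A') (ob A')" "?t \<in> NCr r (ob B') (ob B')"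
    using s t r2 by (auto simp: NCr_def intro: enat_le_trans)
  have "rel A' B' (?s \<odot> a \<odot> ?t) (?s \<odot> ?w \<odot> ?t)"
    by (rule rel_right[OF rel_left[OF aw a(1) st(1)] a(2) st(2)])
  \<comment> \<open>The product has rank 0 and is determined by its closures. Each of them is
    \<open>a\<close> applied to some matching, and \<open>a\<close> maps all matchings to the same
    one.\<close>
  moreover have "?s \<odot> ?w \<odot> ?t = hat a"
  proof -
    have sw: "?s \<odot> ?w \<in> NC (ob A') (ob B')" "nc_rank (?s \<odot> ?w) = 0"
      using nc_mult_NC[OF s w] nc_rank_mult_right[OF s w] w0 by auto
    have swt: "nc_rank (?s \<odot> ?w \<odot> ?t) = 0" using nc_rank_mult_left[OF sw(1) t] sw(2) by simp
    have "ucl (?s \<odot> ?w \<odot> ?t) = ?s \<odot> ucl ?w"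
      using ucl_mult_right[OF sw(1) _ t ev(2)] ucl_mult_left[OF s w _ ev(2)] sw w0 by simp
    also have "\<dots> = a \<odot> (flip a \<odot> ucl ?w)" by (rule nc_mult_assoc[OF a(3) fa ucl_NC[OF w ev(2)]])
    also have "\<dots> = ucl a"
      by (rule ucl_eq[OF a(3) _ nc_mult_NC[OF fa ucl_NC[OF w ev(2)]]]) (simp add: a(4))
    finally have 1: "ucl (?s \<odot> ?w \<odot> ?t) = ucl a" .
    have "lcl (?s \<odot> ?w \<odot> ?t) = lcl ?w \<odot> ?t"
      using lcl_mult_right[OF sw(1) _ t ev(1)] lcl_mult_left[OF s w _ ev(1)] sw w0 by simp
    also have "\<dots> = (lcl ?w \<odot> flip a) \<odot> a" by (rule nc_mult_assoc[OF lcl_NC[OF w ev(1)] fa a(3), symmetric])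
    also have "\<dots> = lcl a"
      by (rule lcl_eq[OF a(3) _ nc_mult_NC[OF lcl_NC[OF w ev(1)] fa]]) (simp add: a(4))
    finally show ?thesis
      using 1 rank0_decomp(1)[OF nc_mult_NC[OF sw(1) t] swt] by (simp add: hat_def)
  qed
  ultimately show ?thesis using saa ata by simp
qed

text \<open>A nontrivial relation between matchings is reduced to four points, where it relates the
  only two matchings; from there \<open>exchange_closed_universal\<close> spreads it. The
  multipliers through four points have rank up to 4, which is where \<open>4 \<le> r\<close>
  enters.\<close>

lemma matchings_universal:
  assumes r4: "4 \<le> r" and G: "ext D {} G G'" "G \<noteq> G'"
    and A: "A \<in> C" "B \<in> C" and H: "H \<in> NC (ob A) {}" "H' \<in> NC (ob A) {}" and V: "V \<in> NC {} (ob B)"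
  shows "rel A B (H \<odot> V) (H' \<odot> V)"
proof -
  have GN: "G \<in> NC D {}" "G' \<in> NC D {}" using G(1) by (auto simp: ext_def NCr_def)
  obtain Q where Q: "Q \<in> NC D {1..4}" "flip Q \<odot> G \<noteq> flip Q \<odot> G'"
    using rank0_separation[OF GN G(2)] by blast
  note fQ = flip_NC[OF Q(1)]
  have e: "ext {1..4} {} (flip Q \<odot> G) (flip Q \<odot> G')" by (rule ext_left[OF G(1) fQ])
  have r0: "x \<in> NCr r X {}" if "x \<in> NC X {}" for x X
    using that rank0_NC(1)[OF that] by (simp add: NCr_def enat_0)
  \<comment> \<open>Four points have only two matchings, and \<open>flip Q \<odot> G\<close> and
    \<open>flip Q \<odot> G'\<close> are different ones.\<close>
  have all: "ext {1..4} {} m m'" if m: "m \<in> NC {1..4} {}" and m': "m' \<in> NC {1..4} {}" for m m'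
  proof -
    let ?a = "flip Q \<odot> G" and ?b = "flip Q \<odot> G'"
    have ab: "?a \<in> NC {1..4} {}" "?b \<in> NC {1..4} {}" using nc_mult_NC[OF fQ] GN by auto
    have "m = ?a \<or> m = ?b" if m: "m \<in> NC {1..4} {}" for m
      using two_matchings_of_four[OF m] two_matchings_of_four[OF ab(1)] two_matchings_of_four[OF ab(2)] ab m Q(2) by metis
    then show ?thesis using m m' e ext_sym[OF e] ext_refl[OF r0[OF m]] by metis
  qed
  have oA: "finite (ob A)" "\<And>a. a \<in> ob A \<Longrightarrow> 0 < a" using ob[OF A(1)] by auto
  have Vr: "V \<in> NCr r {} (ob B)" using V rank0_NC(2)[OF V] by (simp add: NCr_def enat_0)
  have mr: "X \<odot> V \<in> NCr r (ob A) (ob B)" if "X \<in> NC (ob A) {}" for X by (rule NCr_mult_right[OF that Vr])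
  have "exchange_closed (ob A) {(H, H'). rel A B (H \<odot> V) (H' \<odot> V)}"
    unfolding exchange_closed_def mem_Collect_eq case_prod_conv
  proof (intro conjI)
    show "\<forall>G\<in>NC (ob A) {}. rel A B (G \<odot> V) (G \<odot> V)" using rel_refl[OF A mr] by blast
    show "\<forall>R\<in>NC (ob A) {1..4}. \<forall>m\<in>NC {1..4} {}. \<forall>m'\<in>NC {1..4} {}. rel A B (R \<odot> m \<odot> V) (R \<odot> m' \<odot> V)"
    proof (intro ballI)
      fix R m m' assume R: "R \<in> NC (ob A) {1..4}" and m: "m \<in> NC {1..4} {}" "m' \<in> NC {1..4} {}"
      have "nc_rank R \<le> 4" using nc_rank_le(1)[OF R] by simp
      then have "enat (nc_rank R) \<le> 4" by (simp add: numeral_eq_enat)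
      then have "R \<in> NCr r (ob A) {1..4}" using R r4 by (auto simp: NCr_def)
      then show "rel A B (R \<odot> m \<odot> V) (R \<odot> m' \<odot> V)" by (rule extD[OF all[OF m] A _ Vr])
    qed
    show "\<forall>X Y. rel A B (X \<odot> V) (Y \<odot> V) \<longrightarrow> rel A B (Y \<odot> V) (X \<odot> V)" using rel_sym by blast
    show "\<forall>X Y Z. rel A B (X \<odot> V) (Y \<odot> V) \<longrightarrow> rel A B (Y \<odot> V) (Z \<odot> V) \<longrightarrow> rel A B (X \<odot> V) (Z \<odot> V)"
      by (intro allI impI) (rule rel_trans)
    show "finite (ob A)" "\<forall>b\<in>ob A. 0 < b" using oA by auto
  qed
  from exchange_closed_universal[OF this H] show ?thesis by simp
qed

text \<open>Closing both lower rows by one common matching leaves the two upper closures, related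
  over the empty lower row.\<close>

lemma rank0_upper_universal:
  assumes r4: "4 \<le> r" and xy: "rel A B x y" "nc_rank x = 0" "nc_rank y = 0" "ucl x \<noteq> ucl y"
    and A: "A' \<in> C" "B' \<in> C" and H: "H \<in> NC (ob A') {}" "H' \<in> NC (ob A') {}" and V: "V \<in> NC {} (ob B')"
  shows "rel A' B' (H \<odot> V) (H' \<odot> V)"
proof -
  have x: "x \<in> NC (ob A) (ob B)" "y \<in> NC (ob A) (ob B)" using relD[OF xy(1)] by (auto simp: NCr_def)
  have ev: "even (card (ob B))" by (rule rank0_decomp(3)[OF x(1) xy(2)])
  have L: "lower_closure x \<in> NC (ob B) {}" by (rule lower_closure_NC[OF x(1) ev])
  have "ext (ob A) {} (x \<odot> lower_closure x) (y \<odot> lower_closure x)"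
    by (rule ext_right[OF rel_ext[OF xy(1)] L])
  then have "ext (ob A) {} (ucl x) (ucl y)" using ucl_eq[OF x(1) _ L] ucl_eq[OF x(2) _ L] xy by simp
  then show ?thesis by (rule matchings_universal[OF r4 _ xy(4) A H V])
qed

lemma rank0_lower_universal:
  assumes r4: "4 \<le> r" and xy: "rel A B x y" "nc_rank x = 0" "nc_rank y = 0" "lcl x \<noteq> lcl y"
    and A: "A' \<in> C" "B' \<in> C" and H: "H \<in> NC (ob A') {}" and V: "V \<in> NC {} (ob B')" "V' \<in> NC {} (ob B')"
  shows "rel A' B' (H \<odot> V) (H \<odot> V')"
proof -
  interpret d: tl_congruence C ob r "\<lambda>A B x y. rel B A (flip x) (flip y)" by (rule dual)
  have x: "x \<in> NC (ob A) (ob B)" "y \<in> NC (ob A) (ob B)" using relD[OF xy(1)] by (auto simp: NCr_def)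
  have "ucl (flip x) \<noteq> ucl (flip y)" using xy(4) unfolding lcl_def by metis
  then have "rel A' B' (flip (flip V \<odot> flip H)) (flip (flip V' \<odot> flip H))"
    using d.rank0_upper_universal[OF r4, where A = B and B = A and x = "flip x" and y = "flip y" and
        A' = B' and B' = A' and H = "flip V" and H' = "flip V'" and V = "flip H"]
      xy nc_rank_flip[OF x(1)] nc_rank_flip[OF x(2)] A flip_NC[OF H] flip_NC[OF V(1)] flip_NC[OF V(2)] by simp
  then show ?thesis using flip_mult[OF H V(1)] flip_mult[OF H V(2)] by (metis flip_flip)
qed

text \<open>A diagram \<open>u\<close> of smaller rank has an upper arc between neighbours
  \<open>i\<close> and \<open>i + 1\<close> and absorbs the generator there. Multiplying the
  relation between the identity and \<open>u\<close> by this generator relates it to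
  \<open>u\<close>, hence to the identity, and \<open>hook_braid\<close> moves the relation on to
  neighbouring generators.\<close>

lemma ext_hooks:
  assumes k: "4 \<le> k" and e: "ext {1..int k} {1..int k} (nc_id {1..int k}) u" "nc_rank u < k"
  shows "ext {1..int k} {1..int k} (nc_id {1..int k}) (hook {1..int k} 1 2)"
    and "ext {1..int k} {1..int k} (nc_id {1..int k}) (hook {1..int k} 2 3)"
proof -
  let ?K = "{1..int k}" and ?I = "nc_id {1..int k}"
  have K: "finite ?K" "\<And>a. a \<in> ?K \<Longrightarrow> 0 < a" by auto
  have uK: "u \<in> NC ?K ?K" using e(1) by (auto simp: ext_def NCr_def)
  have adj: "adjacent ?K i (i + 1)" if "1 \<le> i" "i < int k" for i using that by (auto simp: adjacent_def)
  have adjD: "1 \<le> i \<and> i < int k \<and> j = i + 1" if "adjacent ?K i j" for i j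
  proof (rule ccontr)
    assume n: "\<not> ?thesis"
    have ij: "1 \<le> i" "j \<le> int k" "i < j" "\<not> (i < i + 1 \<and> i + 1 < j)" if "i + 1 \<in> ?K"
      using \<open>adjacent ?K i j\<close> that by (auto simp: adjacent_def)
    have b: "1 \<le> i" "j \<le> int k" "i < j" using \<open>adjacent ?K i j\<close> by (auto simp: adjacent_def)
    then have "i + 1 \<in> ?K" by simp
    then show False using ij(4) b n by linarith
  qed
  obtain a where "a \<in> ?K" "u (- a) < 0" using arc_if_not_full[OF uK] e(2) by auto
  then obtain i j where "adjacent ?K i j" "u (- i) = - j" using exists_adjacent_arc[OF uK] by blast
  then have i: "1 \<le> i" "i < int k" "u (- i) = - (i + 1)" using adjD[of i j] by auto
  have h: "hook ?K j (j + 1) \<in> NC ?K ?K" if "1 \<le> j" "j < int k" for j by (rule hook_NC[OF K adj[OF that]])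
  \<comment> \<open>Multiplying the relation between the identity and \<open>h\<close> by
    \<open>h'\<close> on the right relates \<open>h'\<close> to \<open>h \<odot> h'\<close>;
    multiplying it by \<open>h \<odot> h'\<close> on the left relates \<open>h \<odot> h'\<close> to
    \<open>h\<close>.\<close>
  have trans1: "ext ?K ?K ?I h'" if h: "ext ?K ?K ?I h" "h \<in> NC ?K ?K" and h': "h' \<in> NC ?K ?K" and b: "h \<odot> h' \<odot> h = h" for h h'
  proof -
    have "ext ?K ?K h' (h \<odot> h')" using ext_right[OF h(1) h'] nc_mult_id_left[OF h'] by simp
    moreover have "ext ?K ?K (h \<odot> h') h"
      using ext_left[OF h(1) nc_mult_NC[OF h(2) h']] nc_mult_id_right[OF nc_mult_NC[OF h(2) h']] b by simp
    ultimately show ?thesis using h(1) ext_sym ext_trans by meson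
  qed
  have hi: "ext ?K ?K ?I (hook ?K i (i + 1))"
  proof -
    have "ext ?K ?K (hook ?K i (i + 1)) u"
      using ext_left[OF e(1) h[OF i(1,2)]] nc_mult_id_right[OF h[OF i(1,2)]]
        hook_absorb[OF K adj[OF i(1,2)] uK i(3)] by simp
    then show ?thesis using e(1) ext_sym ext_trans by meson
  qed
  \<comment> \<open>The starting index \<open>i\<close> is not under control, but only the first two
    generators are wanted: one moves down to index 1 and then up by one.\<close>
  have down: "ext ?K ?K ?I (hook ?K j (j + 1))" if "1 \<le> j" "j \<le> i" for j
    using that(2,1)
  proof (induction rule: int_le_induct)
    case base show ?case by (rule hi)
  next
    case (step j)
    have j: "1 \<le> j" "j < int k" "1 \<le> j - 1" "j - 1 < int k" using step i by auto
    have "hook ?K j (j + 1) \<odot> hook ?K (j - 1) j \<odot> hook ?K j (j + 1) = hook ?K j (j + 1)"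
      by (rule hook_braid(1)[OF K]) (use adj[OF j(3,4)] adj[OF j(1,2)] in auto)
    then show ?case using trans1[OF step.IH h[OF j(1,2)] h[OF j(3,4)]] j by simp
  qed
  have h1: "ext ?K ?K ?I (hook ?K 1 2)" using down[of 1] i by simp
  then show "ext ?K ?K ?I (hook ?K 1 2)" .
  have "hook ?K 1 2 \<odot> hook ?K 2 3 \<odot> hook ?K 1 2 = hook ?K 1 2"
    by (rule hook_braid(2)[OF K]) (use adj[of 1] adj[of 2] k in auto)
  then show "ext ?K ?K ?I (hook ?K 2 3)" using trans1[OF h1] h[of 1] h[of 2] k by simp
qed

text \<open>The first two generators turn one matching into two different ones, which relates all
  elements of rank 0 with equal rows. It remains to relate every element of rank at most
  \<open>k\<close> to one of rank 0.\<close>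

lemma high_rank_universal:
  assumes xy: "rel A B x y" "x \<noteq> y" and k: "nc_rank x = k" "nc_rank y \<le> k" "4 \<le> k"
    and a: "A' \<in> C" "B' \<in> C" "a \<in> NC (ob A') (ob B')" "nc_rank a \<le> k" "b \<in> NC (ob A') (ob B')" "nc_rank b \<le> k"
  shows "rel A' B' a b"
proof -
  have kr: "enat k \<le> r" and ABC: "A \<in> C" using relD[OF xy(1)] k by (auto simp: NCr_def)
  have xN: "x \<in> NC (ob A) (ob B)" using relD[OF xy(1)] by (auto simp: NCr_def)
  have evk: "even k" using nc_rank_even[OF xN] ob[OF ABC] k(1) by simp
  have "enat 4 \<le> enat k" using k(3) by simp
  then have r4: "4 \<le> r" using kr by (metis numeral_eq_enat order.trans)
  obtain x' y' where xy': "rel A B x' y'" "nc_rank x' = k" "nc_rank y' < k" using drop_rank[OF xy k(1,2)] k(3) by auto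
  obtain u where u: "ext {1..int k} {1..int k} (nc_id {1..int k}) u" "nc_rank u < k" using ext_id[OF xy'] by blast
  let ?K = "{1..int k}" and ?I = "nc_id {1..int k}"
  have K: "finite ?K" "\<And>a. a \<in> ?K \<Longrightarrow> 0 < a" by auto
  note h = ext_hooks[OF k(3) u]
  have adj: "adjacent ?K 1 2" "adjacent ?K 2 3" using k(3) by (auto simp: adjacent_def)
  note h12 = hook_NC[OF K adj(1)] and h23 = hook_NC[OF K adj(2)]
  obtain G where G: "G \<in> NC ?K {}" using NC_nonempty[OF K] evk by auto
  have hh: "ext ?K ?K (hook ?K 1 2) (hook ?K 2 3)" using h ext_sym ext_trans by meson
  have e1: "ext ?K {} (hook ?K 1 2 \<odot> G) (hook ?K 2 3 \<odot> G)" by (rule ext_right[OF hh G])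
  have ne1: "hook ?K 1 2 \<odot> G \<noteq> hook ?K 2 3 \<odot> G"
  proof
    assume eq: "hook ?K 1 2 \<odot> G = hook ?K 2 3 \<odot> G"
    have "(hook ?K 1 2 \<odot> G) (- 1) = - 2" "(hook ?K 1 2 \<odot> G) (- 2) = - 3"
      using hook_arc[OF K adj(1) G] hook_arc[OF K adj(2) G] eq by auto
    then show False using NC_D(8)[OF nc_mult_NC[OF h12 G], of "- 1"] by simp
  qed
  have flip_hook: "flip (hook ?K i j) = hook ?K i j" if "adjacent ?K i j" for i j
    unfolding hook_def using flip_mult[OF cup_NC[OF that K] flip_NC[OF cup_NC[OF that K]]] by simp
  interpret d: tl_congruence C ob r "\<lambda>A B x y. rel B A (flip x) (flip y)" by (rule dual)
  \<comment> \<open>The generators are their own reflections, so their relation also holds in the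
    reflected congruence.\<close>
  have e2: "d.ext ?K {} (hook ?K 1 2 \<odot> G) (hook ?K 2 3 \<odot> G)"
    unfolding d.ext_def
  proof (intro conjI ballI)
    show "hook ?K 1 2 \<odot> G \<in> NCr r ?K {}" "hook ?K 2 3 \<odot> G \<in> NCr r ?K {}"
      using e1 by (auto simp: ext_def)
    fix A B p q assume A: "A \<in> C" "B \<in> C" "p \<in> NCr r (ob A) ?K" "q \<in> NCr r {} (ob B)"
    note p = NCr_NC[OF A(3)] and q = NCr_NC[OF A(4)]
    have fl: "flip (p \<odot> (w \<odot> G) \<odot> q) = (flip q \<odot> flip G) \<odot> w' \<odot> flip p"
      if w: "w \<in> NC ?K ?K" "flip w = w'" for w w'
      using flip_mult[OF nc_mult_NC[OF p nc_mult_NC[OF w(1) G]] q] flip_mult[OF p nc_mult_NC[OF w(1) G]]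
        flip_mult[OF w(1) G] w(2) nc_mult_assoc[OF flip_NC[OF q] nc_mult_NC[OF flip_NC[OF G] flip_NC[OF w(1)]] flip_NC[OF p]]
        nc_mult_assoc[OF flip_NC[OF q] flip_NC[OF G] flip_NC[OF w(1)]] by simp
    have "rel B A ((flip q \<odot> flip G) \<odot> hook ?K 1 2 \<odot> flip p) ((flip q \<odot> flip G) \<odot> hook ?K 2 3 \<odot> flip p)"
      by (rule extD[OF hh A(2,1) NCr_mult_left[OF NCr_flip[OF A(4)] flip_NC[OF G]] NCr_flip[OF A(3)]])
    then show "rel B A (flip (p \<odot> (hook ?K 1 2 \<odot> G) \<odot> q)) (flip (p \<odot> (hook ?K 2 3 \<odot> G) \<odot> q))"
      using fl[OF h12 flip_hook[OF adj(1)]] fl[OF h23 flip_hook[OF adj(2)]] by simp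
  qed
  have U1: "rel A' B' (H \<odot> V) (H' \<odot> V)"
    if "A' \<in> C" "B' \<in> C" "H \<in> NC (ob A') {}" "H' \<in> NC (ob A') {}" "V \<in> NC {} (ob B')" for A' B' H H' V
    by (rule matchings_universal[OF r4 e1 ne1 that])
  have U2: "rel A' B' (H \<odot> V) (H \<odot> V')"
    if t: "A' \<in> C" "B' \<in> C" "H \<in> NC (ob A') {}" "V \<in> NC {} (ob B')" "V' \<in> NC {} (ob B')" for A' B' H V V'
  proof -
    have "rel A' B' (flip (flip V \<odot> flip H)) (flip (flip V' \<odot> flip H))"
      by (rule d.matchings_universal[OF r4 e2 ne1 t(2,1) flip_NC[OF t(4)] flip_NC[OF t(5)] flip_NC[OF t(3)]])
    then show ?thesis using flip_mult[OF t(3,4)] flip_mult[OF t(3,5)] by (metis flip_flip)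
  qed
  have zero: "rel A' B' x y" if t: "A' \<in> C" "B' \<in> C" "x \<in> NC (ob A') (ob B')" "nc_rank x = 0"
      "y \<in> NC (ob A') (ob B')" "nc_rank y = 0" for A' B' x y
  proof -
    have ev: "even (card (ob A'))" "even (card (ob B'))" using ob t by auto
    note cl = ucl_NC[OF t(3) ev(2)] ucl_NC[OF t(5) ev(2)] lcl_NC[OF t(3) ev(1)] lcl_NC[OF t(5) ev(1)]
    have "rel A' B' (ucl x \<odot> lcl x) (ucl y \<odot> lcl y)"
      using rel_trans[OF U1[OF t(1,2) cl(1,2,3)] U2[OF t(1,2) cl(2,3,4)]] .
    then show ?thesis using rank0_decomp(1)[OF t(3,4)] rank0_decomp(1)[OF t(5,6)] by simp
  qed
  \<comment> \<open>The relation between the identity and a diagram with an arc from 1 to 2 descends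
    from \<open>k\<close> to every even \<open>j\<close> by closing the last two points on both
    sides. As \<open>2 \<le> j\<close>, the points 1 and 2 are never among those closed.\<close>
  have P: "\<exists>u. ext {1..int j} {1..int j} (nc_id {1..int j}) u \<and> u (- 1) = - 2"
    if j: "even j" "2 \<le> j" "j \<le> k" for j
    using j(3,1,2)
  proof (induction "k - j" arbitrary: j rule: less_induct)
    case less
    show ?case
    proof (cases "j = k")
      case True
      have "hook ?K 1 2 (- 1) = - 2"
        using hook_arc[OF K adj(1) nc_id_NC[OF K]] nc_mult_id_right[OF h12] by simp
      then show ?thesis using h(1) True by blast
    next
      case False
      then have jk: "j + 2 \<le> k" using less.prems evk by (metis Suc_leI add_2_eq_Suc' even_Suc le_neq_implies_less le_SucE less_eq_Suc_le)
      then obtain w where w: "ext {1..int (j + 2)} {1..int (j + 2)} (nc_id {1..int (j + 2)}) w" "w (- 1) = - 2"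
      proof -
        have "k - (j + 2) < k - j" using jk by simp
        from less.hyps[OF this jk] less.prems that show ?thesis by auto
      qed
      let ?J = "{1..int (j + 2)}" and ?p = "int j + 1" and ?q = "int j + 2"
      have J: "finite ?J" "\<And>a. a \<in> ?J \<Longrightarrow> 0 < a" by auto
      have pq: "adjacent ?J ?p ?q" by (auto simp: adjacent_def)
      have Jd: "?J - {?p, ?q} = {1..int j}" by auto
      let ?c = "cup ?J ?p ?q"
      have c: "?c \<in> NC ?J {1..int j}" using cup_NC[OF pq J] Jd by simp
      note c' = flip_NC[OF c]
      have wN: "w \<in> NC ?J ?J" using w(1) by (auto simp: ext_def NCr_def)
      have "ext {1..int j} {1..int j} (flip ?c \<odot> nc_id ?J \<odot> ?c) (flip ?c \<odot> w \<odot> ?c)"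
        by (rule ext_right[OF ext_left[OF w(1) c'] c])
      moreover have "flip ?c \<odot> nc_id ?J \<odot> ?c = nc_id {1..int j}"
        using nc_mult_id_right[OF c'] full_flip_mult[OF c] cup_full[OF pq J] Jd by simp
      moreover have "(flip ?c \<odot> w \<odot> ?c) (- 1) = - 2"
      proof -
        have "(flip ?c \<odot> w) (- 1) = - 2"
          unfolding uncup[OF pq wN] using w(2) less.prems by (simp add: contract_def)
        then show ?thesis using nc_mult_up[OF nc_mult_NC[OF c' wN] c, of "- 1"] by simp
      qed
      ultimately show ?thesis by auto
    qed
  qed
  \<comment> \<open>Inserting such a diagram at the cut through the transversals of \<open>x\<close>
    gives a related element of smaller rank.\<close>
  have low: "\<exists>z. rel A' B' x z \<and> nc_rank z = 0"
    if "A' \<in> C" "B' \<in> C" "x \<in> NC (ob A') (ob B')" "nc_rank x \<le> k" for A' B' x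
    using that(3,4)
  proof (induction "nc_rank x" arbitrary: x rule: less_induct)
    case less
    show ?case
    proof (cases "nc_rank x = 0")
      case True
      then have "x \<in> NCr r (ob A') (ob B')" using less.prems by (simp add: NCr_def enat_0)
      then show ?thesis using rel_refl[OF that(1,2)] True by blast
    next
      case False
      let ?j = "nc_rank x"
      have evj: "even ?j" using nc_rank_even[OF less.prems(1)] ob[OF that(1)] by simp
      have "even n \<Longrightarrow> n \<noteq> 0 \<Longrightarrow> 2 \<le> n" for n :: nat by presburger
      then have j2: "2 \<le> ?j" using False evj by blast
      obtain w where w: "ext {1..int ?j} {1..int ?j} (nc_id {1..int ?j}) w" "w (- 1) = - 2"
        using P[OF evj j2 less.prems(2)] by blast
      have wN: "w \<in> NC {1..int ?j} {1..int ?j}" using w(1) by (auto simp: ext_def NCr_def)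
      obtain P R where PR: "P \<in> NC (ob A') {1..int ?j}" "R \<in> NC (ob B') {1..int ?j}" "nc_rank P = ?j"
        "nc_rank R = ?j" "x = P \<odot> flip R"
        by (rule full_split[OF less.prems(1) refl]) blast
      note fR = flip_NC[OF PR(2)]
      have jr: "enat ?j \<le> r" using less.prems(2) kr by (metis enat_ord_simps(1) order.trans)
      have PRr: "P \<in> NCr r (ob A') {1..int ?j}" "flip R \<in> NCr r {1..int ?j} (ob B')"
        using PR fR nc_rank_flip[OF PR(2)] jr by (auto simp: NCr_def)
      let ?z = "P \<odot> w \<odot> flip R"
      have xz: "rel A' B' x ?z" using extD[OF w(1) that(1,2) PRr] nc_mult_id_right[OF PR(1)] PR(5) by simp
      have "nc_rank w < ?j" using not_full_if_arc[OF wN, of 1] w(2) j2 by simp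
      then have rz: "nc_rank ?z < ?j"
        using nc_rank_mult_left[OF nc_mult_NC[OF PR(1) wN] fR] nc_rank_mult_right[OF PR(1) wN] by simp
      have "?z \<in> NC (ob A') (ob B')" using relD[OF xz] by (auto simp: NCr_def)
      then obtain z where "rel A' B' ?z z" "nc_rank z = 0" using less.hyps[OF rz] rz less.prems(2) by auto
      then show ?thesis using rel_trans[OF xz] by blast
    qed
  qed
  obtain z z' where z: "rel A' B' a z" "nc_rank z = 0" and z': "rel A' B' b z'" "nc_rank z' = 0"
    using low[OF a(1,2,3,4)] low[OF a(1,2,5,6)] by blast
  have "rel A' B' z z'"
    by (rule zero[OF a(1,2)]) (use z z' relD[OF z(1)] relD[OF z'(1)] in \<open>auto simp: NCr_def\<close>)
  then show ?thesis using z(1) z'(1) rel_sym rel_trans by meson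
qed

end

section \<open>Diagrams as involutions\<close>

definition tl_object :: "'a rel \<Rightarrow> bool" where
  "tl_object A \<longleftrightarrow> Linear_order A \<and> finite (Field A)"

text \<open>\<open>under\<close> contains the element itself, so positions start at 1 and 0 is left
  free as the fixed point between the two rows.\<close>

definition pos :: "'a rel \<Rightarrow> 'a \<Rightarrow> int" where
  "pos A a = int (card (under A a))"

definition ob :: "'a rel \<Rightarrow> int set" where
  "ob A = {1..int (card (Field A))}"

definition pt :: "'a rel \<Rightarrow> 'a rel \<Rightarrow> 'a + 'a \<Rightarrow> int" where
  "pt A B = case_sum (\<lambda>a. - pos A a) (\<lambda>b. pos B b)"

abbreviation pts :: "'a rel \<Rightarrow> 'a rel \<Rightarrow> ('a + 'a) set" where
  "pts A B \<equiv> Field A <+> Field B"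

definition dg :: "'a rel \<Rightarrow> 'a rel \<Rightarrow> (int \<Rightarrow> int) \<Rightarrow> 'a diagram" where
  "dg A B f = Diagram A {{x, y} | x y. x \<in> pts A B \<and> y \<in> pts A B \<and> pt A B y = f (pt A B x)} B"

lemma dg_simps [simp]: "source (dg A B f) = A" "target (dg A B f) = B"
  by (simp_all add: dg_def)

lemma ob_simps: "finite (ob A)" "a \<in> ob A \<Longrightarrow> 0 < a" "card (ob A) = card (Field A)"
  by (auto simp: ob_def)

lemma tl_objectD:
  assumes "tl_object A"
  shows "finite (Field A)" "a \<in> Field A \<Longrightarrow> (a, a) \<in> A" "(a, b) \<in> A \<Longrightarrow> (b, c) \<in> A \<Longrightarrow> (a, c) \<in> A"
    "(a, b) \<in> A \<Longrightarrow> (b, a) \<in> A \<Longrightarrow> a = b"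
    "a \<in> Field A \<Longrightarrow> b \<in> Field A \<Longrightarrow> a \<noteq> b \<Longrightarrow> (a, b) \<in> A \<or> (b, a) \<in> A"
    "(a, b) \<in> A \<Longrightarrow> a \<in> Field A \<and> b \<in> Field A"
  using assms unfolding tl_object_def linear_order_on_def partial_order_on_def preorder_on_def
  by (auto simp: refl_on_def antisym_def total_on_def Field_def dest: transD)

lemma pos_less:
  assumes A: "tl_object A" and ab: "(a, b) \<in> A" "a \<noteq> b"
  shows "pos A a < pos A b"
  unfolding pos_def of_nat_less_iff
proof (rule psubset_card_mono)
  have "under A b \<subseteq> Field A" using tl_objectD(6)[OF A] by (auto simp: under_def)
  then show "finite (under A b)" using tl_objectD(1)[OF A] finite_subset by blast
  have "under A a \<subseteq> under A b" using tl_objectD(3)[OF A _ ab(1)] by (auto simp: under_def)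
  moreover have "b \<in> under A b" "b \<notin> under A a"
    using tl_objectD(2)[OF A, of b] tl_objectD(6)[OF A ab(1)] tl_objectD(4)[OF A ab(1)] ab(2) by (auto simp: under_def)
  ultimately show "under A a \<subset> under A b" by blast
qed

lemma pos_less_iff:
  assumes A: "tl_object A" and ab: "a \<in> Field A" "b \<in> Field A"
  shows "pos A a < pos A b \<longleftrightarrow> (a, b) \<in> A \<and> a \<noteq> b"
  using pos_less[OF A] tl_objectD(5)[OF A ab] by (metis less_asym less_irrefl)

lemma pos_bij:
  assumes A: "tl_object A"
  shows "bij_betw (pos A) (Field A) (ob A)"
proof -
  have inj: "inj_on (pos A) (Field A)"
    by (rule inj_onI) (metis pos_less_iff[OF A] tl_objectD(5)[OF A] less_irrefl)
  have "pos A a \<in> ob A" if a: "a \<in> Field A" for a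
  proof -
    have sub: "under A a \<subseteq> Field A" using tl_objectD(6)[OF A] by (auto simp: under_def)
    have fin: "finite (under A a)" using sub tl_objectD(1)[OF A] finite_subset by blast
    have "a \<in> under A a" using tl_objectD(2)[OF A a] by (simp add: under_def)
    then have "0 < card (under A a)" using fin by (auto simp: card_gt_0_iff)
    moreover have "card (under A a) \<le> card (Field A)" by (rule card_mono[OF tl_objectD(1)[OF A] sub])
    ultimately show ?thesis by (auto simp: pos_def ob_def)
  qed
  then have sub: "pos A ` Field A \<subseteq> ob A" by blast
  have "card (pos A ` Field A) = card (ob A)" using card_image[OF inj] by (simp add: ob_def)
  then have "pos A ` Field A = ob A" using sub by (intro card_subset_eq) (auto simp: ob_def)
  then show ?thesis using inj by (simp add: bij_betw_def)
qed

lemma pos_in: "tl_object A \<Longrightarrow> a \<in> Field A \<Longrightarrow> pos A a \<in> ob A"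
  using pos_bij bij_betwE by blast

lemma pos_pos: "tl_object A \<Longrightarrow> a \<in> Field A \<Longrightarrow> 0 < pos A a"
  by (rule ob_simps(2)) (rule pos_in)

lemma pos_inj: "tl_object A \<Longrightarrow> a \<in> Field A \<Longrightarrow> b \<in> Field A \<Longrightarrow> pos A a = pos A b \<Longrightarrow> a = b"
  using pos_bij by (metis bij_betw_inv_into_left)

lemma pt_simps [simp]: "pt A B (Inl a) = - pos A a" "pt A B (Inr b) = pos B b"
  by (simp_all add: pt_def)

lemma pt_bij:
  assumes A: "tl_object A" and B: "tl_object B"
  shows "bij_betw (pt A B) (pts A B) (uminus ` ob A \<union> ob B)"
proof -
  have "inj_on (pt A B) (pts A B)"
  proof (rule inj_onI)
    fix x y assume xy: "x \<in> pts A B" "y \<in> pts A B" "pt A B x = pt A B y"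
    show "x = y"
      using xy pos_pos[OF A] pos_pos[OF B] pos_inj[OF A] pos_inj[OF B]
      by (cases x; cases y) (auto dest: less_trans, (metis neg_0_less_iff_less not_less_iff_gr_or_eq)+)
  qed
  moreover have "pt A B ` pts A B = uminus ` ob A \<union> ob B"
  proof -
    have "pt A B ` pts A B = uminus ` pos A ` Field A \<union> pos B ` Field B"
      by (auto simp: Plus_def image_Un image_image)
    then show ?thesis using pos_bij[OF A] pos_bij[OF B] by (simp add: bij_betw_def)
  qed
  ultimately show ?thesis by (simp add: bij_betw_def)
qed

lemma pt_inj: "tl_object A \<Longrightarrow> tl_object B \<Longrightarrow> x \<in> pts A B \<Longrightarrow> y \<in> pts A B \<Longrightarrow> pt A B x = pt A B y \<Longrightarrow> x = y"
  using pt_bij by (metis bij_betw_inv_into_left)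

lemma pt_surj: "tl_object A \<Longrightarrow> tl_object B \<Longrightarrow> - z \<in> ob A \<or> z \<in> ob B \<Longrightarrow> \<exists>x\<in>pts A B. pt A B x = z"
proof -
  assume A: "tl_object A" "tl_object B" and z: "- z \<in> ob A \<or> z \<in> ob B"
  then have "z \<in> uminus ` ob A \<union> ob B" by (simp add: uminus_image_iff)
  then show ?thesis using pt_bij[OF A] unfolding bij_betw_def by (metis imageE)
qed

lemma pt_in:
  assumes "tl_object A" "tl_object B" "x \<in> pts A B"
  shows "- pt A B x \<in> ob A \<or> pt A B x \<in> ob B"
proof (cases x)
  case (Inl a)
  then show ?thesis using pos_in[OF assms(1), of a] assms(3) by auto
next
  case (Inr b)
  then show ?thesis using pos_in[OF assms(2), of b] assms(3) by auto
qed

text \<open>The code of a Brauer partition before planarity is imposed.\<close>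

definition matching_on :: "'a rel \<Rightarrow> 'a rel \<Rightarrow> (int \<Rightarrow> int) \<Rightarrow> bool" where
  "matching_on A B f \<longleftrightarrow> involution f \<and> (\<forall>z. f z \<noteq> z \<longleftrightarrow> - z \<in> ob A \<or> z \<in> ob B)"

lemma NC_iff_matching_on: "f \<in> NC (ob A) (ob B) \<longleftrightarrow> matching_on A B f \<and> noncrossing (\<lambda>z. z) f"
proof
  show "f \<in> NC (ob A) (ob B) \<Longrightarrow> matching_on A B f \<and> noncrossing (\<lambda>z. z) f"
    using NC_D(1,3,9) unfolding matching_on_def by blast
  assume f: "matching_on A B f \<and> noncrossing (\<lambda>z. z) f"
  show "f \<in> NC (ob A) (ob B)"
    by (rule NC_I) (use f in \<open>auto simp: matching_on_def involution_def noncrossing_def ob_simps\<close>)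
qed

context
  fixes A B :: "'a rel"
  assumes A: "tl_object A" and B: "tl_object B"
begin

lemma partner_ex:
  assumes f: "matching_on A B f" and x: "x \<in> pts A B"
  shows "\<exists>y\<in>pts A B. pt A B y = f (pt A B x)" "y \<in> pts A B \<Longrightarrow> pt A B y = f (pt A B x) \<Longrightarrow> y \<noteq> x \<and> pt A B x = f (pt A B y)"
proof -
  have ff: "f (f z) = z" for z using f by (simp add: matching_on_def involution_def)
  have ne: "f (pt A B x) \<noteq> pt A B x" using f pt_in[OF A B x] by (auto simp: matching_on_def)
  then have "f (f (pt A B x)) \<noteq> f (pt A B x)" using ff by metis
  then show "\<exists>y\<in>pts A B. pt A B y = f (pt A B x)"
    using f pt_surj[OF A B] by (auto simp: matching_on_def)
  show "y \<in> pts A B \<Longrightarrow> pt A B y = f (pt A B x) \<Longrightarrow> y \<noteq> x \<and> pt A B x = f (pt A B y)"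
    using ne ff by metis
qed

lemma dg_blocks_eq:
  assumes f: "matching_on A B f" and b: "b \<in> blocks (dg A B f)" and x: "x \<in> b"
  shows "x \<in> pts A B" "\<exists>y\<in>pts A B. pt A B y = f (pt A B x) \<and> b = {x, y}"
proof -
  obtain u v where uv: "u \<in> pts A B" "v \<in> pts A B" "pt A B v = f (pt A B u)" "b = {u, v}"
    using b by (auto simp: dg_def)
  have vu: "pt A B u = f (pt A B v)" using partner_ex(2)[OF f uv(1,2,3)] by simp
  have "x = u \<or> x = v" using x uv(4) by simp
  then have "x \<in> pts A B \<and> (\<exists>y\<in>pts A B. pt A B y = f (pt A B x) \<and> b = {x, y})"
  proof
    assume xu: "x = u"
    show ?thesis unfolding xu using uv by blast
  next
    assume xv: "x = v"
    show ?thesis unfolding xv using uv vu by blast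
  qed
  then show "x \<in> pts A B" "\<exists>y\<in>pts A B. pt A B y = f (pt A B x) \<and> b = {x, y}" by blast+
qed

lemma dg_blockI:
  assumes "x \<in> pts A B" "y \<in> pts A B" "pt A B y = f (pt A B x)"
  shows "{x, y} \<in> blocks (dg A B f)"
  using assms by (auto simp: dg_def)

lemma dg_brauer:
  assumes f: "matching_on A B f"
  shows "is_brauer (dg A B f)"
  unfolding is_brauer_def
proof
  let ?bs = "blocks (dg A B f)"
  show "partition_on (Field (source (dg A B f)) <+> Field (target (dg A B f))) ?bs"
    unfolding dg_simps
  proof (rule partition_onI)
    show "\<Union> ?bs = pts A B"
    proof
      show "\<Union> ?bs \<subseteq> pts A B" using dg_blocks_eq(1)[OF f] by blast
      show "pts A B \<subseteq> \<Union> ?bs"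
      proof
        fix x assume x: "x \<in> pts A B"
        obtain y where "y \<in> pts A B" "pt A B y = f (pt A B x)" using partner_ex(1)[OF f x] by blast
        then show "x \<in> \<Union> ?bs" using dg_blockI[where f = f, OF x] by blast
      qed
    qed
    show "{} \<notin> ?bs" by (auto simp: dg_def)
    show "disjnt b c" if b: "b \<in> ?bs" and c: "c \<in> ?bs" and ne: "b \<noteq> c" for b c
    proof (rule ccontr)
      assume "\<not> disjnt b c"
      then obtain x where x: "x \<in> b" "x \<in> c" by (auto simp: disjnt_def)
      obtain y where y: "y \<in> pts A B" "pt A B y = f (pt A B x)" "b = {x, y}" using dg_blocks_eq(2)[OF f b x(1)] by blast
      obtain y' where y': "y' \<in> pts A B" "pt A B y' = f (pt A B x)" "c = {x, y'}" using dg_blocks_eq(2)[OF f c x(2)] by blast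
      have "y = y'" by (rule pt_inj[OF A B y(1) y'(1)]) (simp add: y(2) y'(2))
      then show False using ne y y' by simp
    qed
  qed
  show "\<forall>b\<in>?bs. card b = 2"
  proof
    fix b assume b: "b \<in> ?bs"
    then obtain x where "x \<in> b" by (auto simp: dg_def)
    then obtain y where y: "x \<in> pts A B" "y \<in> pts A B" "pt A B y = f (pt A B x)" "b = {x, y}"
      using dg_blocks_eq[OF f b] by blast
    then have "y \<noteq> x" using partner_ex(2)[OF f y(1,2,3)] by simp
    then show "card b = 2" using y by simp
  qed
qed

lemma dg_inj:
  assumes f: "matching_on A B f" and g: "matching_on A B g" and eq: "dg A B f = dg A B g"
  shows "f = g"
proof
  fix z
  show "f z = g z"
  proof (cases "- z \<in> ob A \<or> z \<in> ob B")
    case True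
    then obtain x where x: "x \<in> pts A B" "pt A B x = z" using pt_surj[OF A B] by blast
    obtain y where y: "y \<in> pts A B" "pt A B y = f (pt A B x)" using partner_ex(1)[OF f x(1)] by blast
    have "{x, y} \<in> blocks (dg A B g)" using dg_blockI[where f = f, OF x(1) y] eq by simp
    then obtain y' where y': "y' \<in> pts A B" "pt A B y' = g (pt A B x)" "{x, y} = {x, y'}"
      using dg_blocks_eq(2)[OF g, of "{x, y}" x] by blast
    have "y \<noteq> x" using partner_ex(2)[OF f x(1) y] by simp
    then have "y = y'" using y'(3) by (metis doubleton_eq_iff)
    then show ?thesis using y y' x by simp
  next
    case False
    then show ?thesis using f g by (auto simp: matching_on_def)
  qed
qed

text \<open>A partition into pairs has a partner function on the vertices; the involution is this
  function carried over to positions and extended by the identity.\<close>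

lemma dg_surj:
  assumes b: "is_brauer \<alpha>" and s: "source \<alpha> = A" "target \<alpha> = B"
  shows "\<exists>f. matching_on A B f \<and> \<alpha> = dg A B f"
proof -
  have part: "partition_on (pts A B) (blocks \<alpha>)" and c2: "\<And>b. b \<in> blocks \<alpha> \<Longrightarrow> card b = 2"
    using b s by (auto simp: is_brauer_def)
  have ex: "\<exists>y. y \<noteq> x \<and> {x, y} \<in> blocks \<alpha>" if x: "x \<in> pts A B" for x
  proof -
    obtain b where b: "b \<in> blocks \<alpha>" "x \<in> b" using part x by (auto simp: partition_on_def)
    then show ?thesis using c2[OF b(1)] by (auto simp: card_2_iff) (metis insert_commute)
  qed
  have uniq: "y = y'" if "{x, y} \<in> blocks \<alpha>" "{x, y'} \<in> blocks \<alpha>" "y \<noteq> x" for x y y'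
  proof -
    have "{x, y} = {x, y'}"
      using part that(1,2) unfolding partition_on_def disjoint_def by (metis disjoint_iff insertI1)
    then show ?thesis using that(3) by (metis doubleton_eq_iff)
  qed
  define p where "p x = (SOME y. y \<noteq> x \<and> {x, y} \<in> blocks \<alpha>)" for x
  have p: "p x \<noteq> x" "{x, p x} \<in> blocks \<alpha>" if "x \<in> pts A B" for x
    using someI_ex[OF ex[OF that]] by (auto simp: p_def)
  have pW: "p x \<in> pts A B" if "x \<in> pts A B" for x
    using p(2)[OF that] part by (auto simp: partition_on_def)
  have pp: "p (p x) = x" if x: "x \<in> pts A B" for x
    using uniq[of "p x" "p (p x)" x] p[OF x] p[OF pW[OF x]] by (simp add: insert_commute)
  let ?S = "uminus ` ob A \<union> ob B"
  define q where "q = inv_into (pts A B) (pt A B)"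
  have q: "q z \<in> pts A B" "pt A B (q z) = z" if "z \<in> ?S" for z
  proof -
    have "z \<in> pt A B ` pts A B" using pt_bij[OF A B] that by (simp add: bij_betw_def)
    then show "q z \<in> pts A B" "pt A B (q z) = z" unfolding q_def by (rule inv_into_into, rule f_inv_into_f)
  qed
  have qpt: "q (pt A B x) = x" if "x \<in> pts A B" for x
    unfolding q_def using pt_bij[OF A B] that by (simp add: bij_betw_def)
  have ptS: "pt A B x \<in> ?S" if "x \<in> pts A B" for x using pt_bij[OF A B] that by (auto simp: bij_betw_def)
  define f where "f z = (if z \<in> ?S then pt A B (p (q z)) else z)" for z
  have fx: "f (pt A B x) = pt A B (p x)" if "x \<in> pts A B" for x
    using ptS[OF that] qpt[OF that] by (simp add: f_def)
  have Siff: "z \<in> ?S \<longleftrightarrow> - z \<in> ob A \<or> z \<in> ob B" for z by (simp add: uminus_image_iff)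
  have m: "matching_on A B f"
    unfolding matching_on_def involution_def
  proof (intro conjI allI)
    fix z
    show "f (f z) = z"
    proof (cases "z \<in> ?S")
      case True
      then show ?thesis using fx[OF q(1)[OF True]] fx[OF pW[OF q(1)[OF True]]] pp[OF q(1)[OF True]] q(2)[OF True] by simp
    qed (simp add: f_def)
    show "f z \<noteq> z \<longleftrightarrow> - z \<in> ob A \<or> z \<in> ob B"
      unfolding Siff[symmetric]
    proof
      assume z: "z \<in> ?S"
      have "f z \<noteq> pt A B (q z)"
        using fx[OF q(1)[OF z]] q(2)[OF z] pt_inj[OF A B pW[OF q(1)[OF z]] q(1)[OF z]] p(1)[OF q(1)[OF z]] by auto
      then show "f z \<noteq> z" using q(2)[OF z] by simp
    next
      show "f z \<noteq> z \<Longrightarrow> z \<in> ?S" unfolding f_def by presburger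
    qed
  qed
  have "blocks \<alpha> = blocks (dg A B f)"
  proof
    show "blocks \<alpha> \<subseteq> blocks (dg A B f)"
    proof
      fix b assume b: "b \<in> blocks \<alpha>"
      then obtain x y where xy: "b = {x, y}" "x \<noteq> y" using c2[OF b] by (auto simp: card_2_iff)
      have W: "x \<in> pts A B" "y \<in> pts A B" using part b xy by (auto simp: partition_on_def)
      have "y = p x" using uniq[of x y "p x"] b xy p[OF W(1)] by auto
      then show "b \<in> blocks (dg A B f)" using dg_blockI[where f = f, OF W] fx[OF W(1)] xy by simp
    qed
    show "blocks (dg A B f) \<subseteq> blocks \<alpha>"
    proof
      fix b assume b: "b \<in> blocks (dg A B f)"
      then obtain x y where xy: "x \<in> pts A B" "y \<in> pts A B" "pt A B y = f (pt A B x)" "b = {x, y}" by (auto simp: dg_def)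
      have "y = p x" by (rule pt_inj[OF A B xy(2) pW[OF xy(1)]]) (use xy fx in simp)
      then show "b \<in> blocks \<alpha>" using p(2)[OF xy(1)] xy by simp
    qed
  qed
  then have "\<alpha> = dg A B f" using s by (cases \<alpha>) (simp add: dg_def)
  then show ?thesis using m by blast
qed

text \<open>Each transversal block is counted at its unique upper end.\<close>

lemma drank_dg:
  assumes f: "matching_on A B f"
  shows "drank (dg A B f) = nc_rank f"
  unfolding drank_def dg_simps nc_rank_def
proof (rule bij_betw_same_card[symmetric])
  let ?T = "{z. z < 0 \<and> 0 < f z}"
  let ?BB = "{b \<in> blocks (dg A B f). b \<inter> Inl ` Field A \<noteq> {} \<and> b \<inter> Inr ` Field B \<noteq> {}}"
  define g where "g z = {x \<in> pts A B. pt A B x = z \<or> pt A B x = f z}" for z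
  have ff: "f (f z) = z" for z using f by (simp add: matching_on_def involution_def)
  have gx: "g (pt A B x) = {x, y}" if "x \<in> pts A B" "y \<in> pts A B" "pt A B y = f (pt A B x)" for x y
  proof (rule Set.set_eqI)
    fix w
    have "w \<in> pts A B \<and> pt A B w = pt A B x \<longleftrightarrow> w = x" using that(1) pt_inj[OF A B, of w x] by blast
    moreover have "w \<in> pts A B \<and> pt A B w = f (pt A B x) \<longleftrightarrow> w = y"
      unfolding that(3)[symmetric] using that(2) pt_inj[OF A B, of w y] by blast
    ultimately show "w \<in> g (pt A B x) \<longleftrightarrow> w \<in> {x, y}" unfolding g_def by blast
  qed
  have ptl: "pt A B x < 0 \<Longrightarrow> \<exists>a\<in>Field A. x = Inl a" "0 < pt A B x \<Longrightarrow> \<exists>a\<in>Field B. x = Inr a" if "x \<in> pts A B" for x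
    using that pos_pos[OF A] pos_pos[OF B] by (cases x; force)+
  have T: "\<exists>x y. x \<in> pts A B \<and> y \<in> pts A B \<and> pt A B x = z \<and> pt A B y = f z" if z: "z \<in> ?T" for z
  proof -
    have "f z \<noteq> z" "f (f z) \<noteq> f z" using z ff by auto
    then show ?thesis using f pt_surj[OF A B, of z] pt_surj[OF A B, of "f z"] by (auto simp: matching_on_def)
  qed
  show "bij_betw g ?T ?BB"
    unfolding bij_betw_def
  proof
    show "inj_on g ?T"
    proof (rule inj_onI)
      fix z w assume z: "z \<in> ?T" and w: "w \<in> ?T" and e: "g z = g w"
      obtain x where x: "x \<in> pts A B" "pt A B x = z" using T[OF z] by blast
      then have "x \<in> g w" using e by (auto simp: g_def)
      then have "z = w \<or> z = f w" using x by (auto simp: g_def)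
      then show "z = w" using z w by auto
    qed
    show "g ` ?T = ?BB"
    proof
      show "g ` ?T \<subseteq> ?BB"
      proof
        fix b assume "b \<in> g ` ?T"
        then obtain z where z: "z \<in> ?T" "b = g z" by blast
        obtain x y where xy: "x \<in> pts A B" "y \<in> pts A B" "pt A B x = z" "pt A B y = f z" using T[OF z(1)] by blast
        have "b = {x, y}" using gx[OF xy(1,2)] xy z by simp
        moreover have "{x, y} \<in> blocks (dg A B f)" using dg_blockI[where f = f, OF xy(1,2)] xy by simp
        moreover obtain a a' where "a \<in> Field A" "x = Inl a" "a' \<in> Field B" "y = Inr a'"
          using ptl(1)[OF xy(1)] ptl(2)[OF xy(2)] xy z by auto
        ultimately show "b \<in> ?BB" by auto
      qed
      show "?BB \<subseteq> g ` ?T"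
      proof
        fix b assume b: "b \<in> ?BB"
        then obtain a c where ac: "a \<in> Field A" "Inl a \<in> b" "c \<in> Field B" "Inr c \<in> b" by auto
        obtain y where y: "y \<in> pts A B" "pt A B y = f (pt A B (Inl a))" "b = {Inl a, y}"
          using dg_blocks_eq(2)[OF f _ ac(2)] b by blast
        then have yc: "y = Inr c" using ac by auto
        have "b = g (- pos A a)" using gx[of "Inl a" y] y ac by auto
        moreover have "- pos A a \<in> ?T" using y yc pos_pos[OF A ac(1)] pos_pos[OF B ac(3)] by simp
        ultimately show "b \<in> g ` ?T" by blast
      qed
    qed
  qed
qed

end

text \<open>The join of equivalences is computed explicitly as the pullback \<open>R\<close> of path
  connectivity along the coordinates \<open>\<phi>\<close>: \<open>R\<close> is an equivalence
  containing both parts, and any equivalence containing both parts contains the ends of every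
  path.\<close>

lemma dg_mult:
  assumes A: "tl_object A" and B: "tl_object B" and C: "tl_object C"
    and f: "f \<in> NC (ob A) (ob B)" and g: "g \<in> NC (ob B) (ob C)"
  shows "diagram_mult (dg A B f) (dg B C g) = dg A C (f \<odot> g)"
proof -
  have mf: "matching_on A B f" and mg: "matching_on B C g" using f g NC_iff_matching_on by auto
  define up :: "'a + 'a \<Rightarrow> 'a layered" where "up = case_sum Upper Middle"
  define low :: "'a + 'a \<Rightarrow> 'a layered" where "low = case_sum Middle Lower"
  define out :: "'a + 'a \<Rightarrow> 'a layered" where "out = case_sum Upper Lower"
  define Z where "Z = Upper ` Field A \<union> Middle ` Field B \<union> Lower ` Field C"
  define Rf where "Rf = map_prod up up ` block_rel (blocks (dg A B f))"
  define Rg where "Rg = map_prod low low ` block_rel (blocks (dg B C g))"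
  define E where "E = \<Inter>{E. equiv Z E \<and> Rf \<subseteq> E \<and> Rg \<subseteq> E}"
  define \<phi> :: "'a layered \<Rightarrow> nat \<times> int" where
    "\<phi> p = (case p of Upper a \<Rightarrow> (0, pos A a) | Middle b \<Rightarrow> (1, pos B b) | Lower c \<Rightarrow> (2, pos C c))" for p
  have \<phi>_up: "\<phi> (up x) = place 0 1 (pt A B x)" "up x \<in> Z" if "x \<in> pts A B" for x
    using that pos_pos[OF A] pos_pos[OF B] by (cases x; force simp: \<phi>_def up_def place_def Z_def)+
  have \<phi>_low: "\<phi> (low x) = place 1 2 (pt B C x)" "low x \<in> Z" if "x \<in> pts B C" for x
    using that pos_pos[OF B] pos_pos[OF C] by (cases x; force simp: \<phi>_def low_def place_def Z_def)+
  have \<phi>_out: "\<phi> (out x) = place 0 2 (pt A C x)" "out x \<in> Z" if "x \<in> pts A C" for x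
    using that pos_pos[OF A] pos_pos[OF C] by (cases x; force simp: \<phi>_def out_def place_def Z_def)+
  have \<phi>_inj: "p = q" if "p \<in> Z" "q \<in> Z" "\<phi> p = \<phi> q" for p q
    using that pos_inj[OF A] pos_inj[OF B] pos_inj[OF C] by (auto simp: Z_def \<phi>_def)
  have symc: "sym (conn f g)"
  proof -
    have "sym (layer i j h)" if "involution h" for i j h
      using involutionD[OF that] by (auto simp: sym_def layer_def)
    then have "sym (layer 0 1 f \<union> layer 1 2 g)"
      using NC_D(1)[OF f] NC_D(1)[OF g] by (intro sym_Un) auto
    then show ?thesis unfolding conn_def by (rule sym_rtrancl)
  qed
  define R where "R = {(p, q). p \<in> Z \<and> q \<in> Z \<and> (\<phi> p, \<phi> q) \<in> conn f g}"
  have "equiv Z R"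
  proof (rule equivI)
    show "sym R" by (rule symI) (use symD[OF symc] in \<open>simp add: R_def\<close>)
    show "trans R"
    proof (rule transI)
      fix p q s assume "(p, q) \<in> R" "(q, s) \<in> R"
      then show "(p, s) \<in> R" using conn_trans[of "\<phi> p" "\<phi> q" f g "\<phi> s"] by (simp add: R_def)
    qed
  qed (auto simp: R_def refl_on_def conn_refl)
  moreover have "Rf \<subseteq> R"
  proof
    fix e assume "e \<in> Rf"
    then obtain b x y where b: "b \<in> blocks (dg A B f)" "x \<in> b" "y \<in> b" "e = (up x, up y)"
      by (auto simp: Rf_def block_rel_def)
    have x: "x \<in> pts A B" "y \<in> pts A B" using dg_blocks_eq(1)[OF A B mf b(1)] b by auto
    have "pt A B y = pt A B x \<or> pt A B y = f (pt A B x)" using dg_blocks_eq(2)[OF A B mf b(1,2)] b(3) by auto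
    then have "(\<phi> (up x), \<phi> (up y)) \<in> conn f g" using \<phi>_up[OF x(1)] \<phi>_up[OF x(2)] conn_left conn_refl by metis
    then show "e \<in> R" using b \<phi>_up x by (auto simp: R_def)
  qed
  moreover have "Rg \<subseteq> R"
  proof
    fix e assume "e \<in> Rg"
    then obtain b x y where b: "b \<in> blocks (dg B C g)" "x \<in> b" "y \<in> b" "e = (low x, low y)"
      by (auto simp: Rg_def block_rel_def)
    have x: "x \<in> pts B C" "y \<in> pts B C" using dg_blocks_eq(1)[OF B C mg b(1)] b by auto
    have "pt B C y = pt B C x \<or> pt B C y = g (pt B C x)" using dg_blocks_eq(2)[OF B C mg b(1,2)] b(3) by auto
    then have "(\<phi> (low x), \<phi> (low y)) \<in> conn f g" using \<phi>_low[OF x(1)] \<phi>_low[OF x(2)] conn_right conn_refl by metis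
    then show "e \<in> R" using b \<phi>_low x by (auto simp: R_def)
  qed
  ultimately have ER: "E \<subseteq> R" unfolding E_def by blast
  have "R \<subseteq> E"
    unfolding E_def
  proof (intro Inter_greatest)
    fix F assume "F \<in> {E. equiv Z E \<and> Rf \<subseteq> E \<and> Rg \<subseteq> E}"
    then have F: "equiv Z F" "Rf \<subseteq> F" "Rg \<subseteq> F" by auto
    have trF: "trans F" and rF: "\<And>p. p \<in> Z \<Longrightarrow> (p, p) \<in> F" using F(1) by (auto simp: equiv_def refl_on_def)
    \<comment> \<open>A path in coordinates is lifted to vertices. Coordinates range over all
      integers, but a step that moves anything starts at a vertex, and all other steps are
      trivial.\<close>
    have path: "\<exists>q\<in>Z. \<phi> q = s \<and> (p, q) \<in> F" if p: "p \<in> Z" and s: "(\<phi> p, s) \<in> conn f g" for p s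
      using s unfolding conn_def
    proof (induction rule: rtrancl_induct)
      case base then show ?case using p rF by blast
    next
      case (step s t)
      then obtain q where q: "q \<in> Z" "\<phi> q = s" "(p, q) \<in> F" by blast
      from step(2) consider z where "s = place 0 1 z" "t = place 0 1 (f z)"
        | z where "s = place 1 2 z" "t = place 1 2 (g z)" by (auto simp: layer_def)
      then show ?case
      proof cases
        case 1
        show ?thesis
        proof (cases "f z = z")
          case True then show ?thesis using 1 q by auto
        next
          case False
          then obtain x where x: "x \<in> pts A B" "pt A B x = z" using pt_surj[OF A B] NC_D(9)[OF f] by blast
          obtain y where y: "y \<in> pts A B" "pt A B y = f (pt A B x)" using partner_ex(1)[OF A B mf x(1)] by blast
          have "{x, y} \<in> blocks (dg A B f)" by (rule dg_blockI[where f = f, OF A B x(1) y])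
          then have "(up x, up y) \<in> Rf" unfolding Rf_def block_rel_def by (intro image_eqI[of _ _ "(x, y)"]) auto
          moreover have "q = up x" using \<phi>_inj[OF q(1) \<phi>_up(2)[OF x(1)]] \<phi>_up(1)[OF x(1)] x 1 q by simp
          ultimately have "(p, up y) \<in> F" using q(3) F(2) trF by (blast dest: transD)
          then show ?thesis using \<phi>_up[OF y(1)] y x 1 by auto
        qed
      next
        case 2
        show ?thesis
        proof (cases "g z = z")
          case True then show ?thesis using 2 q by auto
        next
          case False
          then obtain x where x: "x \<in> pts B C" "pt B C x = z" using pt_surj[OF B C] NC_D(9)[OF g] by blast
          obtain y where y: "y \<in> pts B C" "pt B C y = g (pt B C x)" using partner_ex(1)[OF B C mg x(1)] by blast
          have "{x, y} \<in> blocks (dg B C g)" by (rule dg_blockI[where f = g, OF B C x(1) y])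
          then have "(low x, low y) \<in> Rg" unfolding Rg_def block_rel_def by (intro image_eqI[of _ _ "(x, y)"]) auto
          moreover have "q = low x" using \<phi>_inj[OF q(1) \<phi>_low(2)[OF x(1)]] \<phi>_low(1)[OF x(1)] x 2 q by simp
          ultimately have "(p, low y) \<in> F" using q(3) F(3) trF by (blast dest: transD)
          then show ?thesis using \<phi>_low[OF y(1)] y x 2 by auto
        qed
      qed
    qed
    show "R \<subseteq> F"
    proof
      fix e assume "e \<in> R"
      then obtain p q where pq: "e = (p, q)" "p \<in> Z" "q \<in> Z" "(\<phi> p, \<phi> q) \<in> conn f g" by (auto simp: R_def)
      obtain q' where "q' \<in> Z" "\<phi> q' = \<phi> q" "(p, q') \<in> F" using path[OF pq(2,4)] by blast
      then show "e \<in> F" using \<phi>_inj[of q' q] pq by auto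
    qed
  qed
  then have ER: "E = R" using ER by blast
  let ?h = "f \<odot> g"
  have h: "?h \<in> NC (ob A) (ob C)" by (rule nc_mult_NC[OF f g])
  then have mh: "matching_on A C ?h" using NC_iff_matching_on by blast
  have outE: "(out x, out y) \<in> E \<longleftrightarrow> y = x \<or> pt A C y = ?h (pt A C x)" if x: "x \<in> pts A C" "y \<in> pts A C" for x y
  proof -
    have "(out x, out y) \<in> E \<longleftrightarrow> (place 0 2 (pt A C x), place 0 2 (pt A C y)) \<in> conn f g"
      using ER \<phi>_out[OF x(1)] \<phi>_out[OF x(2)] by (simp add: R_def)
    also have "\<dots> \<longleftrightarrow> pt A C y = pt A C x \<or> pt A C y = ?h (pt A C x)" by (rule nc_mult_conn(1)[OF f g])
    also have "\<dots> \<longleftrightarrow> y = x \<or> pt A C y = ?h (pt A C x)" using pt_inj[OF A C x(2) x(1)] by auto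
    finally show ?thesis .
  qed
  let ?Q = "{(x, y). x \<in> pts A C \<and> y \<in> pts A C \<and> (out x, out y) \<in> E}"
  have cls: "?Q `` {x} = {x, y}" if "x \<in> pts A C" "y \<in> pts A C" "pt A C y = ?h (pt A C x)" for x y
  proof (rule Set.set_eqI)
    fix w
    have "w \<in> pts A C \<and> pt A C w = ?h (pt A C x) \<longleftrightarrow> w = y"
      unfolding that(3)[symmetric] using that(2) pt_inj[OF A C, of w y] by blast
    then show "w \<in> ?Q `` {x} \<longleftrightarrow> w \<in> {x, y}" using outE[OF that(1), of w] that(1) by blast
  qed
  have "pts A C // ?Q = blocks (dg A C ?h)"
  proof
    show "pts A C // ?Q \<subseteq> blocks (dg A C ?h)"
    proof
      fix b assume "b \<in> pts A C // ?Q"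
      then obtain x where x: "x \<in> pts A C" "b = ?Q `` {x}" by (auto simp: quotient_def)
      obtain y where y: "y \<in> pts A C" "pt A C y = ?h (pt A C x)" using partner_ex(1)[OF A C mh x(1)] by blast
      show "b \<in> blocks (dg A C ?h)" using dg_blockI[where f = "f \<odot> g", OF A C x(1) y] cls[OF x(1) y] x by simp
    qed
    show "blocks (dg A C ?h) \<subseteq> pts A C // ?Q"
    proof
      fix b assume "b \<in> blocks (dg A C ?h)"
      then obtain x y where xy: "x \<in> pts A C" "y \<in> pts A C" "pt A C y = ?h (pt A C x)" "b = {x, y}" by (auto simp: dg_def)
      show "b \<in> pts A C // ?Q" using cls[OF xy(1-3)] xy quotientI[OF xy(1), of ?Q] by simp
    qed
  qed
  moreover have "diagram_mult (dg A B f) (dg B C g) = Diagram A (pts A C // ?Q) C"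
    unfolding diagram_mult_def Let_def dg_simps up_def[symmetric] low_def[symmetric] out_def[symmetric]
      Z_def[symmetric] Rf_def[symmetric] Rg_def[symmetric] E_def[symmetric] ..
  ultimately show ?thesis by (simp add: dg_def)
qed

section \<open>Planarity\<close>

text \<open>A tent over the segment from \<open>i\<close> to \<open>j\<close> at height
  \<open>s\<close>, with sides of slope \<open>c\<close> and \<open>- c\<close>. Piecewise linear
  drawings reduce disjointness to linear inequalities.\<close>

definition cap_path :: "real \<Rightarrow> real \<Rightarrow> real \<Rightarrow> real \<Rightarrow> real \<Rightarrow> real \<times> real" where
  "cap_path s c i j t = (i + t * (j - i), s + c * (j - i) * min t (1 - t))"

lemma cap_path_ends: "pathstart (cap_path s c i j) = (i, s)" "pathfinish (cap_path s c i j) = (j, s)"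
  by (simp_all add: cap_path_def pathstart_def pathfinish_def)

lemma arc_cap_path:
  assumes "i < j"
  shows "arc (cap_path s c i j)"
  unfolding arc_def
proof
  have "continuous_on {0..1} (\<lambda>t. (i + t * (j - i), s + c * (j - i) * min t (1 - t)))"
    by (intro continuous_intros)
  then show "path (cap_path s c i j)"
    unfolding path_def cap_path_def[abs_def] .
  show "inj_on (cap_path s c i j) {0..1}"
    by (rule inj_onI) (use assms in \<open>simp add: cap_path_def\<close>)
qed

lemma cap_path_image:
  assumes "i < j" "p \<in> path_image (cap_path s c i j)"
  shows "i \<le> fst p" "fst p \<le> j" "snd p = s + c * min (fst p - i) (j - fst p)"
proof -
  obtain t where t: "0 \<le> t" "t \<le> 1" "p = cap_path s c i j t"
    using assms(2) by (auto simp: path_image_def)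
  have d: "0 \<le> j - i" using assms(1) by simp
  show "i \<le> fst p" using t d by (simp add: cap_path_def)
  have "t * (j - i) \<le> 1 * (j - i)" by (rule mult_right_mono) (use t d in auto)
  then show "fst p \<le> j" using t by (simp add: cap_path_def)
  have "(j - i) * min t (1 - t) = min ((j - i) * t) ((j - i) * (1 - t))"
    using min_mult_distrib_left[of "j - i" t "1 - t"] d by auto
  also have "\<dots> = min (fst p - i) (j - fst p)"
    using t by (simp add: cap_path_def algebra_simps)
  finally show "snd p = s + c * min (fst p - i) (j - fst p)"
    using t by (simp add: cap_path_def mult.assoc)
qed

definition vx :: "int \<Rightarrow> real \<times> real" where
  "vx z = (if z < 0 then (- real_of_int z, 1) else (real_of_int z, 0))"

text \<open>The slope \<open>1 / (2 * m)\<close> makes every tent at most 1/4 deep, so tents on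
  opposite rows stay apart. It is also flatter than any straight transversal, which moves at most
  \<open>m\<close> sideways over height 1.\<close>

definition edge :: "real \<Rightarrow> int \<Rightarrow> int \<Rightarrow> real \<Rightarrow> real \<times> real" where
  "edge m L R =
    (if R < 0 then cap_path 1 (- 1 / (2 * m)) (- real_of_int R) (- real_of_int L)
     else if 0 < L then cap_path 0 (1 / (2 * m)) (real_of_int L) (real_of_int R)
     else linepath (- real_of_int L, 1) (real_of_int R, 0))"

lemma edge_basic:
  assumes "L < R" "L \<noteq> 0" "R \<noteq> 0"
  shows "arc (edge m L R)" "{pathstart (edge m L R), pathfinish (edge m L R)} = {vx L, vx R}"
  using assms by (auto simp: edge_def vx_def cap_path_ends arc_cap_path arc_linepath)

lemma edge_image:
  assumes "L < R" "L \<noteq> 0" "R \<noteq> 0" "p \<in> path_image (edge m L R)"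
  shows "R < 0 \<Longrightarrow> - R \<le> fst p \<and> fst p \<le> - L \<and> snd p = 1 - min (fst p + R) (- L - fst p) / (2 * m)"
    and "0 < L \<Longrightarrow> L \<le> fst p \<and> fst p \<le> R \<and> snd p = min (fst p - L) (R - fst p) / (2 * m)"
    and "L < 0 \<Longrightarrow> 0 < R \<Longrightarrow> \<exists>u::real. 0 \<le> u \<and> u \<le> 1 \<and> fst p = (1 - u) * (- real_of_int L) + u * real_of_int R \<and> snd p = 1 - u"
proof -
  assume R: "R < 0"
  have "- real_of_int R < - real_of_int L" using assms(1) by simp
  from cap_path_image[OF this, of p 1 "- 1 / (2 * m)"] assms(4) R
  show "- R \<le> fst p \<and> fst p \<le> - L \<and> snd p = 1 - min (fst p + R) (- L - fst p) / (2 * m)"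
    by (simp add: edge_def)
next
  assume L: "0 < L"
  have "real_of_int L < real_of_int R" using assms(1) by simp
  from cap_path_image[OF this, of p 0 "1 / (2 * m)"] assms(1,4) L
  show "L \<le> fst p \<and> fst p \<le> R \<and> snd p = min (fst p - L) (R - fst p) / (2 * m)"
    by (simp add: edge_def)
next
  assume "L < 0" "0 < R"
  then obtain u where "0 \<le> u" "u \<le> 1" "p = (1 - u) *\<^sub>R (- real_of_int L, 1) + u *\<^sub>R (real_of_int R, 0)"
    using assms(4) by (auto simp: edge_def closed_segment_def)
  then show "\<exists>u::real. 0 \<le> u \<and> u \<le> 1 \<and> fst p = (1 - u) * (- real_of_int L) + u * real_of_int R \<and> snd p = 1 - u"
    by (intro exI[of _ u]) simp
qed

lemma cap_depth:
  assumes "0 < m" "0 \<le> i" "j \<le> m" "i \<le> x" "x \<le> (j::real)"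
  shows "0 \<le> min (x - i) (j - x) / (2 * m)" "min (x - i) (j - x) / (2 * m) \<le> 1 / 4"
proof -
  show "0 \<le> min (x - i) (j - x) / (2 * m)" using assms by auto
  have "min (x - i) (j - x) \<le> m / 2" using assms by (auto simp: min_def)
  then show "min (x - i) (j - x) / (2 * m) \<le> 1 / 4" using assms(1) by (simp add: field_simps)
qed

lemma edge_in_box:
  assumes LR: "L < R" "L \<noteq> 0" "R \<noteq> 0" and m: "0 < m" "\<bar>real_of_int L\<bar> \<le> m" "\<bar>real_of_int R\<bar> \<le> m"
  shows "path_image (edge m L R) \<subseteq> {0..m} \<times> {0..1}"
proof
  fix p assume p: "p \<in> path_image (edge m L R)"
  consider "R < 0" | "0 < L" | "L < 0" "0 < R" using LR by linarith
  then have "0 \<le> fst p \<and> fst p \<le> m \<and> 0 \<le> snd p \<and> snd p \<le> 1"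
  proof cases
    case 1
    note e = edge_image(1)[OF LR p 1]
    have "0 \<le> min (fst p + R) (- L - fst p) / (2 * m)" "min (fst p + R) (- L - fst p) / (2 * m) \<le> 1 / 4"
      using cap_depth[of m "- R" "- L" "fst p"] e 1 m by auto
    moreover have "0 \<le> fst p" "fst p \<le> m" using e 1 m by linarith+
    ultimately show ?thesis using e by linarith
  next
    case 2
    note e = edge_image(2)[OF LR p 2]
    have "0 \<le> min (fst p - L) (R - fst p) / (2 * m)" "min (fst p - L) (R - fst p) / (2 * m) \<le> 1 / 4"
      using cap_depth[of m L R "fst p"] e 2 m by auto
    moreover have "0 \<le> fst p" "fst p \<le> m" using e 2 m by linarith+
    ultimately show ?thesis using e by linarith
  next
    case 3
    obtain u where u: "0 \<le> u" "u \<le> 1" "fst p = (1 - u) * (- real_of_int L) + u * real_of_int R" "snd p = 1 - u"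
      using edge_image(3)[OF LR p 3] by blast
    have 1: "(1 - u) * (- real_of_int L) \<le> (1 - u) * m"
      by (rule mult_left_mono) (use u m in linarith)+
    have 2: "u * real_of_int R \<le> u * m"
      by (rule mult_left_mono) (use u m in linarith)+
    have 3: "0 \<le> (1 - u) * (- real_of_int L)" "0 \<le> u * real_of_int R"
      by (rule mult_nonneg_nonneg; use u 3 in simp)+
    have 4: "(1 - u) * m + u * m = m" by (simp add: algebra_simps)
    have "0 \<le> fst p" unfolding u(3) by (rule add_nonneg_nonneg[OF 3])
    moreover have "fst p \<le> m" unfolding u(3) using add_mono[OF 1 2] 4 by (rule order.trans[OF _ eq_refl])
    ultimately show ?thesis using u by simp
  qed
  then show "p \<in> {0..m} \<times> {0..1}" by (cases p) auto
qed

text \<open>At a point of depth \<open>u\<close> in a tent the nearer foot is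
  \<open>2 * m * u\<close> away horizontally, while a transversal at that depth has moved by at most
  \<open>m * u\<close>. So the transversal would have started between the feet.\<close>

lemma line_avoids_cap:
  fixes i j k l x u m :: real
  assumes "0 < m" "i \<le> x" "x \<le> j" "u = min (x - i) (j - x) / (2 * m)" "x = (1 - u) * k + u * l"
    "k < i \<or> j < k" "0 \<le> k" "k \<le> m" "0 \<le> l" "l \<le> m"
  shows False
proof -
  have "0 \<le> min (x - i) (j - x)" using assms(2,3) by simp
  then have u0: "0 \<le> u" unfolding assms(4) using assms(1) by simp
  have um: "u * m = min (x - i) (j - x) / 2" unfolding assms(4) using assms(1) by simp
  have "\<bar>l - k\<bar> \<le> m" using assms(7-10) by linarith
  then have "u * \<bar>l - k\<bar> \<le> u * m" by (rule mult_left_mono[OF _ u0])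
  moreover have "x - k = u * (l - k)"
    by (subst assms(5)) (simp add: algebra_simps)
  then have "\<bar>x - k\<bar> = u * \<bar>l - k\<bar>" using u0 by (simp add: abs_mult)
  ultimately have "\<bar>x - k\<bar> \<le> min (x - i) (j - x) / 2" using um by linarith
  moreover obtain M where M: "M = min (x - i) (j - x)" "M \<le> x - i" "M \<le> j - x" by simp
  ultimately have "x - k \<le> M / 2" "- (x - k) \<le> M / 2" unfolding abs_le_iff by simp_all
  then show False using assms(2,3,6) M(2,3) by linarith
qed

lemma min_less_min: "a < c \<Longrightarrow> b < d \<Longrightarrow> min a b < min c (d::real)"
  by (simp add: min_less_iff_disj)

text \<open>Nested tents in one row have different depths at every common abscissa, two transversals
  are strictly ordered at every height, and a tent and a transversal are separated by
  \<open>line_avoids_cap\<close>. For tents on the lower row the transversal is read upwards, which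
  accounts for \<open>1 - u\<close>.\<close>

lemma edges_disjoint_nested:
  assumes o: "L < L'" "L' < R'" "R' < R" and nz: "L \<noteq> 0" "R \<noteq> 0" "L' \<noteq> 0" "R' \<noteq> 0"
    and m: "0 < m" "\<bar>real_of_int L\<bar> \<le> m" "\<bar>real_of_int R\<bar> \<le> m" "\<bar>real_of_int L'\<bar> \<le> m" "\<bar>real_of_int R'\<bar> \<le> m"
    and p: "p \<in> path_image (edge m L R)" "p \<in> path_image (edge m L' R')"
  shows False
proof -
  have LR: "L < R" using o by simp
  note e = edge_image[OF LR nz(1,2) p(1)] and e' = edge_image[OF o(2) nz(3,4) p(2)]
  have ro: "real_of_int L < L'" "real_of_int L' < R'" "real_of_int R' < R" using o by auto
  consider "R < 0" | "0 < L" | "L < 0" "0 < R" using LR nz by linarith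
  then show False
  proof cases
    case 1
    have "min (fst p + R) (- L - fst p) / (2 * m) = min (fst p + R') (- L' - fst p) / (2 * m)"
      using e(1)[OF 1] e'(1) 1 o by linarith
    then have "min (fst p + R) (- L - fst p) = min (fst p + R') (- L' - fst p)" using m(1) by simp
    moreover have "min (fst p + R') (- L' - fst p) < min (fst p + R) (- L - fst p)"
      by (rule min_less_min) (use ro in simp_all)
    ultimately show False by simp
  next
    case 2
    have "min (fst p - L) (R - fst p) / (2 * m) = min (fst p - L') (R' - fst p) / (2 * m)"
      using e(2)[OF 2] e'(2) 2 o by linarith
    then have "min (fst p - L) (R - fst p) = min (fst p - L') (R' - fst p)" using m(1) by simp
    moreover have "min (fst p - L') (R' - fst p) < min (fst p - L) (R - fst p)"
      by (rule min_less_min) (use ro in simp_all)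
    ultimately show False by simp
  next
    case 3
    obtain u where u: "0 \<le> u" "u \<le> 1" "fst p = (1 - u) * (- real_of_int L) + u * real_of_int R" "snd p = 1 - u"
      using e(3)[OF 3] by blast
    consider "R' < 0" | "0 < L'" | "L' < 0" "0 < R'" using o nz by linarith
    then show False
    proof cases
      case c: 1
      have 1: "- R' \<le> fst p" "fst p \<le> - L'" "snd p = 1 - min (fst p + R') (- L' - fst p) / (2 * m)"
        using e'(1)[OF c] by auto
      have "u = min (fst p - (- real_of_int R')) (- real_of_int L' - fst p) / (2 * m)" using 1(3) u(4) by simp
      from line_avoids_cap[OF m(1) _ _ this u(3)] show False using 1(1,2) 3 m ro by simp
    next
      case c: 2
      have 1: "L' \<le> fst p" "fst p \<le> R'" "snd p = min (fst p - L') (R' - fst p) / (2 * m)"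
        using e'(2)[OF c] by auto
      have c1: "1 - u = min (fst p - real_of_int L') (real_of_int R' - fst p) / (2 * m)" using 1(3) u(4) by simp
      have c2: "fst p = (1 - (1 - u)) * real_of_int R + (1 - u) * (- real_of_int L)" using u(3) by simp
      show False by (rule line_avoids_cap[OF m(1) 1(1,2) c1 c2]) (use 3 m ro in linarith)+
    next
      case c: 3
      obtain u' where u': "fst p = (1 - u') * (- real_of_int L') + u' * real_of_int R'" "snd p = 1 - u'"
        using e'(3)[OF c] by blast
      have "u' = u" using u u' by simp
      then have e0: "(1 - u) * (real_of_int L' - real_of_int L) + u * (real_of_int R - real_of_int R') = 0"
        using u(3) u'(1) by (simp add: algebra_simps)
      have p1: "0 \<le> (1 - u) * (real_of_int L' - real_of_int L)" by (rule mult_nonneg_nonneg) (use u ro in simp_all)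
      have p2: "0 \<le> u * (real_of_int R - real_of_int R')" by (rule mult_nonneg_nonneg) (use u ro in simp_all)
      have "(1 - u) * (real_of_int L' - real_of_int L) = 0" "u * (real_of_int R - real_of_int R') = 0"
        using e0 p1 p2 by linarith+
      then show False using ro by simp
    qed
  qed
qed

text \<open>In this position two transversals cannot occur, but tents on opposite rows can; their
  depth of at most 1/4 keeps them apart.\<close>

lemma edges_disjoint_separate:
  assumes o: "L < R" "R < L'" "L' < R'" and nz: "L \<noteq> 0" "R \<noteq> 0" "L' \<noteq> 0" "R' \<noteq> 0"
    and m: "0 < m" "\<bar>real_of_int L\<bar> \<le> m" "\<bar>real_of_int R\<bar> \<le> m" "\<bar>real_of_int L'\<bar> \<le> m" "\<bar>real_of_int R'\<bar> \<le> m"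
    and p: "p \<in> path_image (edge m L R)" "p \<in> path_image (edge m L' R')"
  shows False
proof -
  note e = edge_image[OF o(1) nz(1,2) p(1)] and e' = edge_image[OF o(3) nz(3,4) p(2)]
  have ro: "real_of_int L < R" "real_of_int R < L'" "real_of_int L' < R'" using o by auto
  consider "R < 0" | "0 < L" | "L < 0" "0 < R" using o nz by linarith
  then show False
  proof cases
    case 1
    have a: "- R \<le> fst p" "fst p \<le> - L" "snd p = 1 - min (fst p + R) (- L - fst p) / (2 * m)"
      using e(1)[OF 1] by auto
    consider "R' < 0" | "0 < L'" | "L' < 0" "0 < R'" using o nz by linarith
    then show False
    proof cases
      case c: 1
      have "- real_of_int R' \<le> fst p" "fst p \<le> - real_of_int L'" using e'(1)[OF c] by simp_all
      then show False using a(1,2) ro by simp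
    next
      case c: 2
      have b: "L' \<le> fst p" "fst p \<le> R'" "snd p = min (fst p - L') (R' - fst p) / (2 * m)" using e'(2)[OF c] by auto
      have "min (fst p - real_of_int L') (real_of_int R' - fst p) / (2 * m) \<le> 1 / 4"
        using cap_depth(2)[OF m(1) _ _ b(1,2)] c m by simp
      moreover have "min (fst p - (- real_of_int R)) (- real_of_int L - fst p) / (2 * m) \<le> 1 / 4"
        using cap_depth(2)[OF m(1), of "- real_of_int R" "- real_of_int L" "fst p"] a(1,2) 1 m by simp
      ultimately show False using a(3) b(3) by simp
    next
      case c: 3
      obtain u where u: "0 \<le> u" "u \<le> 1" "fst p = (1 - u) * (- real_of_int L') + u * real_of_int R'" "snd p = 1 - u"
        using e'(3)[OF c] by blast
      have "u = min (fst p - (- real_of_int R)) (- real_of_int L - fst p) / (2 * m)" using a(3) u(4) by simp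
      from line_avoids_cap[OF m(1) _ _ this u(3)] show False using a(1,2) c m ro by simp
    qed
  next
    case 2
    have "0 < L'" using 2 o by simp
    from e'(2)[OF this] e(2)[OF 2] show False using ro by linarith
  next
    case 3
    obtain u where u: "0 \<le> u" "u \<le> 1" "fst p = (1 - u) * (- real_of_int L) + u * real_of_int R" "snd p = 1 - u"
      using e(3)[OF 3] by blast
    have b: "L' \<le> fst p" "fst p \<le> R'" "snd p = min (fst p - L') (R' - fst p) / (2 * m)" using e'(2) 3 o by auto
    have c1: "1 - u = min (fst p - real_of_int L') (real_of_int R' - fst p) / (2 * m)" using b(3) u(4) by simp
    have c2: "fst p = (1 - (1 - u)) * real_of_int R + (1 - u) * (- real_of_int L)" using u(3) by simp
    show False by (rule line_avoids_cap[OF m(1) b(1,2) c1 c2]) (use 3 m ro in linarith)+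
  qed
qed

text \<open>Bending the rectangle to a half annulus puts all vertices on one line, so that interlaced
  endpoints fall under the hypothesis of the lemma \<open>fashoda_interlace\<close>.\<close>

definition bend :: "real \<times> real \<Rightarrow> real ^ 2" where
  "bend p = (\<chi> i. if i = 1 then (fst p + 1) * cos (pi * snd p) else (fst p + 1) * sin (pi * snd p))"

lemma bend_nth [simp]: "bend p $ 1 = (fst p + 1) * cos (pi * snd p)" "bend p $ 2 = (fst p + 1) * sin (pi * snd p)"
  by (simp_all add: bend_def)

lemma continuous_bend: "continuous_on S bend"
  unfolding bend_def[abs_def]
proof (rule continuous_on_vec_lambda)
  show "continuous_on S (\<lambda>p. if i = 1 then (fst p + 1) * cos (pi * snd p) else (fst p + 1) * sin (pi * snd p))" for i :: 2
    by (cases "i = 1") (auto intro!: continuous_intros)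
qed

text \<open>These are polar coordinates with angle \<open>pi * snd p\<close> between 0 and
  \<open>pi\<close>. The radius is at least 1, so the angle can be recovered.\<close>

lemma bend_inj:
  assumes p: "p \<in> {0..m} \<times> {0..1}" "q \<in> {0..m} \<times> {0..1}" and e: "bend p = bend q"
  shows "p = q"
proof -
  have b: "0 \<le> fst p" "0 \<le> snd p" "snd p \<le> 1" "0 \<le> fst q" "0 \<le> snd q" "snd q \<le> 1" using p by auto
  have 1: "(fst p + 1) * cos (pi * snd p) = (fst q + 1) * cos (pi * snd q)"
    and 2: "(fst p + 1) * sin (pi * snd p) = (fst q + 1) * sin (pi * snd q)"
    using arg_cong[OF e, of "\<lambda>v. v $ 1"] arg_cong[OF e, of "\<lambda>v. v $ 2"] by auto
  have sq: "(a * cos t)\<^sup>2 + (a * sin t)\<^sup>2 = a\<^sup>2" for a t :: real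
    by (simp only: power_mult_distrib distrib_left[symmetric] sin_cos_squared_add2 mult_1_right)
  have "(fst p + 1)\<^sup>2 = (fst q + 1)\<^sup>2"
    unfolding sq[of "fst p + 1" "pi * snd p", symmetric] sq[of "fst q + 1" "pi * snd q", symmetric] 1 2 ..
  then have "fst p + 1 = fst q + 1" by (rule power2_eq_imp_eq) (use b in simp_all)
  then have f: "fst p = fst q" by simp
  have "fst q + 1 \<noteq> 0" using b by linarith
  then have c: "cos (pi * snd p) = cos (pi * snd q)" using 1 unfolding f by simp
  have le: "pi * snd p \<le> pi" "pi * snd q \<le> pi"
    using mult_left_mono[of "snd p" 1 pi] mult_left_mono[of "snd q" 1 pi] b by simp_all
  have "pi * snd p = pi * snd q"
    by (rule cos_inj_pi) (use b le c in simp_all)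
  then have "snd p = snd q" by simp
  with f show ?thesis by (rule prod_eqI)
qed

text \<open>The sign added to \<open>z\<close> is the offset of the radius: both rows move outwards
  by 1, and the order of the vertices is kept.\<close>

lemma bend_vx: "z \<noteq> 0 \<Longrightarrow> bend (vx z) $ 2 = 0" "z \<noteq> 0 \<Longrightarrow> bend (vx z) $ 1 = real_of_int (z + sgn z)"
  by (auto simp: vx_def sgn_if)

lemma interlaced_paths_meet:
  assumes g: "path g" "path h" "path_image g \<subseteq> {0..m} \<times> {0..1}" "path_image h \<subseteq> {0..m} \<times> {0..1}"
    and ends: "pathstart g = vx a" "pathfinish g = vx b" "pathstart h = vx c" "pathfinish h = vx d"
    and o: "a < c" "c < b" "b < d" and nz: "a \<noteq> 0" "b \<noteq> 0" "c \<noteq> 0" "d \<noteq> 0"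
  shows "path_image g \<inter> path_image h \<noteq> {}"
proof -
  \<comment> \<open>The half annulus lies above the line through the vertices, so all four ends are
    on the bottom edge of this box.\<close>
  let ?lo = "(\<chi> i. if i = 1 then - (m + 1) else 0) :: real ^ 2" and ?hi = "(\<chi> i. m + 1) :: real ^ 2"
  have box: "bend ` S \<subseteq> cbox ?lo ?hi" if S: "S \<subseteq> {0..m} \<times> {0..1}" for S
  proof
    fix v assume "v \<in> bend ` S"
    then obtain p where p: "v = bend p" "0 \<le> fst p" "fst p \<le> m" "0 \<le> snd p" "snd p \<le> 1" using S by fastforce
    have "pi * snd p \<le> pi * 1" by (rule mult_left_mono) (use p in auto)
    then have s: "0 \<le> sin (pi * snd p)" using p by (intro sin_ge_zero) auto
    have r: "0 \<le> fst p + 1" "fst p + 1 \<le> m + 1" using p by auto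
    have "\<bar>(fst p + 1) * cos (pi * snd p)\<bar> \<le> (m + 1) * 1" "\<bar>(fst p + 1) * sin (pi * snd p)\<bar> \<le> (m + 1) * 1"
      unfolding abs_mult using r by (intro mult_mono; simp)+
    moreover have "0 \<le> (fst p + 1) * sin (pi * snd p)" using r s by simp
    ultimately show "v \<in> cbox ?lo ?hi" unfolding mem_box_cart forall_2 p(1) by auto
  qed
  have o': "real_of_int (a + sgn a) < real_of_int (c + sgn c)" "real_of_int (c + sgn c) < real_of_int (b + sgn b)"
    "real_of_int (b + sgn b) < real_of_int (d + sgn d)"
    unfolding of_int_less_iff using o nz by (auto simp: sgn_if)
  obtain z where z: "z \<in> path_image (bend \<circ> g)" "z \<in> path_image (bend \<circ> h)"
  proof (rule fashoda_interlace[of "bend \<circ> g" "bend \<circ> h" ?lo ?hi])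
    show "path (bend \<circ> g)" "path (bend \<circ> h)"
      using g(1,2) continuous_bend by (auto intro: path_continuous_image)
    show "path_image (bend \<circ> g) \<subseteq> cbox ?lo ?hi" "path_image (bend \<circ> h) \<subseteq> cbox ?lo ?hi"
      unfolding path_image_compose using box g(3,4) by blast+
  qed (use bend_vx nz ends o' in \<open>auto simp: pathstart_compose pathfinish_compose simp del: bend_nth\<close>)
  then obtain p q where "p \<in> path_image g" "q \<in> path_image h" "bend p = bend q"
    unfolding path_image_compose by auto
  then have "p = q" using bend_inj[of p m q] g(3,4) by blast
  then show ?thesis using \<open>p \<in> path_image g\<close> \<open>q \<in> path_image h\<close> by blast
qed

lemma oriented_path:
  assumes "path g" "{pathstart g, pathfinish g} = {u, v}" "u \<noteq> v"
  obtains h where "path h" "path_image h = path_image g" "pathstart h = u" "pathfinish h = v"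
proof (cases "pathstart g = u")
  case True
  then have "pathfinish g = v" using assms by (auto simp: doubleton_eq_iff)
  then show ?thesis using that[of g] assms True by simp
next
  case False
  then have "pathstart g = v" "pathfinish g = u" using assms by (auto simp: doubleton_eq_iff)
  then show ?thesis using that[of "reversepath g"] assms by simp
qed

section \<open>Planar drawings and noncrossing involutions\<close>

lemma vertex_vx:
  assumes "tl_object A" "tl_object B" "x \<in> pts A B"
  shows "vertex A B x = vx (pt A B x)"
  using assms pos_pos by (cases x) (auto simp: vertex_def vx_def pos_def, force+)

lemma vx_inj: "z \<noteq> 0 \<Longrightarrow> w \<noteq> 0 \<Longrightarrow> vx z = vx w \<Longrightarrow> z = w"
  by (auto simp: vx_def split: if_splits)

text \<open>For the converse the blocks are drawn by \<open>edge\<close>: two pairs on a line that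
  do not interlace are nested or lie side by side, which are the two situations settled by the
  disjointness lemmas.\<close>

lemma planar_dg_iff:
  assumes A: "tl_object A" and B: "tl_object B" and f: "matching_on A B f"
  shows "planar_diagram (dg A B f) \<longleftrightarrow> noncrossing (\<lambda>z. z) f"
proof
  define m where "m = real (max (card (Field A)) (card (Field B)) + 1)"
  have ff: "f (f z) = z" for z using f by (simp add: matching_on_def involution_def)
  have dom: "f z \<noteq> z \<longleftrightarrow> - z \<in> ob A \<or> z \<in> ob B" for z using f by (simp add: matching_on_def)
  have nz: "z \<noteq> 0" if "f z \<noteq> z" for z using that dom[of z] ob_simps(2)[of 0] by auto
  have fne: "f (f z) \<noteq> f z" if "f z \<noteq> z" for z using that ff by metis
  have zm: "\<bar>real_of_int z\<bar> \<le> m" if "f z \<noteq> z" for z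
    using that unfolding dom by (auto simp: ob_def m_def)
  have blk: "\<exists>x y. x \<in> pts A B \<and> y \<in> pts A B \<and> pt A B x = z \<and> pt A B y = f z \<and> {x, y} \<in> blocks (dg A B f)"
    if z: "f z \<noteq> z" for z
  proof -
    obtain x where x: "x \<in> pts A B" "pt A B x = z" using z dom pt_surj[OF A B] by blast
    obtain y where y: "y \<in> pts A B" "pt A B y = f (pt A B x)" using partner_ex(1)[OF A B f x(1)] by blast
    show ?thesis using x y dg_blockI[where f = f, OF A B x(1) y] by blast
  qed
  {
    assume "planar_diagram (dg A B f)"
    then obtain e where E: "\<forall>b\<in>blocks (dg A B f). arc (e b) \<and>
          {pathstart (e b), pathfinish (e b)} = vertex A B ` b \<and> path_image (e b) \<subseteq> {0..m} \<times> {0..1}"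
      "\<forall>b\<in>blocks (dg A B f). \<forall>c\<in>blocks (dg A B f). b \<noteq> c \<longrightarrow> path_image (e b) \<inter> path_image (e c) = {}"
      unfolding planar_diagram_def Let_def dg_simps m_def[symmetric] by (elim exE conjE) (rule that)
    note e = E(1)[rule_format] and e_disj = E(2)[rule_format]
    show "noncrossing (\<lambda>z. z) f"
      unfolding noncrossing_def
    proof (intro allI notI)
      fix a c assume o: "a < c \<and> c < f a \<and> f a < f c"
      then have ne: "f a \<noteq> a" "f c \<noteq> c" by auto
      obtain x y where xy: "x \<in> pts A B" "y \<in> pts A B" "pt A B x = a" "pt A B y = f a" "{x, y} \<in> blocks (dg A B f)"
        using blk[OF ne(1)] by blast
      obtain u v where uv: "u \<in> pts A B" "v \<in> pts A B" "pt A B u = c" "pt A B v = f c" "{u, v} \<in> blocks (dg A B f)"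
        using blk[OF ne(2)] by blast
      have nzs: "a \<noteq> 0" "f a \<noteq> 0" "c \<noteq> 0" "f c \<noteq> 0" using nz ne fne by auto
      have ve: "vertex A B ` {x, y} = {vx a, vx (f a)}" "vertex A B ` {u, v} = {vx c, vx (f c)}"
        unfolding image_insert image_empty vertex_vx[OF A B xy(1)] vertex_vx[OF A B xy(2)]
          vertex_vx[OF A B uv(1)] vertex_vx[OF A B uv(2)] xy(3,4) uv(3,4) by (rule refl)+
      have ne': "a \<noteq> f a" "c \<noteq> f c" using ne by metis+
      have vne: "vx a \<noteq> vx (f a)" "vx c \<noteq> vx (f c)"
        using vx_inj[OF nzs(1,2)] vx_inj[OF nzs(3,4)] ne' by blast+
      have ar: "path (e {x, y})" "path (e {u, v})"
        using e[OF xy(5)] e[OF uv(5)] arc_imp_path by blast+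
      have en: "{pathstart (e {x, y}), pathfinish (e {x, y})} = {vx a, vx (f a)}"
        "{pathstart (e {u, v}), pathfinish (e {u, v})} = {vx c, vx (f c)}"
        using e[OF xy(5)] e[OF uv(5)] unfolding ve by blast+
      have bx: "path_image (e {x, y}) \<subseteq> {0..m} \<times> {0..1}" "path_image (e {u, v}) \<subseteq> {0..m} \<times> {0..1}"
        using e[OF xy(5)] e[OF uv(5)] by blast+
      obtain g where g: "path g" "path_image g = path_image (e {x, y})" "pathstart g = vx a" "pathfinish g = vx (f a)"
        by (rule oriented_path[OF ar(1) en(1) vne(1)])
      obtain h where h: "path h" "path_image h = path_image (e {u, v})" "pathstart h = vx c" "pathfinish h = vx (f c)"
        by (rule oriented_path[OF ar(2) en(2) vne(2)])
      note bx' = bx[folded g(2) h(2)]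
      have o1: "a < c" and o2: "c < f a" and o3: "f a < f c" using o by blast+
      have "path_image g \<inter> path_image h \<noteq> {}"
        by (rule interlaced_paths_meet[OF g(1) h(1) bx' g(3,4) h(3,4) o1 o2 o3 nzs])
      moreover have "{x, y} \<noteq> {u, v}"
      proof
        assume "{x, y} = {u, v}"
        then have "x = u \<or> x = v" by (metis doubleton_eq_iff)
        then have "a = c \<or> a = f c" using xy(3) uv(3,4) by metis
        then show False using o1 o2 o3 by linarith
      qed
      ultimately show False using e_disj[OF xy(5) uv(5)] g(2) h(2) by simp
    qed
  }
  {
    assume nc: "noncrossing (\<lambda>z. z) f"
    have fN: "f \<in> NC (ob A) (ob B)" using nc f NC_iff_matching_on by blast
    \<comment> \<open>The ends of a block are recovered from it as the smallest and the largest of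
      its coordinates.\<close>
    define e where "e b = edge m (Min (pt A B ` b)) (Max (pt A B ` b))" for b
    have m0: "0 < m" by (simp add: m_def)
    have bd: "\<exists>L R. L < R \<and> f L = R \<and> pt A B ` b = {L, R} \<and> e b = edge m L R" if b: "b \<in> blocks (dg A B f)" for b
    proof -
      obtain x y where xy: "x \<in> pts A B" "y \<in> pts A B" "pt A B y = f (pt A B x)" "b = {x, y}"
        using b by (auto simp: dg_def)
      let ?z = "pt A B x"
      have ne: "f ?z \<noteq> ?z" using pt_in[OF A B xy(1)] dom by blast
      have i: "pt A B ` b = {?z, f ?z}" using xy by auto
      show ?thesis
      proof (cases "?z < f ?z")
        case True
        then show ?thesis using i by (intro exI[of _ ?z] exI[of _ "f ?z"]) (simp add: e_def)
      next
        case False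
        then show ?thesis using i ne ff[of ?z] by (intro exI[of _ "f ?z"] exI[of _ ?z]) (auto simp: e_def)
      qed
    qed
    show "planar_diagram (dg A B f)"
      unfolding planar_diagram_def Let_def dg_simps m_def[symmetric]
    proof (intro exI[of _ e] conjI ballI impI)
      fix b assume b: "b \<in> blocks (dg A B f)"
      obtain L R where L: "L < R" "f L = R" "pt A B ` b = {L, R}" "e b = edge m L R" using bd[OF b] by blast
      note fR = ff[of L, unfolded L(2)]
      have ne: "f L \<noteq> L" "f R \<noteq> R" unfolding L(2) fR using L(1) by simp_all
      note nzz = nz[OF ne(1)] nz[OF ne(2)]
      show "arc (e b)" unfolding L(4) by (rule edge_basic[OF L(1) nzz])
      have "vertex A B ` b = vx ` pt A B ` b"
        unfolding image_image using vertex_vx[OF A B] dg_blocks_eq(1)[OF A B f b] by (intro image_cong) auto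
      then show "{pathstart (e b), pathfinish (e b)} = vertex A B ` b"
        unfolding L(4) edge_basic(2)[OF L(1) nzz] L(3) by simp
      show "path_image (e b) \<subseteq> {0..m} \<times> {0..1}"
        unfolding L(4) by (rule edge_in_box[OF L(1) nzz m0 zm[OF ne(1)] zm[OF ne(2)]])
    next
      fix b c assume b: "b \<in> blocks (dg A B f)" and c: "c \<in> blocks (dg A B f)" and bc: "b \<noteq> c"
      obtain L R where L: "L < R" "f L = R" "pt A B ` b = {L, R}" "e b = edge m L R" using bd[OF b] by blast
      obtain L' R' where L': "L' < R'" "f L' = R'" "pt A B ` c = {L', R'}" "e c = edge m L' R'" using bd[OF c] by blast
      note fR = ff[of L, unfolded L(2)] and fR' = ff[of L', unfolded L'(2)]
      have ne: "f L \<noteq> L" "f R \<noteq> R" "f L' \<noteq> L'" "f R' \<noteq> R'"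
        unfolding L(2) L'(2) fR fR' using L(1) L'(1) by simp_all
      note nzz = nz[OF ne(1)] nz[OF ne(2)] nz[OF ne(3)] nz[OF ne(4)]
      note zz = zm[OF ne(1)] zm[OF ne(2)] zm[OF ne(3)] zm[OF ne(4)]
      have sets: "{L, R} \<noteq> {L', R'}"
      proof
        assume "{L, R} = {L', R'}"
        moreover have "inj_on (pt A B) (pts A B)" using pt_bij[OF A B] by (simp add: bij_betw_def)
        moreover have "b \<subseteq> pts A B" "c \<subseteq> pts A B" using dg_blocks_eq(1)[OF A B f b] dg_blocks_eq(1)[OF A B f c] by auto
        ultimately have "b = c" using L(3) L'(3) inj_on_image_eq_iff by metis
        then show False using bc by simp
      qed
      have "L \<noteq> L'" using sets L(2) L'(2) by blast
      moreover have "R \<noteq> R'" using sets fR fR' by blast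
      moreover have "L \<noteq> R'" using sets L(2) fR' by (metis insert_commute)
      moreover have "R \<noteq> L'" using sets fR L'(2) by (metis insert_commute)
      ultimately have d: "L \<noteq> L'" "R \<noteq> R'" "L \<noteq> R'" "R \<noteq> L'" by blast+
      have nn: "\<not> (x < y \<and> y < f x \<and> f x < f y)" for x y using nc by (auto simp: noncrossing_def)
      have nLL: "\<not> (L < L' \<and> L' < R \<and> R < R')" "\<not> (L' < L \<and> L < R' \<and> R' < R)"
        using nn[of L L'] nn[of L' L] unfolding L(2) L'(2) by blast+
      consider "L < L'" "R' < R" | "L' < L" "R < R'" | "R < L'" | "R' < L"
        using nLL d L(1) L'(1) by linarith
      note four = this
      have "False" if p: "p \<in> path_image (edge m L R)" "p \<in> path_image (edge m L' R')" for p
        using four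
      proof cases
        case 1 show ?thesis by (rule edges_disjoint_nested[OF 1(1) L'(1) 1(2) nzz m0 zz p])
      next
        case 2 show ?thesis
          by (rule edges_disjoint_nested[OF 2(1) L(1) 2(2) nzz(3,4,1,2) m0 zz(3,4,1,2) p(2,1)])
      next
        case 3 show ?thesis by (rule edges_disjoint_separate[OF L(1) 3 L'(1) nzz m0 zz p])
      next
        case 4 show ?thesis
          by (rule edges_disjoint_separate[OF L'(1) 4 L(1) nzz(3,4,1,2) m0 zz(3,4,1,2) p(2,1)])
      qed
      then have "\<not> (p \<in> path_image (e b) \<and> p \<in> path_image (e c))" for p unfolding L(4) L'(4) by blast
      then show "path_image (e b) \<inter> path_image (e c) = {}" by blast
    qed
  }
qed

section \<open>Lattices\<close>

lemma inclusion_order_simps [simp]: "carrier (inclusion_order F) = F" "eq (inclusion_order F) = (=)"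
  "le (inclusion_order F) = (\<subseteq>)"
  by (simp_all add: inclusion_order_def)

lemma times_order_simps [simp]: "carrier (times_order L M) = carrier L \<times> carrier M" "eq (times_order L M) = (=)"
  "le (times_order L M) p q \<longleftrightarrow> le L (fst p) (fst q) \<and> le M (snd p) (snd q)"
  by (simp_all add: times_order_def)

lemma PiE_order_simps [simp]: "carrier (PiE_order J K) = (\<Pi>\<^sub>E i\<in>J. carrier (K i))" "eq (PiE_order J K) = (=)"
  "le (PiE_order J K) f g \<longleftrightarrow> (\<forall>i\<in>J. le (K i) (f i) (g i))"
  by (simp_all add: PiE_order_def)

lemma two_chain_simps [simp]: "carrier two_chain = UNIV" "eq two_chain = (=)" "le two_chain = (\<le>)"
  by (simp_all add: two_chain_def)

definition is_join :: "'x gorder \<Rightarrow> 'x \<Rightarrow> 'x \<Rightarrow> 'x \<Rightarrow> bool" where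
  "is_join L x y s \<longleftrightarrow> s \<in> carrier L \<and> le L x s \<and> le L y s \<and> (\<forall>z\<in>carrier L. le L x z \<and> le L y z \<longrightarrow> le L s z)"

definition is_meet :: "'x gorder \<Rightarrow> 'x \<Rightarrow> 'x \<Rightarrow> 'x \<Rightarrow> bool" where
  "is_meet L x y s \<longleftrightarrow> s \<in> carrier L \<and> le L s x \<and> le L s y \<and> (\<forall>z\<in>carrier L. le L z x \<and> le L z y \<longrightarrow> le L z s)"

lemma latticeI:
  fixes L :: "'x gorder"
  assumes eq: "eq L = (=)"
    and rfl: "\<And>x. x \<in> carrier L \<Longrightarrow> le L x x"
    and anti: "\<And>x y. x \<in> carrier L \<Longrightarrow> y \<in> carrier L \<Longrightarrow> le L x y \<Longrightarrow> le L y x \<Longrightarrow> x = y"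
    and tr: "\<And>x y z. x \<in> carrier L \<Longrightarrow> y \<in> carrier L \<Longrightarrow> z \<in> carrier L \<Longrightarrow> le L x y \<Longrightarrow> le L y z \<Longrightarrow> le L x z"
    and join: "\<And>x y. x \<in> carrier L \<Longrightarrow> y \<in> carrier L \<Longrightarrow> \<exists>s. is_join L x y s"
    and meet: "\<And>x y. x \<in> carrier L \<Longrightarrow> y \<in> carrier L \<Longrightarrow> \<exists>s. is_meet L x y s"
  shows "lattice L"
proof unfold_locales
  show "\<exists>s. least L s (Order.Upper L {x, y})" if xy: "x \<in> carrier L" "y \<in> carrier L" for x y
  proof -
    obtain s where "is_join L x y s" using join[OF xy] by blast
    then have "least L s (Order.Upper L {x, y})" using xy by (auto simp: is_join_def least_def Upper_def)
    then show ?thesis by blast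
  qed
  show "\<exists>s. greatest L s (Order.Lower L {x, y})" if xy: "x \<in> carrier L" "y \<in> carrier L" for x y
  proof -
    obtain s where "is_meet L x y s" using meet[OF xy] by blast
    then have "greatest L s (Order.Lower L {x, y})" using xy by (auto simp: is_meet_def greatest_def Lower_def)
    then show ?thesis by blast
  qed
qed (simp_all add: eq rfl, (metis anti | metis tr)+)

lemma lattice_order:
  assumes "lattice L"
  shows "x \<in> carrier L \<Longrightarrow> le L x x"
    "x \<in> carrier L \<Longrightarrow> y \<in> carrier L \<Longrightarrow> le L x y \<Longrightarrow> le L y x \<Longrightarrow> x = y"
    "x \<in> carrier L \<Longrightarrow> y \<in> carrier L \<Longrightarrow> z \<in> carrier L \<Longrightarrow> le L x y \<Longrightarrow> le L y z \<Longrightarrow> le L x z"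
    "eq L = (=)"
proof -
  interpret lattice L by (rule assms)
  show "x \<in> carrier L \<Longrightarrow> le L x x" by simp
  show "x \<in> carrier L \<Longrightarrow> y \<in> carrier L \<Longrightarrow> le L x y \<Longrightarrow> le L y x \<Longrightarrow> x = y" by (rule le_antisym)
  show "x \<in> carrier L \<Longrightarrow> y \<in> carrier L \<Longrightarrow> z \<in> carrier L \<Longrightarrow> le L x y \<Longrightarrow> le L y z \<Longrightarrow> le L x z" by (rule le_trans)
  show "eq L = (=)" by (rule eq_is_equal)
qed

lemma lattice_join:
  assumes "lattice L" "x \<in> carrier L" "y \<in> carrier L"
  shows "is_join L x y (join L x y)" "is_meet L x y (meet L x y)"
proof -
  interpret lattice L by (rule assms)
  show "is_join L x y (join L x y)" unfolding is_join_def
    using assms(2,3) by (auto intro: join_left join_right join_le)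
  show "is_meet L x y (meet L x y)" unfolding is_meet_def
    using assms(2,3) by (auto intro: meet_left meet_right meet_le)
qed

text \<open>Joins and meets are determined by the order, so an order isomorphism transports them
  together with the lattice property. Both directions are recorded because the maps constructed
  later go from parameters to congruences, opposite to the isomorphisms that are wanted.\<close>

lemma lattice_isomorphic_if_order_isomorphic:
  fixes L :: "'x gorder" and M :: "'y gorder"
  assumes L: "lattice L" and eqM: "eq M = (=)" and f: "bij_betw f (carrier L) (carrier M)"
    and le: "\<And>x y. x \<in> carrier L \<Longrightarrow> y \<in> carrier L \<Longrightarrow> le M (f x) (f y) \<longleftrightarrow> le L x y"
  shows "lattice_isomorphic L M \<and> lattice_isomorphic M L"
proof -
  have fin: "f x \<in> carrier M" if "x \<in> carrier L" for x using f that bij_betwE by blast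
  have surj: "\<exists>x\<in>carrier L. u = f x" if "u \<in> carrier M" for u using f that unfolding bij_betw_def by blast
  note o = lattice_order[OF L]
  have J: "is_join M (f x) (f y) (f s)" if "is_join L x y s" "x \<in> carrier L" "y \<in> carrier L" for x y s
    unfolding is_join_def
  proof (intro conjI ballI impI)
    fix z assume z: "z \<in> carrier M" "le M (f x) z \<and> le M (f y) z"
    obtain w where "w \<in> carrier L" "z = f w" using surj[OF z(1)] by blast
    then show "le M (f s) z" using z that le unfolding is_join_def by metis
  qed (use that fin le in \<open>simp_all add: is_join_def\<close>)
  have K: "is_meet M (f x) (f y) (f s)" if "is_meet L x y s" "x \<in> carrier L" "y \<in> carrier L" for x y s
    unfolding is_meet_def
  proof (intro conjI ballI impI)
    fix z assume z: "z \<in> carrier M" "le M z (f x) \<and> le M z (f y)"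
    obtain w where "w \<in> carrier L" "z = f w" using surj[OF z(1)] by blast
    then show "le M z (f s)" using z that le unfolding is_meet_def by metis
  qed (use that fin le in \<open>simp_all add: is_meet_def\<close>)
  have M: "lattice M"
  proof (rule latticeI)
    show "eq M = (=)" by (rule eqM)
    fix u v assume "u \<in> carrier M" "v \<in> carrier M"
    then obtain x y where x: "x \<in> carrier L" "y \<in> carrier L" "u = f x" "v = f y" using surj by meson
    show "\<exists>s. is_join M u v s" using J[OF lattice_join(1)[OF L x(1,2)] x(1,2)] x by blast
    show "\<exists>s. is_meet M u v s" using K[OF lattice_join(2)[OF L x(1,2)] x(1,2)] x by blast
    show "u = v" if "le M u v" "le M v u" using that x le o(2) by metis
    fix w assume "w \<in> carrier M" and uvw: "le M u v" "le M v w"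
    then obtain z where z: "z \<in> carrier L" "w = f z" using surj by meson
    show "le M u w" using uvw x z le o(3)[OF x(1,2) z(1)] by metis
  next
    fix u assume "u \<in> carrier M"
    then show "le M u u" using surj le o(1) by metis
  qed
  note oM = lattice_order[OF M]
  have join: "f (join L x y) = join M (f x) (f y)" and meet: "f (meet L x y) = meet M (f x) (f y)"
    if x: "x \<in> carrier L" "y \<in> carrier L" for x y
  proof -
    have "is_join M (f x) (f y) (f (join L x y))" "is_join M (f x) (f y) (join M (f x) (f y))"
      using J[OF lattice_join(1)[OF L x] x] lattice_join(1)[OF M fin[OF x(1)] fin[OF x(2)]] by auto
    then show "f (join L x y) = join M (f x) (f y)" unfolding is_join_def using oM(2) by meson
    have "is_meet M (f x) (f y) (f (meet L x y))" "is_meet M (f x) (f y) (meet M (f x) (f y))"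
      using K[OF lattice_join(2)[OF L x] x] lattice_join(2)[OF M fin[OF x(1)] fin[OF x(2)]] by auto
    then show "f (meet L x y) = meet M (f x) (f y)" unfolding is_meet_def using oM(2) by meson
  qed
  define g where "g = inv_into (carrier L) f"
  have g: "bij_betw g (carrier M) (carrier L)" unfolding g_def by (rule bij_betw_inv_into[OF f])
  have gf: "g (f x) = x" if "x \<in> carrier L" for x unfolding g_def by (rule bij_betw_inv_into_left[OF f that])
  have 1: "lattice_isomorphic L M"
    unfolding lattice_isomorphic_def join_pres_def meet_pres_def using f L M join meet by blast
  have "g (join M u v) = join L (g u) (g v)" "g (meet M u v) = meet L (g u) (g v)"
    if uv: "u \<in> carrier M" "v \<in> carrier M" for u v
  proof -
    obtain x y where x: "x \<in> carrier L" "y \<in> carrier L" "u = f x" "v = f y" using surj uv by meson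
    have c: "join L x y \<in> carrier L" "meet L x y \<in> carrier L"
      using lattice_join[OF L x(1,2)] unfolding is_join_def is_meet_def by auto
    show "g (join M u v) = join L (g u) (g v)"
      using join[OF x(1,2)] gf[OF c(1)] gf[OF x(1)] gf[OF x(2)] x by simp
    show "g (meet M u v) = meet L (g u) (g v)"
      using meet[OF x(1,2)] gf[OF c(2)] gf[OF x(1)] gf[OF x(2)] x by simp
  qed
  then have "lattice_isomorphic M L"
    unfolding lattice_isomorphic_def join_pres_def meet_pres_def using g L M by blast
  with 1 show ?thesis by blast
qed

lemma equiv_D:
  assumes "equiv Z E"
  shows "x \<in> Z \<Longrightarrow> (x, x) \<in> E" "(x, y) \<in> E \<Longrightarrow> (y, x) \<in> E" "(x, y) \<in> E \<Longrightarrow> (y, z) \<in> E \<Longrightarrow> (x, z) \<in> E"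
    "(x, y) \<in> E \<Longrightarrow> x \<in> Z \<and> y \<in> Z"
proof -
  have E: "refl_on Z E" "sym E" "trans E" "E \<subseteq> Z \<times> Z" using assms by (simp_all add: equiv_def)
  show "x \<in> Z \<Longrightarrow> (x, x) \<in> E" by (rule refl_onD[OF E(1)])
  show "(x, y) \<in> E \<Longrightarrow> (y, x) \<in> E" by (rule symD[OF E(2)])
  show "(x, y) \<in> E \<Longrightarrow> (y, z) \<in> E \<Longrightarrow> (x, z) \<in> E" by (rule transD[OF E(3)])
  show "(x, y) \<in> E \<Longrightarrow> x \<in> Z \<and> y \<in> Z" using E(4) by blast
qed

lemma equiv_intro:
  assumes "\<And>x. x \<in> Z \<Longrightarrow> (x, x) \<in> E" "\<And>x y. (x, y) \<in> E \<Longrightarrow> (y, x) \<in> E"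
    "\<And>x y z. (x, y) \<in> E \<Longrightarrow> (y, z) \<in> E \<Longrightarrow> (x, z) \<in> E" "\<And>x y. (x, y) \<in> E \<Longrightarrow> x \<in> Z \<and> y \<in> Z"
  shows "equiv Z E"
proof (rule equivI)
  show "E \<subseteq> Z \<times> Z" using assms(4) by fast
  show "refl_on Z E" by (rule refl_onI) (rule assms(1))
  show "sym E" by (rule symI) (rule assms(2))
  show "trans E" by (rule transI) (rule assms(3))
qed

lemma lattice_Equivs: "lattice (inclusion_order (Equivs Z))"
proof (rule latticeI)
  fix x y assume "x \<in> carrier (inclusion_order (Equivs Z))" "y \<in> carrier (inclusion_order (Equivs Z))"
  then have x: "equiv Z x" "equiv Z y" by (simp_all add: Equivs_def)
  let ?S = "{E. equiv Z E \<and> x \<union> y \<subseteq> E}"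
  \<comment> \<open>The full relation is an upper bound, so the intersection that defines the join
    is taken over a non-empty set.\<close>
  have "equiv Z (Z \<times> Z)" by (rule equiv_intro) simp_all
  moreover have "x \<union> y \<subseteq> Z \<times> Z" using x by (simp add: equiv_def)
  ultimately have all: "Z \<times> Z \<in> ?S" by blast
  have S: "equiv Z E" if "E \<in> ?S" for E using that by blast
  have "equiv Z (\<Inter>?S)"
  proof (rule equiv_intro)
    show "(a, a) \<in> \<Inter>?S" if a: "a \<in> Z" for a
    proof (rule InterI)
      fix E assume "E \<in> ?S" then show "(a, a) \<in> E" by (rule equiv_D(1)[OF S a])
    qed
    show "(b, a) \<in> \<Inter>?S" if ab: "(a, b) \<in> \<Inter>?S" for a b
    proof (rule InterI)
      fix E assume E: "E \<in> ?S" then show "(b, a) \<in> E" by (rule equiv_D(2)[OF S InterD[OF ab E]])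
    qed
    show "(a, c) \<in> \<Inter>?S" if ab: "(a, b) \<in> \<Inter>?S" and bc: "(b, c) \<in> \<Inter>?S" for a b c
    proof (rule InterI)
      fix E assume E: "E \<in> ?S" then show "(a, c) \<in> E" by (rule equiv_D(3)[OF S InterD[OF ab E] InterD[OF bc E]])
    qed
    show "a \<in> Z \<and> b \<in> Z" if ab: "(a, b) \<in> \<Inter>?S" for a b using InterD[OF ab all] by blast
  qed
  then have "is_join (inclusion_order (Equivs Z)) x y (\<Inter>?S)"
    unfolding is_join_def inclusion_order_simps Equivs_def by (intro conjI ballI impI CollectI Inter_lower) blast+
  then show "\<exists>s. is_join (inclusion_order (Equivs Z)) x y s" by blast
  note X = equiv_D[OF x(1)] and Y = equiv_D[OF x(2)]
  have "equiv Z (x \<inter> y)"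
  proof (rule equiv_intro)
    show "(a, a) \<in> x \<inter> y" if "a \<in> Z" for a using X(1)[OF that] Y(1)[OF that] by blast
    show "(b, a) \<in> x \<inter> y" if "(a, b) \<in> x \<inter> y" for a b using that X(2)[of a b] Y(2)[of a b] by blast
    show "(a, c) \<in> x \<inter> y" if "(a, b) \<in> x \<inter> y" "(b, c) \<in> x \<inter> y" for a b c
      using that X(3)[of a b c] Y(3)[of a b c] by blast
    show "a \<in> Z \<and> b \<in> Z" if "(a, b) \<in> x \<inter> y" for a b using that X(4)[of a b] by blast
  qed
  then have "is_meet (inclusion_order (Equivs Z)) x y (x \<inter> y)"
    by (simp add: is_meet_def Equivs_def)
  then show "\<exists>s. is_meet (inclusion_order (Equivs Z)) x y s" by blast
qed auto

lemma lattice_times: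
  assumes L: "lattice L" and M: "lattice M"
  shows "lattice (times_order L M)"
proof (rule latticeI)
  note o = lattice_order[OF L] lattice_order[OF M]
  fix p q assume "p \<in> carrier (times_order L M)" "q \<in> carrier (times_order L M)"
  then have p: "fst p \<in> carrier L" "snd p \<in> carrier M" "fst q \<in> carrier L" "snd q \<in> carrier M" by auto
  show "p = q" if "le (times_order L M) p q" "le (times_order L M) q p"
    using that o(2)[OF p(1,3)] o(6)[OF p(2,4)] by (simp add: prod_eq_iff)
  show "\<exists>s. is_join (times_order L M) p q s"
    using lattice_join(1)[OF L p(1,3)] lattice_join(1)[OF M p(2,4)]
    by (intro exI[of _ "(join L (fst p) (fst q), join M (snd p) (snd q))"]) (auto simp: is_join_def)
  show "\<exists>s. is_meet (times_order L M) p q s"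
    using lattice_join(2)[OF L p(1,3)] lattice_join(2)[OF M p(2,4)]
    by (intro exI[of _ "(meet L (fst p) (fst q), meet M (snd p) (snd q))"]) (auto simp: is_meet_def)
  fix s assume "s \<in> carrier (times_order L M)" "le (times_order L M) p q" "le (times_order L M) q s"
  then show "le (times_order L M) p s"
    using o(3)[OF p(1,3), of "fst s"] o(7)[OF p(2,4), of "snd s"] by auto
qed (use lattice_order(1)[OF L] lattice_order(1)[OF M] in auto)

lemma lattice_PiE:
  assumes L: "\<And>i. i \<in> J \<Longrightarrow> lattice (K i)"
  shows "lattice (PiE_order J K)"
proof (rule latticeI)
  note o = lattice_order[OF L]
  fix p q assume p: "p \<in> carrier (PiE_order J K)" "q \<in> carrier (PiE_order J K)"
  then have i: "p i \<in> carrier (K i)" "q i \<in> carrier (K i)" if "i \<in> J" for i using that by auto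
  show "p = q" if "le (PiE_order J K) p q" "le (PiE_order J K) q p"
  proof (rule PiE_ext)
    show "p \<in> (\<Pi>\<^sub>E i\<in>J. carrier (K i))" "q \<in> (\<Pi>\<^sub>E i\<in>J. carrier (K i))" using p by simp_all
    show "p i = q i" if "i \<in> J" for i
      using o(2)[OF that i[OF that]] that \<open>le (PiE_order J K) p q\<close> \<open>le (PiE_order J K) q p\<close> by simp
  qed
  have "is_join (PiE_order J K) p q (\<lambda>i\<in>J. join (K i) (p i) (q i))"
    unfolding is_join_def
  proof (intro conjI ballI impI)
    have s: "is_join (K j) (p j) (q j) (join (K j) (p j) (q j))" if "j \<in> J" for j
      by (rule lattice_join(1)[OF L[OF that] i[OF that]])
    show "(\<lambda>i\<in>J. join (K i) (p i) (q i)) \<in> carrier (PiE_order J K)"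
      "le (PiE_order J K) p (\<lambda>i\<in>J. join (K i) (p i) (q i))" "le (PiE_order J K) q (\<lambda>i\<in>J. join (K i) (p i) (q i))"
      using s by (auto simp: is_join_def)
    fix z assume z: "z \<in> carrier (PiE_order J K)"
      "le (PiE_order J K) p z \<and> le (PiE_order J K) q z"
    have zj: "z j \<in> carrier (K j)" if "j \<in> J" for j using z(1) that by auto
    show "le (PiE_order J K) (\<lambda>i\<in>J. join (K i) (p i) (q i)) z"
      using z(2) zj s by (simp add: is_join_def)
  qed
  then show "\<exists>s. is_join (PiE_order J K) p q s" by blast
  have "is_meet (PiE_order J K) p q (\<lambda>i\<in>J. meet (K i) (p i) (q i))"
    unfolding is_meet_def
  proof (intro conjI ballI impI)
    have s: "is_meet (K j) (p j) (q j) (meet (K j) (p j) (q j))" if "j \<in> J" for j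
      by (rule lattice_join(2)[OF L[OF that] i[OF that]])
    show "(\<lambda>i\<in>J. meet (K i) (p i) (q i)) \<in> carrier (PiE_order J K)"
      "le (PiE_order J K) (\<lambda>i\<in>J. meet (K i) (p i) (q i)) p" "le (PiE_order J K) (\<lambda>i\<in>J. meet (K i) (p i) (q i)) q"
      using s by (auto simp: is_meet_def)
    fix z assume z: "z \<in> carrier (PiE_order J K)"
      "le (PiE_order J K) z p \<and> le (PiE_order J K) z q"
    have zj: "z j \<in> carrier (K j)" if "j \<in> J" for j using z(1) that by auto
    show "le (PiE_order J K) z (\<lambda>i\<in>J. meet (K i) (p i) (q i))"
      using z(2) zj s by (simp add: is_meet_def)
  qed
  then show "\<exists>s. is_meet (PiE_order J K) p q s" by blast
  fix s assume s: "s \<in> carrier (PiE_order J K)" "le (PiE_order J K) p q" "le (PiE_order J K) q s"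
  show "le (PiE_order J K) p s"
    unfolding PiE_order_simps
  proof
    fix j assume j: "j \<in> J"
    have "s j \<in> carrier (K j)" using s(1) j by auto
    then show "le (K j) (p j) (s j)" using o(3)[OF j i[OF j]] s(2,3) j by simp
  qed
qed (use lattice_order(1)[OF L] in auto)

lemma lattice_two_chain: "lattice two_chain"
proof (rule latticeI)
  show "\<exists>s. is_join two_chain x y s" "\<exists>s. is_meet two_chain x y s" for x y
    by (intro exI[of _ "x \<or> y"] exI[of _ "x \<and> y"]; auto simp: is_join_def is_meet_def)+
qed auto

section \<open>Planar equivalences\<close>

text \<open>\<open>H\<close> is meant as a matching with empty lower row; its pairs become the
  classes.\<close>

definition eqv :: "'a rel \<Rightarrow> (int \<Rightarrow> int) \<Rightarrow> 'a rel" where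
  "eqv A H = {(a, b). a \<in> Field A \<and> b \<in> Field A \<and> (a = b \<or> H (- pos A a) = - pos A b)}"

lemma ob_empty [simp]: "ob {} = {}"
  by (simp add: ob_def)

lemma NC_partner:
  assumes A: "tl_object A" and H: "H \<in> NC (ob A) {}" and a: "a \<in> Field A"
  shows "\<exists>b\<in>Field A. b \<noteq> a \<and> H (- pos A a) = - pos A b \<and> H (- pos A b) = - pos A a"
proof -
  have m: "H (- pos A a) \<noteq> - pos A a" using NC_D(9)[OF H, of "- pos A a"] pos_in[OF A a] by simp
  have ii: "H (H (- pos A a)) = - pos A a" by (rule NC_D(8)[OF H])
  then have "- H (- pos A a) \<in> ob A" using NC_D(9)[OF H, of "H (- pos A a)"] m by simp
  then obtain b where b: "b \<in> Field A" "pos A b = - H (- pos A a)"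
    using pos_bij[OF A] unfolding bij_betw_def by (metis imageE)
  then have e: "H (- pos A a) = - pos A b" by simp
  have "b \<noteq> a" using e m by auto
  moreover have "H (- pos A b) = - pos A a" using ii unfolding e .
  ultimately show ?thesis using b(1) e by blast
qed

lemma eqv_class:
  assumes A: "tl_object A" and H: "H \<in> NC (ob A) {}" and U: "U \<in> Field A // eqv A H"
  shows "\<exists>a\<in>Field A. \<exists>b\<in>Field A. pos A a < pos A b \<and> U = {a, b} \<and> H (- pos A a) = - pos A b \<and> H (- pos A b) = - pos A a"
proof -
  obtain a where a: "a \<in> Field A" "U = eqv A H `` {a}" using U by (auto elim: quotientE)
  obtain b where b: "b \<in> Field A" "b \<noteq> a" "H (- pos A a) = - pos A b" "H (- pos A b) = - pos A a"
    using NC_partner[OF A H a(1)] by blast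
  have U: "U = {a, b}"
  proof (rule Set.set_eqI)
    fix c
    have "c \<in> U \<longleftrightarrow> (a, c) \<in> eqv A H" unfolding a(2) by (rule Image_singleton_iff)
    also have "\<dots> \<longleftrightarrow> c \<in> Field A \<and> (a = c \<or> pos A b = pos A c)"
      unfolding eqv_def mem_Collect_eq prod.case b(3) neg_equal_iff_equal using a(1) by blast
    also have "\<dots> \<longleftrightarrow> c \<in> {a, b}" using pos_inj[OF A b(1)] a(1) b(1) by blast
    finally show "c \<in> U \<longleftrightarrow> c \<in> {a, b}" .
  qed
  have "pos A a \<noteq> pos A b" using pos_inj[OF A a(1) b(1)] b(2) by blast
  then consider "pos A a < pos A b" | "pos A b < pos A a" by linarith
  then show ?thesis
  proof cases
    case 1 then show ?thesis using a(1) b U by blast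
  next
    case 2 then show ?thesis using a(1) b U insert_commute by blast
  qed
qed

lemma eqv_equiv:
  assumes A: "tl_object A" and H: "H \<in> NC (ob A) {}"
  shows "equiv (Field A) (eqv A H)"
proof (rule equivI)
  have ii: "H u = v \<Longrightarrow> H v = u" for u v using NC_D(8)[OF H, of u] by simp
  show "sym (eqv A H)" by (rule symI) (auto simp: eqv_def dest: ii)
  show "trans (eqv A H)"
  proof (rule transI)
    fix a b c assume ab: "(a, b) \<in> eqv A H" and bc: "(b, c) \<in> eqv A H"
    show "(a, c) \<in> eqv A H"
    proof (cases "a = b \<or> b = c")
      case False
      then have e: "H (- pos A a) = - pos A b" "H (- pos A b) = - pos A c" "a \<in> Field A" "c \<in> Field A"
        using ab bc by (auto simp: eqv_def)
      have "pos A a = pos A c" using ii[OF e(1)] e(2) by simp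
      then have "a = c" by (rule pos_inj[OF A e(3,4)])
      then show ?thesis using e(3) by (simp add: eqv_def)
    qed (use ab bc in auto)
  qed
qed (auto simp: eqv_def refl_on_def)

text \<open>Two disjoint pairs on a line are side by side, nested or interlaced, and
  \<open>noncrossing\<close> excludes the last. Since positions are stored with negative sign, the
  instances appear in reversed order.\<close>

lemma eqv_planar:
  assumes A: "tl_object A" and H: "H \<in> NC (ob A) {}"
  shows "eqv A H \<in> planar_Eq2 A"
proof -
  have lt: "olt A u v \<longleftrightarrow> pos A u < pos A v" if "u \<in> Field A" "v \<in> Field A" for u v
    using pos_less_iff[OF A that] by (simp add: olt_def)
  have ncr: "\<not> (x < y \<and> y < H x \<and> H x < H y)" for x y
    using NC_D(3)[OF H] by (simp add: noncrossing_def)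
  have "card U = 2" if U: "U \<in> Field A // eqv A H" for U
  proof -
    obtain a b where "pos A a < pos A b" "U = {a, b}" using eqv_class[OF A H U] by blast
    then show ?thesis by (cases "a = b") simp_all
  qed
  moreover have "separated A U V \<or> nested_by A U V \<or> nested_by A V U"
    if U: "U \<in> Field A // eqv A H" and V: "V \<in> Field A // eqv A H" and ne: "U \<noteq> V" for U V
  proof -
    obtain a b where ab: "a \<in> Field A" "b \<in> Field A" "pos A a < pos A b" "U = {a, b}"
      "H (- pos A a) = - pos A b" "H (- pos A b) = - pos A a" using eqv_class[OF A H U] by blast
    obtain c d where cd: "c \<in> Field A" "d \<in> Field A" "pos A c < pos A d" "V = {c, d}"
      "H (- pos A c) = - pos A d" "H (- pos A d) = - pos A c" using eqv_class[OF A H V] by blast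
    have disj: "U \<inter> V = {}" using quotient_disj[OF eqv_equiv[OF A H] U V] ne by blast
    have "pos A a \<noteq> pos A c" "pos A a \<noteq> pos A d" "pos A b \<noteq> pos A c" "pos A b \<noteq> pos A d"
      using pos_inj[OF A] ab(1,2) cd(1,2) disj ab(4) cd(4) by blast+
    moreover have "\<not> (pos A a < pos A c \<and> pos A c < pos A b \<and> pos A b < pos A d)"
      using ncr[of "- pos A d" "- pos A b"] ab(5,6) cd(5,6) by auto
    moreover have "\<not> (pos A c < pos A a \<and> pos A a < pos A d \<and> pos A d < pos A b)"
      using ncr[of "- pos A b" "- pos A d"] ab(5,6) cd(5,6) by auto
    ultimately consider "pos A b < pos A c" | "pos A d < pos A a"
      | "pos A c < pos A a" "pos A b < pos A d" | "pos A a < pos A c" "pos A d < pos A b" using ab(3) cd(3) by linarith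
    then show ?thesis
    proof cases
      case 1 then have "separated A U V" using ab cd lt by (auto simp: separated_def)
      then show ?thesis by blast
    next
      case 2 then have "separated A U V" using ab cd lt by (auto simp: separated_def)
      then show ?thesis by blast
    next
      case 3
      have "nested_by A U V" unfolding nested_by_def ab(4) cd(4)
        by (rule bexI[of _ c], rule bexI[of _ d]) (use 3 ab cd lt in auto)
      then show ?thesis by blast
    next
      case 4
      have "nested_by A V U" unfolding nested_by_def ab(4) cd(4)
        by (rule bexI[of _ a], rule bexI[of _ b]) (use 4 ab cd lt in auto)
      then show ?thesis by blast
    qed
  qed
  ultimately show ?thesis
    using eqv_equiv[OF A H] by (auto simp: planar_Eq2_def Eq2_def Equivs_def planar_equiv_def)
qed

lemma eqv_inj:
  assumes A: "tl_object A" and H: "H \<in> NC (ob A) {}" "H' \<in> NC (ob A) {}" and e: "eqv A H = eqv A H'"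
  shows "H = H'"
proof
  fix z
  show "H z = H' z"
  proof (cases "- z \<in> ob A")
    case True
    then obtain a where a: "a \<in> Field A" "pos A a = - z"
      using pos_bij[OF A] unfolding bij_betw_def by (metis imageE)
    obtain b where b: "b \<in> Field A" "b \<noteq> a" "H (- pos A a) = - pos A b"
      using NC_partner[OF A H(1) a(1)] by blast
    have "(a, b) \<in> eqv A H" using a(1) b by (simp add: eqv_def)
    then have "H' (- pos A a) = - pos A b" unfolding e using b(2) by (simp add: eqv_def)
    then show ?thesis using b(3) a(2) by simp
  next
    case False
    then show ?thesis using NC_D(9)[OF H(1), of z] NC_D(9)[OF H(2), of z] by simp
  qed
qed

lemma separated_or_nested_positions:
  assumes A: "tl_object A" and f: "a \<in> Field A" "b \<in> Field A" "c \<in> Field A" "d \<in> Field A"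
    and p: "separated A {a, b} {c, d} \<or> nested_by A {a, b} {c, d} \<or> nested_by A {c, d} {a, b}"
  shows "\<not> (pos A a < pos A c \<and> pos A c < pos A b \<and> pos A b < pos A d)"
proof
  assume o: "pos A a < pos A c \<and> pos A c < pos A b \<and> pos A b < pos A d"
  have lt: "olt A u v \<longleftrightarrow> pos A u < pos A v" if "u \<in> Field A" "v \<in> Field A" for u v
    using pos_less_iff[OF A that] by (simp add: olt_def)
  have "\<not> separated A {a, b} {c, d}" using o f by (auto simp: separated_def lt)
  moreover have "\<not> nested_by A {a, b} {c, d}" using o f by (auto simp: nested_by_def lt)
  moreover have "\<not> nested_by A {c, d} {a, b}" using o f by (auto simp: nested_by_def lt)
  ultimately show False using p by blast
qed

lemma eqv_surj:
  assumes A: "tl_object A" and E: "E \<in> planar_Eq2 A"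
  shows "\<exists>H\<in>NC (ob A) {}. eqv A H = E"
proof -
  have eq: "equiv (Field A) E" and c2: "\<And>U. U \<in> Field A // E \<Longrightarrow> card U = 2"
    and pl: "\<And>U V. U \<in> Field A // E \<Longrightarrow> V \<in> Field A // E \<Longrightarrow> U \<noteq> V \<Longrightarrow>
        separated A U V \<or> nested_by A U V \<or> nested_by A V U"
    using E by (auto simp: planar_Eq2_def Eq2_def Equivs_def planar_equiv_def)
  have sub: "E \<subseteq> Field A \<times> Field A" using eq by (simp add: equiv_def)
  have self: "a \<in> E `` {a}" if "a \<in> Field A" for a using equiv_class_self[OF eq that] .
  have "\<exists>b. b \<noteq> a \<and> E `` {a} = {a, b}" if "a \<in> Field A" for a
  proof -
    have "card (E `` {a}) = 2" by (rule c2) (rule quotientI[OF that])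
    then obtain x y where "E `` {a} = {x, y}" "x \<noteq> y" by (meson card_2_iff)
    then show ?thesis using self[OF that] by (metis insertE insert_commute singletonD)
  qed
  then obtain p where p: "\<And>a. a \<in> Field A \<Longrightarrow> p a \<noteq> a \<and> E `` {a} = {a, p a}" by metis
  have pf: "p a \<in> Field A" if "a \<in> Field A" for a using p[OF that] sub by blast
  have pp: "p (p a) = a" if "a \<in> Field A" for a
  proof -
    have "(a, p a) \<in> E" using p[OF that] by blast
    then have "E `` {a} = E `` {p a}" by (rule equiv_class_eq[OF eq])
    then have "{a, p a} = {p a, p (p a)}" using p[OF that] p[OF pf[OF that]] by simp
    then show ?thesis using p[OF that] by (metis doubleton_eq_iff)
  qed
  define v where "v = inv_into (Field A) (pos A)"
  have v: "v (pos A a) = a" if "a \<in> Field A" for a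
    unfolding v_def by (rule bij_betw_inv_into_left[OF pos_bij[OF A] that])
  define H where "H = (\<lambda>z. if - z \<in> ob A then - pos A (p (v (- z))) else z)"
  have Ha: "H (- pos A a) = - pos A (p a)" if "a \<in> Field A" for a
    using v[OF that] pos_in[OF A that] by (simp add: H_def)
  have rep: "\<exists>a\<in>Field A. z = - pos A a" if "- z \<in> ob A" for z
    using pos_bij[OF A] that unfolding bij_betw_def by (metis imageE minus_minus)
  have Hid: "H z = z" if "- z \<notin> ob A" for z using that by (simp add: H_def)
  have inv: "H (H z) = z" for z
  proof (cases "- z \<in> ob A")
    case True
    then obtain a where "a \<in> Field A" "z = - pos A a" using rep by blast
    then show ?thesis using Ha pf pp by metis
  qed (simp add: Hid)
  have move: "H z \<noteq> z \<longleftrightarrow> - z \<in> ob A" for z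
  proof (cases "- z \<in> ob A")
    case True
    then obtain a where a: "a \<in> Field A" "z = - pos A a" using rep by blast
    have "pos A (p a) \<noteq> pos A a" using pos_inj[OF A pf[OF a(1)] a(1)] p[OF a(1)] by blast
    then show ?thesis using Ha[OF a(1)] a(2) True by simp
  qed (simp add: Hid)
  have ncr: "noncrossing (\<lambda>z. z) H"
    unfolding noncrossing_def
  proof (intro allI notI)
    fix x y assume o: "x < y \<and> y < H x \<and> H x < H y"
    then have "- x \<in> ob A" "- y \<in> ob A" using move[of x] move[of y] by auto
    then obtain a c where ac: "a \<in> Field A" "x = - pos A a" "c \<in> Field A" "y = - pos A c" using rep by meson
    have o': "pos A (p c) < pos A (p a)" "pos A (p a) < pos A c" "pos A c < pos A a"
      using o Ha ac by auto
    have q: "E `` {c} \<in> Field A // E" "E `` {a} \<in> Field A // E" using ac quotientI by fast+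
    have "E `` {c} \<noteq> E `` {a}"
    proof
      assume "E `` {c} = E `` {a}"
      then have "c \<in> {a, p a}" using p[OF ac(1)] p[OF ac(3)] by blast
      then show False using o' by auto
    qed
    then have "separated A (E `` {c}) (E `` {a}) \<or> nested_by A (E `` {c}) (E `` {a}) \<or> nested_by A (E `` {a}) (E `` {c})"
      using pl[OF q] by blast
    then have "separated A {p c, c} {p a, a} \<or> nested_by A {p c, c} {p a, a} \<or> nested_by A {p a, a} {p c, c}"
      using p[OF ac(1)] p[OF ac(3)] by (metis insert_commute)
    then show False
      using separated_or_nested_positions[OF A pf[OF ac(3)] ac(3) pf[OF ac(1)] ac(1)] o' by blast
  qed
  have N: "H \<in> NC (ob A) {}"
    using NC_iff_matching_on[of H A "{}"] inv move ncr by (simp add: matching_on_def involution_def)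
  have "eqv A H = E"
  proof (rule Set.set_eqI)
    fix z :: "'a \<times> 'a"
    obtain a b where z: "z = (a, b)" by (cases z)
    have "(a, b) \<in> eqv A H \<longleftrightarrow> a \<in> Field A \<and> b \<in> Field A \<and> (b = a \<or> pos A (p a) = pos A b)"
      using Ha[of a] by (auto simp: eqv_def)
    also have "\<dots> \<longleftrightarrow> a \<in> Field A \<and> b \<in> Field A \<and> b \<in> {a, p a}"
      using pos_inj[OF A pf, of a b] by auto
    also have "\<dots> \<longleftrightarrow> (a, b) \<in> E" using p[of a] sub by blast
    finally show "z \<in> eqv A H \<longleftrightarrow> z \<in> E" unfolding z .
  qed
  then show ?thesis using N by blast
qed

lemma eqv_bij: "tl_object A \<Longrightarrow> bij_betw (eqv A) (NC (ob A) {}) (planar_Eq2 A)"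
  unfolding bij_betw_def inj_on_def using eqv_inj eqv_planar eqv_surj by blast

section \<open>Congruences of the Temperley--Lieb category\<close>

text \<open>The inverse of \<open>dg\<close> for given source and target; the description is unique
  by \<open>dg_inj\<close>.\<close>

definition mat :: "'a diagram \<Rightarrow> int \<Rightarrow> int" where
  "mat \<alpha> = (THE f. matching_on (source \<alpha>) (target \<alpha>) f \<and> \<alpha> = dg (source \<alpha>) (target \<alpha>) f)"

text \<open>Relations on diagrams are handled as families of relations on involutions, indexed by
  source and target, so that the results on \<open>tl_congruence\<close> apply to them.\<close>

definition pairs_of :: "('a rel \<Rightarrow> 'a rel \<Rightarrow> (int \<Rightarrow> int) \<Rightarrow> (int \<Rightarrow> int) \<Rightarrow> bool) \<Rightarrow> ('a diagram \<times> 'a diagram) set" where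
  "pairs_of rel = {(dg A B f, dg A B g) | A B f g. rel A B f g}"

definition hat_dg :: "'a diagram \<Rightarrow> 'a diagram" where
  "hat_dg x = dg (source x) (target x) (hat (mat x))"

lemma TL_simps [simp]: "pdom (TL_sub C r) = source" "pcod (TL_sub C r) = target"
  "pmul (TL_sub C r) = diagram_mult" "carrier (TL_sub C r) = TL_ideal C r"
  by (simp_all add: subsemi_def TL_def)

lemma subsemi_subsemi: "subsemi (subsemi S J) K = subsemi S K"
  by (simp add: subsemi_def)

lemma TL_sub_infinity: "TL_sub C \<infinity> = TL C"
  by (simp add: subsemi_def TL_ideal_def)

locale tl_category =
  fixes C :: "'a rel set"
  assumes nonempty: "C \<noteq> {}"
    and objects: "\<And>A. A \<in> C \<Longrightarrow> tl_object A \<and> even (card (Field A))"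
begin

lemma objD: "A \<in> C \<Longrightarrow> tl_object A" and ev: "A \<in> C \<Longrightarrow> even (card (ob A))"
  using objects by (auto simp: ob_simps)

lemma ob_props: "A \<in> C \<Longrightarrow> finite (ob A) \<and> (\<forall>a\<in>ob A. 0 < a) \<and> even (card (ob A))"
  using ev by (auto simp: ob_simps)

lemma ex_matching: "A \<in> C \<Longrightarrow> \<exists>H. H \<in> NC (ob A) {}"
  by (rule NC_nonempty) (use ev in \<open>auto simp: ob_simps\<close>)

lemma matching_NC: "f \<in> NC (ob A) (ob B) \<Longrightarrow> matching_on A B f"
  using NC_iff_matching_on by blast

lemma mat_dg: "A \<in> C \<Longrightarrow> B \<in> C \<Longrightarrow> f \<in> NC (ob A) (ob B) \<Longrightarrow> mat (dg A B f) = f"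
  unfolding mat_def dg_simps
  by (rule the_equality) (use dg_inj[OF objD objD] matching_NC in blast)+

lemma dg_eq_iff:
  assumes "A \<in> C" "B \<in> C" "f \<in> NC (ob A) (ob B)" "A' \<in> C" "B' \<in> C" "g \<in> NC (ob A') (ob B')"
  shows "dg A B f = dg A' B' g \<longleftrightarrow> A = A' \<and> B = B' \<and> f = g"
  using mat_dg assms by (metis dg_simps)

lemma carrier_TL: "x \<in> carrier (TL C) \<longleftrightarrow> (\<exists>A\<in>C. \<exists>B\<in>C. \<exists>f\<in>NC (ob A) (ob B). x = dg A B f)"
proof
  assume "x \<in> carrier (TL C)"
  then have x: "source x \<in> C" "target x \<in> C" "is_brauer x" "planar_diagram x" by (auto simp: TL_def)
  obtain f where f: "matching_on (source x) (target x) f" "x = dg (source x) (target x) f"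
    using dg_surj[OF objD[OF x(1)] objD[OF x(2)] x(3) refl refl] by blast
  have "noncrossing (\<lambda>z. z) f"
    using planar_dg_iff[OF objD[OF x(1)] objD[OF x(2)] f(1)] x(4) f(2) by simp
  then show "\<exists>A\<in>C. \<exists>B\<in>C. \<exists>f\<in>NC (ob A) (ob B). x = dg A B f" using x f NC_iff_matching_on by blast
next
  assume "\<exists>A\<in>C. \<exists>B\<in>C. \<exists>f\<in>NC (ob A) (ob B). x = dg A B f"
  then obtain A B f where f: "A \<in> C" "B \<in> C" "f \<in> NC (ob A) (ob B)" "x = dg A B f" by blast
  then have m: "matching_on A B f" "noncrossing (\<lambda>z. z) f" using NC_iff_matching_on by auto
  show "x \<in> carrier (TL C)"
    using f dg_brauer[OF objD[OF f(1)] objD[OF f(2)] m(1)] planar_dg_iff[OF objD[OF f(1)] objD[OF f(2)] m(1)] m(2)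
    by (simp add: TL_def)
qed

lemma ideal_iff: "x \<in> TL_ideal C r \<longleftrightarrow> (\<exists>A\<in>C. \<exists>B\<in>C. \<exists>f\<in>NCr r (ob A) (ob B). x = dg A B f)"
proof -
  have "drank (dg A B f) = nc_rank f" if "A \<in> C" "B \<in> C" "f \<in> NC (ob A) (ob B)" for A B f
    using drank_dg[OF objD[OF that(1)] objD[OF that(2)] matching_NC[OF that(3)]] .
  then show ?thesis unfolding TL_ideal_def NCr_def mem_Collect_eq carrier_TL by fastforce
qed

lemma dg_ideal_iff:
  assumes "A \<in> C" "B \<in> C" "f \<in> NC (ob A) (ob B)"
  shows "dg A B f \<in> TL_ideal C r \<longleftrightarrow> enat (nc_rank f) \<le> r"
proof
  assume "dg A B f \<in> TL_ideal C r"
  then obtain A' B' g where "A' \<in> C" "B' \<in> C" "g \<in> NCr r (ob A') (ob B')" "dg A B f = dg A' B' g"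
    unfolding ideal_iff by blast
  then show "enat (nc_rank f) \<le> r" using dg_eq_iff[OF assms, of A' B' g] by (auto simp: NCr_def)
qed (use assms in \<open>auto simp: ideal_iff NCr_def\<close>)

lemma dg_in_ideal: "A \<in> C \<Longrightarrow> B \<in> C \<Longrightarrow> f \<in> NCr r (ob A) (ob B) \<Longrightarrow> dg A B f \<in> TL_ideal C r"
  unfolding ideal_iff by blast

lemma mult_dg:
  "A \<in> C \<Longrightarrow> B \<in> C \<Longrightarrow> D \<in> C \<Longrightarrow> f \<in> NC (ob A) (ob B) \<Longrightarrow> g \<in> NC (ob B) (ob D) \<Longrightarrow>
    diagram_mult (dg A B f) (dg B D g) = dg A D (f \<odot> g)"
  by (rule dg_mult) (auto intro: objD)

lemma pairs_of_iff:
  assumes r: "\<And>A B f g. rel A B f g \<Longrightarrow> A \<in> C \<and> B \<in> C \<and> f \<in> NCr r (ob A) (ob B) \<and> g \<in> NCr r (ob A) (ob B)"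
    and A: "A \<in> C" "B \<in> C" "f \<in> NC (ob A) (ob B)" and B: "A' \<in> C" "B' \<in> C" "g \<in> NC (ob A') (ob B')"
  shows "(dg A B f, dg A' B' g) \<in> pairs_of rel \<longleftrightarrow> A' = A \<and> B' = B \<and> rel A B f g"
proof
  assume "(dg A B f, dg A' B' g) \<in> pairs_of rel"
  then obtain P Q u v where e: "dg A B f = dg P Q u" "dg A' B' g = dg P Q v" "rel P Q u v"
    unfolding pairs_of_def by blast
  have u: "P \<in> C" "Q \<in> C" "u \<in> NC (ob P) (ob Q)" "v \<in> NC (ob P) (ob Q)" using r[OF e(3)] NCr_NC by auto
  show "A' = A \<and> B' = B \<and> rel A B f g"
    using e dg_eq_iff[OF A u(1,2,3)] dg_eq_iff[OF B u(1,2,4)] by auto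
qed (auto simp: pairs_of_def)

lemma pairs_of_eqI:
  assumes "\<And>x y. (x, y) \<in> S \<Longrightarrow> \<exists>A\<in>C. \<exists>B\<in>C. \<exists>f\<in>NCr r (ob A) (ob B). \<exists>g\<in>NCr r (ob A) (ob B). x = dg A B f \<and> y = dg A B g"
    and "\<And>A B f g. A \<in> C \<Longrightarrow> B \<in> C \<Longrightarrow> f \<in> NCr r (ob A) (ob B) \<Longrightarrow> g \<in> NCr r (ob A) (ob B) \<Longrightarrow>
        (dg A B f, dg A B g) \<in> S \<longleftrightarrow> rel A B f g"
    and "\<And>A B f g. rel A B f g \<Longrightarrow> A \<in> C \<and> B \<in> C \<and> f \<in> NCr r (ob A) (ob B) \<and> g \<in> NCr r (ob A) (ob B)"
  shows "S = pairs_of rel"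
proof (rule Set.set_eqI)
  fix p :: "'a diagram \<times> 'a diagram"
  obtain x y where p: "p = (x, y)" by (cases p)
  show "p \<in> S \<longleftrightarrow> p \<in> pairs_of rel"
  proof
    assume "p \<in> S"
    then obtain A B f g where "A \<in> C" "B \<in> C" "f \<in> NCr r (ob A) (ob B)" "g \<in> NCr r (ob A) (ob B)"
      "x = dg A B f" "y = dg A B g" using assms(1) p by blast
    then show "p \<in> pairs_of rel" using assms(2) \<open>p \<in> S\<close> p unfolding pairs_of_def by blast
  next
    assume "p \<in> pairs_of rel"
    then obtain A B f g where "p = (dg A B f, dg A B g)" "rel A B f g" unfolding pairs_of_def by blast
    then show "p \<in> S" using assms(2,3) by metis
  qed
qed

lemma pairs_of_subset_iff:
  assumes "\<And>A B f g. rel A B f g \<Longrightarrow> A \<in> C \<and> B \<in> C \<and> f \<in> NCr r (ob A) (ob B) \<and> g \<in> NCr r (ob A) (ob B)"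
    and "\<And>A B f g. rel' A B f g \<Longrightarrow> A \<in> C \<and> B \<in> C \<and> f \<in> NCr r' (ob A) (ob B) \<and> g \<in> NCr r' (ob A) (ob B)"
  shows "pairs_of rel \<subseteq> pairs_of rel' \<longleftrightarrow> (\<forall>A B f g. rel A B f g \<longrightarrow> rel' A B f g)"
proof
  assume s: "pairs_of rel \<subseteq> pairs_of rel'"
  show "\<forall>A B f g. rel A B f g \<longrightarrow> rel' A B f g"
  proof (intro allI impI)
    fix A B f g assume R: "rel A B f g"
    then have "(dg A B f, dg A B g) \<in> pairs_of rel'" using s unfolding pairs_of_def by blast
    moreover have "A \<in> C" "B \<in> C" "f \<in> NC (ob A) (ob B)" "g \<in> NC (ob A) (ob B)" using assms(1)[OF R] NCr_NC by auto
    ultimately show "rel' A B f g" using pairs_of_iff[of rel' r', OF assms(2)] by blast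
  qed
qed (unfold pairs_of_def, blast)

definition rel_of :: "enat \<Rightarrow> ('a diagram \<times> 'a diagram) set \<Rightarrow> 'a rel \<Rightarrow> 'a rel \<Rightarrow> (int \<Rightarrow> int) \<Rightarrow> (int \<Rightarrow> int) \<Rightarrow> bool" where
  "rel_of r \<sigma> A B f g \<longleftrightarrow> A \<in> C \<and> B \<in> C \<and> f \<in> NCr r (ob A) (ob B) \<and> g \<in> NCr r (ob A) (ob B) \<and>
     (dg A B f, dg A B g) \<in> \<sigma>"

lemma sim_form:
  assumes "(x, y) \<in> sim (TL_sub C r)"
  shows "\<exists>A\<in>C. \<exists>B\<in>C. \<exists>f\<in>NCr r (ob A) (ob B). \<exists>g\<in>NCr r (ob A) (ob B). x = dg A B f \<and> y = dg A B g"
proof -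
  have xy: "x \<in> TL_ideal C r" "y \<in> TL_ideal C r" "source x = source y" "target x = target y"
    using assms by (auto simp: sim_def)
  obtain A B f where f: "A \<in> C" "B \<in> C" "f \<in> NCr r (ob A) (ob B)" "x = dg A B f" using xy(1) ideal_iff by blast
  obtain A' B' g where g: "A' \<in> C" "B' \<in> C" "g \<in> NCr r (ob A') (ob B')" "y = dg A' B' g" using xy(2) ideal_iff by blast
  show ?thesis using f g xy(3,4) by auto
qed

lemma sim_eq: "sim (TL_sub C r) = pairs_of (\<lambda>A B f g. A \<in> C \<and> B \<in> C \<and> f \<in> NCr r (ob A) (ob B) \<and> g \<in> NCr r (ob A) (ob B))"
  by (rule pairs_of_eqI[where r = r]) (use sim_form dg_in_ideal in \<open>auto simp: sim_def\<close>)

lemma Cong_rel_of: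
  assumes \<sigma>: "\<sigma> \<in> Cong (TL_sub C r)"
  shows "tl_congruence C ob r (rel_of r \<sigma>)" "\<sigma> = pairs_of (rel_of r \<sigma>)"
proof -
  have eq: "equiv (TL_ideal C r) \<sigma>" and sub: "\<sigma> \<subseteq> sim (TL_sub C r)"
    and mult: "\<And>x y s. (x, y) \<in> \<sigma> \<Longrightarrow> s \<in> TL_ideal C r \<Longrightarrow>
        (target s = source x \<longrightarrow> (diagram_mult s x, diagram_mult s y) \<in> \<sigma>) \<and>
        (target x = source s \<longrightarrow> (diagram_mult x s, diagram_mult y s) \<in> \<sigma>)"
    using \<sigma> unfolding Cong_def by auto
  have rfl: "\<And>x. x \<in> TL_ideal C r \<Longrightarrow> (x, x) \<in> \<sigma>" and sy: "sym \<sigma>" and tr: "trans \<sigma>"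
    using eq by (auto simp: equiv_def refl_on_def)
  show "tl_congruence C ob r (rel_of r \<sigma>)"
  proof
    fix A B f g h D s
    assume R: "rel_of r \<sigma> A B f g"
    then have fg: "A \<in> C" "B \<in> C" "f \<in> NCr r (ob A) (ob B)" "g \<in> NCr r (ob A) (ob B)" "(dg A B f, dg A B g) \<in> \<sigma>"
      by (auto simp: rel_of_def)
    show "rel_of r \<sigma> A B g f" using R symD[OF sy] by (auto simp: rel_of_def)
    show "rel_of r \<sigma> A B f h" if "rel_of r \<sigma> A B g h" using R that transD[OF tr] by (auto simp: rel_of_def)
    show "rel_of r \<sigma> D B (s \<odot> f) (s \<odot> g)" if D: "D \<in> C" "s \<in> NCr r (ob D) (ob A)"
      using mult[OF fg(5) dg_in_ideal[OF D(1) fg(1) D(2)]] fg D NCr_mult_right[OF NCr_NC[OF D(2)]]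
        mult_dg[OF D(1) fg(1,2) NCr_NC[OF D(2)] NCr_NC] by (simp add: rel_of_def)
    show "rel_of r \<sigma> A D (f \<odot> s) (g \<odot> s)" if D: "D \<in> C" "s \<in> NCr r (ob B) (ob D)"
      using mult[OF fg(5) dg_in_ideal[OF fg(2) D(1) D(2)]] fg D NCr_mult_left[OF _ NCr_NC[OF D(2)]]
        mult_dg[OF fg(1,2) D(1) NCr_NC NCr_NC[OF D(2)]] by (simp add: rel_of_def)
  qed (use ob_props rfl dg_in_ideal in \<open>auto simp: rel_of_def\<close>)
  show "\<sigma> = pairs_of (rel_of r \<sigma>)"
    by (rule pairs_of_eqI[where r = r]) (use sub sim_form in \<open>auto simp: rel_of_def\<close>)
qed

lemma pairs_of_Cong:
  assumes R: "tl_congruence C ob r rel"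
  shows "pairs_of rel \<in> Cong (TL_sub C r)"
proof -
  interpret tl_congruence C ob r rel by (rule R)
  have sub: "pairs_of rel \<subseteq> sim (TL_sub C r)"
    unfolding sim_eq using relD unfolding pairs_of_def by blast
  have form: "\<exists>A B f g. x = dg A B f \<and> y = dg A B g \<and> rel A B f g" if "(x, y) \<in> pairs_of rel" for x y
    using that unfolding pairs_of_def by blast
  have in_pairs: "(dg A B f, dg A B g) \<in> pairs_of rel" if "rel A B f g" for A B f g
    using that unfolding pairs_of_def by blast
  have "equiv (TL_ideal C r) (pairs_of rel)"
  proof (rule equivI)
    show "refl_on (TL_ideal C r) (pairs_of rel)"
    proof (rule refl_onI)
      fix x assume "x \<in> TL_ideal C r"
      then obtain A B f where f: "A \<in> C" "B \<in> C" "f \<in> NCr r (ob A) (ob B)" "x = dg A B f" using ideal_iff by blast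
      show "(x, x) \<in> pairs_of rel" unfolding f(4) by (rule in_pairs[OF rel_refl[OF f(1,2,3)]])
    qed
    show "sym (pairs_of rel)" using form in_pairs rel_sym by (fastforce intro: symI)
    show "trans (pairs_of rel)"
    proof (rule transI)
      fix x y z assume xy: "(x, y) \<in> pairs_of rel" and yz: "(y, z) \<in> pairs_of rel"
      obtain A B f g where f: "x = dg A B f" "y = dg A B g" "rel A B f g" using form[OF xy] by blast
      obtain A' B' g' h where h: "y = dg A' B' g'" "z = dg A' B' h" "rel A' B' g' h" using form[OF yz] by blast
      have "A = A' \<and> B = B' \<and> g = g'"
        using dg_eq_iff[of A B g A' B' g'] relD[OF f(3)] relD[OF h(3)] NCr_NC f(2) h(1) by metis
      then show "(x, z) \<in> pairs_of rel" using f h in_pairs rel_trans by metis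
    qed
    show "pairs_of rel \<subseteq> TL_ideal C r \<times> TL_ideal C r" using sub by (auto simp: sim_def)
  qed
  moreover have "(target s = source x \<longrightarrow> (diagram_mult s x, diagram_mult s y) \<in> pairs_of rel) \<and>
        (target x = source s \<longrightarrow> (diagram_mult x s, diagram_mult y s) \<in> pairs_of rel)"
    if xy: "(x, y) \<in> pairs_of rel" and s: "s \<in> TL_ideal C r" for x y s
  proof -
    obtain A B f g where f: "x = dg A B f" "y = dg A B g" "rel A B f g" using form[OF xy] by blast
    have N: "A \<in> C" "B \<in> C" "f \<in> NC (ob A) (ob B)" "g \<in> NC (ob A) (ob B)" using relD[OF f(3)] NCr_NC by auto
    obtain P Q t where t: "P \<in> C" "Q \<in> C" "t \<in> NCr r (ob P) (ob Q)" "s = dg P Q t" using s ideal_iff by blast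
    note tN = NCr_NC[OF t(3)]
    have "(diagram_mult s x, diagram_mult s y) \<in> pairs_of rel" if "Q = A"
      using in_pairs[OF rel_left[OF f(3) t(1), of t]] t f N tN that
        mult_dg[OF t(1) N(1,2), of t f] mult_dg[OF t(1) N(1,2), of t g] by simp
    moreover have "(diagram_mult x s, diagram_mult y s) \<in> pairs_of rel" if "P = B"
      using in_pairs[OF rel_right[OF f(3) t(2), of t]] t f N tN that
        mult_dg[OF N(1,2) t(2), of f t] mult_dg[OF N(1,2) t(2), of g t] by simp
    ultimately show ?thesis using t f by auto
  qed
  ultimately show ?thesis using sub unfolding Cong_def by auto
qed

text \<open>A common form for all congruences in the classification at \<open>4 \<le> r\<close>.
  \<open>K1\<close> and \<open>K2\<close> say that the upper or the lower closure is disregarded: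
  \<open>\<mu>\<close> disregards neither, \<open>\<lambda>\<close> the upper, \<open>\<rho>\<close>
  the lower and the Rees congruence both.\<close>

definition relG :: "enat \<Rightarrow> enat \<Rightarrow> bool \<Rightarrow> bool \<Rightarrow> 'a rel \<Rightarrow> 'a rel \<Rightarrow> (int \<Rightarrow> int) \<Rightarrow> (int \<Rightarrow> int) \<Rightarrow> bool" where
  "relG r q K1 K2 A B f g \<longleftrightarrow> A \<in> C \<and> B \<in> C \<and> f \<in> NCr r (ob A) (ob B) \<and> g \<in> NCr r (ob A) (ob B) \<and>
     (f = g \<or> (enat (nc_rank f) \<le> q \<and> enat (nc_rank g) \<le> q \<and> (K1 \<or> ucl f = ucl g) \<and> (K2 \<or> lcl f = lcl g)))"

lemma relG_dom: "relG r q K1 K2 A B f g \<Longrightarrow> A \<in> C \<and> B \<in> C \<and> f \<in> NCr r (ob A) (ob B) \<and> g \<in> NCr r (ob A) (ob B)"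
  by (simp add: relG_def)

lemma enat_le_2: "enat n \<le> q \<Longrightarrow> q \<le> 2 \<Longrightarrow> n \<le> 2"
  by (metis enat_ord_simps(1) numeral_eq_enat order.trans)

text \<open>Comparing closures is compatible with multiplication where closures are independent of
  choices, that is up to rank 2. If both closures are disregarded, only the rank matters and any
  bound \<open>q\<close> will do.\<close>

lemma relG_congruence:
  assumes q: "q \<le> 2 \<or> (K1 \<and> K2)"
  shows "tl_congruence C ob r (relG r q K1 K2)"
proof
  fix A B f g h D s
  assume R: "relG r q K1 K2 A B f g"
  note d = relG_dom[OF R]
  note fN = NCr_NC[of f r "ob A" "ob B"] and gN = NCr_NC[of g r "ob A" "ob B"]
  show "relG r q K1 K2 A B g f" using R by (auto simp: relG_def)
  show "relG r q K1 K2 A B f h" if "relG r q K1 K2 A B g h" using R that by (auto simp: relG_def)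
  show "relG r q K1 K2 D B (s \<odot> f) (s \<odot> g)" if D: "D \<in> C" "s \<in> NCr r (ob D) (ob A)"
  proof (cases "f = g")
    case True then show ?thesis using d D NCr_mult_right[OF NCr_NC[OF D(2)]] by (simp add: relG_def)
  next
    case False
    then have r: "enat (nc_rank f) \<le> q" "enat (nc_rank g) \<le> q" "K1 \<or> ucl f = ucl g" "K2 \<or> lcl f = lcl g"
      using R by (auto simp: relG_def)
    note s = NCr_NC[OF D(2)]
    have "enat (nc_rank (s \<odot> f)) \<le> q" "enat (nc_rank (s \<odot> g)) \<le> q"
      using enat_le_trans[OF nc_rank_mult_right[OF s fN] r(1)] enat_le_trans[OF nc_rank_mult_right[OF s gN] r(2)] d by auto
    moreover have "K1 \<or> ucl (s \<odot> f) = ucl (s \<odot> g)" "K2 \<or> lcl (s \<odot> f) = lcl (s \<odot> g)"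
      using q r ucl_mult_left[OF s fN enat_le_2[OF r(1)]] ucl_mult_left[OF s gN enat_le_2[OF r(2)]]
        lcl_mult_left[OF s fN enat_le_2[OF r(1)]] lcl_mult_left[OF s gN enat_le_2[OF r(2)]] d ev by auto
    ultimately show ?thesis using d D NCr_mult_right[OF s] by (simp add: relG_def)
  qed
  show "relG r q K1 K2 A D (f \<odot> s) (g \<odot> s)" if D: "D \<in> C" "s \<in> NCr r (ob B) (ob D)"
  proof (cases "f = g")
    case True then show ?thesis using d D NCr_mult_left[OF _ NCr_NC[OF D(2)]] by (simp add: relG_def)
  next
    case False
    then have r: "enat (nc_rank f) \<le> q" "enat (nc_rank g) \<le> q" "K1 \<or> ucl f = ucl g" "K2 \<or> lcl f = lcl g"
      using R by (auto simp: relG_def)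
    note s = NCr_NC[OF D(2)]
    have "enat (nc_rank (f \<odot> s)) \<le> q" "enat (nc_rank (g \<odot> s)) \<le> q"
      using enat_le_trans[OF nc_rank_mult_left[OF fN s] r(1)] enat_le_trans[OF nc_rank_mult_left[OF gN s] r(2)] d by auto
    moreover have "K1 \<or> ucl (f \<odot> s) = ucl (g \<odot> s)" "K2 \<or> lcl (f \<odot> s) = lcl (g \<odot> s)"
      using q r ucl_mult_right[OF fN enat_le_2[OF r(1)] s] ucl_mult_right[OF gN enat_le_2[OF r(2)] s]
        lcl_mult_right[OF fN enat_le_2[OF r(1)] s] lcl_mult_right[OF gN enat_le_2[OF r(2)] s] d ev by auto
    ultimately show ?thesis using d D NCr_mult_left[OF _ s] by (simp add: relG_def)
  qed
qed (use ob_props in \<open>auto simp: relG_def\<close>)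

section \<open>Minimal ideal, retractions and Green's relations\<close>

lemma rank0_NCr:
  assumes "H \<in> NC (ob A) {}" "V \<in> NC {} (ob B)"
  shows "H \<odot> V \<in> NCr r (ob A) (ob B)"
  using rank0_mult(1,2)[OF assms] by (simp add: NCr_def zero_enat_def[symmetric])

lemma ideal_is_ideal:
  assumes "q \<le> r"
  shows "is_ideal (TL_sub C r) (TL_ideal C q)"
  unfolding is_ideal_def TL_simps
proof (intro conjI ballI impI)
  obtain A H where "A \<in> C" "H \<in> NC (ob A) {}" using nonempty ex_matching by blast
  then have "dg A A (H \<odot> flip H) \<in> TL_ideal C q"
    using dg_in_ideal rank0_NCr flip_NC by blast
  then show "TL_ideal C q \<noteq> {}" by blast
  show "TL_ideal C q \<subseteq> TL_ideal C r" using assms by (auto simp: TL_ideal_def intro: order.trans)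
next
  fix x s assume x: "x \<in> TL_ideal C q" and s: "s \<in> TL_ideal C r"
  obtain A B f where f: "A \<in> C" "B \<in> C" "f \<in> NCr q (ob A) (ob B)" "x = dg A B f" using x ideal_iff by blast
  obtain P Q t where t: "P \<in> C" "Q \<in> C" "t \<in> NCr r (ob P) (ob Q)" "s = dg P Q t" using s ideal_iff by blast
  note fN = NCr_NC[OF f(3)] and tN = NCr_NC[OF t(3)]
  show "diagram_mult s x \<in> TL_ideal C q" if "target s = source x"
    using that t f mult_dg[OF t(1) f(1,2), of t f] dg_in_ideal[OF t(1) f(2) NCr_mult_right[of t "ob P" "ob A" f]] fN tN by simp
  show "diagram_mult x s \<in> TL_ideal C q" if "target x = source s"
    using that t f mult_dg[OF f(1,2) t(2), of f t] dg_in_ideal[OF f(1) t(2) NCr_mult_left[of f q "ob A" "ob B" t]] fN tN by simp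
qed

text \<open>From any element \<open>f\<close> of an ideal every \<open>?U \<odot> ?V\<close> of rank
  0 is obtained: multiply on both sides by rank-zero diagrams with outer parts \<open>?U\<close> and
  \<open>?V\<close>; whatever remains around \<open>f\<close> closes up to loops.\<close>

lemma minimal_ideal_iff: "is_minimal_ideal (TL_sub C r) M \<longleftrightarrow> M = TL_ideal C 0"
proof -
  have i0: "is_ideal (TL_sub C r) (TL_ideal C 0)" by (rule ideal_is_ideal) simp
  have least: "TL_ideal C 0 \<subseteq> J" if J: "is_ideal (TL_sub C r) J" for J
  proof
    fix y assume "y \<in> TL_ideal C 0"
    then obtain P Q g where g: "P \<in> C" "Q \<in> C" "g \<in> NCr 0 (ob P) (ob Q)" "y = dg P Q g" using ideal_iff by blast
    have gN: "g \<in> NC (ob P) (ob Q)" "nc_rank g = 0" using g(3) by (auto simp: NCr_def zero_enat_def)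
    obtain x where x: "x \<in> J" "x \<in> TL_ideal C r" using J by (auto simp: is_ideal_def)
    obtain A B f where f: "A \<in> C" "B \<in> C" "f \<in> NCr r (ob A) (ob B)" "x = dg A B f" using x(2) ideal_iff by blast
    note fN = NCr_NC[OF f(3)]
    obtain HA HB where H: "HA \<in> NC (ob A) {}" "HB \<in> NC (ob B) {}" using ex_matching f by blast
    let ?U = "ucl g" and ?V = "lcl g"
    have UV: "?U \<in> NC (ob P) {}" "?V \<in> NC {} (ob Q)" using ucl_NC[OF gN(1)] lcl_NC[OF gN(1)] ev g by auto
    let ?p = "?U \<odot> flip HA" and ?q = "HB \<odot> ?V"
    note fH = flip_NC[OF H(1)]
    have pq: "?p \<in> NCr r (ob P) (ob A)" "?q \<in> NCr r (ob B) (ob Q)"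
      by (rule rank0_NCr[OF UV(1) fH], rule rank0_NCr[OF H(2) UV(2)])
    note pN = NCr_NC[OF pq(1)] and qN = NCr_NC[OF pq(2)]
    have px: "diagram_mult (dg P A ?p) x \<in> J"
      using J x(1) dg_in_ideal[OF g(1) f(1) pq(1)] f(4) unfolding is_ideal_def by simp
    then have "diagram_mult (diagram_mult (dg P A ?p) x) (dg B Q ?q) \<in> J"
      using J dg_in_ideal[OF f(2) g(2) pq(2)] mult_dg[OF g(1) f(1,2) pN fN] f(4) unfolding is_ideal_def by auto
    moreover have "diagram_mult (diagram_mult (dg P A ?p) x) (dg B Q ?q) = dg P Q ((?p \<odot> f) \<odot> ?q)"
      using mult_dg[OF g(1) f(1,2) pN fN] mult_dg[OF g(1) f(2) g(2) nc_mult_NC[OF pN fN] qN] f(4) by simp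
    moreover have "(?p \<odot> f) \<odot> ?q = ?U \<odot> ?V"
      using nc_mult_assoc[OF UV(1) fH fN] middle_cancel[OF UV(1) nc_mult_NC[OF fH fN] H(2) UV(2)] by simp
    ultimately show "y \<in> J" using rank0_decomp(1)[OF gN] g(4) by simp
  qed
  show ?thesis
    unfolding is_minimal_ideal_def using i0 least by blast
qed

lemma min_ideal_eq: "min_ideal (TL_sub C r) = TL_ideal C 0"
  unfolding min_ideal_def by (rule the_equality) (simp_all add: minimal_ideal_iff)

lemma hat_dg_dg:
  "A \<in> C \<Longrightarrow> B \<in> C \<Longrightarrow> f \<in> NC (ob A) (ob B) \<Longrightarrow> hat_dg (dg A B f) = dg A B (hat f)"
  by (simp add: hat_dg_def mat_dg)

lemma hat_NCr: "A \<in> C \<Longrightarrow> B \<in> C \<Longrightarrow> f \<in> NC (ob A) (ob B) \<Longrightarrow> hat f \<in> NCr r (ob A) (ob B)"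
  using hat_props(1,2)[of f "ob A" "ob B"] ev by (simp add: NCr_def zero_enat_def[symmetric])

lemma hat_retraction:
  assumes q: "q \<le> r" "q \<le> 2"
  shows "is_retraction (TL_sub C r) (TL_ideal C q) hat_dg"
  unfolding is_retraction_def min_ideal_eq TL_simps
proof (intro conjI ballI impI)
  fix x assume "x \<in> TL_ideal C q"
  then obtain A B f where f: "A \<in> C" "B \<in> C" "f \<in> NCr q (ob A) (ob B)" "x = dg A B f" using ideal_iff by blast
  note fN = NCr_NC[OF f(3)]
  have h: "hat_dg x = dg A B (hat f)" using hat_dg_dg[OF f(1,2) fN] f(4) by simp
  show "hat_dg x \<in> TL_ideal C 0" unfolding h by (rule dg_in_ideal[OF f(1,2) hat_NCr[OF f(1,2) fN]])
  have "dg A B (hat f) \<in> TL_ideal C r" by (rule dg_in_ideal[OF f(1,2) hat_NCr[OF f(1,2) fN]])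
  moreover have "x \<in> TL_ideal C r"
    unfolding f(4) by (rule dg_in_ideal[OF f(1,2)]) (use f(3) q in \<open>auto simp: NCr_def\<close>)
  ultimately show "(x, hat_dg x) \<in> sim (TL_sub C r)" unfolding h using f(4) by (simp add: sim_def)
  fix y assume "y \<in> TL_ideal C q" and xy: "target x = source y"
  then obtain D g where g: "D \<in> C" "g \<in> NCr q (ob B) (ob D)" "y = dg B D g" using ideal_iff f(4) by fastforce
  note gN = NCr_NC[OF g(2)]
  have r2: "nc_rank f \<le> 2" "nc_rank g \<le> 2" using f(3) g(2) enat_le_2 q(2) by (auto simp: NCr_def)
  have hN: "hat f \<in> NC (ob A) (ob B)" "hat g \<in> NC (ob B) (ob D)" using hat_NCr NCr_NC f g fN gN by blast+
  show "hat_dg (diagram_mult x y) = diagram_mult (hat_dg x) (hat_dg y)"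
    using mult_dg[OF f(1,2) g(1) fN gN] mult_dg[OF f(1,2) g(1) hN] hat_dg_dg[OF f(1) g(1) nc_mult_NC[OF fN gN]]
      hat_dg_dg[OF f(2) g(1) gN] h hat_mult[OF fN r2(1) gN r2(2)] ev f g by simp
next
  fix x assume "x \<in> TL_ideal C 0"
  then obtain A B f where f: "A \<in> C" "B \<in> C" "f \<in> NCr 0 (ob A) (ob B)" "x = dg A B f" using ideal_iff by blast
  then show "hat_dg x = x"
    using hat_dg_dg[OF f(1,2) NCr_NC[OF f(3)]] hat_rank0[OF NCr_NC[OF f(3)]] by (simp add: NCr_def zero_enat_def)
qed

text \<open>A retraction is the identity on products with rank-zero elements, since these have rank
  0. Multiplying \<open>f\<close> by one on the left reveals the lower closure of its image,
  multiplying on the right reveals the upper closure.\<close>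

lemma retraction_unique:
  assumes q: "q \<le> r" "q \<le> 2" and h: "is_retraction (TL_sub C r) (TL_ideal C q) h" and x: "x \<in> TL_ideal C q"
  shows "h x = hat_dg x"
proof -
  obtain A B f where f: "A \<in> C" "B \<in> C" "f \<in> NCr q (ob A) (ob B)" "x = dg A B f" using x ideal_iff by blast
  note fN = NCr_NC[OF f(3)]
  have r2: "nc_rank f \<le> 2" using f(3) enat_le_2 q(2) by (auto simp: NCr_def)
  have hx: "h x \<in> TL_ideal C 0" "(x, h x) \<in> sim (TL_sub C r)"
    and hm: "\<And>x y. x \<in> TL_ideal C q \<Longrightarrow> y \<in> TL_ideal C q \<Longrightarrow> target x = source y \<Longrightarrow>
        h (diagram_mult x y) = diagram_mult (h x) (h y)"
    and h0: "\<And>x. x \<in> TL_ideal C 0 \<Longrightarrow> h x = x"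
    using h x unfolding is_retraction_def min_ideal_eq TL_simps by auto
  obtain A' B' g where g': "A' \<in> C" "B' \<in> C" "g \<in> NCr 0 (ob A') (ob B')" "h x = dg A' B' g"
    using hx(1) ideal_iff by blast
  have "A' = A" "B' = B" using hx(2) f(4) g'(4) by (simp_all add: sim_def)
  then have g: "g \<in> NCr 0 (ob A) (ob B)" "h x = dg A B g" using g' by simp_all
  have gN: "g \<in> NC (ob A) (ob B)" "nc_rank g = 0" using g(1) by (auto simp: NCr_def zero_enat_def)
  obtain HA HB where H: "HA \<in> NC (ob A) {}" "HB \<in> NC (ob B) {}" using ex_matching f by blast
  let ?m = "HA \<odot> flip HA" and ?n = "HB \<odot> flip HB"
  have mn: "?m \<in> NCr s (ob A) (ob A)" "?n \<in> NCr s (ob B) (ob B)" for s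
    using rank0_NCr H flip_NC by blast+
  note mN = NCr_NC[OF mn(1)[of 0]] and nN = NCr_NC[OF mn(2)[of 0]]
  have "dg A B (?m \<odot> f) = dg A B (?m \<odot> g)"
  proof -
    have "dg A B (?m \<odot> f) \<in> TL_ideal C 0" by (rule dg_in_ideal[OF f(1,2) NCr_mult_left[OF mn(1) fN]])
    then show ?thesis
      using hm[OF dg_in_ideal[OF f(1,1) mn(1)] x] h0[OF dg_in_ideal[OF f(1,1) mn(1)]] h0[of "dg A B (?m \<odot> f)"] f(4) g(2)
        mult_dg[OF f(1,1,2) mN fN] mult_dg[OF f(1,1,2) mN gN(1)] by simp
  qed
  then have "?m \<odot> f = ?m \<odot> g"
    using dg_eq_iff[OF f(1,2) nc_mult_NC[OF mN fN] f(1,2) nc_mult_NC[OF mN gN(1)]] by simp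
  then have l: "lcl f = lcl g" using lcl_mult_left[OF mN fN r2] lcl_mult_left[OF mN gN(1)] gN(2) ev f by simp
  have "dg A B (f \<odot> ?n) = dg A B (g \<odot> ?n)"
  proof -
    have "dg A B (f \<odot> ?n) \<in> TL_ideal C 0" by (rule dg_in_ideal[OF f(1,2) NCr_mult_right[OF fN mn(2)]])
    then show ?thesis
      using hm[OF x dg_in_ideal[OF f(2,2) mn(2)]] h0[OF dg_in_ideal[OF f(2,2) mn(2)]] h0[of "dg A B (f \<odot> ?n)"] f(4) g(2)
        mult_dg[OF f(1,2,2) fN nN] mult_dg[OF f(1,2,2) gN(1) nN] by simp
  qed
  then have "f \<odot> ?n = g \<odot> ?n"
    using dg_eq_iff[OF f(1,2) nc_mult_NC[OF fN nN] f(1,2) nc_mult_NC[OF gN(1) nN]] by simp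
  then have u: "ucl f = ucl g" using ucl_mult_right[OF fN r2 nN] ucl_mult_right[OF gN(1) _ nN] gN(2) ev f by simp
  have "g = hat f" using l u rank0_decomp(1)[OF gN] by (simp add: hat_def)
  then show ?thesis using g(2) hat_dg_dg[OF f(1,2) fN] f(4) by simp
qed

lemma retractable_ideal: "q \<le> r \<Longrightarrow> q \<le> 2 \<Longrightarrow> retractable (TL_sub C r) (TL_ideal C q)"
  unfolding retractable_def using ideal_is_ideal hat_retraction by blast

lemma the_retraction_eq:
  assumes q: "q \<le> r" "q \<le> 2" and x: "x \<in> TL_ideal C q"
  shows "the_retraction (TL_sub C r) (TL_ideal C q) x = hat_dg x"
proof -
  have "is_retraction (TL_sub C r) (TL_ideal C q) (the_retraction (TL_sub C r) (TL_ideal C q))"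
    unfolding the_retraction_def by (rule someI[of _ hat_dg]) (rule hat_retraction[OF q])
  then show ?thesis by (rule retraction_unique[OF q _ x])
qed

text \<open>Right multiplication of an element of rank 0 changes only its lower closure, and reaches
  every lower closure over every object.\<close>

lemma Green_R_rank0:
  assumes A: "A \<in> C" "B \<in> C" and f: "f \<in> NC (ob A) (ob B)" "nc_rank f = 0" and g: "g \<in> NC (ob A) (ob B)" "nc_rank g = 0"
  shows "(dg A B f, dg A B g) \<in> Green_R (TL_sub C r) \<longleftrightarrow> ucl f = ucl g"
proof -
  have r0: "h \<in> NCr s (ob A) (ob B)" if "h \<in> NC (ob A) (ob B)" "nc_rank h = 0" for h s
    using that by (simp add: NCr_def zero_enat_def[symmetric])
  have sub: "right_principal (TL_sub C r) (dg A B f) \<subseteq> right_principal (TL_sub C r) (dg A B g)"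
    if f: "f \<in> NC (ob A) (ob B)" "nc_rank f = 0" and g: "g \<in> NC (ob A) (ob B)" "nc_rank g = 0" and u: "ucl f = ucl g" for f g
  proof
    have fd: "f = ucl f \<odot> lcl f" and gd: "g = ucl f \<odot> lcl g"
      using rank0_decomp(1)[OF f] rank0_decomp(1)[OF g] u by auto
    have UV: "ucl f \<in> NC (ob A) {}" "lcl f \<in> NC {} (ob B)" "lcl g \<in> NC {} (ob B)"
      using ucl_NC[OF f(1)] lcl_NC[OF f(1)] lcl_NC[OF g(1)] ev A by auto
    obtain HB where H: "HB \<in> NC (ob B) {}" using ex_matching A by blast
    have into: "dg A D (ucl f \<odot> V) \<in> right_principal (TL_sub C r) (dg A B g)" if D: "D \<in> C" "V \<in> NC {} (ob D)" for D V
    proof -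
      have t: "HB \<odot> V \<in> NCr r (ob B) (ob D)" by (rule rank0_NCr[OF H D(2)])
      have "g \<odot> (HB \<odot> V) = ucl f \<odot> V"
        using middle_cancel[OF UV(1,3) H D(2)] gd by simp
      then have "dg A D (ucl f \<odot> V) = diagram_mult (dg A B g) (dg B D (HB \<odot> V))"
        using mult_dg[OF A D(1) g(1) NCr_NC[OF t]] by simp
      then show ?thesis using dg_in_ideal[OF A(2) D(1) t] unfolding right_principal_def TL_simps by force
    qed
    fix y assume "y \<in> right_principal (TL_sub C r) (dg A B f)"
    then consider "y = dg A B f" | s where "s \<in> TL_ideal C r" "source s = B" "y = diagram_mult (dg A B f) s"
      unfolding right_principal_def TL_simps by fastforce
    then show "y \<in> right_principal (TL_sub C r) (dg A B g)"
    proof cases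
      case 1 then show ?thesis using into[OF A(2) UV(2)] fd by simp
    next
      case 2
      then obtain D t where t: "D \<in> C" "t \<in> NCr r (ob B) (ob D)" "s = dg B D t" using ideal_iff by fastforce
      have "y = dg A D (f \<odot> t)" using 2 t mult_dg[OF A t(1) f(1) NCr_NC[OF t(2)]] by simp
      also have "f \<odot> t = ucl f \<odot> (lcl f \<odot> t)"
        using nc_mult_assoc[OF UV(1,2) NCr_NC[OF t(2)]] fd by simp
      finally show ?thesis using into[OF t(1) nc_mult_NC[OF UV(2) NCr_NC[OF t(2)]]] by simp
    qed
  qed
  show ?thesis
  proof
    assume "(dg A B f, dg A B g) \<in> Green_R (TL_sub C r)"
    then have "dg A B f \<in> right_principal (TL_sub C r) (dg A B g)"
      unfolding Green_R_def by (auto simp: right_principal_def)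
    then consider "dg A B f = dg A B g" | s where "s \<in> TL_ideal C r" "source s = B" "dg A B f = diagram_mult (dg A B g) s"
      unfolding right_principal_def TL_simps by fastforce
    then show "ucl f = ucl g"
    proof cases
      case 1 then show ?thesis using dg_eq_iff[OF A f(1) A g(1)] by simp
    next
      case 2
      then obtain D t where t: "D \<in> C" "t \<in> NCr r (ob B) (ob D)" "s = dg B D t" using ideal_iff by fastforce
      note tN = NCr_NC[OF t(2)]
      have "dg A B f = dg A D (g \<odot> t)" using 2 t mult_dg[OF A t(1) g(1) tN] by simp
      then have "f = g \<odot> t" using dg_eq_iff[OF A f(1) A(1) t(1) nc_mult_NC[OF g(1) tN]] by simp
      then show ?thesis using ucl_mult_right[OF g(1) _ tN] g(2) ev A by simp
    qed
  next
    assume u: "ucl f = ucl g"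
    have "dg A B f \<in> TL_ideal C r" "dg A B g \<in> TL_ideal C r" using dg_in_ideal[OF A] r0 f g by auto
    then show "(dg A B f, dg A B g) \<in> Green_R (TL_sub C r)"
      unfolding Green_R_def using sub[OF f g u] sub[OF g f u[symmetric]] by auto
  qed
qed

lemma Green_L_rank0:
  assumes A: "A \<in> C" "B \<in> C" and f: "f \<in> NC (ob A) (ob B)" "nc_rank f = 0" and g: "g \<in> NC (ob A) (ob B)" "nc_rank g = 0"
  shows "(dg A B f, dg A B g) \<in> Green_L (TL_sub C r) \<longleftrightarrow> lcl f = lcl g"
proof -
  have r0: "h \<in> NCr s (ob A) (ob B)" if "h \<in> NC (ob A) (ob B)" "nc_rank h = 0" for h s
    using that by (simp add: NCr_def zero_enat_def[symmetric])
  have sub: "left_principal (TL_sub C r) (dg A B f) \<subseteq> left_principal (TL_sub C r) (dg A B g)"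
    if f: "f \<in> NC (ob A) (ob B)" "nc_rank f = 0" and g: "g \<in> NC (ob A) (ob B)" "nc_rank g = 0" and u: "lcl f = lcl g" for f g
  proof
    have fd: "f = ucl f \<odot> lcl f" and gd: "g = ucl g \<odot> lcl f"
      using rank0_decomp(1)[OF f] rank0_decomp(1)[OF g] u by auto
    have UV: "ucl f \<in> NC (ob A) {}" "lcl f \<in> NC {} (ob B)" "ucl g \<in> NC (ob A) {}"
      using ucl_NC[OF f(1)] lcl_NC[OF f(1)] ucl_NC[OF g(1)] ev A by auto
    obtain HA where "HA \<in> NC (ob A) {}" using ex_matching A by blast
    then have H: "flip HA \<in> NC {} (ob A)" by (rule flip_NC)
    have into: "dg D B (U \<odot> lcl f) \<in> left_principal (TL_sub C r) (dg A B g)" if D: "D \<in> C" "U \<in> NC (ob D) {}" for D U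
    proof -
      have t: "U \<odot> flip HA \<in> NCr r (ob D) (ob A)" by (rule rank0_NCr[OF D(2) H])
      have "(U \<odot> flip HA) \<odot> g = U \<odot> lcl f"
        using middle_cancel[OF D(2) H UV(3,2)] gd by simp
      then have "dg D B (U \<odot> lcl f) = diagram_mult (dg D A (U \<odot> flip HA)) (dg A B g)"
        using mult_dg[OF D(1) A NCr_NC[OF t] g(1)] by simp
      then show ?thesis using dg_in_ideal[OF D(1) A(1) t] unfolding left_principal_def TL_simps by force
    qed
    fix y assume "y \<in> left_principal (TL_sub C r) (dg A B f)"
    then consider "y = dg A B f" | s where "s \<in> TL_ideal C r" "target s = A" "y = diagram_mult s (dg A B f)"
      unfolding left_principal_def TL_simps by fastforce
    then show "y \<in> left_principal (TL_sub C r) (dg A B g)"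
    proof cases
      case 1 then show ?thesis using into[OF A(1) UV(1)] fd by simp
    next
      case 2
      then obtain D t where t: "D \<in> C" "t \<in> NCr r (ob D) (ob A)" "s = dg D A t" using ideal_iff by fastforce
      have "y = dg D B (t \<odot> f)" using 2 t mult_dg[OF t(1) A NCr_NC[OF t(2)] f(1)] by simp
      also have "t \<odot> f = (t \<odot> ucl f) \<odot> lcl f"
        using nc_mult_assoc[OF NCr_NC[OF t(2)] UV(1,2)] fd by simp
      finally show ?thesis using into[OF t(1) nc_mult_NC[OF NCr_NC[OF t(2)] UV(1)]] by simp
    qed
  qed
  show ?thesis
  proof
    assume "(dg A B f, dg A B g) \<in> Green_L (TL_sub C r)"
    then have "dg A B f \<in> left_principal (TL_sub C r) (dg A B g)"
      unfolding Green_L_def by (auto simp: left_principal_def)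
    then consider "dg A B f = dg A B g" | s where "s \<in> TL_ideal C r" "target s = A" "dg A B f = diagram_mult s (dg A B g)"
      unfolding left_principal_def TL_simps by fastforce
    then show "lcl f = lcl g"
    proof cases
      case 1 then show ?thesis using dg_eq_iff[OF A f(1) A g(1)] by simp
    next
      case 2
      then obtain D t where t: "D \<in> C" "t \<in> NCr r (ob D) (ob A)" "s = dg D A t" using ideal_iff by fastforce
      note tN = NCr_NC[OF t(2)]
      have "dg A B f = dg D B (t \<odot> g)" using 2 t mult_dg[OF t(1) A tN g(1)] by simp
      then have "f = t \<odot> g" using dg_eq_iff[OF A f(1) t(1) A(2) nc_mult_NC[OF tN g(1)]] by simp
      then show ?thesis using lcl_mult_left[OF tN g(1)] g(2) ev A by simp
    qed
  next
    assume u: "lcl f = lcl g"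
    have "dg A B f \<in> TL_ideal C r" "dg A B g \<in> TL_ideal C r" using dg_in_ideal[OF A] r0 f g by auto
    then show "(dg A B f, dg A B g) \<in> Green_L (TL_sub C r)"
      unfolding Green_L_def using sub[OF f g u] sub[OF g f u[symmetric]] by auto
  qed
qed

lemma Rees_cong_eq:
  assumes "q \<le> r"
  shows "Rees_cong (TL_sub C r) (TL_ideal C q) = pairs_of (relG r q True True)"
proof (rule pairs_of_eqI[where r = r])
  have sub: "TL_ideal C q \<subseteq> TL_ideal C r" using ideal_is_ideal[OF assms] by (auto simp: is_ideal_def)
  fix x y assume "(x, y) \<in> Rees_cong (TL_sub C r) (TL_ideal C q)"
  then have "(x, y) \<in> sim (TL_sub C r)"
    unfolding Rees_cong_def subsemi_subsemi Delta_def using sub by (auto simp: sim_def Id_on_def)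
  then show "\<exists>A\<in>C. \<exists>B\<in>C. \<exists>f\<in>NCr r (ob A) (ob B). \<exists>g\<in>NCr r (ob A) (ob B). x = dg A B f \<and> y = dg A B g"
    by (rule sim_form)
next
  fix A B f g
  assume A: "A \<in> C" "B \<in> C" and f: "f \<in> NCr r (ob A) (ob B)" and g: "g \<in> NCr r (ob A) (ob B)"
  have e: "dg A B f = dg A B g \<longleftrightarrow> f = g" using dg_eq_iff[OF A NCr_NC[OF f] A NCr_NC[OF g]] by simp
  show "(dg A B f, dg A B g) \<in> Rees_cong (TL_sub C r) (TL_ideal C q) \<longleftrightarrow> relG r q True True A B f g"
    unfolding Rees_cong_def subsemi_subsemi Delta_def relG_def
    using A f g e dg_ideal_iff[OF A NCr_NC[OF f]] dg_ideal_iff[OF A NCr_NC[OF g]] dg_in_ideal[OF A f]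
    by (auto simp: sim_def Id_on_iff)
qed (rule relG_dom)

text \<open>Elements are compared through their retracts, which have rank 0 and the same closures as
  the elements themselves; so knowing \<open>K\<close> at rank 0 is enough.\<close>

lemma Green_cong_eq:
  assumes q: "q \<le> r" "q \<le> 2"
    and K: "\<And>A B f g. A \<in> C \<Longrightarrow> B \<in> C \<Longrightarrow> f \<in> NC (ob A) (ob B) \<Longrightarrow> nc_rank f = 0 \<Longrightarrow> g \<in> NC (ob A) (ob B) \<Longrightarrow> nc_rank g = 0 \<Longrightarrow>
       (dg A B f, dg A B g) \<in> K \<longleftrightarrow> (K1 \<or> ucl f = ucl g) \<and> (K2 \<or> lcl f = lcl g)"
  shows "Green_cong (TL_sub C r) K (TL_ideal C q) = pairs_of (relG r q K1 K2)"
proof (rule pairs_of_eqI[where r = r])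
  fix x y assume "(x, y) \<in> Green_cong (TL_sub C r) K (TL_ideal C q)"
  then have "(x, y) \<in> sim (TL_sub C r)"
    unfolding Green_cong_def Delta_def by (auto simp: sim_def Id_on_def)
  then show "\<exists>A\<in>C. \<exists>B\<in>C. \<exists>f\<in>NCr r (ob A) (ob B). \<exists>g\<in>NCr r (ob A) (ob B). x = dg A B f \<and> y = dg A B g"
    by (rule sim_form)
next
  fix A B f g
  assume A: "A \<in> C" "B \<in> C" and f: "f \<in> NCr r (ob A) (ob B)" and g: "g \<in> NCr r (ob A) (ob B)"
  note fN = NCr_NC[OF f] and gN = NCr_NC[OF g]
  have e: "dg A B f = dg A B g \<longleftrightarrow> f = g" using dg_eq_iff[OF A fN A gN] by simp
  have i: "dg A B f \<in> TL_ideal C q \<longleftrightarrow> enat (nc_rank f) \<le> q" "dg A B g \<in> TL_ideal C q \<longleftrightarrow> enat (nc_rank g) \<le> q"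
    by (rule dg_ideal_iff[OF A fN], rule dg_ideal_iff[OF A gN])
  have s: "(dg A B f, dg A B g) \<in> sim (TL_sub C r)"
    using dg_in_ideal[OF A f] dg_in_ideal[OF A g] by (simp add: sim_def)
  have hK: "(hat_dg (dg A B f), hat_dg (dg A B g)) \<in> K \<longleftrightarrow> (K1 \<or> ucl f = ucl g) \<and> (K2 \<or> lcl f = lcl g)"
    unfolding hat_dg_dg[OF A fN] hat_dg_dg[OF A gN]
    using K[OF A hat_props(1,2)[OF fN ev ev] hat_props(1,2)[OF gN ev ev]] hat_props(3,4)[OF fN ev ev] hat_props(3,4)[OF gN ev ev] A by simp
  show "(dg A B f, dg A B g) \<in> Green_cong (TL_sub C r) K (TL_ideal C q) \<longleftrightarrow> relG r q K1 K2 A B f g"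
  proof (cases "enat (nc_rank f) \<le> q \<and> enat (nc_rank g) \<le> q")
    case True
    then have t: "the_retraction (TL_sub C r) (TL_ideal C q) (dg A B f) = hat_dg (dg A B f)"
      "the_retraction (TL_sub C r) (TL_ideal C q) (dg A B g) = hat_dg (dg A B g)"
      using the_retraction_eq[OF q] i by auto
    show ?thesis
      unfolding Green_cong_def Delta_def relG_def
      using A f g e i s t hK True dg_in_ideal[OF A f] by (auto simp: Id_on_iff)
  next
    case False
    then show ?thesis
      unfolding Green_cong_def Delta_def relG_def
      using A f g e i dg_in_ideal[OF A f] by (auto simp: Id_on_iff)
  qed
qed (rule relG_dom)

lemma diamond_cong_eq:
  assumes q: "q \<le> r" "q \<le> 2"
  shows "diamond_cong k (TL_sub C r) (TL_ideal C q) = pairs_of (relG r q (k = Lam \<or> k = Rees) (k = Rho \<or> k = Rees))"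
proof (cases k)
  case Mu
  then show ?thesis
    using Green_cong_eq[OF q, of "Green_H (TL_sub C r)" False False] Green_R_rank0 Green_L_rank0
    by (auto simp: mu_cong_def Green_H_def)
next
  case Lam
  then show ?thesis
    using Green_cong_eq[OF q, of "Green_L (TL_sub C r)" True False] Green_L_rank0 by (auto simp: lambda_cong_def)
next
  case Rho
  then show ?thesis
    using Green_cong_eq[OF q, of "Green_R (TL_sub C r)" False True] Green_R_rank0 by (auto simp: rho_cong_def)
next
  case Rees
  then show ?thesis using Rees_cong_eq[OF q(1)] by simp
qed

end

section \<open>Existence of diagrams of prescribed rank\<close>

lemma full_exists:
  assumes "j \<le> n" "even n" "even j"
  shows "\<exists>P\<in>NC {1..int n} {1..int j}. nc_rank P = j"
  using assms
proof (induction "n - j" arbitrary: n rule: less_induct)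
  case less
  show ?case
  proof (cases "n = j")
    case True
    have "nc_id {1..int j} \<in> NC {1..int j} {1..int j}" "nc_rank (nc_id {1..int j}) = j"
      using nc_id_NC[of "{1..int j}"] nc_rank_id[of "{1..int j}"] by auto
    then show ?thesis using True by blast
  next
    case False
    have gap: "b + 2 \<le> a \<and> even (a - 2)" if "b \<le> a" "even a" "even b" "a \<noteq> b" for a b :: nat
      using that by presburger
    define m where "m = n - 2"
    have m: "n = m + 2" "j \<le> m" "even m" using gap[OF less.prems False] by (auto simp: m_def)
    have "m - j < n - j" using m by simp
    then obtain P where P: "P \<in> NC {1..int m} {1..int j}" "nc_rank P = j"
      using less.hyps[of m] m less.prems by blast
    let ?N = "{1..int n}" and ?p = "int m + 1" and ?q = "int m + 2"
    have pq: "adjacent ?N ?p ?q" using m by (auto simp: adjacent_def)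
    have d: "?N - {?p, ?q} = {1..int m}" using m by auto
    have N: "finite ?N" "\<And>a. a \<in> ?N \<Longrightarrow> 0 < a" by auto
    have c: "cup ?N ?p ?q \<in> NC ?N {1..int m}" using cup_NC[OF pq N] d by simp
    note c' = flip_NC[OF c] and P' = flip_NC[OF P(1)]
    let ?X = "cup ?N ?p ?q \<odot> P"
    have X: "?X \<in> NC ?N {1..int j}" by (rule nc_mult_NC[OF c P(1)])
    have cc: "flip (cup ?N ?p ?q) \<odot> cup ?N ?p ?q = nc_id {1..int m}"
      by (rule full_flip_mult[OF c]) (use cup_full[OF pq N] d in simp)
    have "flip ?X \<odot> ?X = flip P \<odot> ((flip (cup ?N ?p ?q) \<odot> cup ?N ?p ?q) \<odot> P)"
      using flip_mult[OF c P(1)] nc_mult_assoc[OF P' c' X] nc_mult_assoc[OF c' c P(1)] by simp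
    also have "\<dots> = nc_id {1..int j}"
      unfolding cc nc_mult_id_left[OF P(1)] by (rule full_flip_mult[OF P(1)]) (use P(2) in simp)
    finally have "nc_rank (flip ?X \<odot> ?X) = j" using nc_rank_id[of "{1..int j}"] by simp
    then have "j \<le> nc_rank ?X" using nc_rank_mult_right[OF flip_NC[OF X] X] by simp
    then have "nc_rank ?X = j" using nc_rank_le(1)[OF X] by simp
    then show ?thesis using X by blast
  qed
qed

context tl_category
begin

text \<open>Take \<open>P \<odot> flip P\<close> with \<open>P\<close> full over \<open>j\<close>
  points. Multiplying it by \<open>P\<close> gives back \<open>P\<close>, so no transversal has been
  lost.\<close>

lemma rank_exists:
  assumes A: "A \<in> C" and j: "even j" "j \<le> card (Field A)"
  shows "\<exists>f\<in>NC (ob A) (ob A). nc_rank f = j"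
proof -
  obtain P where P: "P \<in> NC (ob A) {1..int j}" "nc_rank P = j"
    using full_exists[OF j(2) _ j(1)] objects[OF A] by (auto simp: ob_def)
  note P' = flip_NC[OF P(1)]
  have f: "P \<odot> flip P \<in> NC (ob A) (ob A)" by (rule nc_mult_NC[OF P(1) P'])
  have "flip P \<odot> P = nc_id {1..int j}" by (rule full_flip_mult[OF P(1)]) (use P(2) in simp)
  then have "(P \<odot> flip P) \<odot> P = P" using nc_mult_assoc[OF P(1) P' P(1)] nc_mult_id_right[OF P(1)] by simp
  then have "j \<le> nc_rank (P \<odot> flip P)" using nc_rank_mult_left[OF f P(1)] P(2) by simp
  moreover have "nc_rank (P \<odot> flip P) \<le> j" using nc_rank_mult_left[OF P(1) P'] P(2) by simp
  ultimately show ?thesis using f by (intro bexI[of _ "P \<odot> flip P"]) auto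
qed

text \<open>The first two generators force different arcs at point 2 of four points, and a full
  \<open>P\<close> carries the resulting matchings injectively to \<open>A\<close>.\<close>

lemma two_matchings_exist:
  assumes A: "A \<in> C" and 4: "4 \<le> card (Field A)"
  shows "\<exists>H\<in>NC (ob A) {}. \<exists>H'\<in>NC (ob A) {}. H \<noteq> H'"
proof -
  obtain P where P: "P \<in> NC (ob A) {1..int 4}" "nc_rank P = 4"
    using full_exists[OF 4] objects[OF A] by (auto simp: ob_def)
  let ?K = "{1..int 4}"
  note P' = flip_NC[OF P(1)]
  have K: "finite ?K" "\<And>a. a \<in> ?K \<Longrightarrow> 0 < a" by auto
  obtain G where G: "G \<in> NC ?K {}" using NC_nonempty[OF K] by auto
  have adj: "adjacent ?K 1 2" "adjacent ?K 2 3" by (auto simp: adjacent_def)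
  let ?m = "hook ?K 1 2 \<odot> G" and ?n = "hook ?K 2 3 \<odot> G"
  have mn: "?m \<in> NC ?K {}" "?n \<in> NC ?K {}" using nc_mult_NC[OF hook_NC[OF K] G] adj by auto
  have "?m \<noteq> ?n"
  proof
    assume eq: "?m = ?n"
    have "?m (- 1) = - 2" "?m (- 2) = - 3" using hook_arc[OF K adj(1) G] hook_arc[OF K adj(2) G] eq by auto
    then show False using NC_D(8)[OF mn(1), of "- 1"] by simp
  qed
  moreover have "flip P \<odot> (P \<odot> m) = m" if m: "m \<in> NC ?K {}" for m
  proof -
    have "flip P \<odot> P = nc_id ?K" by (rule full_flip_mult[OF P(1)]) (use P(2) in simp)
    then show ?thesis using nc_mult_assoc[OF P' P(1) m] nc_mult_id_left[OF m] by simp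
  qed
  ultimately have "P \<odot> ?m \<noteq> P \<odot> ?n" using mn by metis
  then show ?thesis using nc_mult_NC[OF P(1) mn(1)] nc_mult_NC[OF P(1) mn(2)] by blast
qed

lemma xi_gt_ex:
  assumes "enat n < xi C"
  shows "\<exists>A\<in>C. n \<le> card (Field A)"
proof (rule ccontr)
  assume "\<not> ?thesis"
  then have "\<forall>A\<in>C. enat (card (Field A)) < enat n" by (simp add: not_le)
  then have "xi C \<le> enat n" unfolding xi_def by (rule Least_le)
  then show False using assms by simp
qed

section \<open>Classification for rank bounds of at least four\<close>

lemma pairs_relG_top: "pairs_of (relG r r True True) = sim (TL_sub C r)"
proof -
  have "relG r r True True = (\<lambda>A B f g. A \<in> C \<and> B \<in> C \<and> f \<in> NCr r (ob A) (ob B) \<and> g \<in> NCr r (ob A) (ob B))"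
    by (auto simp: fun_eq_iff relG_def NCr_def)
  then show ?thesis unfolding sim_eq by simp
qed

text \<open>A rank is \<open>bad\<close> if it is the larger rank in some nontrivial related pair. A
  bad rank from 4 on makes the relation full up to that rank, so the largest bad rank determines the
  congruence. If there is none, only ranks 0 and 2 are involved, and the relation is read off from
  retracts and closures.\<close>

lemma classification:
  assumes R: "tl_congruence C ob r rel" and r4: "4 \<le> r" and r: "(\<exists>n. r = enat n) \<or> r = \<infinity>"
  shows "(\<exists>k. \<exists>q\<in>{0, 2}. rel = relG r q (k = Lam \<or> k = Rees) (k = Rho \<or> k = Rees)) \<or>
    (\<exists>q. even q \<and> 4 \<le> q \<and> enat q < r \<and> rel = relG r (enat q) True True) \<or> rel = relG r r True True"
proof -
  interpret tl_congruence C ob r rel by (rule R)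
  define bad where "bad k \<longleftrightarrow> (\<exists>A B f g. rel A B f g \<and> f \<noteq> g \<and> nc_rank f = k \<and> nc_rank g \<le> k)" for k
  have N: "A \<in> C" "B \<in> C" "f \<in> NC (ob A) (ob B)" "g \<in> NC (ob A) (ob B)" if "rel A B f g" for A B f g
    using relD[OF that] NCr_NC by auto
  have bad_max: "bad (max (nc_rank f) (nc_rank g))" if R: "rel A B f g" "f \<noteq> g" for A B f g
  proof (cases "nc_rank g \<le> nc_rank f")
    case True then show ?thesis unfolding bad_def using R by (auto simp: max_def)
  next
    case False
    then have "rel A B g f \<and> g \<noteq> f \<and> nc_rank g = max (nc_rank f) (nc_rank g) \<and> nc_rank f \<le> max (nc_rank f) (nc_rank g)"
      using R rel_sym by (auto simp: max_def)
    then show ?thesis unfolding bad_def by blast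
  qed
  have bad_even: "even k" "enat k \<le> r" if b: "bad k" for k
  proof -
    obtain A B f g where f: "rel A B f g" "nc_rank f = k" using b unfolding bad_def by blast
    show "even k" using nc_rank_even[OF N(3)[OF f(1)]] ob_props[OF N(1)[OF f(1)]] f(2) by simp
    show "enat k \<le> r" using relD[OF f(1)] f(2) by (simp add: NCr_def)
  qed
  have univ: "rel A B f g"
    if k: "bad k" "4 \<le> k" and "A \<in> C" "B \<in> C" "f \<in> NC (ob A) (ob B)" "nc_rank f \<le> k" "g \<in> NC (ob A) (ob B)" "nc_rank g \<le> k"
    for k A B f g
    using k(1) high_rank_universal k(2) that unfolding bad_def by blast
  show ?thesis
  proof (cases "\<exists>k. bad k \<and> 4 \<le> k")
    case True
    show ?thesis
    \<comment> \<open>Bad ranks are at most \<open>r\<close>, so unboundedly many occur only for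
      \<open>r = \<infinity>\<close>; they give the top congruence.\<close>
    proof (cases "\<forall>n. \<exists>k\<ge>n. bad k")
      case unb: True
      have "rel A B f g" if fg: "A \<in> C" "B \<in> C" "f \<in> NC (ob A) (ob B)" "g \<in> NC (ob A) (ob B)" for A B f g
      proof -
        obtain k where k: "k \<ge> max 4 (max (nc_rank f) (nc_rank g))" "bad k" using unb by blast
        show ?thesis by (rule univ[OF k(2) _ fg(1,2,3) _ fg(4)]) (use k(1) in auto)
      qed
      then have "rel A B f g \<longleftrightarrow> relG r r True True A B f g" for A B f g
        using relD[of A B f g] by (auto simp: relG_def NCr_def)
      then show ?thesis by (auto simp: fun_eq_iff)
    next
      case False
      then obtain n where n: "\<And>k. bad k \<Longrightarrow> k < n" by (auto simp: not_le[symmetric])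
      have fin: "finite {k. bad k}" by (rule finite_subset[of _ "{..<n}"]) (use n in auto)
      define q where "q = Max {k. bad k}"
      have q: "bad q" using True Max_in[OF fin] unfolding q_def by blast
      have qm: "k \<le> q" if "bad k" for k unfolding q_def using Max_ge[OF fin] that by simp
      have q4: "4 \<le> q" using True qm by (meson order.trans)
      have eq: "rel A B f g \<longleftrightarrow> relG r (enat q) True True A B f g" for A B f g
      proof
        assume R: "rel A B f g"
        have "f \<noteq> g \<Longrightarrow> nc_rank f \<le> q \<and> nc_rank g \<le> q" using qm[OF bad_max[OF R]] by simp
        then show "relG r (enat q) True True A B f g" using relD[OF R] by (auto simp: relG_def)
      next
        assume R: "relG r (enat q) True True A B f g"
        show "rel A B f g"
        proof (cases "f = g")
          case True then show ?thesis using relG_dom[OF R] rel_refl by blast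
        next
          case False
          then have "nc_rank f \<le> q" "nc_rank g \<le> q" using R by (auto simp: relG_def)
          then show ?thesis using univ[OF q q4] relG_dom[OF R] NCr_NC by blast
        qed
      qed
      then have e: "rel = relG r (enat q) True True" by (simp add: fun_eq_iff)
      show ?thesis
      proof (cases "enat q = r")
        case True then show ?thesis using e by simp
      next
        case False
        then have "enat q < r" using bad_even(2)[OF q] by simp
        then show ?thesis using e q4 bad_even(1)[OF q] by blast
      qed
    qed
  next
    case False
    have small: "nc_rank f = 0 \<or> nc_rank f = 2" "nc_rank g = 0 \<or> nc_rank g = 2" if R: "rel A B f g" "f \<noteq> g" for A B f g
    proof -
      have "max (nc_rank f) (nc_rank g) < 4" using bad_max[OF R] False by (metis not_le)
      moreover have "even (nc_rank f)" "even (nc_rank g)"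
        using nc_rank_even[OF N(3)[OF R(1)]] nc_rank_even[OF N(4)[OF R(1)]] ob_props[OF N(1)[OF R(1)]] by auto
      moreover have "n < 4 \<Longrightarrow> even n \<Longrightarrow> n = 0 \<or> n = 2" for n :: nat by presburger
      ultimately show "nc_rank f = 0 \<or> nc_rank f = 2" "nc_rank g = 0 \<or> nc_rank g = 2" by auto
    qed
    \<comment> \<open>The congruence is nontrivial at rank 2 exactly if 2 is bad; then every element
      of rank 2 is related to its retract by \<open>rank_two_hat\<close>.\<close>
    define q :: nat where "q = (if bad 2 then 2 else 0)"
    have q_rank: "nc_rank f \<le> q \<and> nc_rank g \<le> q" if R: "rel A B f g" "f \<noteq> g" for A B f g
      using small[OF R] bad_max[OF R] by (auto simp: q_def)
    \<comment> \<open>\<open>a\<close> and \<open>b\<close> record whether closures above and below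
      are disregarded; by \<open>rank0_upper_universal\<close> and
      \<open>rank0_lower_universal\<close> a single instance at rank 0 decides this for all
      objects.\<close>
    define a where "a \<longleftrightarrow> (\<exists>A B f g. rel A B f g \<and> nc_rank f = 0 \<and> nc_rank g = 0 \<and> ucl f \<noteq> ucl g)"
    define b where "b \<longleftrightarrow> (\<exists>A B f g. rel A B f g \<and> nc_rank f = 0 \<and> nc_rank g = 0 \<and> lcl f \<noteq> lcl g)"
    have to_hat: "rel A B f (hat f)" if f: "A \<in> C" "B \<in> C" "f \<in> NC (ob A) (ob B)" "nc_rank f \<le> q" for A B f
    proof -
      have "even (nc_rank f)" using nc_rank_even[OF f(3)] ob_props[OF f(1)] by simp
      moreover have "n = 0 \<or> n = 2" if "n \<le> 2" "even n" for n :: nat using that by presburger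
      moreover have "q \<le> 2" by (simp add: q_def)
      ultimately have r02: "nc_rank f = 0 \<or> nc_rank f = 2" using f(4) by (metis order.trans)
      have b2: "bad 2" if "nc_rank f = 2"
      proof (rule ccontr)
        assume "\<not> bad 2"
        then have "q = 0" by (simp add: q_def)
        then show False using f(4) that by simp
      qed
      from r02 b2 consider "nc_rank f = 0" | "nc_rank f = 2" "bad 2" by metis
      then show ?thesis
      proof cases
        case 1
        then have "f \<in> NCr r (ob A) (ob B)" using f(3) by (simp add: NCr_def zero_enat_def[symmetric])
        then show ?thesis using hat_rank0[OF f(3) 1] rel_refl[OF f(1,2)] by simp
      next
        case 2
        then obtain A' B' x y where "rel A' B' x y" "x \<noteq> y" "nc_rank x = 2" "nc_rank y \<le> 2" unfolding bad_def by blast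
        then show ?thesis using rank_two_hat f 2(1) by blast
      qed
    qed
    have hats: "ucl (hat f) = ucl f" "lcl (hat f) = lcl f" "nc_rank (hat f) = 0" if "A \<in> C" "B \<in> C" "f \<in> NC (ob A) (ob B)" for A B f
      using hat_props(2,3,4)[OF that(3)] ev that by auto
    have eq: "rel A B f g \<longleftrightarrow> relG r (enat q) a b A B f g" for A B f g
    proof
      assume R: "rel A B f g"
      note n = N[OF R]
      have "f \<noteq> g \<Longrightarrow> (a \<or> ucl f = ucl g) \<and> (b \<or> lcl f = lcl g)"
      proof -
        assume "f \<noteq> g"
        then have "nc_rank f \<le> q" "nc_rank g \<le> q" using q_rank[OF R] by auto
        then have "rel A B (hat f) (hat g)"
          using to_hat[OF n(1,2,3)] to_hat[OF n(1,2,4)] R rel_sym rel_trans by meson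
        then show ?thesis unfolding a_def b_def using hats[OF n(1,2,3)] hats[OF n(1,2,4)] by metis
      qed
      then show "relG r (enat q) a b A B f g" using relD[OF R] q_rank[OF R] by (auto simp: relG_def)
    next
      assume R: "relG r (enat q) a b A B f g"
      have n: "A \<in> C" "B \<in> C" "f \<in> NC (ob A) (ob B)" "g \<in> NC (ob A) (ob B)" using relG_dom[OF R] NCr_NC by auto
      show "rel A B f g"
      proof (cases "f = g")
        case True then show ?thesis using relG_dom[OF R] rel_refl by blast
      next
        case False
        then have f: "nc_rank f \<le> q" "nc_rank g \<le> q" "a \<or> ucl f = ucl g" "b \<or> lcl f = lcl g"
          using R by (auto simp: relG_def)
        have UV: "ucl f \<in> NC (ob A) {}" "ucl g \<in> NC (ob A) {}" "lcl f \<in> NC {} (ob B)" "lcl g \<in> NC {} (ob B)"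
          using ucl_NC lcl_NC ev n by auto
        \<comment> \<open>The upper closure is changed first and the lower one afterwards, via an
          intermediate element of rank 0.\<close>
        have 1: "rel A B (ucl f \<odot> lcl f) (ucl g \<odot> lcl f)"
        proof (cases "ucl f = ucl g")
          case True then show ?thesis using rel_refl[OF n(1,2) rank0_NCr[OF UV(2,3)]] by simp
        next
          case False
          then obtain A' B' x y where "rel A' B' x y" "nc_rank x = 0" "nc_rank y = 0" "ucl x \<noteq> ucl y" using f(3) a_def by blast
          then show ?thesis by (rule rank0_upper_universal[OF r4 _ _ _ _ n(1,2) UV(1,2,3)])
        qed
        have 2: "rel A B (ucl g \<odot> lcl f) (ucl g \<odot> lcl g)"
        proof (cases "lcl f = lcl g")
          case True then show ?thesis using rel_refl[OF n(1,2) rank0_NCr[OF UV(2,4)]] by simp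
        next
          case False
          then obtain A' B' x y where "rel A' B' x y" "nc_rank x = 0" "nc_rank y = 0" "lcl x \<noteq> lcl y" using f(4) b_def by blast
          then show ?thesis by (rule rank0_lower_universal[OF r4 _ _ _ _ n(1,2) UV(2,3,4)])
        qed
        have "rel A B (hat f) (hat g)" unfolding hat_def by (rule rel_trans[OF 1 2])
        then show ?thesis using to_hat[OF n(1,2,3) f(1)] to_hat[OF n(1,2,4) f(2)] rel_sym rel_trans by meson
      qed
    qed
    define k where "k = (if a \<and> b then Rees else if a then Lam else if b then Rho else Mu)"
    have k: "a = (k = Lam \<or> k = Rees)" "b = (k = Rho \<or> k = Rees)" by (auto simp: k_def)
    have "rel = relG r (enat q) (k = Lam \<or> k = Rees) (k = Rho \<or> k = Rees)"
      using eq unfolding k[symmetric] by (simp add: fun_eq_iff)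
    moreover have "enat q \<in> {0, 2}" by (auto simp: q_def zero_enat_def numeral_eq_enat)
    ultimately show ?thesis by blast
  qed
qed

text \<open>An object with four points separates the eight relations: its two matchings give pairs
  that differ in one closure only, and an element of rank 2 with its retract tells
  \<open>q = 2\<close> from \<open>q = 0\<close>.\<close>

lemma relG_mono_iff:
  assumes q: "q \<in> {0, 2}" "q' \<in> {0, 2}" and r: "2 \<le> r" and w: "\<exists>A\<in>C. 4 \<le> card (Field A)"
  shows "pairs_of (relG r q a b) \<subseteq> pairs_of (relG r q' a' b') \<longleftrightarrow> q \<le> q' \<and> (a \<longrightarrow> a') \<and> (b \<longrightarrow> b')"
proof -
  have "(\<forall>A B f g. relG r q a b A B f g \<longrightarrow> relG r q' a' b' A B f g) \<longleftrightarrow> q \<le> q' \<and> (a \<longrightarrow> a') \<and> (b \<longrightarrow> b')"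
  proof
    assume S: "\<forall>A B f g. relG r q a b A B f g \<longrightarrow> relG r q' a' b' A B f g"
    obtain A where A: "A \<in> C" "4 \<le> card (Field A)" using w by blast
    obtain H H' where H: "H \<in> NC (ob A) {}" "H' \<in> NC (ob A) {}" "H \<noteq> H'" using two_matchings_exist[OF A] by blast
    note fH = flip_NC[OF H(1)] flip_NC[OF H(2)]
    have z: "nc_rank (X \<odot> Y) = 0" "ucl (X \<odot> Y) = X" "lcl (X \<odot> Y) = Y" "X \<odot> Y \<in> NCr r (ob A) (ob A)"
      if "X \<in> NC (ob A) {}" "Y \<in> NC {} (ob A)" for X Y
      using rank0_mult[OF that] rank0_NCr[OF that] by auto
    have fne: "flip H \<noteq> flip H'" using H(3) by (metis flip_flip)
    have ne1: "H \<odot> flip H \<noteq> H' \<odot> flip H" using z(2)[OF H(1) fH(1)] z(2)[OF H(2) fH(1)] H(3) by metis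
    have ne2: "H \<odot> flip H \<noteq> H \<odot> flip H'" using z(3)[OF H(1) fH(1)] z(3)[OF H(1) fH(2)] fne by metis
    have "a \<longrightarrow> a'"
    proof
      assume a
      then have "relG r q a b A A (H \<odot> flip H) (H' \<odot> flip H)"
        using A z[OF H(1) fH(1)] z[OF H(2) fH(1)] by (simp add: relG_def zero_enat_def[symmetric])
      then have "relG r q' a' b' A A (H \<odot> flip H) (H' \<odot> flip H)" using S by blast
      then show a' using ne1 z[OF H(1) fH(1)] z[OF H(2) fH(1)] H(3) by (simp add: relG_def)
    qed
    moreover have "b \<longrightarrow> b'"
    proof
      assume b
      then have "relG r q a b A A (H \<odot> flip H) (H \<odot> flip H')"
        using A z[OF H(1) fH(1)] z[OF H(1) fH(2)] by (simp add: relG_def zero_enat_def[symmetric])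
      then have "relG r q' a' b' A A (H \<odot> flip H) (H \<odot> flip H')" using S by blast
      then show b' using ne2 z[OF H(1) fH(1)] z[OF H(1) fH(2)] fne by (simp add: relG_def)
    qed
    moreover have "q \<le> q'"
    proof (rule ccontr)
      assume "\<not> q \<le> q'"
      then have q: "q = 2" "q' = 0" using q by auto
      obtain f where f: "f \<in> NC (ob A) (ob A)" "nc_rank f = 2" using rank_exists[OF A(1), of 2] A(2) by auto
      have h: "hat f \<in> NCr r (ob A) (ob A)" "nc_rank (hat f) = 0" "ucl (hat f) = ucl f" "lcl (hat f) = lcl f"
        using hat_NCr[OF A(1,1) f(1)] hat_props(2-4)[OF f(1) ev[OF A(1)] ev[OF A(1)]] by auto
      have "f \<in> NCr r (ob A) (ob A)" using f r by (simp add: NCr_def numeral_eq_enat)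
      then have "relG r q a b A A f (hat f)"
        using A h f q by (simp add: relG_def numeral_eq_enat)
      then have "relG r q' a' b' A A f (hat f)" using S by blast
      moreover have "f \<noteq> hat f" using f(2) h(2) by auto
      ultimately show False using f(2) q by (simp add: relG_def zero_enat_def)
    qed
    ultimately show "q \<le> q' \<and> (a \<longrightarrow> a') \<and> (b \<longrightarrow> b')" by blast
  qed (auto simp: relG_def intro: order.trans)
  then show ?thesis using pairs_of_subset_iff[OF relG_dom[of r q a b] relG_dom[of r q' a' b']] by simp
qed

lemma diamond_le_iff: "diamond_le k k' \<longleftrightarrow>
    ((k = Lam \<or> k = Rees) \<longrightarrow> (k' = Lam \<or> k' = Rees)) \<and> ((k = Rho \<or> k = Rees) \<longrightarrow> (k' = Rho \<or> k' = Rees))"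
  by (cases k; cases k') (auto simp: diamond_le_def)

text \<open>Strictness is witnessed by an element \<open>f\<close> of rank \<open>j\<close> and any
  element of rank 0 with the same rows. \<open>hat f\<close> is a convenient one, even at ranks
  where it depends on the chosen closures.\<close>

lemma relG_strict:
  assumes q: "q < j" "enat j \<le> q'" "q' \<le> r" and A: "A \<in> C" "even j" "j \<le> card (Field A)"
  shows "pairs_of (relG r (enat q) True True) \<subset> pairs_of (relG r q' True True)"
proof -
  obtain f where f: "f \<in> NC (ob A) (ob A)" "nc_rank f = j" using rank_exists[OF A] by blast
  have h: "hat f \<in> NCr r (ob A) (ob A)" "nc_rank (hat f) = 0"
    using hat_NCr[OF A(1,1) f(1)] hat_props(2)[OF f(1) ev[OF A(1)] ev[OF A(1)]] by auto
  have fr: "f \<in> NCr r (ob A) (ob A)" using f q by (auto simp: NCr_def)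
  have ne: "f \<noteq> hat f" using f(2) h(2) q(1) by auto
  have qq: "enat q \<le> q'" using q(1,2) by (metis enat_ord_simps(1) less_imp_le order.trans)
  have "relG r q' True True A A f (hat f)"
    using A(1) h fr f(2) q by (simp add: relG_def zero_enat_def[symmetric])
  moreover have "\<not> relG r (enat q) True True A A f (hat f)" using ne f(2) q(1) by (simp add: relG_def)
  moreover have "\<forall>A B f g. relG r (enat q) True True A B f g \<longrightarrow> relG r q' True True A B f g"
  proof (intro allI impI)
    fix A B f g assume R: "relG r (enat q) True True A B f g"
    then have "f = g \<or> nc_rank f \<le> q \<and> nc_rank g \<le> q" by (simp add: relG_def)
    then have "f = g \<or> enat (nc_rank f) \<le> q' \<and> enat (nc_rank g) \<le> q'" using enat_le_trans[OF _ qq] by blast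
    then show "relG r q' True True A B f g" using relG_dom[OF R] by (simp add: relG_def)
  qed
  moreover have "pairs_of (relG r u True True) \<subseteq> pairs_of (relG r v True True) \<longleftrightarrow>
      (\<forall>A B f g. relG r u True True A B f g \<longrightarrow> relG r v True True A B f g)" for u v
    by (rule pairs_of_subset_iff[where r = r and r' = r]) (rule relG_dom, assumption)+
  ultimately show ?thesis unfolding less_le_not_le by metis
qed

theorem part_three:
  assumes r: "(\<exists>n. r = enat n \<and> even n \<and> 4 \<le> n \<and> r < xi C) \<or> (r = \<infinity> \<and> xi C = \<infinity>)"
  shows "(\<forall>q\<in>{0, 2}. retractable (TL_sub C r) (TL_ideal C q)) \<and>
       Cong (TL_sub C r) =
         {diamond_cong k (TL_sub C r) (TL_ideal C q) | k q. q \<in> {0, 2}} \<union>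
         {Rees_cong (TL_sub C r) (TL_ideal C (enat q)) | q. even q \<and> 4 \<le> q \<and> enat q < r} \<union>
         {sim (TL_sub C r)} \<and>
       (\<forall>q\<in>{0, 2}. \<forall>q'\<in>{0, 2}. \<forall>k k'.
          diamond_cong k (TL_sub C r) (TL_ideal C q) \<subseteq> diamond_cong k' (TL_sub C r) (TL_ideal C q')
            \<longleftrightarrow> q \<le> q' \<and> diamond_le k k') \<and>
       inj_on (\<lambda>(k, q). diamond_cong k (TL_sub C r) (TL_ideal C q)) (UNIV \<times> {0, 2}) \<and>
       (\<forall>q q'. even q \<and> even q' \<and> 2 \<le> q \<and> q < q' \<and> enat q' < r \<longrightarrow>
          Rees_cong (TL_sub C r) (TL_ideal C (enat q)) \<subset> Rees_cong (TL_sub C r) (TL_ideal C (enat q'))) \<and>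
       (\<forall>q. even q \<and> 2 \<le> q \<and> enat q < r \<longrightarrow>
          Rees_cong (TL_sub C r) (TL_ideal C (enat q)) \<subset> sim (TL_sub C r)) \<and>
       (\<forall>\<sigma>\<in>Cong (TL_sub C r). \<sigma> \<subseteq> sim (TL_sub C r))"
proof -
  have r4: "4 \<le> r" using r by (auto simp: numeral_eq_enat)
  have r24: "(2::enat) \<le> 4" by (simp add: numeral_eq_enat)
  have r2: "2 \<le> r" using r24 r4 by (rule order.trans)
  have big: "\<exists>A\<in>C. j \<le> card (Field A)" if j: "enat j \<le> r" for j
    using r
  proof
    assume "\<exists>n. r = enat n \<and> even n \<and> 4 \<le> n \<and> r < xi C"
    then have "enat j < xi C" using j by (metis le_less_trans)
    then show ?thesis by (rule xi_gt_ex)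
  next
    assume "r = \<infinity> \<and> xi C = \<infinity>"
    then show ?thesis using xi_gt_ex[of j] by simp
  qed
  have w4: "\<exists>A\<in>C. 4 \<le> card (Field A)" using big[of 4] r4 by (simp add: numeral_eq_enat)
  have qr: "q \<le> r" "q \<le> 2" if "q \<in> {0, 2}" for q :: enat using that r2 by auto
  have dc: "diamond_cong k (TL_sub C r) (TL_ideal C q) = pairs_of (relG r q (k = Lam \<or> k = Rees) (k = Rho \<or> k = Rees))"
    if "q \<in> {0, 2}" for k q by (rule diamond_cong_eq[OF qr[OF that]])
  have rc: "Rees_cong (TL_sub C r) (TL_ideal C (enat q)) = pairs_of (relG r (enat q) True True)" if "enat q < r" for q
    by (rule Rees_cong_eq) (use that in simp)
  have incl: "diamond_cong k (TL_sub C r) (TL_ideal C q) \<subseteq> diamond_cong k' (TL_sub C r) (TL_ideal C q')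
            \<longleftrightarrow> q \<le> q' \<and> diamond_le k k'" if q: "q \<in> {0, 2}" "q' \<in> {0, 2}" for q q' k k'
    unfolding dc[OF q(1)] dc[OF q(2)] diamond_le_iff by (rule relG_mono_iff[OF q r2 w4])
  have c2: "Cong (TL_sub C r) =
         {diamond_cong k (TL_sub C r) (TL_ideal C q) | k q. q \<in> {0, 2}} \<union>
         {Rees_cong (TL_sub C r) (TL_ideal C (enat q)) | q. even q \<and> 4 \<le> q \<and> enat q < r} \<union>
         {sim (TL_sub C r)}" (is "_ = ?A \<union> ?B \<union> ?D")
  proof
    show "Cong (TL_sub C r) \<subseteq> ?A \<union> ?B \<union> ?D"
    proof
      fix \<sigma> assume s: "\<sigma> \<in> Cong (TL_sub C r)"
      have rr: "(\<exists>n. r = enat n) \<or> r = \<infinity>" using r by blast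
      note e = Cong_rel_of(2)[OF s]
      from classification[OF Cong_rel_of(1)[OF s] r4 rr] show "\<sigma> \<in> ?A \<union> ?B \<union> ?D"
      proof (elim disjE exE bexE conjE)
        fix k q assume "q \<in> {0, 2}" "rel_of r \<sigma> = relG r q (k = Lam \<or> k = Rees) (k = Rho \<or> k = Rees)"
        then have "\<sigma> = diamond_cong k (TL_sub C r) (TL_ideal C q)" using e dc by metis
        then show ?thesis using \<open>q \<in> {0, 2}\<close> by blast
      next
        fix q assume q: "even q" "4 \<le> q" "enat q < r" "rel_of r \<sigma> = relG r (enat q) True True"
        then have "\<sigma> = Rees_cong (TL_sub C r) (TL_ideal C (enat q))" using e rc by metis
        then show ?thesis using q by blast
      next
        assume "rel_of r \<sigma> = relG r r True True"
        then have "\<sigma> = sim (TL_sub C r)" using e pairs_relG_top by metis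
        then show ?thesis by blast
      qed
    qed
    show "?A \<union> ?B \<union> ?D \<subseteq> Cong (TL_sub C r)"
    proof (intro Un_least subsetI)
      fix \<sigma> assume "\<sigma> \<in> ?A"
      then obtain k q where "q \<in> {0, 2}" "\<sigma> = diamond_cong k (TL_sub C r) (TL_ideal C q)" by blast
      then show "\<sigma> \<in> Cong (TL_sub C r)"
        using dc pairs_of_Cong[OF relG_congruence] qr(2) by metis
    next
      fix \<sigma> assume "\<sigma> \<in> ?B"
      then obtain q where "enat q < r" "\<sigma> = Rees_cong (TL_sub C r) (TL_ideal C (enat q))" by blast
      then show "\<sigma> \<in> Cong (TL_sub C r)"
        using rc pairs_of_Cong[OF relG_congruence] by metis
    next
      fix \<sigma> assume "\<sigma> \<in> ?D"
      then show "\<sigma> \<in> Cong (TL_sub C r)"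
        using pairs_relG_top pairs_of_Cong[OF relG_congruence] by (metis singletonD)
    qed
  qed
  have c4: "inj_on (\<lambda>(k, q). diamond_cong k (TL_sub C r) (TL_ideal C q)) (UNIV \<times> {0, 2})"
  proof (rule inj_onI)
    fix x y assume xy: "x \<in> UNIV \<times> {0, 2::enat}" "y \<in> UNIV \<times> {0, 2::enat}"
      "(case x of (k, q) \<Rightarrow> diamond_cong k (TL_sub C r) (TL_ideal C q)) = (case y of (k, q) \<Rightarrow> diamond_cong k (TL_sub C r) (TL_ideal C q))"
    obtain k q where x: "x = (k, q)" by (cases x)
    obtain k' q' where y: "y = (k', q')" by (cases y)
    have q: "q \<in> {0, 2}" "q' \<in> {0, 2}" using xy x y by auto
    note eqd = xy(3)[unfolded x y prod.case]
    have "q \<le> q' \<and> diamond_le k k'" by (rule iffD1[OF incl[OF q] equalityD1[OF eqd]])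
    moreover have "q' \<le> q \<and> diamond_le k' k" by (rule iffD1[OF incl[OF q(2,1)] equalityD2[OF eqd]])
    ultimately show "x = y" unfolding x y by (auto simp: diamond_le_def)
  qed
  have c5: "Rees_cong (TL_sub C r) (TL_ideal C (enat q)) \<subset> Rees_cong (TL_sub C r) (TL_ideal C (enat q'))"
    if q: "even q'" "q < q'" "enat q' < r" for q q'
  proof -
    obtain A where A: "A \<in> C" "q' \<le> card (Field A)" using big[OF less_imp_le[OF q(3)]] by blast
    have qr': "enat q < r" using q(2,3) by (metis enat_ord_simps(2) order.strict_trans)
    show ?thesis unfolding rc[OF q(3)] rc[OF qr']
      by (rule relG_strict[OF q(2) order.refl less_imp_le[OF q(3)] A(1) q(1) A(2)])
  qed
  have c6: "Rees_cong (TL_sub C r) (TL_ideal C (enat q)) \<subset> sim (TL_sub C r)" if q: "even q" "enat q < r" for q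
  proof -
    \<comment> \<open>A finite \<open>r\<close> is even, so the next even number after
      \<open>q\<close> is still at most \<open>r\<close>; elements of rank \<open>q + 2\<close> will
      witness strictness.\<close>
    have j: "enat (q + 2) \<le> r"
    proof (cases r)
      case (enat n)
      then have "even n" "q < n" using r q by auto
      then have "q + 2 \<le> n" using q(1) by presburger
      then show ?thesis using enat by simp
    qed simp
    obtain A where A: "A \<in> C" "q + 2 \<le> card (Field A)" using big[OF j] by blast
    show ?thesis
      unfolding pairs_relG_top[symmetric] rc[OF q(2)]
      by (rule relG_strict[OF _ j order.refl A(1) _ A(2)]) (use q in auto)
  qed
  have c1: "\<forall>q\<in>{0, 2}. retractable (TL_sub C r) (TL_ideal C q)"
    by (intro ballI) (rule retractable_ideal[OF qr])
  have c3: "\<forall>q\<in>{0, 2}. \<forall>q'\<in>{0, 2}. \<forall>k k'.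
          diamond_cong k (TL_sub C r) (TL_ideal C q) \<subseteq> diamond_cong k' (TL_sub C r) (TL_ideal C q')
            \<longleftrightarrow> q \<le> q' \<and> diamond_le k k'"
    by (intro ballI allI) (rule incl)
  have c5': "\<forall>q q'. even q \<and> even q' \<and> 2 \<le> q \<and> q < q' \<and> enat q' < r \<longrightarrow>
          Rees_cong (TL_sub C r) (TL_ideal C (enat q)) \<subset> Rees_cong (TL_sub C r) (TL_ideal C (enat q'))"
    by (intro allI impI, elim conjE) (rule c5)
  have c6': "\<forall>q. even q \<and> 2 \<le> q \<and> enat q < r \<longrightarrow>
          Rees_cong (TL_sub C r) (TL_ideal C (enat q)) \<subset> sim (TL_sub C r)"
    by (intro allI impI, elim conjE) (rule c6)
  have c7: "\<forall>\<sigma>\<in>Cong (TL_sub C r). \<sigma> \<subseteq> sim (TL_sub C r)" by (simp add: Cong_def)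
  show ?thesis by (rule conjI[OF c1 conjI[OF c2 conjI[OF c3 conjI[OF c4 conjI[OF c5' conjI[OF c6' c7]]]]]])
qed

end

section \<open>Ranks zero and two\<close>

lemma equiv_image:
  assumes h: "bij_betw h M N" and R: "equiv M R"
  shows "equiv N {(h x, h y) | x y. (x, y) \<in> R}" (is "equiv N ?E")
    and "x \<in> M \<Longrightarrow> y \<in> M \<Longrightarrow> (h x, h y) \<in> {(h x, h y) | x y. (x, y) \<in> R} \<longleftrightarrow> (x, y) \<in> R"
proof -
  note E = equiv_D[OF R]
  have inj: "x = y" if "x \<in> M" "y \<in> M" "h x = h y" for x y
    using h that by (auto simp: bij_betw_def inj_on_def)
  have surj: "\<exists>x\<in>M. u = h x" if "u \<in> N" for u using h that by (auto simp: bij_betw_def)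
  have into: "h x \<in> N" if "x \<in> M" for x using h that bij_betwE by blast
  show iff: "(h x, h y) \<in> ?E \<longleftrightarrow> (x, y) \<in> R" if xy: "x \<in> M" "y \<in> M" for x y
  proof
    assume "(h x, h y) \<in> ?E"
    then obtain u v where uv: "h x = h u" "h y = h v" "(u, v) \<in> R" by blast
    have "x = u" "y = v" using inj[OF xy(1) _ uv(1)] inj[OF xy(2) _ uv(2)] E(4)[OF uv(3)] by blast+
    then show "(x, y) \<in> R" using uv(3) by simp
  qed blast
  have form: "\<exists>x y. u = h x \<and> v = h y \<and> (x, y) \<in> R \<and> x \<in> M \<and> y \<in> M" if "(u, v) \<in> ?E" for u v
    using that E(4) by blast
  show "equiv N ?E"
  proof (rule equiv_intro)
    fix u assume "u \<in> N"
    then obtain x where "x \<in> M" "u = h x" using surj by blast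
    then show "(u, u) \<in> ?E" using E(1) by blast
  next
    fix u v assume "(u, v) \<in> ?E"
    then obtain x y where "u = h x" "v = h y" "(x, y) \<in> R" "x \<in> M" "y \<in> M" using form by blast
    then show "(v, u) \<in> ?E" "u \<in> N \<and> v \<in> N" using E(2) into by blast+
  next
    fix u v w assume uv: "(u, v) \<in> ?E" and vw: "(v, w) \<in> ?E"
    obtain x y where x: "u = h x" "v = h y" "(x, y) \<in> R" "x \<in> M" "y \<in> M" using form[OF uv] by blast
    obtain y' z where z: "v = h y'" "w = h z" "(y', z) \<in> R" "y' \<in> M" "z \<in> M" using form[OF vw] by blast
    have "y' = y" by (rule inj[OF z(4) x(5)]) (use x z in simp)
    then have "(x, z) \<in> R" using E(3)[OF x(3)] z(3) by blast
    then show "(u, w) \<in> ?E" using x z by blast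
  qed
qed

lemma equiv_tag:
  assumes e: "equiv P e"
  shows "equiv ({c} \<times> P) {(p, q). fst p = c \<and> fst q = c \<and> (snd p, snd q) \<in> e}" (is "equiv _ ?E")
proof (rule equiv_intro)
  fix x y z
  show "(x, x) \<in> ?E" if "x \<in> {c} \<times> P"
    using that equiv_D(1)[OF e, of "snd x"] by (simp add: mem_Times_iff)
  show "(y, x) \<in> ?E" if "(x, y) \<in> ?E"
    using that equiv_D(2)[OF e, of "snd x" "snd y"] by simp
  show "(x, z) \<in> ?E" if "(x, y) \<in> ?E" "(y, z) \<in> ?E"
    using that equiv_D(3)[OF e, of "snd x" "snd y" "snd z"] by simp
  show "x \<in> {c} \<times> P \<and> y \<in> {c} \<times> P" if "(x, y) \<in> ?E"
    using that equiv_D(4)[OF e, of "snd x" "snd y"] by (simp add: mem_Times_iff)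
qed

lemma equiv_untag: "equiv ({c} \<times> P) E \<Longrightarrow> equiv P {(x, y). ((c, x), (c, y)) \<in> E}"
  by (rule equiv_intro) (auto dest: equiv_D)

lemma lattice_isomorphicD: "lattice_isomorphic L M \<Longrightarrow> lattice L \<and> lattice M"
  by (auto simp: lattice_isomorphic_def join_pres_def)

context tl_category
begin

section \<open>The minimal ideal as a partial rectangular band\<close>

lemma NCr_zero:
  assumes "A \<in> C" "B \<in> C" "f \<in> NCr 0 (ob A) (ob B)"
  shows "f \<in> NC (ob A) (ob B)" "nc_rank f = 0" "ucl f \<in> NC (ob A) {}" "lcl f \<in> NC {} (ob B)"
    "flip (lcl f) \<in> NC (ob B) {}" "ucl f \<odot> lcl f = f" "hat f = f"
proof -
  show f: "f \<in> NC (ob A) (ob B)" "nc_rank f = 0" using assms(3) by (auto simp: NCr_def zero_enat_def)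
  show "ucl f \<in> NC (ob A) {}" by (rule ucl_NC[OF f(1) ev[OF assms(2)]])
  show l: "lcl f \<in> NC {} (ob B)" by (rule lcl_NC[OF f(1) ev[OF assms(1)]])
  show "flip (lcl f) \<in> NC (ob B) {}" by (rule flip_NC[OF l])
  show "ucl f \<odot> lcl f = f" by (rule rank0_decomp(1)[OF f])
  show "hat f = f" by (rule hat_rank0[OF f])
qed

lemma NCr_mono: "f \<in> NCr q D E \<Longrightarrow> q \<le> r \<Longrightarrow> f \<in> NCr r D E"
  by (auto simp: NCr_def intro: order.trans)

text \<open>The relations \<open>\<sigma>\<close> of a partial rectangular band in terms of
  involutions. The lower closure is reflected so that both coordinates are matchings of an upper
  row.\<close>

definition fam :: "('a rel \<Rightarrow> ('a rel \<times> 'a rel) set) \<Rightarrow> ('a rel \<Rightarrow> ('a rel \<times> 'a rel) set) \<Rightarrow>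
    'a rel \<Rightarrow> 'a rel \<Rightarrow> (int \<Rightarrow> int) \<Rightarrow> (int \<Rightarrow> int) \<Rightarrow> bool" where
  "fam e1 e2 A B f g \<longleftrightarrow> A \<in> C \<and> B \<in> C \<and> f \<in> NCr 0 (ob A) (ob B) \<and> g \<in> NCr 0 (ob A) (ob B) \<and>
     (eqv A (ucl f), eqv A (ucl g)) \<in> e1 A \<and> (eqv B (flip (lcl f)), eqv B (flip (lcl g))) \<in> e2 B"

lemma fam_dom: "fam e1 e2 A B f g \<Longrightarrow> A \<in> C \<and> B \<in> C \<and> f \<in> NCr 0 (ob A) (ob B) \<and> g \<in> NCr 0 (ob A) (ob B)"
  by (simp add: fam_def)

lemma eqv_in: "A \<in> C \<Longrightarrow> H \<in> NC (ob A) {} \<Longrightarrow> eqv A H \<in> planar_Eq2 A"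
  by (rule eqv_planar[OF objD])

text \<open>Left multiplication by \<open>s\<close> replaces the upper coordinate of both elements
  by that of \<open>s\<close> and keeps the lower coordinates; right multiplication does the
  reverse.\<close>

lemma fam_congruence:
  assumes e: "\<And>A. A \<in> C \<Longrightarrow> equiv (planar_Eq2 A) (e1 A)" "\<And>A. A \<in> C \<Longrightarrow> equiv (planar_Eq2 A) (e2 A)"
  shows "tl_congruence C ob 0 (fam e1 e2)"
proof unfold_locales
  show "finite (ob A) \<and> (\<forall>a\<in>ob A. 0 < a) \<and> even (card (ob A))" if "A \<in> C" for A by (rule ob_props[OF that])
  show "A \<in> C \<and> B \<in> C \<and> f \<in> NCr 0 (ob A) (ob B) \<and> g \<in> NCr 0 (ob A) (ob B)" if "fam e1 e2 A B f g" for A B f g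
    by (rule fam_dom[OF that])
  show "fam e1 e2 A B f f" if A: "A \<in> C" "B \<in> C" "f \<in> NCr 0 (ob A) (ob B)" for A B f
    using A equiv_D(1)[OF e(1)[OF A(1)] eqv_in[OF A(1) NCr_zero(3)[OF A]]]
      equiv_D(1)[OF e(2)[OF A(2)] eqv_in[OF A(2) NCr_zero(5)[OF A]]] by (simp add: fam_def)
  show "fam e1 e2 A B g f" if R: "fam e1 e2 A B f g" for A B f g
    using R equiv_D(2)[OF e(1)] equiv_D(2)[OF e(2)] unfolding fam_def by blast
  show "fam e1 e2 A B f h" if R: "fam e1 e2 A B f g" "fam e1 e2 A B g h" for A B f g h
    using R equiv_D(3)[OF e(1)] equiv_D(3)[OF e(2)] unfolding fam_def by blast
  show "fam e1 e2 D B (s \<odot> f) (s \<odot> g)" if R: "fam e1 e2 A B f g" and D: "D \<in> C" "s \<in> NCr 0 (ob D) (ob A)" for A B f g D s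
  proof -
    have d: "A \<in> C" "B \<in> C" "f \<in> NCr 0 (ob A) (ob B)" "g \<in> NCr 0 (ob A) (ob B)" using fam_dom[OF R] by auto
    note s = NCr_zero[OF D(1) d(1) D(2)] and f = NCr_zero[OF d(1,2,3)] and g = NCr_zero[OF d(1,2,4)]
    have u: "ucl (s \<odot> x) = ucl s" if "x \<in> NC (ob A) (ob B)" for x
      by (rule ucl_mult_right[OF s(1) _ that ev[OF d(1)]]) (simp add: s(2))
    have l: "lcl (s \<odot> x) = lcl x" if "x \<in> NC (ob A) (ob B)" "nc_rank x = 0" for x
      by (rule lcl_mult_left[OF s(1) that(1) _ ev[OF d(1)]]) (simp add: that(2))
    have "(eqv D (ucl s), eqv D (ucl s)) \<in> e1 D" by (rule equiv_D(1)[OF e(1)[OF D(1)] eqv_in[OF D(1) s(3)]])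
    then show ?thesis
      using R D d NCr_mult_right[OF s(1)] u[OF f(1)] u[OF g(1)] l[OF f(1,2)] l[OF g(1,2)] by (simp add: fam_def)
  qed
  show "fam e1 e2 A D (f \<odot> s) (g \<odot> s)" if R: "fam e1 e2 A B f g" and D: "D \<in> C" "s \<in> NCr 0 (ob B) (ob D)" for A B f g D s
  proof -
    have d: "A \<in> C" "B \<in> C" "f \<in> NCr 0 (ob A) (ob B)" "g \<in> NCr 0 (ob A) (ob B)" using fam_dom[OF R] by auto
    note s = NCr_zero[OF d(2) D] and f = NCr_zero[OF d(1,2,3)] and g = NCr_zero[OF d(1,2,4)]
    have u: "ucl (x \<odot> s) = ucl x" if "x \<in> NC (ob A) (ob B)" "nc_rank x = 0" for x
      by (rule ucl_mult_right[OF that(1) _ s(1) ev[OF d(2)]]) (simp add: that(2))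
    have l: "lcl (x \<odot> s) = lcl s" if "x \<in> NC (ob A) (ob B)" for x
      by (rule lcl_mult_left[OF that s(1) _ ev[OF d(2)]]) (simp add: s(2))
    have "(eqv D (flip (lcl s)), eqv D (flip (lcl s))) \<in> e2 D"
      by (rule equiv_D(1)[OF e(2)[OF D(1)] eqv_in[OF D(1) s(5)]])
    then show ?thesis
      using R D d NCr_mult_left[OF _ s(1)] u[OF f(1,2)] u[OF g(1,2)] l[OF f(1)] l[OF g(1)] by (simp add: fam_def)
  qed
qed

text \<open>One coordinate is varied while the other stays at a fixed matching \<open>K\<close>,
  which relates to itself.\<close>

lemma fam_le_iff:
  assumes e: "\<And>A. A \<in> C \<Longrightarrow> equiv (planar_Eq2 A) (e1 A)" "\<And>A. A \<in> C \<Longrightarrow> equiv (planar_Eq2 A) (e2 A)"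
  shows "(\<forall>A B f g. fam e1 e2 A B f g \<longrightarrow> fam e1' e2' A B f g) \<longleftrightarrow> (\<forall>A\<in>C. e1 A \<subseteq> e1' A \<and> e2 A \<subseteq> e2' A)"
proof
  assume S: "\<forall>A B f g. fam e1 e2 A B f g \<longrightarrow> fam e1' e2' A B f g"
  show "\<forall>A\<in>C. e1 A \<subseteq> e1' A \<and> e2 A \<subseteq> e2' A"
  proof
    fix A assume A: "A \<in> C"
    have F: "fam e1 e2 A A (H \<odot> flip K) (H' \<odot> flip K') \<longleftrightarrow> (eqv A H, eqv A H') \<in> e1 A \<and> (eqv A K, eqv A K') \<in> e2 A"
      "fam e1' e2' A A (H \<odot> flip K) (H' \<odot> flip K') \<longleftrightarrow> (eqv A H, eqv A H') \<in> e1' A \<and> (eqv A K, eqv A K') \<in> e2' A"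
      if H: "H \<in> NC (ob A) {}" "H' \<in> NC (ob A) {}" "K \<in> NC (ob A) {}" "K' \<in> NC (ob A) {}" for H H' K K'
      using A rank0_NCr[OF H(1) flip_NC[OF H(3)]] rank0_NCr[OF H(2) flip_NC[OF H(4)]]
        rank0_mult(3,4)[OF H(1) flip_NC[OF H(3)]] rank0_mult(3,4)[OF H(2) flip_NC[OF H(4)]]
      by (simp_all add: fam_def)
    have rep: "\<exists>H\<in>NC (ob A) {}. x = eqv A H" if "x \<in> planar_Eq2 A" for x
      using eqv_surj[OF objD[OF A] that] by blast
    obtain K where K: "K \<in> NC (ob A) {}" using ex_matching[OF A] by blast
    have Kr: "(eqv A K, eqv A K) \<in> e1 A" "(eqv A K, eqv A K) \<in> e2 A"
      using equiv_D(1)[OF e(1)[OF A] eqv_in[OF A K]] equiv_D(1)[OF e(2)[OF A] eqv_in[OF A K]] by auto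
    have "(x, y) \<in> e1' A" if xy: "(x, y) \<in> e1 A" for x y
    proof -
      obtain H H' where H: "H \<in> NC (ob A) {}" "H' \<in> NC (ob A) {}" "x = eqv A H" "y = eqv A H'"
        using equiv_D(4)[OF e(1)[OF A] xy] rep by meson
      then show ?thesis using F[OF H(1,2) K K] Kr xy S by blast
    qed
    moreover have "(x, y) \<in> e2' A" if xy: "(x, y) \<in> e2 A" for x y
    proof -
      obtain H H' where H: "H \<in> NC (ob A) {}" "H' \<in> NC (ob A) {}" "x = eqv A H" "y = eqv A H'"
        using equiv_D(4)[OF e(2)[OF A] xy] rep by meson
      then show ?thesis using F[OF K K H(1,2)] Kr xy S by blast
    qed
    ultimately show "e1 A \<subseteq> e1' A \<and> e2 A \<subseteq> e2' A" by fast
  qed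
next
  assume S: "\<forall>A\<in>C. e1 A \<subseteq> e1' A \<and> e2 A \<subseteq> e2' A"
  show "\<forall>A B f g. fam e1 e2 A B f g \<longrightarrow> fam e1' e2' A B f g"
  proof (intro allI impI)
    fix A B f g assume R: "fam e1 e2 A B f g"
    then have "e1 A \<subseteq> e1' A" "e2 B \<subseteq> e2' B" using S fam_dom[OF R] by blast+
    then show "fam e1' e2' A B f g" using R unfolding fam_def by blast
  qed
qed

abbreviation families :: "('a rel \<Rightarrow> ('a rel \<times> 'a rel) set) set" where
  "families \<equiv> (\<Pi>\<^sub>E A\<in>C. Equivs (planar_Eq2 A))"

lemma families_equiv: "e \<in> families \<Longrightarrow> A \<in> C \<Longrightarrow> equiv (planar_Eq2 A) (e A)"
  using PiE_mem[of e C "\<lambda>A. Equivs (planar_Eq2 A)" A] by (simp add: Equivs_def)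

text \<open>A relation between two elements persists when their lower parts are replaced by any
  common one, and likewise above. Hence the congruence is recovered from its traces \<open>u\<close>
  and \<open>d\<close> on the two coordinates by changing one coordinate after the other.\<close>

lemma congruence_is_fam:
  assumes T: "tl_congruence C ob 0 t"
  shows "\<exists>e1\<in>families. \<exists>e2\<in>families. t = fam e1 e2"
proof -
  interpret tl_congruence C ob 0 t by (rule T)
  define u where "u A = {(H, H'). H \<in> NC (ob A) {} \<and> H' \<in> NC (ob A) {} \<and>
    (\<forall>B\<in>C. \<forall>V\<in>NC {} (ob B). t A B (H \<odot> V) (H' \<odot> V))}" for A
  define d where "d B = {(K, K'). K \<in> NC (ob B) {} \<and> K' \<in> NC (ob B) {} \<and>
    (\<forall>A\<in>C. \<forall>H\<in>NC (ob A) {}. t A B (H \<odot> flip K) (H \<odot> flip K'))}" for B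
  have u: "equiv (NC (ob A) {}) (u A)" if A: "A \<in> C" for A
  proof (rule equiv_intro)
    show "(x, x) \<in> u A" if "x \<in> NC (ob A) {}" for x
      using that rel_refl[OF A _ rank0_NCr[OF that]] by (simp add: u_def)
    show "(y, x) \<in> u A" if "(x, y) \<in> u A" for x y using that rel_sym unfolding u_def by blast
    show "(x, z) \<in> u A" if "(x, y) \<in> u A" "(y, z) \<in> u A" for x y z
      using that unfolding u_def mem_Collect_eq prod.case by (meson rel_trans)
    show "x \<in> NC (ob A) {} \<and> y \<in> NC (ob A) {}" if "(x, y) \<in> u A" for x y using that by (simp add: u_def)
  qed
  have d: "equiv (NC (ob B) {}) (d B)" if B: "B \<in> C" for B
  proof (rule equiv_intro)
    show "(x, x) \<in> d B" if "x \<in> NC (ob B) {}" for x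
      using that rel_refl[OF _ B rank0_NCr[OF _ flip_NC[OF that]]] by (simp add: d_def)
    show "(y, x) \<in> d B" if "(x, y) \<in> d B" for x y using that rel_sym unfolding d_def by blast
    show "(x, z) \<in> d B" if "(x, y) \<in> d B" "(y, z) \<in> d B" for x y z
      using that unfolding d_def mem_Collect_eq prod.case by (meson rel_trans)
    show "x \<in> NC (ob B) {} \<and> y \<in> NC (ob B) {}" if "(x, y) \<in> d B" for x y using that by (simp add: d_def)
  qed
  have tu: "(ucl f, ucl g) \<in> u A" and td: "(flip (lcl f), flip (lcl g)) \<in> d B" if R: "t A B f g" for A B f g
  proof -
    have D: "A \<in> C" "B \<in> C" "f \<in> NCr 0 (ob A) (ob B)" "g \<in> NCr 0 (ob A) (ob B)" using relD[OF R] by auto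
    note f = NCr_zero[OF D(1,2,3)] and g = NCr_zero[OF D(1,2,4)]
    \<comment> \<open>Right multiplication by \<open>flip (lcl f) \<odot> W\<close> replaces the
      lower closures of both elements by \<open>W\<close>.\<close>
    have "t A E (ucl f \<odot> W) (ucl g \<odot> W)" if E: "E \<in> C" "W \<in> NC {} (ob E)" for E W
      using rel_right[OF R E(1) rank0_NCr[OF f(5) E(2)]]
        middle_cancel[OF f(3,4,5) E(2)] middle_cancel[OF g(3,4) f(5) E(2)] f(6) g(6) by simp
    then show "(ucl f, ucl g) \<in> u A" using f(3) g(3) by (simp add: u_def)
    have "t E B (W \<odot> lcl f) (W \<odot> lcl g)" if E: "E \<in> C" "W \<in> NC (ob E) {}" for E W
      using rel_left[OF R E(1) rank0_NCr[OF E(2) flip_NC[OF f(3)]]]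
        middle_cancel[OF E(2) flip_NC[OF f(3)] f(3,4)] middle_cancel[OF E(2) flip_NC[OF f(3)] g(3,4)] f(6) g(6) by simp
    then show "(flip (lcl f), flip (lcl g)) \<in> d B" using f(5) g(5) by (simp add: d_def)
  qed
  define e1 where "e1 = (\<lambda>A\<in>C. {(eqv A H, eqv A H') | H H'. (H, H') \<in> u A})"
  define e2 where "e2 = (\<lambda>A\<in>C. {(eqv A H, eqv A H') | H H'. (H, H') \<in> d A})"
  have e: "e1 \<in> families" "e2 \<in> families"
    unfolding e1_def e2_def Equivs_def
    using equiv_image(1)[OF eqv_bij[OF objD] u] equiv_image(1)[OF eqv_bij[OF objD] d]
    by (intro restrict_PiE_iff[THEN iffD2] ballI CollectI; blast)+
  have i: "(eqv A H, eqv A H') \<in> e1 A \<longleftrightarrow> (H, H') \<in> u A" "(eqv A H, eqv A H') \<in> e2 A \<longleftrightarrow> (H, H') \<in> d A"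
    if "A \<in> C" "H \<in> NC (ob A) {}" "H' \<in> NC (ob A) {}" for A H H'
    unfolding e1_def e2_def restrict_apply'[OF that(1)]
    by (rule equiv_image(2)[OF eqv_bij[OF objD[OF that(1)]] u[OF that(1)] that(2,3)]
        equiv_image(2)[OF eqv_bij[OF objD[OF that(1)]] d[OF that(1)] that(2,3)])+
  have "t A B f g \<longleftrightarrow> fam e1 e2 A B f g" for A B f g
  proof
    assume R: "t A B f g"
    have D: "A \<in> C" "B \<in> C" "f \<in> NCr 0 (ob A) (ob B)" "g \<in> NCr 0 (ob A) (ob B)" using relD[OF R] by auto
    note f = NCr_zero[OF D(1,2,3)] and g = NCr_zero[OF D(1,2,4)]
    show "fam e1 e2 A B f g"
      unfolding fam_def i(1)[OF D(1) f(3) g(3)] i(2)[OF D(2) f(5) g(5)] using D tu[OF R] td[OF R] by blast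
  next
    assume R: "fam e1 e2 A B f g"
    have D: "A \<in> C" "B \<in> C" "f \<in> NCr 0 (ob A) (ob B)" "g \<in> NCr 0 (ob A) (ob B)" using fam_dom[OF R] by auto
    note f = NCr_zero[OF D(1,2,3)] and g = NCr_zero[OF D(1,2,4)]
    have "(ucl f, ucl g) \<in> u A" "(flip (lcl f), flip (lcl g)) \<in> d B"
      using R unfolding fam_def i(1)[OF D(1) f(3) g(3)] i(2)[OF D(2) f(5) g(5)] by blast+
    then have "t A B (ucl f \<odot> lcl f) (ucl g \<odot> lcl f)" "t A B (ucl g \<odot> lcl f) (ucl g \<odot> lcl g)"
      using D f(4) g(3) by (simp_all add: u_def d_def)
    then show "t A B f g" unfolding f(6) g(6) by (rule rel_trans)
  qed
  then have "t = fam e1 e2" by (simp add: fun_eq_iff)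
  then show ?thesis using e by blast
qed

lemma Cong_zero_iso:
  "lattice_isomorphic (inclusion_order (Cong (TL_sub C 0)))
        (times_order
           (PiE_order C (\<lambda>A. inclusion_order (Equivs (planar_Eq2 A))))
           (PiE_order C (\<lambda>A. inclusion_order (Equivs (planar_Eq2 A)))))"
    (is "lattice_isomorphic ?M ?L")
proof -
  have le: "pairs_of (fam e1 e2) \<subseteq> pairs_of (fam e1' e2') \<longleftrightarrow> (\<forall>A\<in>C. e1 A \<subseteq> e1' A \<and> e2 A \<subseteq> e2' A)"
    if e: "e1 \<in> families" "e2 \<in> families" for e1 e2 e1' e2'
    using pairs_of_subset_iff[OF fam_dom[of e1 e2] fam_dom[of e1' e2']]
      fam_le_iff[of e1 e2, OF families_equiv[OF e(1)] families_equiv[OF e(2)]] by simp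
  let ?g = "\<lambda>p. pairs_of (fam (fst p) (snd p))"
  have "bij_betw ?g (carrier ?L) (carrier ?M)"
    unfolding bij_betw_def
  proof
    show "inj_on ?g (carrier ?L)"
    proof (rule inj_onI)
      fix p q assume "p \<in> carrier ?L" "q \<in> carrier ?L" and e: "?g p = ?g q"
      then have p: "fst p \<in> families" "snd p \<in> families" "fst q \<in> families" "snd q \<in> families" by auto
      have "\<forall>A\<in>C. fst p A = fst q A \<and> snd p A = snd q A"
        using e le[OF p(1,2), of "fst q" "snd q"] le[OF p(3,4), of "fst p" "snd p"] by blast
      then have "fst p = fst q" "snd p = snd q" using PiE_ext[OF p(1,3)] PiE_ext[OF p(2,4)] by blast+
      then show "p = q" by (rule prod_eqI)
    qed
    show "?g ` carrier ?L = carrier ?M"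
    proof (intro subset_antisym subsetI)
      fix \<sigma> assume "\<sigma> \<in> ?g ` carrier ?L"
      then obtain p where p: "fst p \<in> families" "snd p \<in> families" "\<sigma> = ?g p" by auto
      show "\<sigma> \<in> carrier ?M"
        unfolding p(3) inclusion_order_simps
        by (rule pairs_of_Cong[OF fam_congruence[OF families_equiv[OF p(1)] families_equiv[OF p(2)]]])
    next
      fix \<sigma> assume "\<sigma> \<in> carrier ?M"
      then have s: "\<sigma> \<in> Cong (TL_sub C 0)" by simp
      obtain e1 e2 where e: "e1 \<in> families" "e2 \<in> families" "rel_of 0 \<sigma> = fam e1 e2"
        using congruence_is_fam[OF Cong_rel_of(1)[OF s]] by blast
      have "\<sigma> = ?g (e1, e2)" using Cong_rel_of(2)[OF s] e(3) by simp
      then show "\<sigma> \<in> ?g ` carrier ?L" by (rule image_eqI) (use e in simp)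
    qed
  qed
  moreover have "lattice ?L" by (intro lattice_times lattice_PiE lattice_Equivs)
  moreover have "le ?M (?g p) (?g q) \<longleftrightarrow> le ?L p q" if "p \<in> carrier ?L" "q \<in> carrier ?L" for p q
  proof -
    have p: "fst p \<in> families" "snd p \<in> families" using that(1) by auto
    show ?thesis
      unfolding inclusion_order_simps times_order_simps PiE_order_simps le[OF p] by blast
  qed
  ultimately show ?thesis using lattice_isomorphic_if_order_isomorphic[of ?L ?M ?g] by simp
qed

text \<open>Each planar equivalence is tagged with its object: different orders on a set can have
  the same planar equivalences, whereas the factors of a partial rectangular band have to be
  disjoint.\<close>

definition band_coords :: "'a diagram \<Rightarrow> ('a rel \<times> 'a rel) \<times> ('a rel \<times> 'a rel)" where
  "band_coords x = ((source x, eqv (source x) (ucl (mat x))), (target x, eqv (target x) (flip (lcl (mat x)))))"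

lemma band_coords_dg:
  "A \<in> C \<Longrightarrow> B \<in> C \<Longrightarrow> f \<in> NC (ob A) (ob B) \<Longrightarrow>
    band_coords (dg A B f) = ((A, eqv A (ucl f)), (B, eqv B (flip (lcl f))))"
  by (simp add: band_coords_def mat_dg)

abbreviation band_factor :: "'a rel \<Rightarrow> ('a rel \<times> 'a rel) set" where
  "band_factor A \<equiv> {A} \<times> planar_Eq2 A"

lemma band_data: "prb_data C band_factor band_factor"
proof -
  have "planar_Eq2 A \<noteq> {}" if "A \<in> C" for A using ex_matching[OF that] eqv_in[OF that] by blast
  then show ?thesis by (auto simp: prb_data_def disjoint_family_on_def)
qed

lemma band_iso: "psemigroup_iso (TL_sub C 0) (prb C band_factor band_factor) band_coords"
  unfolding psemigroup_iso_def TL_simps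
proof (intro conjI ballI impI)
  have zero: "\<exists>A\<in>C. \<exists>B\<in>C. \<exists>f\<in>NCr 0 (ob A) (ob B). x = dg A B f" if "x \<in> TL_ideal C 0" for x
    using that ideal_iff by blast
  have dom: "(THE D. D \<in> C \<and> p \<in> band_factor D) = A" if "A \<in> C" "p \<in> band_factor A" for p A
    by (rule the_equality) (use that in auto)
  show "bij_betw band_coords (TL_ideal C 0) (carrier (prb C band_factor band_factor))"
    unfolding bij_betw_def
  proof
    show "inj_on band_coords (TL_ideal C 0)"
    proof (rule inj_onI)
      fix x y assume x: "x \<in> TL_ideal C 0" and y: "y \<in> TL_ideal C 0" and e: "band_coords x = band_coords y"
      obtain A B f where f: "A \<in> C" "B \<in> C" "f \<in> NCr 0 (ob A) (ob B)" "x = dg A B f" using zero[OF x] by blast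
      obtain A' B' g where g: "A' \<in> C" "B' \<in> C" "g \<in> NCr 0 (ob A') (ob B')" "y = dg A' B' g" using zero[OF y] by blast
      note F = NCr_zero[OF f(1,2,3)] and G = NCr_zero[OF g(1,2,3)]
      have q: "A' = A" "B' = B" "eqv A (ucl f) = eqv A' (ucl g)" "eqv B (flip (lcl f)) = eqv B' (flip (lcl g))"
        using e unfolding f(4) g(4) band_coords_dg[OF f(1,2) F(1)] band_coords_dg[OF g(1,2) G(1)] prod.inject by blast+
      note G' = G[unfolded q(1,2)]
      have "ucl f = ucl g" by (rule eqv_inj[OF objD[OF f(1)] F(3) G'(3) q(3)[unfolded q(1)]])
      moreover have "flip (lcl f) = flip (lcl g)"
        by (rule eqv_inj[OF objD[OF f(2)] F(5) G'(5) q(4)[unfolded q(2)]])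
      then have "lcl f = lcl g" by (metis flip_flip)
      ultimately have "f = g" using F(6) G(6) by metis
      then show "x = y" using f(4) g(4) q(1,2) by simp
    qed
    show "band_coords ` TL_ideal C 0 = carrier (prb C band_factor band_factor)"
    proof (intro subset_antisym subsetI)
      fix p assume "p \<in> band_coords ` TL_ideal C 0"
      then obtain x where x: "x \<in> TL_ideal C 0" "p = band_coords x" by blast
      obtain A B f where f: "A \<in> C" "B \<in> C" "f \<in> NCr 0 (ob A) (ob B)" "x = dg A B f" using zero[OF x(1)] by blast
      note F = NCr_zero[OF f(1,2,3)]
      have "p = ((A, eqv A (ucl f)), (B, eqv B (flip (lcl f))))" using x(2) f(4) band_coords_dg[OF f(1,2) F(1)] by simp
      then show "p \<in> carrier (prb C band_factor band_factor)"
        using f(1,2) eqv_in[OF f(1) F(3)] eqv_in[OF f(2) F(5)] by (auto simp: prb_def)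
    next
      fix p assume "p \<in> carrier (prb C band_factor band_factor)"
      then obtain A B x y where p: "A \<in> C" "B \<in> C" "p = ((A, x), (B, y))" "x \<in> planar_Eq2 A" "y \<in> planar_Eq2 B"
        by (auto simp: prb_def)
      obtain H where H: "H \<in> NC (ob A) {}" "eqv A H = x" using eqv_surj[OF objD[OF p(1)] p(4)] by blast
      obtain K where K: "K \<in> NC (ob B) {}" "eqv B K = y" using eqv_surj[OF objD[OF p(2)] p(5)] by blast
      note r = rank0_mult[OF H(1) flip_NC[OF K(1)]] and n = rank0_NCr[OF H(1) flip_NC[OF K(1)], of 0]
      have "p = band_coords (dg A B (H \<odot> flip K))"
        unfolding band_coords_dg[OF p(1,2) r(1)] r(3,4) p(3) using H(2) K(2) by simp
      then show "p \<in> band_coords ` TL_ideal C 0" using dg_in_ideal[OF p(1,2) n] by blast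
    qed
  qed
  fix x assume x: "x \<in> TL_ideal C 0"
  obtain A B f where f: "A \<in> C" "B \<in> C" "f \<in> NCr 0 (ob A) (ob B)" "x = dg A B f" using zero[OF x] by blast
  note F = NCr_zero[OF f(1,2,3)]
  have bx: "band_coords x = ((A, eqv A (ucl f)), (B, eqv B (flip (lcl f))))"
    using f(4) band_coords_dg[OF f(1,2) F(1)] by simp
  have mem: "(A, eqv A (ucl f)) \<in> band_factor A" "(B, eqv B (flip (lcl f))) \<in> band_factor B"
    using eqv_in[OF f(1) F(3)] eqv_in[OF f(2) F(5)] by blast+
  have sx: "source x = A" "target x = B" using f(4) by simp_all
  show "pdom (prb C band_factor band_factor) (band_coords x) = source x"
    unfolding bx sx using dom[OF f(1) mem(1)] by (simp add: prb_def)
  show "pcod (prb C band_factor band_factor) (band_coords x) = target x"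
    unfolding bx sx using dom[OF f(2) mem(2)] by (simp add: prb_def)
  fix y assume y: "y \<in> TL_ideal C 0" and xy: "target x = source y"
  obtain B' D g where g': "B' \<in> C" "D \<in> C" "g \<in> NCr 0 (ob B') (ob D)" "y = dg B' D g" using zero[OF y] by blast
  have "B' = B" using xy f(4) g'(4) by simp
  then have g: "D \<in> C" "g \<in> NCr 0 (ob B) (ob D)" "y = dg B D g" using g' by simp_all
  note G = NCr_zero[OF f(2) g(1,2)]
  have u: "ucl (f \<odot> g) = ucl f"
    by (rule ucl_mult_right[OF F(1) _ G(1) ev[OF f(2)]]) (simp add: F(2))
  have l: "lcl (f \<odot> g) = lcl g"
    by (rule lcl_mult_left[OF F(1) G(1) _ ev[OF f(2)]]) (simp add: G(2))
  have "diagram_mult x y = dg A D (f \<odot> g)" unfolding f(4) g(3) by (rule mult_dg[OF f(1,2) g(1) F(1) G(1)])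
  then show "band_coords (diagram_mult x y) = pmul (prb C band_factor band_factor) (band_coords x) (band_coords y)"
    using bx band_coords_dg[OF f(2) g(1) G(1)] band_coords_dg[OF f(1) g(1) nc_mult_NC[OF F(1) G(1)]] g(3) u l
    by (simp add: prb_def)
qed

lemma band_sigma_eq:
  "{(\<alpha>, \<beta>). \<alpha> \<in> TL_ideal C 0 \<and> \<beta> \<in> TL_ideal C 0 \<and>
      (band_coords \<alpha>, band_coords \<beta>) \<in> prb_sigma C band_factor band_factor E1 E2} =
    pairs_of (fam (\<lambda>A. {(x, y). ((A, x), (A, y)) \<in> E1 A}) (\<lambda>A. {(x, y). ((A, x), (A, y)) \<in> E2 A}))"
    (is "?S = pairs_of ?f")
proof (rule pairs_of_eqI[where r = 0])
  fix x y assume "(x, y) \<in> ?S"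
  then have xy: "x \<in> TL_ideal C 0" "y \<in> TL_ideal C 0"
    "(band_coords x, band_coords y) \<in> prb_sigma C band_factor band_factor E1 E2" by blast+
  obtain A B f where f: "A \<in> C" "B \<in> C" "f \<in> NCr 0 (ob A) (ob B)" "x = dg A B f" using xy(1) ideal_iff by blast
  obtain A' B' g where g: "A' \<in> C" "B' \<in> C" "g \<in> NCr 0 (ob A') (ob B')" "y = dg A' B' g" using xy(2) ideal_iff by blast
  note F = NCr_zero[OF f(1,2,3)] and G = NCr_zero[OF g(1,2,3)]
  have "A' = A \<and> B' = B"
    using xy(3) band_coords_dg[OF f(1,2) F(1)] band_coords_dg[OF g(1,2) G(1)] f(4) g(4) by (auto simp: prb_sigma_def)
  then show "\<exists>A\<in>C. \<exists>B\<in>C. \<exists>f\<in>NCr 0 (ob A) (ob B). \<exists>g\<in>NCr 0 (ob A) (ob B). x = dg A B f \<and> y = dg A B g"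
    using f g by blast
next
  fix A B f g assume A: "A \<in> C" "B \<in> C" "f \<in> NCr 0 (ob A) (ob B)" "g \<in> NCr 0 (ob A) (ob B)"
  note F = NCr_zero[OF A(1,2,3)] and G = NCr_zero[OF A(1,2,4)]
  show "(dg A B f, dg A B g) \<in> ?S \<longleftrightarrow> ?f A B f g"
    unfolding mem_Collect_eq prod.case band_coords_dg[OF A(1,2) F(1)] band_coords_dg[OF A(1,2) G(1)]
    using A dg_in_ideal[OF A(1,2,3)] dg_in_ideal[OF A(1,2,4)]
      eqv_in[OF A(1) F(3)] eqv_in[OF A(1) G(3)] eqv_in[OF A(2) F(5)] eqv_in[OF A(2) G(5)]
    by (simp add: prb_sigma_def fam_def)
qed (rule fam_dom)

lemma Cong_zero_eq:
  "Cong (TL_sub C 0) =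
     {{(\<alpha>, \<beta>). \<alpha> \<in> TL_ideal C 0 \<and> \<beta> \<in> TL_ideal C 0 \<and>
        (band_coords \<alpha>, band_coords \<beta>) \<in> prb_sigma C band_factor band_factor E1 E2}
      | E1 E2. \<forall>A\<in>C. E1 A \<in> Equivs (band_factor A) \<and> E2 A \<in> Equivs (band_factor A)}"
  unfolding band_sigma_eq
proof (intro subset_antisym subsetI)
  fix \<sigma> assume s: "\<sigma> \<in> Cong (TL_sub C 0)"
  obtain e1 e2 where e: "e1 \<in> families" "e2 \<in> families" "rel_of 0 \<sigma> = fam e1 e2"
    using congruence_is_fam[OF Cong_rel_of(1)[OF s]] by blast
  define tag where "tag e A = {(p, q). fst p = A \<and> fst q = A \<and> (snd p, snd q) \<in> e A}"
    for e :: "'a rel \<Rightarrow> ('a rel \<times> 'a rel) set" and A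
  have "(\<lambda>A. {(x, y). ((A, x), (A, y)) \<in> tag e A}) = e" for e by (simp add: tag_def)
  then have "\<sigma> = pairs_of (fam (\<lambda>A. {(x, y). ((A, x), (A, y)) \<in> tag e1 A}) (\<lambda>A. {(x, y). ((A, x), (A, y)) \<in> tag e2 A}))"
    using Cong_rel_of(2)[OF s] e(3) by simp
  moreover have "tag e A \<in> Equivs (band_factor A)" if "e \<in> families" "A \<in> C" for e A
    unfolding tag_def Equivs_def mem_Collect_eq by (rule equiv_tag[OF families_equiv[OF that]])
  then have "\<forall>A\<in>C. tag e1 A \<in> Equivs (band_factor A) \<and> tag e2 A \<in> Equivs (band_factor A)"
    using e(1,2) by blast
  ultimately show "\<sigma> \<in> {pairs_of (fam (\<lambda>A. {(x, y). ((A, x), (A, y)) \<in> E1 A}) (\<lambda>A. {(x, y). ((A, x), (A, y)) \<in> E2 A}))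
      | E1 E2. \<forall>A\<in>C. E1 A \<in> Equivs (band_factor A) \<and> E2 A \<in> Equivs (band_factor A)}" 
    by (intro CollectI exI[of _ "tag e1"] exI[of _ "tag e2"] conjI)
next
  fix \<sigma> assume "\<sigma> \<in> {pairs_of (fam (\<lambda>A. {(x, y). ((A, x), (A, y)) \<in> E1 A}) (\<lambda>A. {(x, y). ((A, x), (A, y)) \<in> E2 A}))
      | E1 E2. \<forall>A\<in>C. E1 A \<in> Equivs (band_factor A) \<and> E2 A \<in> Equivs (band_factor A)}"
  then obtain E1 E2 where E0: "\<forall>A\<in>C. E1 A \<in> Equivs (band_factor A) \<and> E2 A \<in> Equivs (band_factor A)"
    and E3: "\<sigma> = pairs_of (fam (\<lambda>A. {(x, y). ((A, x), (A, y)) \<in> E1 A}) (\<lambda>A. {(x, y). ((A, x), (A, y)) \<in> E2 A}))"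
    by (elim CollectE exE conjE) (rule that)
  have E: "equiv (band_factor A) (E1 A)" "equiv (band_factor A) (E2 A)" if "A \<in> C" for A
    using E0 that by (simp_all add: Equivs_def)
  show "\<sigma> \<in> Cong (TL_sub C 0)"
    unfolding E3 by (rule pairs_of_Cong[OF fam_congruence[OF equiv_untag[OF E(1)] equiv_untag[OF E(2)]]])
qed

section \<open>Congruences up to rank two\<close>

definition low :: "('a rel \<Rightarrow> 'a rel \<Rightarrow> (int \<Rightarrow> int) \<Rightarrow> (int \<Rightarrow> int) \<Rightarrow> bool) \<Rightarrow>
    'a rel \<Rightarrow> 'a rel \<Rightarrow> (int \<Rightarrow> int) \<Rightarrow> (int \<Rightarrow> int) \<Rightarrow> bool" where
  "low t A B f g \<longleftrightarrow> A \<in> C \<and> B \<in> C \<and> f \<in> NCr 2 (ob A) (ob B) \<and> g \<in> NCr 2 (ob A) (ob B) \<and> (f = g \<or> t A B f g)"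

text \<open>\<open>low\<close> and \<open>high\<close> are the two ways to extend a congruence from
  rank 0 to rank 2: by equality, and by pulling it back along the retraction.\<close>

definition high :: "('a rel \<Rightarrow> 'a rel \<Rightarrow> (int \<Rightarrow> int) \<Rightarrow> (int \<Rightarrow> int) \<Rightarrow> bool) \<Rightarrow>
    'a rel \<Rightarrow> 'a rel \<Rightarrow> (int \<Rightarrow> int) \<Rightarrow> (int \<Rightarrow> int) \<Rightarrow> bool" where
  "high t A B f g \<longleftrightarrow> A \<in> C \<and> B \<in> C \<and> f \<in> NCr 2 (ob A) (ob B) \<and> g \<in> NCr 2 (ob A) (ob B) \<and> t A B (hat f) (hat g)"

lemma low_dom: "low t A B f g \<Longrightarrow> A \<in> C \<and> B \<in> C \<and> f \<in> NCr 2 (ob A) (ob B) \<and> g \<in> NCr 2 (ob A) (ob B)"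
  by (simp add: low_def)

lemma high_dom: "high t A B f g \<Longrightarrow> A \<in> C \<and> B \<in> C \<and> f \<in> NCr 2 (ob A) (ob B) \<and> g \<in> NCr 2 (ob A) (ob B)"
  by (simp add: high_def)

lemma NCr_two: "f \<in> NCr 2 D E \<Longrightarrow> nc_rank f \<le> 2"
  by (simp add: NCr_def numeral_eq_enat)

lemma hat_in: "A \<in> C \<Longrightarrow> B \<in> C \<Longrightarrow> f \<in> NCr 2 (ob A) (ob B) \<Longrightarrow> hat f \<in> NCr r (ob A) (ob B)"
  by (rule hat_NCr[OF _ _ NCr_NC])

lemma hat_mult_two:
  assumes "A \<in> C" "B \<in> C" "D \<in> C" "f \<in> NCr 2 (ob A) (ob B)" "g \<in> NCr 2 (ob B) (ob D)"
  shows "hat (f \<odot> g) = hat f \<odot> hat g"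
  by (rule hat_mult[OF NCr_NC[OF assms(4)] NCr_two[OF assms(4)] NCr_NC[OF assms(5)] NCr_two[OF assms(5)]
        ev[OF assms(1)] ev[OF assms(2)] ev[OF assms(3)]])

text \<open>The pullback of a congruence along a homomorphism, here \<open>hat\<close>.\<close>

lemma high_congruence:
  assumes T: "tl_congruence C ob 0 t"
  shows "tl_congruence C ob 2 (high t)"
proof -
  interpret tl_congruence C ob 0 t by (rule T)
  show ?thesis
  proof unfold_locales
    show "high t A B f f" if "A \<in> C" "B \<in> C" "f \<in> NCr 2 (ob A) (ob B)" for A B f
      using that rel_refl[OF that(1,2) hat_in[OF that]] by (simp add: high_def)
    show "high t A B g f" if "high t A B f g" for A B f g using that rel_sym unfolding high_def by blast
    show "high t A B f h" if "high t A B f g" "high t A B g h" for A B f g h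
      using that rel_trans unfolding high_def by blast
    show "high t D B (s \<odot> f) (s \<odot> g)" if R: "high t A B f g" and D: "D \<in> C" "s \<in> NCr 2 (ob D) (ob A)" for A B f g D s
    proof -
      have d: "A \<in> C" "B \<in> C" "f \<in> NCr 2 (ob A) (ob B)" "g \<in> NCr 2 (ob A) (ob B)" "t A B (hat f) (hat g)"
        using R by (simp_all add: high_def)
      show ?thesis
        using rel_left[OF d(5) D(1) hat_in[OF D(1) d(1) D(2)]] D d NCr_mult_right[OF NCr_NC[OF D(2)]]
          hat_mult_two[OF D(1) d(1,2) D(2)] by (simp add: high_def)
    qed
    show "high t A D (f \<odot> s) (g \<odot> s)" if R: "high t A B f g" and D: "D \<in> C" "s \<in> NCr 2 (ob B) (ob D)" for A B f g D s
    proof -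
      have d: "A \<in> C" "B \<in> C" "f \<in> NCr 2 (ob A) (ob B)" "g \<in> NCr 2 (ob A) (ob B)" "t A B (hat f) (hat g)"
        using R by (simp_all add: high_def)
      show ?thesis
        using rel_right[OF d(5) D(1) hat_in[OF d(2) D]] D d NCr_mult_left[OF _ NCr_NC[OF D(2)]]
          hat_mult_two[OF d(1,2) D(1) _ D(2)] by (simp add: high_def)
    qed
  qed (use ob high_dom in blast)+
qed

text \<open>Nontrivially related elements have rank 0, and so have their products. At rank 0
  \<open>low\<close> and \<open>high\<close> coincide, so compatibility is inherited from
  \<open>high\<close>.\<close>

lemma low_congruence:
  assumes T: "tl_congruence C ob 0 t"
  shows "tl_congruence C ob 2 (low t)"
proof -
  interpret tl_congruence C ob 0 t by (rule T)
  interpret h: tl_congruence C ob 2 "high t" by (rule high_congruence[OF T])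
  have up: "f \<in> NCr 2 (ob A) (ob B)" if "f \<in> NCr 0 (ob A) (ob B)" for f A B
    by (rule NCr_mono[OF that]) simp
  have lift: "low t A B f g" if R: "high t A B f g" and r: "nc_rank f = 0" "nc_rank g = 0" for A B f g
  proof -
    have "hat f = f" "hat g = g" using high_dom[OF R] NCr_NC hat_rank0 r by blast+
    then show ?thesis using R by (simp add: high_def low_def)
  qed
  have sink: "high t A B f g \<and> nc_rank f = 0 \<and> nc_rank g = 0" if R: "t A B f g" for A B f g
  proof -
    have d: "A \<in> C" "B \<in> C" "f \<in> NCr 0 (ob A) (ob B)" "g \<in> NCr 0 (ob A) (ob B)" using relD[OF R] by auto
    note F = NCr_zero[OF d(1,2,3)] and G = NCr_zero[OF d(1,2,4)]
    show ?thesis unfolding high_def F(7) G(7) using d R up F(2) G(2) by blast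
  qed
  show ?thesis
  proof unfold_locales
    show "low t A B f f" if "A \<in> C" "B \<in> C" "f \<in> NCr 2 (ob A) (ob B)" for A B f
      using that by (simp add: low_def)
    show "low t A B g f" if "low t A B f g" for A B f g using that rel_sym unfolding low_def by blast
    show "low t A B f h" if R: "low t A B f g" "low t A B g h" for A B f g h
    proof -
      have "f = g \<or> t A B f g" "g = h \<or> t A B g h" using R unfolding low_def by blast+
      then have "f = h \<or> t A B f h" using rel_trans[of A B f g h] by blast
      then show ?thesis using low_dom[OF R(1)] low_dom[OF R(2)] by (simp add: low_def)
    qed
    show "low t D B (s \<odot> f) (s \<odot> g)" if R: "low t A B f g" and D: "D \<in> C" "s \<in> NCr 2 (ob D) (ob A)" for A B f g D s
    proof (cases "f = g")
      case True
      then show ?thesis using low_dom[OF R] D NCr_mult_right[OF NCr_NC[OF D(2)]] by (simp add: low_def)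
    next
      case False
      then have "t A B f g" using R by (simp add: low_def)
      note sk = sink[OF this]
      have n: "f \<in> NC (ob A) (ob B)" "g \<in> NC (ob A) (ob B)" using low_dom[OF R] NCr_NC by blast+
      have "nc_rank (s \<odot> x) = 0" if "x \<in> NC (ob A) (ob B)" "nc_rank x = 0" for x
        using nc_rank_mult_right[OF NCr_NC[OF D(2)] that(1)] that(2) by simp
      note z = this[OF n(1) conjunct1[OF conjunct2[OF sk]]] this[OF n(2) conjunct2[OF conjunct2[OF sk]]]
      show ?thesis by (rule lift[OF h.rel_left[OF conjunct1[OF sk] D] z])
    qed
    show "low t A D (f \<odot> s) (g \<odot> s)" if R: "low t A B f g" and D: "D \<in> C" "s \<in> NCr 2 (ob B) (ob D)" for A B f g D s
    proof (cases "f = g")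
      case True
      then show ?thesis using low_dom[OF R] D NCr_mult_left[OF _ NCr_NC[OF D(2)]] by (simp add: low_def)
    next
      case False
      then have "t A B f g" using R by (simp add: low_def)
      note sk = sink[OF this]
      have n: "f \<in> NC (ob A) (ob B)" "g \<in> NC (ob A) (ob B)" using low_dom[OF R] NCr_NC by blast+
      have "nc_rank (x \<odot> s) = 0" if "x \<in> NC (ob A) (ob B)" "nc_rank x = 0" for x
        using nc_rank_mult_left[OF that(1) NCr_NC[OF D(2)]] that(2) by simp
      note z = this[OF n(1) conjunct1[OF conjunct2[OF sk]]] this[OF n(2) conjunct2[OF conjunct2[OF sk]]]
      show ?thesis by (rule lift[OF h.rel_right[OF conjunct1[OF sk] D] z])
    qed
  qed (use ob low_dom in blast)+
qed

text \<open>A single nontrivial pair involving rank 2 relates every element to its retract, which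
  forces \<open>high\<close>; otherwise the relation is equality outside rank 0. The congruence on
  rank 0 can be arbitrary, because multipliers of rank at most two exchange no matchings.\<close>

lemma classification_two:
  assumes R: "tl_congruence C ob 2 rel"
  shows "\<exists>t. tl_congruence C ob 0 t \<and> (rel = low t \<or> rel = high t)"
proof -
  interpret tl_congruence C ob 2 rel by (rule R)
  define t where "t A B f g \<longleftrightarrow> rel A B f g \<and> f \<in> NCr 0 (ob A) (ob B) \<and> g \<in> NCr 0 (ob A) (ob B)" for A B f g
  have up: "f \<in> NCr 2 (ob A) (ob B)" if "f \<in> NCr 0 (ob A) (ob B)" for f A B
    by (rule NCr_mono[OF that]) simp
  have T: "tl_congruence C ob 0 t"
  proof unfold_locales
    show "t A B f f" if "A \<in> C" "B \<in> C" "f \<in> NCr 0 (ob A) (ob B)" for A B f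
      using rel_refl[OF that(1,2) up[OF that(3)]] that by (simp add: t_def)
    show "t A B g f" if "t A B f g" for A B f g using that rel_sym unfolding t_def by blast
    show "t A B f h" if "t A B f g" "t A B g h" for A B f g h using that rel_trans unfolding t_def by blast
    show "t D B (s \<odot> f) (s \<odot> g)" if "t A B f g" "D \<in> C" "s \<in> NCr 0 (ob D) (ob A)" for A B f g D s
      using that rel_left up NCr_mult_right[OF NCr_NC[OF that(3)]] unfolding t_def by blast
    show "t A D (f \<odot> s) (g \<odot> s)" if "t A B f g" "D \<in> C" "s \<in> NCr 0 (ob B) (ob D)" for A B f g D s
      using that rel_right up NCr_mult_left[OF _ NCr_NC[OF that(3)]] unfolding t_def by blast
  qed (use ob relD t_def in blast)+
  have zt: "nc_rank f = 0 \<or> nc_rank f = 2" if "A \<in> C" "f \<in> NCr 2 (ob A) (ob B)" for A B f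
  proof -
    have "even (nc_rank f)" using nc_rank_even[OF NCr_NC[OF that(2)]] ev[OF that(1)] by blast
    moreover have "n = 0 \<or> n = 2" if "even n" "n \<le> 2" for n :: nat using that by presburger
    ultimately show ?thesis using NCr_two[OF that(2)] by blast
  qed
  have z: "f \<in> NCr 0 (ob A) (ob B)" if "f \<in> NCr 2 (ob A) (ob B)" "nc_rank f = 0" for A B f
    using that by (simp add: NCr_def zero_enat_def)
  show ?thesis
  proof (cases "\<exists>A B f g. rel A B f g \<and> f \<noteq> g \<and> nc_rank f = 2")
    case True
    then obtain A B f g where fg: "rel A B f g" "f \<noteq> g" "nc_rank f = 2" by blast
    have g2: "nc_rank g \<le> 2" using relD[OF fg(1)] NCr_two by blast
    have to_hat: "rel D E a (hat a)" if D: "D \<in> C" "E \<in> C" "a \<in> NCr 2 (ob D) (ob E)" for D E a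
      using zt[OF D(1,3)]
    proof
      assume "nc_rank a = 0"
      then have "hat a = a" using hat_rank0[OF NCr_NC[OF D(3)]] by blast
      then show ?thesis using rel_refl[OF D] by simp
    next
      assume "nc_rank a = 2"
      then show ?thesis by (rule rank_two_hat[OF fg g2 D(1,2) NCr_NC[OF D(3)]])
    qed
    have "rel D E a b \<longleftrightarrow> high t D E a b" for D E a b
    proof
      assume R: "rel D E a b"
      have d: "D \<in> C" "E \<in> C" "a \<in> NCr 2 (ob D) (ob E)" "b \<in> NCr 2 (ob D) (ob E)" using relD[OF R] by auto
      have "rel D E (hat a) (hat b)"
        by (rule rel_trans[OF rel_sym[OF to_hat[OF d(1,2,3)]] rel_trans[OF R to_hat[OF d(1,2,4)]]])
      then show "high t D E a b" using d hat_in by (simp add: high_def t_def)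
    next
      assume R: "high t D E a b"
      have d: "D \<in> C" "E \<in> C" "a \<in> NCr 2 (ob D) (ob E)" "b \<in> NCr 2 (ob D) (ob E)" "rel D E (hat a) (hat b)"
        using R by (auto simp: high_def t_def)
      show "rel D E a b"
        by (rule rel_trans[OF to_hat[OF d(1,2,3)] rel_trans[OF d(5) rel_sym[OF to_hat[OF d(1,2,4)]]]])
    qed
    then have "rel = high t" by (simp add: fun_eq_iff)
    then show ?thesis using T by blast
  next
    case False
    have "rel A B f g \<longleftrightarrow> low t A B f g" for A B f g
    proof
      assume R: "rel A B f g"
      have d: "A \<in> C" "B \<in> C" "f \<in> NCr 2 (ob A) (ob B)" "g \<in> NCr 2 (ob A) (ob B)" using relD[OF R] by auto
      show "low t A B f g"
      proof (cases "f = g")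
        case False
        then have "nc_rank f \<noteq> 2" "nc_rank g \<noteq> 2"
          using \<open>\<not> (\<exists>A B f g. rel A B f g \<and> f \<noteq> g \<and> nc_rank f = 2)\<close> R rel_sym[OF R] by metis+
        then have "f \<in> NCr 0 (ob A) (ob B)" "g \<in> NCr 0 (ob A) (ob B)"
          using zt[OF d(1,3)] zt[OF d(1,4)] z[OF d(3)] z[OF d(4)] by blast+
        then show ?thesis using R d by (simp add: low_def t_def)
      qed (use d in \<open>simp add: low_def\<close>)
    qed (use rel_refl in \<open>auto simp: low_def t_def\<close>)
    then have "rel = low t" by (simp add: fun_eq_iff)
    then show ?thesis using T by blast
  qed
qed

lemma ideal_zero_two: "TL_ideal C 0 \<subseteq> TL_ideal C 2"
  by (auto simp: TL_ideal_def intro: order.trans)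

lemma pairs_of_low:
  assumes T: "tl_congruence C ob 0 t"
  shows "pairs_of t \<union> Id_on (TL_ideal C 2) = pairs_of (low t)"
proof -
  interpret tl_congruence C ob 0 t by (rule T)
  have up: "f \<in> NCr 2 (ob A) (ob B)" if "f \<in> NCr 0 (ob A) (ob B)" for f A B
    by (rule NCr_mono[OF that]) simp
  show ?thesis
  proof (rule pairs_of_eqI[where r = 2])
    fix x y assume "(x, y) \<in> pairs_of t \<union> Id_on (TL_ideal C 2)"
    then show "\<exists>A\<in>C. \<exists>B\<in>C. \<exists>f\<in>NCr 2 (ob A) (ob B). \<exists>g\<in>NCr 2 (ob A) (ob B). x = dg A B f \<and> y = dg A B g"
    proof
      assume "(x, y) \<in> pairs_of t"
      then obtain A B f g where f: "x = dg A B f" "y = dg A B g" "t A B f g" unfolding pairs_of_def by blast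
      then show ?thesis using relD[OF f(3)] up by blast
    next
      assume "(x, y) \<in> Id_on (TL_ideal C 2)"
      then have "x \<in> TL_ideal C 2" "y = x" by auto
      then show ?thesis using ideal_iff by blast
    qed
  next
    fix A B f g assume A: "A \<in> C" "B \<in> C" "f \<in> NCr 2 (ob A) (ob B)" "g \<in> NCr 2 (ob A) (ob B)"
    note n = NCr_NC[OF A(3)] NCr_NC[OF A(4)]
    have "(dg A B f, dg A B g) \<in> pairs_of t \<longleftrightarrow> t A B f g"
      using pairs_of_iff[OF relD A(1,2) n(1) A(1,2) n(2)] by blast
    moreover have "(dg A B f, dg A B g) \<in> Id_on (TL_ideal C 2) \<longleftrightarrow> f = g"
      using dg_eq_iff[OF A(1,2) n(1) A(1,2) n(2)] dg_in_ideal[OF A(1,2,3)] by (auto simp: Id_on_iff)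
    ultimately show "(dg A B f, dg A B g) \<in> pairs_of t \<union> Id_on (TL_ideal C 2) \<longleftrightarrow> low t A B f g"
      using A by (auto simp: low_def)
  qed (rule low_dom)
qed

text \<open>\<open>\<sigma>\<close> contains the diagonal at rank 0 already, so adding the diagonal
  of \<open>D_2\<close> or that of \<open>I_2\<close> gives the same relation.\<close>

lemma Id_on_absorb:
  assumes "\<sigma> \<in> Cong (TL_sub C 0)"
  shows "\<sigma> \<union> Id_on (TL_ideal C 2 - TL_ideal C 0) = \<sigma> \<union> Id_on (TL_ideal C 2)"
proof -
  have "equiv (TL_ideal C 0) \<sigma>" using assms by (simp add: Cong_def)
  then have "Id_on (TL_ideal C 0) \<subseteq> \<sigma>" using equiv_D(1) by fastforce
  then show ?thesis using ideal_zero_two by blast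
qed

lemma pairs_of_high:
  assumes T: "tl_congruence C ob 0 t"
  shows "theta_cong (TL_sub C 2) (TL_ideal C 2) (pairs_of t) = pairs_of (high t)"
proof -
  interpret tl_congruence C ob 0 t by (rule T)
  interpret h: tl_congruence C ob 2 "high t" by (rule high_congruence[OF T])
  have ret: "the_retraction (TL_sub C 2) (TL_ideal C 2) (dg A B f) = dg A B (hat f)"
    if A: "A \<in> C" "B \<in> C" "f \<in> NCr 2 (ob A) (ob B)" for A B f
    using the_retraction_eq[OF order.refl order.refl dg_in_ideal[OF A]] hat_dg_dg[OF A(1,2) NCr_NC[OF A(3)]] by simp
  have iff: "(dg A B (hat f), dg A' B' (hat g)) \<in> pairs_of t \<longleftrightarrow> A' = A \<and> B' = B \<and> t A B (hat f) (hat g)"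
    if A: "A \<in> C" "B \<in> C" "f \<in> NCr 2 (ob A) (ob B)" "A' \<in> C" "B' \<in> C" "g \<in> NCr 2 (ob A') (ob B')" for A B f A' B' g
    by (rule pairs_of_iff[OF relD A(1,2) NCr_NC[OF hat_in[OF A(1,2,3)]] A(4,5) NCr_NC[OF hat_in[OF A(4,5,6)]]])
  show ?thesis
    unfolding theta_cong_def Delta_def TL_simps
  proof (rule pairs_of_eqI[where r = 2])
    fix x y assume xy: "(x, y) \<in> {(x, y). x \<in> TL_ideal C 2 \<and> y \<in> TL_ideal C 2 \<and>
      (the_retraction (TL_sub C 2) (TL_ideal C 2) x, the_retraction (TL_sub C 2) (TL_ideal C 2) y) \<in> pairs_of t} \<union> Id_on (TL_ideal C 2)"
    then have I: "x \<in> TL_ideal C 2" "y \<in> TL_ideal C 2" by auto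
    obtain A B f where f: "A \<in> C" "B \<in> C" "f \<in> NCr 2 (ob A) (ob B)" "x = dg A B f" using I(1) ideal_iff by blast
    obtain A' B' g where g: "A' \<in> C" "B' \<in> C" "g \<in> NCr 2 (ob A') (ob B')" "y = dg A' B' g" using I(2) ideal_iff by blast
    from xy have "A' = A \<and> B' = B"
    proof
      assume "(x, y) \<in> Id_on (TL_ideal C 2)"
      then show ?thesis using dg_eq_iff[OF f(1,2) NCr_NC[OF f(3)] g(1,2) NCr_NC[OF g(3)]] f(4) g(4) by auto
    next
      assume "(x, y) \<in> {(x, y). x \<in> TL_ideal C 2 \<and> y \<in> TL_ideal C 2 \<and>
        (the_retraction (TL_sub C 2) (TL_ideal C 2) x, the_retraction (TL_sub C 2) (TL_ideal C 2) y) \<in> pairs_of t}"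
      then have "(dg A B (hat f), dg A' B' (hat g)) \<in> pairs_of t" using f(4) g(4) ret[OF f(1,2,3)] ret[OF g(1,2,3)] by simp
      then show ?thesis using iff[OF f(1,2,3) g(1,2,3)] by blast
    qed
    then show "\<exists>A\<in>C. \<exists>B\<in>C. \<exists>f\<in>NCr 2 (ob A) (ob B). \<exists>g\<in>NCr 2 (ob A) (ob B). x = dg A B f \<and> y = dg A B g"
      using f g by blast
  next
    fix A B f g assume A: "A \<in> C" "B \<in> C" "f \<in> NCr 2 (ob A) (ob B)" "g \<in> NCr 2 (ob A) (ob B)"
    have "(dg A B f, dg A B g) \<in> Id_on (TL_ideal C 2) \<longleftrightarrow> f = g"
      using dg_eq_iff[OF A(1,2) NCr_NC[OF A(3)] A(1,2) NCr_NC[OF A(4)]] dg_in_ideal[OF A(1,2,3)] by (auto simp: Id_on_iff)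
    moreover have H: "high t A B f g \<longleftrightarrow> t A B (hat f) (hat g)" using A by (simp add: high_def)
    moreover have "t A B (hat f) (hat g)" if "f = g" using h.rel_refl[OF A(1,2,3)] H that by simp
    ultimately show "(dg A B f, dg A B g) \<in> {(x, y). x \<in> TL_ideal C 2 \<and> y \<in> TL_ideal C 2 \<and>
      (the_retraction (TL_sub C 2) (TL_ideal C 2) x, the_retraction (TL_sub C 2) (TL_ideal C 2) y) \<in> pairs_of t} \<union> Id_on (TL_ideal C 2)
      \<longleftrightarrow> high t A B f g"
      using dg_in_ideal[OF A(1,2,3)] dg_in_ideal[OF A(1,2,4)]
      unfolding Un_iff mem_Collect_eq prod.case ret[OF A(1,2,3)] ret[OF A(1,2,4)] iff[OF A(1,2,3) A(1,2,4)] by auto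
  qed (rule high_dom)
qed

text \<open>At rank 0 all these relations restrict to \<open>t\<close> or \<open>t'\<close>, which
  settles the comparisons upwards. Downwards, \<open>high\<close> relates an element of rank 2 to
  its retract, while \<open>low\<close> relates it to itself only; an object with two points
  provides such an element.\<close>

lemma low_le_iff:
  assumes T: "tl_congruence C ob 0 t" and T': "tl_congruence C ob 0 t'"
  shows "pairs_of (low t) \<subseteq> pairs_of (low t') \<longleftrightarrow> pairs_of t \<subseteq> pairs_of t'"
    "pairs_of (low t) \<subseteq> pairs_of (high t') \<longleftrightarrow> pairs_of t \<subseteq> pairs_of t'"
    "pairs_of (high t) \<subseteq> pairs_of (high t') \<longleftrightarrow> pairs_of t \<subseteq> pairs_of t'"
    "\<exists>A\<in>C. 2 \<le> card (Field A) \<Longrightarrow> \<not> pairs_of (high t) \<subseteq> pairs_of (low t')"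
proof -
  interpret a: tl_congruence C ob 0 t by (rule T)
  interpret b: tl_congruence C ob 0 t' by (rule T')
  interpret h: tl_congruence C ob 2 "high t'" by (rule high_congruence[OF T'])
  have tt: "pairs_of t \<subseteq> pairs_of t' \<longleftrightarrow> (\<forall>A B f g. t A B f g \<longrightarrow> t' A B f g)"
    by (rule pairs_of_subset_iff[where r = 0 and r' = 0]) (rule a.relD b.relD, assumption)+
  have ll: "pairs_of (low t) \<subseteq> pairs_of (low t') \<longleftrightarrow> (\<forall>A B f g. low t A B f g \<longrightarrow> low t' A B f g)"
    by (rule pairs_of_subset_iff[where r = 2 and r' = 2]) (rule low_dom, assumption)+
  have lh: "pairs_of (low t) \<subseteq> pairs_of (high t') \<longleftrightarrow> (\<forall>A B f g. low t A B f g \<longrightarrow> high t' A B f g)"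
    by (rule pairs_of_subset_iff[where r = 2 and r' = 2]) (rule low_dom high_dom, assumption)+
  have hh: "pairs_of (high t) \<subseteq> pairs_of (high t') \<longleftrightarrow> (\<forall>A B f g. high t A B f g \<longrightarrow> high t' A B f g)"
    by (rule pairs_of_subset_iff[where r = 2 and r' = 2]) (rule high_dom, assumption)+
  have hl: "pairs_of (high t) \<subseteq> pairs_of (low t') \<longleftrightarrow> (\<forall>A B f g. high t A B f g \<longrightarrow> low t' A B f g)"
    by (rule pairs_of_subset_iff[where r = 2 and r' = 2]) (rule low_dom high_dom, assumption)+
  have t2: "A \<in> C \<and> B \<in> C \<and> f \<in> NCr 2 (ob A) (ob B) \<and> g \<in> NCr 2 (ob A) (ob B) \<and> hat f = f \<and> hat g = g"
    if "t A B f g" for A B f g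
  proof -
    have d: "A \<in> C" "B \<in> C" "f \<in> NCr 0 (ob A) (ob B)" "g \<in> NCr 0 (ob A) (ob B)" using a.relD[OF that] by auto
    show ?thesis using d NCr_zero(7)[OF d(1,2,3)] NCr_zero(7)[OF d(1,2,4)] NCr_mono[OF d(3), of 2] NCr_mono[OF d(4), of 2] by simp
  qed
  have 1: "pairs_of (low t) \<subseteq> pairs_of (low t') \<longleftrightarrow> pairs_of t \<subseteq> pairs_of t'"
    unfolding ll tt
  proof (rule iffI)
    assume S: "\<forall>A B f g. low t A B f g \<longrightarrow> low t' A B f g"
    show "\<forall>A B f g. t A B f g \<longrightarrow> t' A B f g"
    proof (intro allI impI)
      fix A B f g assume R: "t A B f g"
      then have "low t A B f g" using t2[OF R] by (simp add: low_def)
      then have "f = g \<or> t' A B f g" using S by (simp add: low_def)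
      then show "t' A B f g" using b.rel_refl a.relD[OF R] by blast
    qed
  qed (auto simp: low_def)
  have 2: "pairs_of (low t) \<subseteq> pairs_of (high t') \<longleftrightarrow> pairs_of t \<subseteq> pairs_of t'"
    unfolding lh tt
  proof (rule iffI)
    assume S: "\<forall>A B f g. low t A B f g \<longrightarrow> high t' A B f g"
    show "\<forall>A B f g. t A B f g \<longrightarrow> t' A B f g"
    proof (intro allI impI)
      fix A B f g assume R: "t A B f g"
      then have "low t A B f g" using t2[OF R] by (simp add: low_def)
      then have "t' A B (hat f) (hat g)" using S by (simp add: high_def)
      then show "t' A B f g" using t2[OF R] by simp
    qed
  next
    assume S: "\<forall>A B f g. t A B f g \<longrightarrow> t' A B f g"
    show "\<forall>A B f g. low t A B f g \<longrightarrow> high t' A B f g"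
    proof (intro allI impI)
      fix A B f g assume R: "low t A B f g"
      then consider "f = g" | "t A B f g" by (auto simp: low_def)
      then show "high t' A B f g"
      proof cases
        case 1 then show ?thesis using h.rel_refl low_dom[OF R] by blast
      next
        case 2 then show ?thesis using t2[OF 2] S by (simp add: high_def)
      qed
    qed
  qed
  have 3: "pairs_of (high t) \<subseteq> pairs_of (high t') \<longleftrightarrow> pairs_of t \<subseteq> pairs_of t'"
    unfolding hh tt
  proof (rule iffI)
    assume S: "\<forall>A B f g. high t A B f g \<longrightarrow> high t' A B f g"
    show "\<forall>A B f g. t A B f g \<longrightarrow> t' A B f g"
    proof (intro allI impI)
      fix A B f g assume R: "t A B f g"
      then have "high t A B f g" using t2[OF R] by (simp add: high_def)
      then have "t' A B (hat f) (hat g)" using S by (simp add: high_def)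
      then show "t' A B f g" using t2[OF R] by simp
    qed
  qed (auto simp: high_def)
  have 4: "\<not> pairs_of (high t) \<subseteq> pairs_of (low t')" if w: "\<exists>A\<in>C. 2 \<le> card (Field A)"
  proof -
    obtain A where A: "A \<in> C" "2 \<le> card (Field A)" using w by blast
  obtain f where f: "f \<in> NC (ob A) (ob A)" "nc_rank f = 2" using rank_exists[OF A(1), of 2] A(2) by auto
  have f2: "f \<in> NCr 2 (ob A) (ob A)" using f by (simp add: NCr_def numeral_eq_enat)
  note h0 = NCr_zero[OF A(1,1) hat_in[OF A(1,1) f2]]
  have ne: "f \<noteq> hat f" using f(2) h0(2) by auto
  have "high t A A f (hat f)"
    using A(1) f2 hat_in[OF A(1,1) f2] h0(7) a.rel_refl[OF A(1,1) hat_in[OF A(1,1) f2]] by (simp add: high_def)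
  moreover have "\<not> low t' A A f (hat f)"
  proof
    assume "low t' A A f (hat f)"
    then have "t' A A f (hat f)" using ne by (simp add: low_def)
    then have "f \<in> NCr 0 (ob A) (ob A)" using b.relD by blast
    then show False using f(2) by (simp add: NCr_def zero_enat_def)
  qed
  ultimately show "\<not> pairs_of (high t) \<subseteq> pairs_of (low t')"
    unfolding hl by blast
  qed
  show "pairs_of (low t) \<subseteq> pairs_of (low t') \<longleftrightarrow> pairs_of t \<subseteq> pairs_of t'" by (rule 1)
  show "pairs_of (low t) \<subseteq> pairs_of (high t') \<longleftrightarrow> pairs_of t \<subseteq> pairs_of t'" by (rule 2)
  show "pairs_of (high t) \<subseteq> pairs_of (high t') \<longleftrightarrow> pairs_of t \<subseteq> pairs_of t'" by (rule 3)
  show "\<exists>A\<in>C. 2 \<le> card (Field A) \<Longrightarrow> \<not> pairs_of (high t) \<subseteq> pairs_of (low t')" by (rule 4)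
qed

theorem part_two:
  assumes xi: "xi C > 2"
  shows "retractable (TL C) (TL_ideal C 2) \<and>
       retractable (TL_sub C 2) (TL_ideal C 2) \<and>
       (\<forall>\<tau>\<in>Cong (TL_sub C 0). liftable (TL_sub C 2) \<tau>) \<and>
       Cong (TL_sub C 2) =
         {\<tau> \<union> Id_on (TL_ideal C 2 - TL_ideal C 0) | \<tau>. \<tau> \<in> Cong (TL_sub C 0)} \<union>
         {theta_cong (TL_sub C 2) (TL_ideal C 2) \<tau> | \<tau>. \<tau> \<in> Cong (TL_sub C 0)} \<and>
       lattice_isomorphic (inclusion_order (Cong (TL_sub C 2)))
         (times_order (inclusion_order (Cong (TL_sub C 0))) two_chain)"
proof (intro conjI)
  have "enat 2 < xi C" using xi by (simp add: numeral_eq_enat)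
  then have w: "\<exists>A\<in>C. 2 \<le> card (Field A)" by (rule xi_gt_ex)
  show "retractable (TL C) (TL_ideal C 2)" using retractable_ideal[of 2 \<infinity>] by (simp add: TL_sub_infinity)
  show "retractable (TL_sub C 2) (TL_ideal C 2)" by (rule retractable_ideal) simp_all
  let ?lo = "\<lambda>\<tau>. \<tau> \<union> Id_on (TL_ideal C 2 - TL_ideal C 0)"
  let ?hi = "\<lambda>\<tau>. theta_cong (TL_sub C 2) (TL_ideal C 2) \<tau>"
  have t: "\<exists>t. tl_congruence C ob 0 t \<and> \<tau> = pairs_of t \<and> ?lo \<tau> = pairs_of (low t) \<and> ?hi \<tau> = pairs_of (high t)"
    if "\<tau> \<in> Cong (TL_sub C 0)" for \<tau>
  proof -
    note r = Cong_rel_of[OF that]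
    have "?lo \<tau> = pairs_of (low (rel_of 0 \<tau>))"
      unfolding Id_on_absorb[OF that] pairs_of_low[OF r(1), symmetric] using r(2) by simp
    moreover have "?hi \<tau> = pairs_of (high (rel_of 0 \<tau>))"
      unfolding pairs_of_high[OF r(1), symmetric] using r(2) by simp
    ultimately show ?thesis using r by (intro exI[of _ "rel_of 0 \<tau>"] conjI)
  qed
  have into: "?lo \<tau> \<in> Cong (TL_sub C 2)" "?hi \<tau> \<in> Cong (TL_sub C 2)" if c: "\<tau> \<in> Cong (TL_sub C 0)" for \<tau>
  proof -
    obtain t0 where t0: "tl_congruence C ob 0 t0" "?lo \<tau> = pairs_of (low t0)" "?hi \<tau> = pairs_of (high t0)"
      using t[OF c] by (elim exE conjE) (rule that, assumption+)
    show "?lo \<tau> \<in> Cong (TL_sub C 2)" unfolding t0(2) by (rule pairs_of_Cong[OF low_congruence[OF t0(1)]])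
    show "?hi \<tau> \<in> Cong (TL_sub C 2)" unfolding t0(3) by (rule pairs_of_Cong[OF high_congruence[OF t0(1)]])
  qed
  show "\<forall>\<tau>\<in>Cong (TL_sub C 0). liftable (TL_sub C 2) \<tau>"
  proof
    fix \<tau> assume c: "\<tau> \<in> Cong (TL_sub C 0)"
    have "\<tau> \<union> Id_on (TL_ideal C 2) \<in> Cong (TL_sub C 2)" using into(1)[OF c] unfolding Id_on_absorb[OF c] .
    then show "liftable (TL_sub C 2) \<tau>"
      unfolding liftable_def min_ideal_eq subsemi_subsemi Delta_def TL_simps using c by (rule conjI[rotated])
  qed
  have cover: "\<exists>\<tau>\<in>Cong (TL_sub C 0). \<rho> = ?lo \<tau> \<or> \<rho> = ?hi \<tau>" if s: "\<rho> \<in> Cong (TL_sub C 2)" for \<rho>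
  proof -
    obtain t where T: "tl_congruence C ob 0 t" "rel_of 2 \<rho> = low t \<or> rel_of 2 \<rho> = high t"
      using classification_two[OF Cong_rel_of(1)[OF s]] by (elim exE conjE) (rule that, assumption+)
    note c = pairs_of_Cong[OF T(1)]
    have "\<rho> = ?lo (pairs_of t) \<or> \<rho> = ?hi (pairs_of t)"
      unfolding Id_on_absorb[OF c] pairs_of_low[OF T(1)] pairs_of_high[OF T(1)]
      using T(2) Cong_rel_of(2)[OF s] by metis
    then show ?thesis by (rule bexI[OF _ c])
  qed
  show "Cong (TL_sub C 2) = {?lo \<tau> | \<tau>. \<tau> \<in> Cong (TL_sub C 0)} \<union> {?hi \<tau> | \<tau>. \<tau> \<in> Cong (TL_sub C 0)}"
  proof (intro subset_antisym subsetI)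
    fix \<rho> assume "\<rho> \<in> Cong (TL_sub C 2)"
    then obtain \<tau> where "\<tau> \<in> Cong (TL_sub C 0)" "\<rho> = ?lo \<tau> \<or> \<rho> = ?hi \<tau>" using cover by blast
    then show "\<rho> \<in> {?lo \<tau> | \<tau>. \<tau> \<in> Cong (TL_sub C 0)} \<union> {?hi \<tau> | \<tau>. \<tau> \<in> Cong (TL_sub C 0)}" by blast
  next
    fix \<rho> assume "\<rho> \<in> {?lo \<tau> | \<tau>. \<tau> \<in> Cong (TL_sub C 0)} \<union> {?hi \<tau> | \<tau>. \<tau> \<in> Cong (TL_sub C 0)}"
    then obtain \<tau> where c: "\<tau> \<in> Cong (TL_sub C 0)" "\<rho> = ?lo \<tau> \<or> \<rho> = ?hi \<tau>" by blast
    from c(2) show "\<rho> \<in> Cong (TL_sub C 2)" using into[OF c(1)] by (elim disjE) simp_all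
  qed
  let ?L = "times_order (inclusion_order (Cong (TL_sub C 0))) two_chain"
  let ?M = "inclusion_order (Cong (TL_sub C 2))"
  \<comment> \<open>The Boolean coordinate chooses between extension by equality and extension
    through the retraction.\<close>
  define G where "G p = (if snd p then ?hi (fst p) else ?lo (fst p))" for p
  have le: "G p \<subseteq> G q \<longleftrightarrow> fst p \<subseteq> fst q \<and> (snd p \<longrightarrow> snd q)"
    if p: "fst p \<in> Cong (TL_sub C 0)" "fst q \<in> Cong (TL_sub C 0)" for p q
  proof -
    obtain t1 where T: "tl_congruence C ob 0 t1" "fst p = pairs_of t1" "?lo (fst p) = pairs_of (low t1)" "?hi (fst p) = pairs_of (high t1)"
      using t[OF p(1)] by (elim exE conjE) (rule that, assumption+)
    obtain t2 where T': "tl_congruence C ob 0 t2" "fst q = pairs_of t2" "?lo (fst q) = pairs_of (low t2)" "?hi (fst q) = pairs_of (high t2)"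
      using t[OF p(2)] by (elim exE conjE) (rule that, assumption+)
    have Gp: "G p = (if snd p then pairs_of (high t1) else pairs_of (low t1))" unfolding G_def T(3,4) by (rule refl)
    have Gq: "G q = (if snd q then pairs_of (high t2) else pairs_of (low t2))" unfolding G_def T'(3,4) by (rule refl)
    note l = low_le_iff(1-3)[OF T(1) T'(1)] low_le_iff(4)[OF T(1) T'(1) w]
    show ?thesis
    proof (cases "snd p")
      case True
      show ?thesis
      proof (cases "snd q")
        case True
        then show ?thesis unfolding Gp Gq T(2) T'(2) using \<open>snd p\<close> l(3) by (simp only: if_True simp_thms)
      next
        case False
        then show ?thesis unfolding Gp Gq using \<open>snd p\<close> l(4) by (simp only: if_True if_False simp_thms)
      qed
    next
      case False
      show ?thesis
      proof (cases "snd q")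
        case True
        then show ?thesis unfolding Gp Gq T(2) T'(2) using \<open>\<not> snd p\<close> l(2) by (simp only: if_True if_False simp_thms)
      next
        case False
        then show ?thesis unfolding Gp Gq T(2) T'(2) using \<open>\<not> snd p\<close> l(1) by (simp only: if_False simp_thms)
      qed
    qed
  qed
  have "bij_betw G (carrier ?L) (carrier ?M)"
    unfolding bij_betw_def
  proof
    show "inj_on G (carrier ?L)"
    proof (rule inj_onI)
      fix p q assume "p \<in> carrier ?L" "q \<in> carrier ?L" and e: "G p = G q"
      then have pq: "fst p \<in> Cong (TL_sub C 0)" "fst q \<in> Cong (TL_sub C 0)" by auto
      have "fst p = fst q" "snd p = snd q"
        using le[OF pq] le[OF pq(2,1)] equalityD1[OF e] equalityD2[OF e] by blast+
      then show "p = q" by (rule prod_eqI)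
    qed
    show "G ` carrier ?L = carrier ?M"
    proof (intro subset_antisym subsetI)
      fix \<rho> assume "\<rho> \<in> G ` carrier ?L"
      then obtain p where p: "fst p \<in> Cong (TL_sub C 0)" "\<rho> = G p" by auto
      show "\<rho> \<in> carrier ?M"
        unfolding p(2) G_def inclusion_order_simps using into[OF p(1)] by (cases "snd p") simp_all
    next
      fix \<rho> assume "\<rho> \<in> carrier ?M"
      then obtain \<tau> where \<tau>: "\<tau> \<in> Cong (TL_sub C 0)" "\<rho> = ?lo \<tau> \<or> \<rho> = ?hi \<tau>" using cover unfolding inclusion_order_simps by blast
      then have "\<rho> = G (\<tau>, False) \<or> \<rho> = G (\<tau>, True)" unfolding G_def fst_conv snd_conv if_True if_False by blast
      moreover have "(\<tau>, b) \<in> carrier ?L" for b using \<tau>(1) by simp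
      ultimately show "\<rho> \<in> G ` carrier ?L" by blast
    qed
  qed
  moreover have "lattice ?L"
    using lattice_times lattice_isomorphicD[OF Cong_zero_iso] lattice_two_chain by blast
  moreover have "le ?M (G p) (G q) \<longleftrightarrow> le ?L p q" if "p \<in> carrier ?L" "q \<in> carrier ?L" for p q
  proof -
    have "fst p \<in> Cong (TL_sub C 0)" "fst q \<in> Cong (TL_sub C 0)" using that by auto
    then show ?thesis unfolding inclusion_order_simps times_order_simps two_chain_simps le_bool_def by (rule le)
  qed
  ultimately show "lattice_isomorphic ?M ?L"
    using lattice_isomorphic_if_order_isomorphic[of ?L ?M G] by simp
qed

end

theorem theorem8p8:
  fixes C :: "'a rel set"
  assumes "C \<noteq> {}"
    and "\<forall>A\<in>C. Linear_order A \<and> finite (Field A) \<and> even (card (Field A))"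
  shows
    "((\<forall>M. is_minimal_ideal (TL C) M \<longleftrightarrow> M = TL_ideal C 0) \<and>
      (\<exists>(X :: 'a rel \<Rightarrow> ('a rel \<times> 'a rel) set) (Y :: 'a rel \<Rightarrow> ('a rel \<times> 'a rel) set) \<phi>.
         prb_data C X Y \<and> psemigroup_iso (TL_sub C 0) (prb C X Y) \<phi> \<and>
         Cong (TL_sub C 0) =
           {{(\<alpha>, \<beta>). \<alpha> \<in> TL_ideal C 0 \<and> \<beta> \<in> TL_ideal C 0 \<and> (\<phi> \<alpha>, \<phi> \<beta>) \<in> prb_sigma C X Y E1 E2}
            | E1 E2. \<forall>A\<in>C. E1 A \<in> Equivs (X A) \<and> E2 A \<in> Equivs (Y A)}) \<and>
      lattice_isomorphic (inclusion_order (Cong (TL_sub C 0)))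
        (times_order
           (PiE_order C (\<lambda>A. inclusion_order (Equivs (planar_Eq2 A))))
           (PiE_order C (\<lambda>A. inclusion_order (Equivs (planar_Eq2 A))))))
     \<and>
     (xi C > 2 \<longrightarrow>
       retractable (TL C) (TL_ideal C 2) \<and>
       retractable (TL_sub C 2) (TL_ideal C 2) \<and>
       (\<forall>\<tau>\<in>Cong (TL_sub C 0). liftable (TL_sub C 2) \<tau>) \<and>
       Cong (TL_sub C 2) =
         {\<tau> \<union> Id_on (TL_ideal C 2 - TL_ideal C 0) | \<tau>. \<tau> \<in> Cong (TL_sub C 0)} \<union>
         {theta_cong (TL_sub C 2) (TL_ideal C 2) \<tau> | \<tau>. \<tau> \<in> Cong (TL_sub C 0)} \<and>
       lattice_isomorphic (inclusion_order (Cong (TL_sub C 2)))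
         (times_order (inclusion_order (Cong (TL_sub C 0))) two_chain))
     \<and>
     (\<forall>r. (\<exists>n. r = enat n \<and> even n \<and> 4 \<le> n \<and> r < xi C) \<or> (r = \<infinity> \<and> xi C = \<infinity>) \<longrightarrow>
       (\<forall>q\<in>{0, 2}. retractable (TL_sub C r) (TL_ideal C q)) \<and>
       Cong (TL_sub C r) =
         {diamond_cong k (TL_sub C r) (TL_ideal C q) | k q. q \<in> {0, 2}} \<union>
         {Rees_cong (TL_sub C r) (TL_ideal C (enat q)) | q. even q \<and> 4 \<le> q \<and> enat q < r} \<union>
         {sim (TL_sub C r)} \<and>
       (\<forall>q\<in>{0, 2}. \<forall>q'\<in>{0, 2}. \<forall>k k'.
          diamond_cong k (TL_sub C r) (TL_ideal C q) \<subseteq> diamond_cong k' (TL_sub C r) (TL_ideal C q')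
            \<longleftrightarrow> q \<le> q' \<and> diamond_le k k') \<and>
       inj_on (\<lambda>(k, q). diamond_cong k (TL_sub C r) (TL_ideal C q)) (UNIV \<times> {0, 2}) \<and>
       (\<forall>q q'. even q \<and> even q' \<and> 2 \<le> q \<and> q < q' \<and> enat q' < r \<longrightarrow>
          Rees_cong (TL_sub C r) (TL_ideal C (enat q)) \<subset> Rees_cong (TL_sub C r) (TL_ideal C (enat q'))) \<and>
       (\<forall>q. even q \<and> 2 \<le> q \<and> enat q < r \<longrightarrow>
          Rees_cong (TL_sub C r) (TL_ideal C (enat q)) \<subset> sim (TL_sub C r)) \<and>
       (\<forall>\<sigma>\<in>Cong (TL_sub C r). \<sigma> \<subseteq> sim (TL_sub C r)))"
proof -
  have "tl_category C"
    by unfold_locales (use assms in \<open>auto simp: tl_object_def\<close>)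
  then interpret tl_category C .
  \<comment> \<open>The whole category is the ideal for the rank bound
    \<open>\<infinity>\<close>.\<close>
  have min: "\<forall>M. is_minimal_ideal (TL C) M \<longleftrightarrow> M = TL_ideal C 0"
    using minimal_ideal_iff[of \<infinity>] unfolding TL_sub_infinity by blast
  have band: "\<exists>(X :: 'a rel \<Rightarrow> ('a rel \<times> 'a rel) set) (Y :: 'a rel \<Rightarrow> ('a rel \<times> 'a rel) set) \<phi>.
         prb_data C X Y \<and> psemigroup_iso (TL_sub C 0) (prb C X Y) \<phi> \<and>
         Cong (TL_sub C 0) =
           {{(\<alpha>, \<beta>). \<alpha> \<in> TL_ideal C 0 \<and> \<beta> \<in> TL_ideal C 0 \<and> (\<phi> \<alpha>, \<phi> \<beta>) \<in> prb_sigma C X Y E1 E2}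
            | E1 E2. \<forall>A\<in>C. E1 A \<in> Equivs (X A) \<and> E2 A \<in> Equivs (Y A)}"
    by (rule exI[of _ band_factor], rule exI[of _ band_factor], rule exI[of _ band_coords])
      (intro conjI band_data band_iso Cong_zero_eq)
  show ?thesis
    by (rule conjI[OF conjI[OF min conjI[OF band Cong_zero_iso]] conjI[OF impI[OF part_two] allI[OF impI[OF part_three]]]])
qed

end
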